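(* Let $C>0$ be a constant, and consider the graphon model on $\mathcal X=[0,1)^d$ with $n$ vertices and observation probability $\rho=\rho_n$ such that $n\rho\ge C\log n$. Suppose that $f$ satisfies, with some $\alpha,L>0$, either the Hölder condition or the Sobolev condition. There exists a constant $\kappa>0$ such that if $\hat M$ is the output of USVT with input $(A,\rho,\tau)$, where $\tau=(1+\delta)\kappa\sqrt{n\rho}$ for some fixed constant $\delta>0$, then $$\mathrm{MSE}(\hat M)\le c''(n\rho)^{-\frac{2\alpha}{2\alpha+d}},$$ where $c''$ is a positive constant independent of $n$.
   Context: Graphon model: $f:\mathcal X\times\mathcal X\to[0,1]$ is a symmetric measurable function and $x_1,\dots,x_n$ are i.i.d. from a probability distribution $\mu$ on $\mathcal X$. The edge probability matrix $M$ has $M_{ij}=f(x_i,x_j)$ for $i\ne j$ and $M_{ii}=0$. With observation probability $\rho\in(0,1]$ (which may depend on $n$), the observed symmetric adjacency matrix $A$ has $A_{ii}=0$ and, conditional on $(x_1,\dots,x_n)$, the entries $A_{ij}=A_{ji}$, $1\le i<j\le n$, are independent with $A_{ij}\sim\mathrm{Bernoulli}(\rho M_{ij})$. USVT with input $(A,\rho,\tau)$, $\tau>0$: take a singular value decomposition $A=\sum_{i=1}^n s_iu_iv_i^\top$, $s_1\ge\cdots\ge s_n$, set $\hat A=\sum_{i:\,s_i\ge\tau}s_iu_iv_i^\top$ and $\tilde M=\hat A/\rho$. The output $\hat M$ is the symmetric matrix with $\hat M_{ii}=0$ and, for $i<j$, $\hat M_{ij}=\hat M_{ji}=\min\{1,\max\{0,\tilde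 M_{ij}\}\}$. $\mathrm{MSE}(\hat M)=\frac1{n^2}\mathbb E[\|M-\hat M\|_F^2]$, with expectation over both $(x_i)$ and $A$. Notation: $\lfloor\alpha\rfloor$ denotes the largest integer strictly smaller than $\alpha$. For a multi-index $\kappa=(\kappa_1,\dots,\kappa_d)$ of nonnegative integers, $|\kappa|=\sum_i\kappa_i$, $\kappa!=\prod_i\kappa_i!$, and $\nabla_\kappa g=\partial^{|\kappa|}g/(\partial x)^\kappa$. Hölder class $\mathcal H(\alpha,L)$: functions $g:\mathcal X\to\mathbb R$ whose partial derivatives satisfy, for all $x,x'\in\mathcal X$, $\sum_{|\kappa|=\lfloor\alpha\rfloor}\frac1{\kappa!}|\nabla_\kappa g(x)-\nabla_\kappa g(x')|\le L\|x-x'\|_\infty^{\alpha-\lfloor\alpha\rfloor}$. Sobolev space $\mathcal S(\alpha,L)$: functions $g:\mathcal X\to\mathbb R$ whose partial derivatives (more generally, weak derivatives) satisfy $\sum_{|\kappa|=\alpha}\int_{\mathcal X}|\nabla_\kappa g(x)|^2\,dx\le L^2$ if $\alpha$ is an integer, and $\sum_{|\kappa|=\lfloor\alpha\rfloor}\int_{\mathcal X\times\mathcal X}\frac{|\nabla_\kappa g(x)-\nabla_\kappa g(y)|^2}{\|x-y\|_2^{2(\alpha-\lfloor\alpha\rfloor)+d}}\,dx\,dy\le L^2$ if $\alpha$ is not an integer. Hölder condition on $f$: $f(\cdot,y)\in\mathcal H(\alpha,L)$ for every $y\in\mathcal X$ ($\mu$ is an arbitrary Borel probability measure on $\mathcal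 X$). Sobolev condition on $f$: $\mu$ is Lebesgue measure on $\mathcal X$, and $f(\cdot,y)\in\mathcal S(\alpha,L(y))$ for every $y\in\mathcal X$, where $L(\cdot):\mathcal X\to\mathbb R$ satisfies $\int_{\mathcal X}L^2(y)\,dy\le L^2$. *)

theory Defs
  imports "HOL-Probability.Probability"
begin

section \<open>Smoothness classes on the half-open cube\<close>

definition cube :: "(real ^ 'd::finite) set" where
  "cube = {x. \<forall>i. 0 \<le> x $ i \<and> x $ i < 1}"

text \<open>The largest integer strictly smaller than \<open>\<alpha>\<close>, for \<open>\<alpha> > 0\<close>; it is \<open>\<alpha> - 1\<close> when \<open>\<alpha>\<close> is
  an integer.\<close>

definition sfloor :: "real \<Rightarrow> nat" where
  "sfloor \<alpha> = nat (\<lceil>\<alpha>\<rceil> - 1)"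

lemma less_iff_le_sfloor: "\<alpha> > 0 \<Longrightarrow> real k < \<alpha> \<longleftrightarrow> k \<le> sfloor \<alpha>"
  unfolding sfloor_def by linarith

type_synonym 'd multi_index = "'d \<Rightarrow> nat"

definition mi_size :: "'d::finite multi_index \<Rightarrow> nat" where
  "mi_size \<kappa> = (\<Sum>i\<in>UNIV. \<kappa> i)"

definition mi_fact :: "'d::finite multi_index \<Rightarrow> real" where
  "mi_fact \<kappa> = (\<Prod>i\<in>UNIV. fact (\<kappa> i))"

lemma finite_mi_size: "finite {\<kappa> :: 'd::finite multi_index. mi_size \<kappa> = m}"
proof (rule finite_subset)
  show "{\<kappa> :: 'd multi_index. mi_size \<kappa> = m} \<subseteq> {\<kappa>. \<forall>i. (i \<in> UNIV \<longrightarrow> \<kappa> i \<in> {..m}) \<and> (i \<notin> UNIV \<longrightarrow> \<kappa> i = 0)}"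
    unfolding mi_size_def by (auto intro!: member_le_sum)
  show "finite {\<kappa> :: 'd multi_index. \<forall>i. (i \<in> UNIV \<longrightarrow> \<kappa> i \<in> {..m}) \<and> (i \<notin> UNIV \<longrightarrow> \<kappa> i = 0)}"
    by (rule finite_set_of_finite_funs) auto
qed

text \<open>\<open>D \<kappa>\<close> plays the role of the partial derivative \<open>\<nabla>\<^sub>\<kappa>\<close> of \<open>D (\<lambda>_. 0)\<close>: every \<open>D \<kappa>\<close> of order
  below \<open>m\<close> has all first-order partial derivatives on \<open>S\<close>, and these are the members of the family
  of the next order. At boundary points of \<open>S\<close> that belong to \<open>S\<close> the derivatives are one-sided.\<close>

definition partial_derivs ::
    "nat \<Rightarrow> (real ^ 'd::finite) set \<Rightarrow> ('d multi_index \<Rightarrow> real ^ 'd \<Rightarrow> real) \<Rightarrow> bool" where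
  "partial_derivs m S D \<longleftrightarrow>
     (\<forall>\<kappa> i. \<forall>x\<in>S. mi_size \<kappa> < m \<longrightarrow>
        ((\<lambda>t. D \<kappa> (x + t *\<^sub>R axis i 1)) has_real_derivative D (\<kappa>(i := Suc (\<kappa> i))) x)
          (at 0 within {t. x + t *\<^sub>R axis i 1 \<in> S}))"

text \<open>\<open>infnorm\<close> is the library's sup-norm \<open>\<parallel>\<cdot>\<parallel>\<^sub>\<infinity>\<close>.\<close>

definition hoelder_class :: "real \<Rightarrow> real \<Rightarrow> (real ^ 'd::finite \<Rightarrow> real) set" where
  "hoelder_class \<alpha> L = {g. \<exists>D.
      (\<forall>x\<in>cube. D (\<lambda>_. 0) x = g x) \<and> partial_derivs (sfloor \<alpha>) cube D \<and>
      (\<forall>x\<in>cube. \<forall>x'\<in>cube.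
         (\<Sum>\<kappa> | mi_size \<kappa> = sfloor \<alpha>. 1 / mi_fact \<kappa> * \<bar>D \<kappa> x - D \<kappa> x'\<bar>)
           \<le> L * infnorm (x - x') powr (\<alpha> - real (sfloor \<alpha>)))}"

text \<open>\<open>\<Phi>\<close> is the family of all partial derivatives of a function in \<open>C\<^sub>c\<^sup>\<infinity>\<close> of the open cube.\<close>

definition test_family :: "('d::finite multi_index \<Rightarrow> real ^ 'd \<Rightarrow> real) \<Rightarrow> bool" where
  "test_family \<Phi> \<longleftrightarrow>
     (\<forall>m. partial_derivs m UNIV \<Phi>) \<and> (\<forall>\<kappa>. continuous_on UNIV (\<Phi> \<kappa>)) \<and>
     (\<exists>K. compact K \<and> K \<subseteq> interior cube \<and> (\<forall>x. x \<notin> K \<longrightarrow> \<Phi> (\<lambda>_. 0) x = 0))"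

definition locally_integrable :: "(real ^ 'd::finite \<Rightarrow> real) \<Rightarrow> bool" where
  "locally_integrable g \<longleftrightarrow>
     (\<forall>K. compact K \<and> K \<subseteq> interior cube \<longrightarrow> set_integrable lborel K g)"

definition weak_deriv ::
    "(real ^ 'd::finite \<Rightarrow> real) \<Rightarrow> 'd multi_index \<Rightarrow> (real ^ 'd \<Rightarrow> real) \<Rightarrow> bool" where
  "weak_deriv g \<kappa> h \<longleftrightarrow>
     locally_integrable g \<and> locally_integrable h \<and>
     (\<forall>\<Phi>. test_family \<Phi> \<longrightarrow>
        (LINT x:interior cube|lborel. g x * \<Phi> \<kappa> x) =
        (- 1) ^ mi_size \<kappa> * (LINT x:interior cube|lborel. h x * \<Phi> (\<lambda>_. 0) x))"

definition sobolev_class :: "real \<Rightarrow> real \<Rightarrow> (real ^ 'd::finite \<Rightarrow> real) set" where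
  "sobolev_class \<alpha> L = {g. \<exists>D :: 'd multi_index \<Rightarrow> real ^ 'd \<Rightarrow> real.
      if \<alpha> \<in> \<int> then
        (\<forall>\<kappa>. real (mi_size \<kappa>) = \<alpha> \<longrightarrow> weak_deriv g \<kappa> (D \<kappa>)) \<and>
        (\<Sum>\<kappa> | real (mi_size \<kappa>) = \<alpha>. \<integral>\<^sup>+x\<in>cube. ennreal (\<bar>D \<kappa> x\<bar>\<^sup>2) \<partial>lborel) \<le> ennreal (L\<^sup>2)
      else
        (\<forall>\<kappa>. mi_size \<kappa> = sfloor \<alpha> \<longrightarrow> weak_deriv g \<kappa> (D \<kappa>)) \<and>
        (\<Sum>\<kappa> | mi_size \<kappa> = sfloor \<alpha>.
           \<integral>\<^sup>+x\<in>cube. (\<integral>\<^sup>+y\<in>cube.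
             ennreal (\<bar>D \<kappa> x - D \<kappa> y\<bar>\<^sup>2 /
                      norm (x - y) powr (2 * (\<alpha> - real (sfloor \<alpha>)) + real CARD('d))) \<partial>lborel) \<partial>lborel)
          \<le> ennreal (L\<^sup>2)}"

definition hoelder_condition :: "real \<Rightarrow> real \<Rightarrow> (real ^ 'd::finite \<Rightarrow> real ^ 'd \<Rightarrow> real) \<Rightarrow> bool" where
  "hoelder_condition \<alpha> L f \<longleftrightarrow> (\<forall>y\<in>cube. (\<lambda>x. f x y) \<in> hoelder_class \<alpha> L)"

definition sobolev_condition ::
    "(real ^ 'd::finite) measure \<Rightarrow> real \<Rightarrow> real \<Rightarrow> (real ^ 'd \<Rightarrow> real ^ 'd \<Rightarrow> real) \<Rightarrow> bool" where
  "sobolev_condition \<mu> \<alpha> L f \<longleftrightarrow>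
     \<mu> = restrict_space lborel cube \<and>
     (\<exists>l. l \<in> borel_measurable (restrict_space borel cube) \<and>
          (\<integral>\<^sup>+y\<in>cube. ennreal ((l y)\<^sup>2) \<partial>lborel) \<le> ennreal (L\<^sup>2) \<and>
          (\<forall>y\<in>cube. (\<lambda>x. f x y) \<in> sobolev_class \<alpha> (l y)))"


section \<open>The graphon model\<close>

text \<open>An \<open>n \<times> n\<close> matrix is a function of two indices, of which only the values at indices below \<open>n\<close>
  matter.\<close>

type_synonym rmatrix = "nat \<Rightarrow> nat \<Rightarrow> real"

definition graphon :: "(real ^ 'd::finite \<Rightarrow> real ^ 'd \<Rightarrow> real) \<Rightarrow> bool" where
  "graphon f \<longleftrightarrow>
     case_prod f \<in> borel_measurable (restrict_space borel cube \<Otimes>\<^sub>M restrict_space borel cube) \<and>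
     (\<forall>x\<in>cube. \<forall>y\<in>cube. f x y = f y x \<and> 0 \<le> f x y \<and> f x y \<le> 1)"

definition edge_prob :: "('a \<Rightarrow> 'a \<Rightarrow> real) \<Rightarrow> (nat \<Rightarrow> 'a) \<Rightarrow> rmatrix" where
  "edge_prob f x i j = (if i = j then 0 else f (x i) (x j))"

definition adj_matrix :: "(nat \<times> nat \<Rightarrow> bool) \<Rightarrow> rmatrix" where
  "adj_matrix E i j = (if i < j then of_bool (E (i, j)) else if j < i then of_bool (E (j, i)) else 0)"

text \<open>The conditional distribution of the adjacency matrix given the latent variables \<open>x\<close>.\<close>

definition adj_pmf :: "('a \<Rightarrow> 'a \<Rightarrow> real) \<Rightarrow> real \<Rightarrow> nat \<Rightarrow> (nat \<Rightarrow> 'a) \<Rightarrow> rmatrix pmf" where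
  "adj_pmf f \<rho> n x =
     map_pmf adj_matrix
       (Pi_pmf {(i, j). i < j \<and> j < n} False (\<lambda>(i, j). bernoulli_pmf (\<rho> * edge_prob f x i j)))"

text \<open>The joint distribution of the latent variables and the adjacency matrix.\<close>

definition graphon_model ::
    "'a measure \<Rightarrow> ('a \<Rightarrow> 'a \<Rightarrow> real) \<Rightarrow> real \<Rightarrow> nat \<Rightarrow> ((nat \<Rightarrow> 'a) \<times> rmatrix) measure" where
  "graphon_model \<mu> f \<rho> n =
     (let X = Pi\<^sub>M {..<n} (\<lambda>_. \<mu>) in
      X \<bind> (\<lambda>x. measure_pmf (adj_pmf f \<rho> n x) \<bind> (\<lambda>A. return (X \<Otimes>\<^sub>M count_space UNIV) (x, A))))"

text \<open>The joint distribution is well defined: the conditional distribution is a measurable kernel, so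
  the distribution is a probability measure and expectations can be computed iteratively.\<close>

lemma measurable_edge:
  assumes "graphon f" "sets \<mu> = sets (restrict_space borel cube)" "i < n" "j < n"
  shows "(\<lambda>x. edge_prob f x i j) \<in> borel_measurable (Pi\<^sub>M {..<n} (\<lambda>_. \<mu>))"
proof (cases "i = j")
  case False
  have "case_prod f \<in> borel_measurable (\<mu> \<Otimes>\<^sub>M \<mu>)"
    using assms(1) unfolding graphon_def
    by (subst measurable_cong_sets[OF sets_pair_measure_cong[OF assms(2) assms(2)] refl]) auto
  from measurable_compose[OF _ this, of "\<lambda>x. (x i, x j)" "Pi\<^sub>M {..<n} (\<lambda>_. \<mu>)"]
  show ?thesis using False assms by (simp add: edge_prob_def)
qed (simp add: edge_prob_def)

lemma edge_bounds:
  assumes "graphon f" "sets \<mu> = sets (restrict_space borel cube)" "i < n" "j < n"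
     "x \<in> space (Pi\<^sub>M {..<n} (\<lambda>_. \<mu>))"
  shows "0 \<le> edge_prob f x i j" "edge_prob f x i j \<le> 1"
proof -
  have "space \<mu> = cube" using sets_eq_imp_space_eq[OF assms(2)] by (simp add: space_restrict_space)
  then have "x i \<in> cube" "x j \<in> cube" using assms by (auto simp: space_PiM)
  then show "0 \<le> edge_prob f x i j" "edge_prob f x i j \<le> 1"
    using assms(1) by (auto simp: edge_prob_def graphon_def)
qed

lemma adj_pmf_measurable:
  assumes "graphon f" "sets \<mu> = sets (restrict_space borel cube)" "0 \<le> \<rho>" "\<rho> \<le> 1"
  shows "(\<lambda>x. measure_pmf (adj_pmf f \<rho> n x)) \<in> Pi\<^sub>M {..<n} (\<lambda>_. \<mu>) \<rightarrow>\<^sub>M subprob_algebra (count_space UNIV)"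
proof (rule measurable_subprob_algebra)
  fix B :: "rmatrix set"
  let ?P = "{(i, j). i < j \<and> j < n}" and ?X = "Pi\<^sub>M {..<n} (\<lambda>_. \<mu>)"
  let ?F = "PiE_dflt ?P False (\<lambda>_. UNIV :: bool set)"
  have finP: "finite ?P" by (rule finite_subset[of _ "{..<n} \<times> {..<n}"]) auto
  have finF: "finite ?F" using finP by (intro finite_PiE_dflt) auto
  have pr: "\<rho> * edge_prob f x i j \<in> {0..1}" if "x \<in> space ?X" "i < j" "j < n" for x i j
    using edge_bounds[OF assms(1,2), of i n j x] that assms(3,4) by (auto intro: mult_le_one)
  have "emeasure (measure_pmf (adj_pmf f \<rho> n x)) B =
      (\<Sum>E\<in>?F \<inter> adj_matrix -` B. ennreal (\<Prod>(i,j)\<in>?P. if E (i,j) then \<rho> * edge_prob f x i j else 1 - \<rho> * edge_prob f x i j))"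
    if x: "x \<in> space ?X" for x
  proof -
    let ?p = "Pi_pmf ?P False (\<lambda>(i, j). bernoulli_pmf (\<rho> * edge_prob f x i j))"
    have sub: "set_pmf ?p \<subseteq> ?F"
      using set_Pi_pmf_subset[OF finP, of False "\<lambda>(i, j). bernoulli_pmf (\<rho> * edge_prob f x i j)"]
      by (auto simp: PiE_dflt_def)
    have "emeasure (measure_pmf (adj_pmf f \<rho> n x)) B = emeasure (measure_pmf ?p) (adj_matrix -` B)"
      unfolding adj_pmf_def by simp
    also have "\<dots> = emeasure (measure_pmf ?p) (?F \<inter> adj_matrix -` B)"
      using sub by (intro emeasure_eq_AE) (auto simp: AE_measure_pmf_iff)
    also have "\<dots> = (\<Sum>E\<in>?F \<inter> adj_matrix -` B. ennreal (pmf ?p E))"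
      using finF by (simp add: emeasure_measure_pmf_finite)
    also have "\<dots> = (\<Sum>E\<in>?F \<inter> adj_matrix -` B. ennreal (\<Prod>(i,j)\<in>?P. if E (i,j) then \<rho> * edge_prob f x i j else 1 - \<rho> * edge_prob f x i j))"
    proof (rule sum.cong[OF refl], rule arg_cong[of _ _ ennreal])
      fix E assume E: "E \<in> ?F \<inter> adj_matrix -` B"
      have "pmf ?p E = (\<Prod>e\<in>?P. pmf ((\<lambda>(i, j). bernoulli_pmf (\<rho> * edge_prob f x i j)) e) (E e))"
        using E by (intro pmf_Pi' finP) (auto simp: PiE_dflt_def)
      also have "\<dots> = (\<Prod>(i,j)\<in>?P. if E (i,j) then \<rho> * edge_prob f x i j else 1 - \<rho> * edge_prob f x i j)"
        using pr[OF x] by (intro prod.cong) auto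
      finally show "pmf ?p E = (\<Prod>(i,j)\<in>?P. if E (i,j) then \<rho> * edge_prob f x i j else 1 - \<rho> * edge_prob f x i j)" .
    qed
    finally show ?thesis .
  qed
  moreover have "(\<lambda>x. \<Sum>E\<in>?F \<inter> adj_matrix -` B. ennreal (\<Prod>(i,j)\<in>?P. if E (i,j) then \<rho> * edge_prob f x i j else 1 - \<rho> * edge_prob f x i j)) \<in> borel_measurable ?X"
  proof (intro borel_measurable_sum measurable_compose[OF _ measurable_ennreal] borel_measurable_prod)
    fix E e assume "e \<in> ?P"
    then obtain i j where e: "e = (i,j)" "i < n" "j < n" by auto
    have [measurable]: "(\<lambda>x. edge_prob f x i j) \<in> borel_measurable ?X"
      using measurable_edge[OF assms(1,2)] e by blast
    show "(\<lambda>x. case e of (i,j) \<Rightarrow> if E (i,j) then \<rho> * edge_prob f x i j else 1 - \<rho> * edge_prob f x i j) \<in> borel_measurable ?X"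
      using e by (cases "E (i,j)") simp_all
  qed
  ultimately show "(\<lambda>x. emeasure (measure_pmf (adj_pmf f \<rho> n x)) B) \<in> borel_measurable ?X"
    by (subst measurable_cong)
qed (auto intro: prob_space_imp_subprob_space measure_pmf.prob_space_axioms)

lemma graphon_model_facts:
  assumes "graphon f" "sets \<mu> = sets (restrict_space borel cube)" "0 \<le> \<rho>" "\<rho> \<le> 1" "prob_space \<mu>"
  shows "sets (graphon_model \<mu> f \<rho> n) = sets (Pi\<^sub>M {..<n} (\<lambda>_. \<mu>) \<Otimes>\<^sub>M count_space UNIV)"
    and "prob_space (graphon_model \<mu> f \<rho> n)"
    and "g \<in> borel_measurable (Pi\<^sub>M {..<n} (\<lambda>_. \<mu>) \<Otimes>\<^sub>M count_space UNIV) \<Longrightarrow>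
       (\<integral>\<^sup>+z. g z \<partial>graphon_model \<mu> f \<rho> n) =
       (\<integral>\<^sup>+x. \<integral>\<^sup>+A. g (x, A) \<partial>measure_pmf (adj_pmf f \<rho> n x) \<partial>Pi\<^sub>M {..<n} (\<lambda>_. \<mu>))"
proof -
  let ?X = "Pi\<^sub>M {..<n} (\<lambda>_. \<mu>)"
  let ?S = "?X \<Otimes>\<^sub>M count_space (UNIV :: rmatrix set)"
  interpret X: prob_space ?X by (intro prob_space_PiM assms)
  have [measurable]: "(\<lambda>x. measure_pmf (adj_pmf f \<rho> n x)) \<in> ?X \<rightarrow>\<^sub>M subprob_algebra (count_space UNIV)"
    by (rule adj_pmf_measurable) fact+
  have K[measurable]: "(\<lambda>x. measure_pmf (adj_pmf f \<rho> n x) \<bind> (\<lambda>A. return ?S (x, A))) \<in> ?X \<rightarrow>\<^sub>M subprob_algebra ?S"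
    by measurable
  have R: "(\<lambda>A. return ?S (x, A)) \<in> measure_pmf (adj_pmf f \<rho> n x) \<rightarrow>\<^sub>M subprob_algebra ?S"
    if "x \<in> space ?X" for x
    using that by (auto simp: space_subprob_algebra space_pair_measure intro!: prob_space_imp_subprob_space prob_space_return)
  show "prob_space (graphon_model \<mu> f \<rho> n)" unfolding graphon_model_def Let_def
  proof (rule X.prob_space_bind[OF _ K], rule AE_I2)
    fix x assume x: "x \<in> space ?X"
    show "prob_space (measure_pmf (adj_pmf f \<rho> n x) \<bind> (\<lambda>A. return ?S (x, A)))"
      using x by (intro measure_pmf.prob_space_bind[OF _ R[OF x]] AE_I2 prob_space_return)
        (simp add: space_pair_measure)
  qed
  show "sets (graphon_model \<mu> f \<rho> n) = sets ?S" unfolding graphon_model_def Let_def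
    by (rule sets_bind[OF sets_kernel[OF K] X.not_empty])
  assume g: "g \<in> borel_measurable ?S"
  have "(\<integral>\<^sup>+z. g z \<partial>graphon_model \<mu> f \<rho> n) =
     (\<integral>\<^sup>+x. \<integral>\<^sup>+z. g z \<partial>(measure_pmf (adj_pmf f \<rho> n x) \<bind> (\<lambda>A. return ?S (x, A))) \<partial>?X)"
    unfolding graphon_model_def Let_def by (rule nn_integral_bind[OF g K])
  also have "\<dots> = (\<integral>\<^sup>+x. \<integral>\<^sup>+A. g (x, A) \<partial>measure_pmf (adj_pmf f \<rho> n x) \<partial>?X)"
  proof (rule nn_integral_cong)
    fix x assume x: "x \<in> space ?X"
    show "(\<integral>\<^sup>+z. g z \<partial>(measure_pmf (adj_pmf f \<rho> n x) \<bind> (\<lambda>A. return ?S (x, A)))) =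
      (\<integral>\<^sup>+A. g (x, A) \<partial>measure_pmf (adj_pmf f \<rho> n x))"
      using x by (subst nn_integral_bind[OF g R[OF x]])
        (auto intro!: nn_integral_cong nn_integral_return g simp: space_pair_measure)
  qed
  finally show "(\<integral>\<^sup>+z. g z \<partial>graphon_model \<mu> f \<rho> n) =
       (\<integral>\<^sup>+x. \<integral>\<^sup>+A. g (x, A) \<partial>measure_pmf (adj_pmf f \<rho> n x) \<partial>?X)" .
qed

definition MSE :: "'a measure \<Rightarrow> ('a \<Rightarrow> 'a \<Rightarrow> real) \<Rightarrow> real \<Rightarrow> nat \<Rightarrow> (rmatrix \<Rightarrow> rmatrix) \<Rightarrow> real" where
  "MSE \<mu> f \<rho> n Mhat =
     1 / (real n)\<^sup>2 *
     (LINT (x, A)|graphon_model \<mu> f \<rho> n. (\<Sum>i<n. \<Sum>j<n. (edge_prob f x i j - Mhat A i j)\<^sup>2))"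


section \<open>Universal singular value thresholding\<close>

text \<open>The \<open>k\<close>-th left and right singular vectors are \<open>u k\<close> and \<open>v k\<close>.\<close>

definition orthonormal_vecs :: "nat \<Rightarrow> (nat \<Rightarrow> nat \<Rightarrow> real) \<Rightarrow> bool" where
  "orthonormal_vecs n u \<longleftrightarrow> (\<forall>k<n. \<forall>l<n. (\<Sum>i<n. u k i * u l i) = (if k = l then 1 else 0))"

definition is_svd ::
    "nat \<Rightarrow> rmatrix \<Rightarrow> (nat \<Rightarrow> real) \<Rightarrow> (nat \<Rightarrow> nat \<Rightarrow> real) \<Rightarrow> (nat \<Rightarrow> nat \<Rightarrow> real) \<Rightarrow> bool" where
  "is_svd n A s u v \<longleftrightarrow>
     orthonormal_vecs n u \<and> orthonormal_vecs n v \<and>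
     (\<forall>k<n. 0 \<le> s k) \<and> (\<forall>k l. k \<le> l \<and> l < n \<longrightarrow> s l \<le> s k) \<and>
     (\<forall>i<n. \<forall>j<n. A i j = (\<Sum>k<n. s k * u k i * v k j))"

text \<open>A relation, because the singular value decomposition is not unique. (The output is, since all
  singular values of the same size are kept or discarded together.)\<close>

definition usvt_output :: "nat \<Rightarrow> rmatrix \<Rightarrow> real \<Rightarrow> real \<Rightarrow> rmatrix \<Rightarrow> bool" where
  "usvt_output n A \<rho> \<tau> Mhat \<longleftrightarrow> (\<exists>s u v. is_svd n A s u v \<and>
     (let Ahat = (\<lambda>i j. \<Sum>k | k < n \<and> s k \<ge> \<tau>. s k * u k i * v k j);
          Mtilde = (\<lambda>i j. Ahat i j / \<rho>)
      in (\<forall>i<n. Mhat i i = 0) \<and>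
         (\<forall>i j. i < j \<and> j < n \<longrightarrow>
            Mhat i j = min 1 (max 0 (Mtilde i j)) \<and> Mhat j i = Mhat i j)))"

end

theory Submission
  imports Defs "HOL-Computational_Algebra.Polynomial" "HOL-Real_Asymp.Real_Asymp"
begin

text \<open>
  If the noise \<open>A - \<rho> M\<close> has operator norm at most \<open>\<theta>\<close>, then thresholding at
  \<open>\<tau> = (1 + \<delta>) \<theta>\<close> has squared error \<open>O(R \<tau>\<^sup>2 + \<rho>\<^sup>2 \<parallel>M - P\<parallel>\<^sub>F\<^sup>2)\<close> for every
  matrix \<open>P\<close> of rank \<open>R\<close>. Here \<open>P\<close> comes from replacing every \<open>f(\<cdot>, y)\<close> by a polynomial on
  each of \<open>m\<^sup>d\<close> cubes of side \<open>1 / m\<close>, so that \<open>R = O(m\<^sup>d)\<close> and the error per entry is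
  \<open>O(m powr (- 2 \<alpha>))\<close>; the choice \<open>m = (n \<rho>) powr (1 / (2 \<alpha> + d))\<close> balances the two terms.

  The bound \<open>\<theta> = O(sqrt (n \<rho>))\<close> on the noise uses trace moments of order \<open>2 K\<close> with
  \<open>K\<close> of the order of \<open>n \<rho>\<close>. After symmetrisation only closed walks that use every edge an even
  number of times contribute. Their number on \<open>n\<close> vertices is compared with that on \<open>O(K)\<close>
  vertices, which is the mean trace of a power of a random sign matrix and is bounded
  with an exponentially large net of lattice points.

  In the Sobolev case the polynomials are found by duality. On an interval, a test
  function minus a combination of derivatives of a fixed bump that has the same moments is an
  iterated derivative of a test function; doing this in one coordinate after the other for tensor
  products of test functions moves the derivatives to \<open>g\<close>, where they are weak derivatives.
\<close>

section \<open>Thresholding below the noise level\<close>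

text \<open>The sparse regime shapes the noise bound: when \<open>n * \<rho>\<close> is of order
  \<open>ln n\<close>, the noise entries are far from sub-Gaussian at scale
  \<open>sqrt \<rho>\<close>, and a net in dimension \<open>n\<close> is too lossy. Even closed
  walks of length \<open>2 * K\<close> visit at most \<open>K + 1\<close> vertices, so they can be
  transplanted to \<open>2 * K + 2\<close> vertices, where a net costs only a constant to the power
  \<open>K\<close>, that is a constant factor after a root of order \<open>2 * K\<close>. Markov's
  inequality leaves \<open>n * exp (- K)\<close>, and \<open>C * ln n \<le> n * \<rho>\<close>
  allows \<open>K \<ge> 4 * ln n\<close> with \<open>K\<close> still of order
  \<open>n * \<rho>\<close>. The factor \<open>1 + \<delta>\<close> bounds the number of kept
  singular values: each exceeds the noise by a fixed fraction, which the rank or the error of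
  \<open>P\<close> has to pay for. A weak derivative is known only through its pairings with test
  functions. L2 errors are therefore measured by such pairings too. Tensor products suffice because
  they are L2-dense, and with them everything reduces to integration in one variable.\<close>

definition ip :: "nat \<Rightarrow> (nat \<Rightarrow> real) \<Rightarrow> (nat \<Rightarrow> real) \<Rightarrow> real" where
  "ip n x y = (\<Sum>i<n. x i * y i)"

definition mv :: "nat \<Rightarrow> rmatrix \<Rightarrow> (nat \<Rightarrow> real) \<Rightarrow> nat \<Rightarrow> real" where
  "mv n A x = (\<lambda>i. \<Sum>j<n. A i j * x j)"

definition op_le :: "nat \<Rightarrow> rmatrix \<Rightarrow> real \<Rightarrow> bool" where
  "op_le n A \<theta> \<longleftrightarrow> (\<forall>x. ip n (mv n A x) (mv n A x) \<le> \<theta>\<^sup>2 * ip n x x)"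

lemma ip_commute: "ip n x y = ip n y x"
  by (simp add: ip_def mult.commute)

lemma ip_add_left: "ip n (\<lambda>i. x i + y i) z = ip n x z + ip n y z"
  by (simp add: ip_def distrib_right sum.distrib)

lemma ip_diff_left: "ip n (\<lambda>i. x i - y i) z = ip n x z - ip n y z"
  by (simp add: ip_def left_diff_distrib sum_subtractf)

lemma ip_scale_left: "ip n (\<lambda>i. c * x i) z = c * ip n x z"
  by (simp add: ip_def sum_distrib_left mult.assoc)

lemma ip_sum_left: "ip n (\<lambda>i. \<Sum>k\<in>K. x k i) z = (\<Sum>k\<in>K. ip n (x k) z)"
  unfolding ip_def sum_distrib_right by (rule sum.swap)

lemma ip_add_right: "ip n z (\<lambda>i. x i + y i) = ip n z x + ip n z y"
  and ip_diff_right: "ip n z (\<lambda>i. x i - y i) = ip n z x - ip n z y"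
  and ip_scale_right: "ip n z (\<lambda>i. c * x i) = c * ip n z x"
  by (simp_all add: ip_commute[of n z] ip_add_left ip_diff_left ip_scale_left)

lemma ip_sum_right: "ip n z (\<lambda>i. \<Sum>k\<in>K. x k i) = (\<Sum>k\<in>K. ip n z (x k))"
  by (simp add: ip_commute[of n z] ip_sum_left)

lemmas ip_linear = ip_add_left ip_diff_left ip_scale_left ip_sum_left
  ip_add_right ip_diff_right ip_scale_right ip_sum_right

lemma ip_cong: "(\<And>i. i < n \<Longrightarrow> x i = x' i) \<Longrightarrow> (\<And>i. i < n \<Longrightarrow> y i = y' i) \<Longrightarrow> ip n x y = ip n x' y'"
  by (simp add: ip_def)

lemma ip_self_nonneg [simp]: "0 \<le> ip n x x"
  by (simp add: ip_def sum_nonneg)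

lemma ip_self_eq_0_iff: "ip n x x = 0 \<longleftrightarrow> (\<forall>i<n. x i = 0)"
  by (auto simp: ip_def sum_nonneg_eq_0_iff)

lemma ip_Cauchy_Schwarz: "(ip n x y)\<^sup>2 \<le> ip n x x * ip n y y"
  using Cauchy_Schwarz_ineq_sum[of x y "{..<n}"] by (simp add: ip_def power2_eq_square)

lemma abs_ip_le: "\<bar>ip n x y\<bar> \<le> sqrt (ip n x x) * sqrt (ip n y y)"
  using real_sqrt_le_mono[OF ip_Cauchy_Schwarz[of n x y]] by (simp add: real_sqrt_mult)

lemma mv_sum: "mv n A (\<lambda>j. \<Sum>k\<in>K. x k j) = (\<lambda>i. \<Sum>k\<in>K. mv n A (x k) i)"
  unfolding mv_def sum_distrib_left by (rule ext, rule sum.swap)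

lemma mv_scale: "mv n A (\<lambda>j. c * x j) = (\<lambda>i. c * mv n A x i)"
  by (simp add: mv_def sum_distrib_left mult.left_commute)

lemma mv_matrix_diff: "mv n (\<lambda>i j. A i j - B i j) x = (\<lambda>i. mv n A x i - mv n B x i)"
  by (simp add: mv_def left_diff_distrib sum_subtractf)

lemma mv_row: "mv n A x i = ip n (A i) x"
  by (simp add: mv_def ip_def)

lemma op_leD: "op_le n A \<theta> \<Longrightarrow> 0 \<le> \<theta> \<Longrightarrow> sqrt (ip n (mv n A x) (mv n A x)) \<le> \<theta> * sqrt (ip n x x)"
  unfolding op_le_def by (metis real_sqrt_le_mono real_sqrt_mult real_sqrt_unique)

section \<open>Orthonormal families, residuals and Parseval's identity\<close>

definition onf :: "nat \<Rightarrow> nat \<Rightarrow> (nat \<Rightarrow> nat \<Rightarrow> real) \<Rightarrow> bool" where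
  "onf n R q \<longleftrightarrow> (\<forall>r<R. \<forall>t<R. ip n (q r) (q t) = of_bool (r = t))"

lemma onf_ip_sum:
  assumes "onf n R q" "r < R"
  shows "ip n (q r) (\<lambda>i. \<Sum>t<R. c t * q t i) = c r"
proof -
  have "ip n (q r) (\<lambda>i. \<Sum>t<R. c t * q t i) = (\<Sum>t<R. c t * of_bool (r = t))"
    using assms by (simp add: ip_linear onf_def)
  also have "\<dots> = c r" using assms by (simp add: of_bool_def if_distrib cong: if_cong)
  finally show ?thesis .
qed

definition residual :: "nat \<Rightarrow> nat \<Rightarrow> (nat \<Rightarrow> nat \<Rightarrow> real) \<Rightarrow> (nat \<Rightarrow> real) \<Rightarrow> nat \<Rightarrow> real" where
  "residual n R q x = (\<lambda>i. x i - (\<Sum>r<R. ip n (q r) x * q r i))"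

lemma residual_orth: "onf n R q \<Longrightarrow> r < R \<Longrightarrow> ip n (q r) (residual n R q x) = 0"
  unfolding residual_def ip_diff_right using onf_ip_sum[of n R q r "\<lambda>r. ip n (q r) x"] by simp

lemma ip_self_residual:
  assumes "onf n R q"
  shows "ip n x x = ip n (residual n R q x) (residual n R q x) + (\<Sum>r<R. (ip n (q r) x)\<^sup>2)"
proof -
  let ?y = "residual n R q x"
  have "ip n ?y ?y = ip n x ?y - (\<Sum>r<R. ip n (q r) x * ip n (q r) ?y)"
    by (subst residual_def) (simp add: ip_linear)
  also have "\<dots> = ip n x ?y" using residual_orth[OF assms] by simp
  also have "\<dots> = ip n x x - (\<Sum>r<R. (ip n (q r) x)\<^sup>2)"
    by (simp add: residual_def ip_linear ip_commute[of n x "q _"] power2_eq_square)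
  finally show ?thesis by simp
qed

lemma Bessel: "onf n R q \<Longrightarrow> (\<Sum>r<R. (ip n (q r) x)\<^sup>2) \<le> ip n x x"
  using ip_self_residual[of n R q x] by simp

lemma ip_residual_le: "onf n R q \<Longrightarrow> ip n (residual n R q x) (residual n R q x) \<le> ip n x x"
  using ip_self_residual[of n R q x] by (simp add: sum_nonneg)

text \<open>Lets a column of \<open>B\<close> be replaced by its error against the column of
  \<open>P\<close>, which lies in the span of \<open>q\<close>.\<close>

lemma residual_diff_span:
  assumes "onf n R q"
  shows "residual n R q (\<lambda>i. x i - (\<Sum>r<R. b r * q r i)) = residual n R q x"
  unfolding residual_def ip_diff_right
  by (simp add: onf_ip_sum[OF assms] left_diff_distrib sum_subtractf)

text \<open>Projecting commutes with applying the matrix, so the residuals of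
  \<open>mv n B (v k)\<close> over a basis add up to the Frobenius norm of the matrix with projected
  columns.\<close>

lemma residual_mv:
  "residual n R q (mv n B x) = mv n (\<lambda>i j. residual n R q (\<lambda>i. B i j) i) x"
proof
  fix i
  have "(\<Sum>r<R. ip n (q r) (mv n B x) * q r i) = (\<Sum>r<R. \<Sum>j<n. ip n (q r) (\<lambda>i. B i j) * q r i * x j)"
  proof (rule sum.cong[OF refl])
    fix r
    have "ip n (q r) (mv n B x) = (\<Sum>j<n. x j * ip n (q r) (\<lambda>i. B i j))"
      unfolding mv_def ip_sum_right by (simp add: ip_scale_right[symmetric] mult.commute)
    then show "ip n (q r) (mv n B x) * q r i = (\<Sum>j<n. ip n (q r) (\<lambda>i. B i j) * q r i * x j)"
      by (simp add: sum_distrib_left sum_distrib_right mult_ac)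
  qed
  also have "\<dots> = (\<Sum>j<n. \<Sum>r<R. ip n (q r) (\<lambda>i. B i j) * q r i * x j)" by (rule sum.swap)
  finally show "residual n R q (mv n B x) i = mv n (\<lambda>i j. residual n R q (\<lambda>i. B i j) i) x i"
    by (simp add: residual_def mv_def left_diff_distrib sum_subtractf sum_distrib_right)
qed

text \<open>\<open>n\<close> orthonormal vectors in dimension \<open>n\<close> are complete because
  \<open>\<parallel>I - P\<parallel>\<^sub>F\<^sup>2 = n - 2 n + n = 0\<close> for \<open>P = \<Sum>k. v\<^sub>k v\<^sub>k\<^sup>T\<close>.\<close>

lemma onf_complete:
  assumes "onf n n v" "i < n" "j < n"
  shows "(\<Sum>k<n. v k i * v k j) = of_bool (i = j)"
proof -
  let ?P = "\<lambda>i j. \<Sum>k<n. v k i * v k j"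
  have tr: "(\<Sum>i<n. ?P i i) = real n"
  proof -
    have "(\<Sum>i<n. ?P i i) = (\<Sum>k<n. ip n (v k) (v k))" unfolding ip_def by (rule sum.swap)
    then show ?thesis using assms(1) by (simp add: onf_def)
  qed
  have sq: "(\<Sum>i<n. \<Sum>j<n. (?P i j)\<^sup>2) = real n"
  proof -
    have "(\<Sum>i<n. \<Sum>j<n. (?P i j)\<^sup>2) = (\<Sum>i<n. \<Sum>j<n. \<Sum>k<n. \<Sum>l<n. (v k i * v l i) * (v k j * v l j))"
      by (simp add: power2_eq_square sum_product mult_ac)
    also have "\<dots> = (\<Sum>i<n. \<Sum>k<n. \<Sum>j<n. \<Sum>l<n. (v k i * v l i) * (v k j * v l j))"
      by (rule sum.cong[OF refl], rule sum.swap)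
    also have "\<dots> = (\<Sum>k<n. \<Sum>i<n. \<Sum>j<n. \<Sum>l<n. (v k i * v l i) * (v k j * v l j))"
      by (rule sum.swap)
    also have "\<dots> = (\<Sum>k<n. \<Sum>i<n. \<Sum>l<n. \<Sum>j<n. (v k i * v l i) * (v k j * v l j))"
      by (rule sum.cong[OF refl], rule sum.cong[OF refl], rule sum.swap)
    also have "\<dots> = (\<Sum>k<n. \<Sum>l<n. \<Sum>i<n. \<Sum>j<n. (v k i * v l i) * (v k j * v l j))"
      by (rule sum.cong[OF refl], rule sum.swap)
    also have "\<dots> = (\<Sum>k<n. \<Sum>l<n. (ip n (v k) (v l))\<^sup>2)"
      by (simp add: ip_def power2_eq_square sum_product)
    also have "\<dots> = (\<Sum>k<n. \<Sum>l<n. of_bool (k = l))"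
      using assms(1) by (intro sum.cong refl) (simp add: onf_def)
    also have "\<dots> = real n" by (simp add: of_bool_def)
    finally show ?thesis .
  qed
  have "(\<Sum>i<n. \<Sum>j<n. (of_bool (i = j) - ?P i j)\<^sup>2)
      = (\<Sum>i<n. \<Sum>j<n. of_bool (i = j) - 2 * (of_bool (i = j) * ?P i j) + (?P i j)\<^sup>2)"
    by (intro sum.cong refl) (simp add: power2_diff)
  also have "\<dots> = (\<Sum>i<n. \<Sum>j<n. of_bool (i = j)) - 2 * (\<Sum>i<n. \<Sum>j<n. of_bool (i = j) * ?P i j)
      + (\<Sum>i<n. \<Sum>j<n. (?P i j)\<^sup>2)"
    by (simp only: sum.distrib sum_subtractf sum_distrib_left)
  also have "(\<Sum>i<n. \<Sum>j<n. of_bool (i = j)) = real n" by (simp add: of_bool_def)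
  also have "(\<Sum>i<n. \<Sum>j<n. of_bool (i = j) * ?P i j) = (\<Sum>i<n. ?P i i)"
    by (rule sum.cong[OF refl]) (simp add: of_bool_def if_distribR if_distrib cong: if_cong)
  also have "real n - 2 * (\<Sum>i<n. ?P i i) + (\<Sum>i<n. \<Sum>j<n. (?P i j)\<^sup>2) = 0" unfolding tr sq by simp
  finally have 0: "(\<Sum>i<n. \<Sum>j<n. (of_bool (i = j) - ?P i j)\<^sup>2) = 0" .
  then have "\<forall>i\<in>{..<n}. (\<Sum>j<n. (of_bool (i = j) - ?P i j)\<^sup>2) = 0"
    by (subst (asm) sum_nonneg_eq_0_iff) (auto intro: sum_nonneg)
  then have "(\<Sum>j<n. (of_bool (i = j) - ?P i j)\<^sup>2) = 0" using assms(2) by blast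
  then have "\<forall>j\<in>{..<n}. (of_bool (i = j) - ?P i j)\<^sup>2 = 0"
    by (subst (asm) sum_nonneg_eq_0_iff) auto
  then show ?thesis using assms(3) by simp
qed

lemma Parseval:
  assumes "onf n n v"
  shows "(\<Sum>k<n. (ip n (v k) x)\<^sup>2) = ip n x x"
proof -
  have "(\<Sum>k<n. (ip n (v k) x)\<^sup>2) = (\<Sum>k<n. \<Sum>i<n. \<Sum>j<n. v k i * v k j * (x i * x j))"
    by (simp add: ip_def power2_eq_square sum_product mult_ac)
  also have "\<dots> = (\<Sum>i<n. \<Sum>k<n. \<Sum>j<n. v k i * v k j * (x i * x j))"
    by (rule sum.swap)
  also have "\<dots> = (\<Sum>i<n. \<Sum>j<n. \<Sum>k<n. v k i * v k j * (x i * x j))"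
    by (rule sum.cong[OF refl], rule sum.swap)
  also have "\<dots> = (\<Sum>i<n. \<Sum>j<n. of_bool (i = j) * (x i * x j))"
    by (intro sum.cong refl) (simp add: onf_complete[OF assms] flip: sum_distrib_right)
  also have "\<dots> = ip n x x" by (simp add: ip_def of_bool_def if_distribR if_distrib cong: if_cong)
  finally show ?thesis .
qed

text \<open>Parseval's identity applied to each row of \<open>X\<close>.\<close>

lemma frobenius_basis:
  assumes "onf n n v"
  shows "(\<Sum>k<n. ip n (mv n X (v k)) (mv n X (v k))) = (\<Sum>i<n. \<Sum>j<n. (X i j)\<^sup>2)"
proof -
  have "(\<Sum>k<n. ip n (mv n X (v k)) (mv n X (v k))) = (\<Sum>k<n. \<Sum>i<n. (ip n (v k) (X i))\<^sup>2)"
    by (simp add: ip_def[of n "mv n X _"] mv_row power2_eq_square ip_commute[of n "X _"])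
  also have "\<dots> = (\<Sum>i<n. \<Sum>k<n. (ip n (v k) (X i))\<^sup>2)" by (rule sum.swap)
  also have "\<dots> = (\<Sum>i<n. \<Sum>j<n. (X i j)\<^sup>2)"
    by (simp add: Parseval[OF assms]) (simp add: ip_def power2_eq_square)
  finally show ?thesis .
qed

lemma le_of_sq_le: "(a::real) \<le> b * sqrt a \<Longrightarrow> 0 \<le> a \<Longrightarrow> 0 \<le> b \<Longrightarrow> a \<le> b\<^sup>2"
proof -
  assume h: "a \<le> b * sqrt a" "0 \<le> a" "0 \<le> b"
  show "a \<le> b\<^sup>2"
  proof (cases "a = 0")
    case False
    then have "sqrt a > 0" using h by simp
    moreover have "sqrt a * sqrt a \<le> b * sqrt a" using h by simp
    ultimately have "sqrt a \<le> b" by (rule mult_right_le_imp_le[rotated])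
    then have "(sqrt a)\<^sup>2 \<le> b\<^sup>2" using h by (intro power_mono) auto
    then show ?thesis using h by simp
  qed simp
qed

text \<open>The thresholded matrix is compared with \<open>B\<close> on the basis \<open>v\<close>: on the kept vectors the two
  differ by the noise, and on the discarded ones the part of \<open>B v\<^sub>k\<close> in the span of \<open>q\<close> is small
  because \<open>A\<close> itself is at most \<open>\<tau>\<close> there.\<close>

lemma svt_frobenius:
  assumes svd: "is_svd n A s u v" and E: "op_le n (\<lambda>i j. A i j - B i j) \<theta>"
    and \<theta>: "0 < \<theta>" and \<delta>: "0 < \<delta>" and \<tau>: "\<tau> = (1 + \<delta>) * \<theta>" and q: "onf n R q"
    and P: "\<And>j. j < n \<Longrightarrow> \<forall>i<n. P i j = (\<Sum>r<R. b r j * q r i)"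
  defines "Ahat \<equiv> (\<lambda>i j. \<Sum>k | k < n \<and> s k \<ge> \<tau>. s k * u k i * v k j)"
    and "Dsq \<equiv> (\<Sum>i<n. \<Sum>j<n. (B i j - P i j)\<^sup>2)"
    and "\<epsilon> \<equiv> \<delta> / (4 * (1 + \<delta>))"
  shows "(\<Sum>i<n. \<Sum>j<n. (B i j - Ahat i j)\<^sup>2) \<le>
     (2 / \<epsilon> * (1 + 1 / (4 * \<epsilon>)) + 4) * (real R * \<tau>\<^sup>2 + Dsq)"
proof -
  let ?E = "\<lambda>i j. A i j - B i j"
  let ?S = "{k. k < n \<and> s k \<ge> \<tau>}" and ?N = "{k. k < n \<and> \<not> s k \<ge> \<tau>}"
  have \<tau>0: "\<tau> > 0" "\<theta> \<le> \<tau>" using \<theta> \<delta> \<tau> by (auto simp: mult_le_cancel_right1)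
  have \<epsilon>0: "\<epsilon> > 0" using \<delta> by (simp add: \<epsilon>_def)
  have v: "onf n n v" and u: "onf n n u"
    using svd by (auto simp: is_svd_def orthonormal_vecs_def onf_def ip_def)
  have s0: "0 \<le> s k" if "k < n" for k using svd that by (auto simp: is_svd_def)
  have A: "A i j = (\<Sum>k<n. s k * u k i * v k j)" if "i < n" "j < n" for i j
    using svd that by (auto simp: is_svd_def)
  have SN: "{..<n} = ?S \<union> ?N" "?S \<inter> ?N = {}" "finite ?S" "finite ?N" by auto
  have mvsum: "mv n (\<lambda>i j. \<Sum>k\<in>K. s k * u k i * v k j) x i = (\<Sum>k\<in>K. s k * ip n (v k) x * u k i)"
    for K x i
    unfolding mv_def ip_def sum_distrib_right sum_distrib_left by (subst sum.swap) (simp add: mult_ac)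
  have Av: "mv n A x i = (\<Sum>k<n. s k * ip n (v k) x * u k i)" if "i < n" for x i
    unfolding mvsum[symmetric] by (simp add: mv_def A that)
  have vk: "ip n (v l) (v k) = of_bool (l = k)" "ip n (u l) (u k) = of_bool (l = k)"
    if "k < n" "l < n" for k l using v u that by (auto simp: onf_def)
  have Avk: "mv n A (v k) i = s k * u k i" if "i < n" "k < n" for i k
  proof -
    have "mv n A (v k) i = (\<Sum>l<n. if l = k then s l * u l i else 0)"
      unfolding Av[OF that(1)] using that by (intro sum.cong) (auto simp: vk)
    then show ?thesis using that by simp
  qed
  have Ahv: "mv n Ahat (v k) i = (if k \<in> ?S then s k * u k i else 0)" if "k < n" for i k
  proof -
    have "mv n Ahat (v k) i = (\<Sum>l\<in>?S. if l = k then s l * u l i else 0)"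
      unfolding Ahat_def mvsum using that by (intro sum.cong) (auto simp: vk)
    then show ?thesis by simp
  qed
  have Evk: "ip n (mv n ?E (v k)) (mv n ?E (v k)) \<le> \<theta>\<^sup>2" if "k < n" for k
    using E[unfolded op_le_def, rule_format, of "v k"] vk[OF that that] by simp
  have BAE: "mv n B x i = mv n A x i - mv n ?E x i" for x i
    by (simp add: mv_matrix_diff)
  let ?res = "\<lambda>k. residual n R q (mv n B (v k))"
  have res_nonneg: "0 \<le> ip n (?res k) (?res k)" for k by simp
  have resD: "(\<Sum>k<n. ip n (?res k) (?res k)) \<le> Dsq"
  proof -
    have "(\<Sum>k<n. ip n (?res k) (?res k)) = (\<Sum>i<n. \<Sum>j<n. (residual n R q (\<lambda>i. B i j) i)\<^sup>2)"
      unfolding residual_mv by (rule frobenius_basis[OF v])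
    also have "\<dots> = (\<Sum>j<n. \<Sum>i<n. (residual n R q (\<lambda>i. B i j) i)\<^sup>2)" by (rule sum.swap)
    also have "\<dots> = (\<Sum>j<n. ip n (residual n R q (\<lambda>i. B i j)) (residual n R q (\<lambda>i. B i j)))"
      by (simp add: ip_def power2_eq_square)
    also have "\<dots> \<le> (\<Sum>j<n. \<Sum>i<n. (B i j - P i j)\<^sup>2)"
    proof (rule sum_mono)
      fix j assume j: "j \<in> {..<n}"
      let ?y = "\<lambda>i. B i j - (\<Sum>r<R. b r j * q r i)"
      have "ip n (residual n R q (\<lambda>i. B i j)) (residual n R q (\<lambda>i. B i j)) =
         ip n (residual n R q ?y) (residual n R q ?y)"
        using residual_diff_span[OF q, of "\<lambda>i. B i j" "\<lambda>r. b r j"] by simp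
      also have "\<dots> \<le> ip n ?y ?y" by (rule ip_residual_le[OF q])
      also have "\<dots> = (\<Sum>i<n. (B i j - P i j)\<^sup>2)" using P[of j] j by (simp add: ip_def power2_eq_square)
      finally show "ip n (residual n R q (\<lambda>i. B i j)) (residual n R q (\<lambda>i. B i j)) \<le> (\<Sum>i<n. (B i j - P i j)\<^sup>2)" .
    qed
    also have "\<dots> = Dsq" unfolding Dsq_def by (rule sum.swap)
    finally show ?thesis .
  qed
  have Dsq0: "0 \<le> Dsq" unfolding Dsq_def by (intro sum_nonneg) auto
  \<comment> \<open>Counts the kept singular values, so that the noise on the kept vectors can be
    summed. No singular values of \<open>B\<close> enter.\<close>
  have "real (card ?S) * (2 * \<epsilon>) \<le> real R * (1 + 1 / (4 * \<epsilon>)) + Dsq / (4 * \<epsilon> * \<tau>\<^sup>2)"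
  proof -
    let ?a = "\<lambda>k. \<Sum>r<R. (ip n (q r) (u k))\<^sup>2"
    \<comment> \<open>The pairing of a kept \<open>u k\<close> with \<open>B v k\<close> is at least
      \<open>s k - \<theta>\<close>. Splitting \<open>B v k\<close> along \<open>q\<close> charges
      this to the part of \<open>u k\<close> in the span of \<open>q\<close>, to the noise in that
      span and to the residual.\<close>
    have each: "1 - \<theta> / \<tau> - 2 * \<epsilon> \<le> ?a k * (1 + 1 / (4 * \<epsilon>)) + ip n (?res k) (?res k) / (4 * \<epsilon> * \<tau>\<^sup>2)"
      if k: "k \<in> ?S" for k
    proof -
      have kn: "k < n" and sk: "s k \<ge> \<tau>" "s k > 0" using k \<tau>0 by auto
      let ?Ev = "mv n ?E (v k)"
      have uEv: "\<bar>ip n (u k) ?Ev\<bar> \<le> \<theta>"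
      proof -
        have "\<bar>ip n (u k) ?Ev\<bar> \<le> sqrt (ip n (u k) (u k)) * sqrt (ip n ?Ev ?Ev)" by (rule abs_ip_le)
        also have "\<dots> \<le> 1 * sqrt (\<theta>\<^sup>2)" using Evk[OF kn] vk[OF kn kn] by (intro mult_mono real_sqrt_le_mono) auto
        finally show ?thesis using \<theta> by simp
      qed
      have uB: "ip n (u k) (mv n B (v k)) = s k - ip n (u k) ?Ev"
      proof -
        have "ip n (u k) (mv n B (v k)) = ip n (u k) (\<lambda>i. s k * u k i - ?Ev i)"
          by (rule ip_cong) (auto simp: BAE Avk kn)
        then show ?thesis using vk[OF kn kn] by (simp add: ip_linear)
      qed
      have qB: "ip n (q r) (mv n B (v k)) = s k * ip n (q r) (u k) - ip n (q r) ?Ev" for r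
      proof -
        have "ip n (q r) (mv n B (v k)) = ip n (q r) (\<lambda>i. s k * u k i - ?Ev i)"
          by (rule ip_cong) (auto simp: BAE Avk kn)
        then show ?thesis by (simp add: ip_linear)
      qed
      have dec: "ip n (u k) (mv n B (v k)) = ip n (u k) (?res k) + (\<Sum>r<R. ip n (q r) (mv n B (v k)) * ip n (q r) (u k))"
        unfolding residual_def by (simp add: ip_linear ip_commute[of n "u k" "q _"])
      have "s k - \<theta> \<le> ip n (u k) (mv n B (v k))" using uB uEv by auto
      also have "\<dots> = ip n (u k) (?res k) + s k * ?a k - (\<Sum>r<R. ip n (q r) ?Ev * ip n (q r) (u k))"
        unfolding dec qB by (simp add: algebra_simps sum_subtractf sum_distrib_left power2_eq_square)
      finally have 1: "s k - \<theta> \<le> ip n (u k) (?res k) + s k * ?a k - (\<Sum>r<R. ip n (q r) ?Ev * ip n (q r) (u k))" .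
      \<comment> \<open>Here and in the next fact a norm is linearised by
        \<open>sqrt a \<le> \<epsilon> + a / (4 * \<epsilon>)\<close>. Each time one
        \<open>\<epsilon>\<close> of the available
        \<open>1 - \<theta> / \<tau> = 4 * \<epsilon>\<close> is spent, so
        \<open>2 * \<epsilon>\<close> remains.\<close>
      have 2: "\<bar>\<Sum>r<R. ip n (q r) ?Ev * ip n (q r) (u k)\<bar> \<le> \<tau> * (\<epsilon> + ?a k / (4 * \<epsilon>))"
      proof -
        have a0: "0 \<le> ?a k" by (intro sum_nonneg) auto
        have "(\<Sum>r<R. ip n (q r) ?Ev * ip n (q r) (u k))\<^sup>2 \<le> (\<Sum>r<R. (ip n (q r) ?Ev)\<^sup>2) * ?a k"
          by (rule Cauchy_Schwarz_ineq_sum)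
        also have "\<dots> \<le> \<tau>\<^sup>2 * ?a k"
        proof (rule mult_right_mono[OF _ a0])
          have "(\<Sum>r<R. (ip n (q r) ?Ev)\<^sup>2) \<le> \<theta>\<^sup>2" using Bessel[OF q, of ?Ev] Evk[OF kn] by linarith
          also have "\<dots> \<le> \<tau>\<^sup>2" using \<tau>0 \<theta> by (intro power_mono) auto
          finally show "(\<Sum>r<R. (ip n (q r) ?Ev)\<^sup>2) \<le> \<tau>\<^sup>2" .
        qed
        also have "\<dots> \<le> (\<tau> * (\<epsilon> + ?a k / (4 * \<epsilon>)))\<^sup>2"
        proof -
          have "?a k \<le> (\<epsilon> + ?a k / (4 * \<epsilon>))\<^sup>2"
          proof -
            have "(\<epsilon> + ?a k / (4 * \<epsilon>))\<^sup>2 - ?a k = (\<epsilon> - ?a k / (4 * \<epsilon>))\<^sup>2"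
              using \<epsilon>0 by (simp add: power2_eq_square field_simps)
            then show ?thesis by (smt (verit) zero_le_power2)
          qed
          then show ?thesis by (simp add: power_mult_distrib mult_left_mono)
        qed
        finally have "\<bar>\<Sum>r<R. ip n (q r) ?Ev * ip n (q r) (u k)\<bar> \<le> \<bar>\<tau> * (\<epsilon> + ?a k / (4 * \<epsilon>))\<bar>"
          by (simp only: abs_le_square_iff)
        moreover have "0 \<le> \<tau> * (\<epsilon> + ?a k / (4 * \<epsilon>))" using a0 \<epsilon>0 \<tau>0 by simp
        ultimately show ?thesis by linarith
      qed
      have 3: "ip n (u k) (?res k) \<le> \<tau> * (\<epsilon> + ip n (?res k) (?res k) / (4 * \<epsilon> * \<tau>\<^sup>2))"
      proof -
        let ?r = "sqrt (ip n (?res k) (?res k))"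
        have "ip n (u k) (?res k) \<le> ?r" using abs_ip_le[of n "u k" "?res k"] vk[OF kn kn] by simp
        also have "\<dots> \<le> \<tau> * (\<epsilon> + ?r\<^sup>2 / (4 * \<epsilon> * \<tau>\<^sup>2))"
        proof -
          have "\<tau> * (\<epsilon> + ?r\<^sup>2 / (4 * \<epsilon> * \<tau>\<^sup>2)) - ?r = (2 * \<epsilon> * \<tau> - ?r)\<^sup>2 / (4 * \<epsilon> * \<tau>)"
            using \<epsilon>0 \<tau>0 by (simp add: power2_eq_square field_simps)
          moreover have "0 \<le> (2 * \<epsilon> * \<tau> - ?r)\<^sup>2 / (4 * \<epsilon> * \<tau>)" using \<epsilon>0 \<tau>0 by simp
          ultimately show ?thesis by linarith
        qed
        finally show ?thesis by simp
      qed
      let ?z = "\<epsilon> + ip n (?res k) (?res k) / (4 * \<epsilon> * \<tau>\<^sup>2)" and ?y = "\<epsilon> + ?a k / (4 * \<epsilon>)"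
      have zy: "0 \<le> ?z" "0 \<le> ?y" using \<epsilon>0 \<tau>0 by (auto intro!: add_nonneg_nonneg divide_nonneg_nonneg sum_nonneg)
      have "s k * (1 - \<theta> / \<tau>) \<le> s k - \<theta>"
        using sk \<tau>0 \<theta> by (simp add: field_simps)
      also have "\<dots> \<le> \<tau> * ?z + s k * ?a k + \<tau> * ?y" using 1 2 3 by linarith
      also have "\<dots> \<le> s k * ?z + s k * ?a k + s k * ?y"
        using sk zy by (intro add_mono mult_right_mono order_refl) auto
      finally have "s k * (1 - \<theta> / \<tau>) \<le> s k * (?z + ?a k + ?y)" by (simp add: algebra_simps)
      then have "1 - \<theta> / \<tau> \<le> ?z + ?a k + ?y" using sk by simp
      then show ?thesis by (simp add: algebra_simps)
    qed
    have \<epsilon>': "1 - \<theta> / \<tau> - 2 * \<epsilon> = 2 * \<epsilon>"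
    proof -
      have "\<theta> / \<tau> = 1 / (1 + \<delta>)" unfolding \<tau> using \<theta> \<delta> by simp
      moreover have "1 - 1 / (1 + \<delta>) = 4 * \<epsilon>" unfolding \<epsilon>_def using \<delta> by (simp add: field_simps)
      ultimately show ?thesis by linarith
    qed
    have "real (card ?S) * (2 * \<epsilon>) = (\<Sum>k\<in>?S. 2 * \<epsilon>)" by simp
    also have "\<dots> \<le> (\<Sum>k\<in>?S. ?a k * (1 + 1 / (4 * \<epsilon>)) + ip n (?res k) (?res k) / (4 * \<epsilon> * \<tau>\<^sup>2))"
      using each unfolding \<epsilon>' by (intro sum_mono) auto
    also have "\<dots> \<le> (\<Sum>k<n. ?a k * (1 + 1 / (4 * \<epsilon>)) + ip n (?res k) (?res k) / (4 * \<epsilon> * \<tau>\<^sup>2))"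
      using \<epsilon>0 by (intro sum_mono2) (auto intro!: add_nonneg_nonneg mult_nonneg_nonneg sum_nonneg)
    also have "\<dots> = (\<Sum>k<n. ?a k) * (1 + 1 / (4 * \<epsilon>)) + (\<Sum>k<n. ip n (?res k) (?res k)) / (4 * \<epsilon> * \<tau>\<^sup>2)"
      by (simp add: sum.distrib sum_distrib_right sum_divide_distrib)
    also have "\<dots> \<le> real R * (1 + 1 / (4 * \<epsilon>)) + Dsq / (4 * \<epsilon> * \<tau>\<^sup>2)"
    proof (intro add_mono mult_right_mono divide_right_mono resD)
      have "(\<Sum>k<n. ?a k) = (\<Sum>r<R. \<Sum>k<n. (ip n (u k) (q r))\<^sup>2)"
        by (subst sum.swap) (simp add: ip_commute)
      also have "\<dots> = real R" using q by (simp add: Parseval[OF u] onf_def)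
      finally show "(\<Sum>k<n. ?a k) \<le> real R" by simp
    qed (use \<epsilon>0 in auto)
    finally show ?thesis .
  qed
  then have card: "real (card ?S) * \<tau>\<^sup>2 \<le> 1 / (2 * \<epsilon>) * (1 + 1 / (4 * \<epsilon>)) * (real R * \<tau>\<^sup>2 + Dsq)"
  proof -
    assume h: "real (card ?S) * (2 * \<epsilon>) \<le> real R * (1 + 1 / (4 * \<epsilon>)) + Dsq / (4 * \<epsilon> * \<tau>\<^sup>2)"
    have "real (card ?S) * \<tau>\<^sup>2 = \<tau>\<^sup>2 / (2 * \<epsilon>) * (real (card ?S) * (2 * \<epsilon>))" using \<epsilon>0 by simp
    also have "\<dots> \<le> \<tau>\<^sup>2 / (2 * \<epsilon>) * (real R * (1 + 1 / (4 * \<epsilon>)) + Dsq / (4 * \<epsilon> * \<tau>\<^sup>2))"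
      using \<epsilon>0 by (intro mult_left_mono[OF h]) auto
    also have "\<dots> = 1 / (2 * \<epsilon>) * ((1 + 1 / (4 * \<epsilon>)) * (real R * \<tau>\<^sup>2) + 1 / (4 * \<epsilon>) * Dsq)"
      using \<epsilon>0 \<tau>0 by (simp add: field_simps)
    also have "\<dots> \<le> 1 / (2 * \<epsilon>) * ((1 + 1 / (4 * \<epsilon>)) * (real R * \<tau>\<^sup>2) + (1 + 1 / (4 * \<epsilon>)) * Dsq)"
      using \<epsilon>0 Dsq0 by (intro mult_left_mono add_left_mono mult_right_mono) auto
    finally show ?thesis by (simp only: distrib_left[symmetric] mult.assoc)
  qed
  \<comment> \<open>Tested with \<open>w\<close>, the part of the transpose of \<open>B\<close>
    applied to \<open>q r\<close> that lies in the span of the discarded \<open>v k\<close>. Its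
    squared norm \<open>c2\<close> equals \<open>ip n (q r) (mv n B w)\<close>, and on
    \<open>w\<close> the matrix \<open>A\<close> is at most \<open>\<tau>\<close> and the noise at
    most \<open>\<theta>\<close>.\<close>
  have qN: "(\<Sum>k\<in>?N. (ip n (q r) (mv n B (v k)))\<^sup>2) \<le> (\<tau> + \<theta>)\<^sup>2" if r: "r < R" for r
  proof -
    let ?c = "\<lambda>k. ip n (q r) (mv n B (v k))"
    define w where "w = (\<lambda>i. \<Sum>k\<in>?N. ?c k * v k i)"
    define c2 where "c2 = (\<Sum>k\<in>?N. (?c k)\<^sup>2)"
    have c20: "0 \<le> c2" unfolding c2_def by (intro sum_nonneg) auto
    have vw: "ip n (v l) w = (if l \<in> ?N then ?c l else 0)" if "l < n" for l
    proof -
      have "ip n (v l) w = (\<Sum>k\<in>?N. if k = l then ?c k else 0)"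
        unfolding w_def ip_linear using that by (intro sum.cong) (auto simp: vk)
      then show ?thesis by simp
    qed
    have sumN: "(\<Sum>l<n. (if l \<in> ?N then g l else 0)) = (\<Sum>k\<in>?N. g k)" for g :: "nat \<Rightarrow> real"
      by (subst sum.inter_restrict[symmetric]) (auto intro!: sum.cong)
    have ww: "ip n w w = c2"
      unfolding Parseval[OF v, symmetric] c2_def sumN[symmetric] by (rule sum.cong) (auto simp: vw)
    have "ip n (mv n A w) (mv n A w) = (\<Sum>l<n. (ip n (u l) (mv n A w))\<^sup>2)" by (simp add: Parseval[OF u])
    also have "\<dots> = (\<Sum>l<n. (s l * ip n (v l) w)\<^sup>2)"
    proof (rule sum.cong[OF refl])
      fix l assume l: "l \<in> {..<n}"
      have "ip n (u l) (mv n A w) = ip n (u l) (\<lambda>i. \<Sum>k<n. s k * ip n (v k) w * u k i)"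
        by (rule ip_cong) (auto simp: Av)
      also have "\<dots> = s l * ip n (v l) w" using onf_ip_sum[OF u, of l "\<lambda>k. s k * ip n (v k) w"] l by simp
      finally show "(ip n (u l) (mv n A w))\<^sup>2 = (s l * ip n (v l) w)\<^sup>2" by simp
    qed
    also have "\<dots> \<le> (\<Sum>l<n. \<tau>\<^sup>2 * (ip n (v l) w)\<^sup>2)"
    proof (rule sum_mono)
      fix l assume l: "l \<in> {..<n}"
      show "(s l * ip n (v l) w)\<^sup>2 \<le> \<tau>\<^sup>2 * (ip n (v l) w)\<^sup>2"
      proof (cases "l \<in> ?N")
        case True
        then have "(s l)\<^sup>2 \<le> \<tau>\<^sup>2" using s0[of l] by (intro power_mono) auto
        then show ?thesis by (simp add: power_mult_distrib mult_right_mono)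
      next
        case False then show ?thesis using vw[of l] l by simp
      qed
    qed
    also have "\<dots> = \<tau>\<^sup>2 * c2" by (simp add: sum_distrib_left[symmetric] Parseval[OF v] ww)
    finally have "sqrt (ip n (mv n A w) (mv n A w)) \<le> \<tau> * sqrt c2"
      using \<tau>0 by (metis less_eq_real_def real_sqrt_abs real_sqrt_le_iff real_sqrt_mult abs_of_pos)
    moreover have "\<bar>ip n (q r) (mv n A w)\<bar> \<le> sqrt (ip n (mv n A w) (mv n A w))"
      using abs_ip_le[of n "q r" "mv n A w"] q r by (simp add: onf_def)
    moreover have "\<bar>ip n (q r) (mv n ?E w)\<bar> \<le> sqrt (ip n (mv n ?E w) (mv n ?E w))"
      using abs_ip_le[of n "q r" "mv n ?E w"] q r by (simp add: onf_def)
    moreover have "sqrt (ip n (mv n ?E w) (mv n ?E w)) \<le> \<theta> * sqrt c2"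
      using op_leD[OF E, of w] \<theta> ww by simp
    moreover have "ip n (q r) (mv n B w) = ip n (q r) (mv n A w) - ip n (q r) (mv n ?E w)"
      by (simp add: mv_matrix_diff ip_linear)
    moreover have "c2 = ip n (q r) (mv n B w)"
      unfolding w_def mv_sum mv_scale ip_linear c2_def by (simp add: power2_eq_square)
    ultimately have "c2 \<le> (\<tau> + \<theta>) * sqrt c2" unfolding distrib_right by linarith
    then show ?thesis using le_of_sq_le[of c2 "\<tau> + \<theta>"] c20 \<tau>0 \<theta> by (simp add: c2_def)
  qed
  have "(\<Sum>i<n. \<Sum>j<n. (B i j - Ahat i j)\<^sup>2) =
      (\<Sum>k<n. ip n (mv n (\<lambda>i j. B i j - Ahat i j) (v k)) (mv n (\<lambda>i j. B i j - Ahat i j) (v k)))"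
    by (rule frobenius_basis[OF v, symmetric])
  also have "\<dots> = (\<Sum>k\<in>?S. ip n (mv n ?E (v k)) (mv n ?E (v k))) + (\<Sum>k\<in>?N. ip n (mv n B (v k)) (mv n B (v k)))"
    unfolding SN(1) sum.union_disjoint[OF SN(3,4,2)]
  proof (intro arg_cong2[of _ _ _ _ "(+)"] sum.cong refl)
    fix k assume k: "k \<in> ?S"
    have "ip n (mv n (\<lambda>i j. B i j - Ahat i j) (v k)) (mv n (\<lambda>i j. B i j - Ahat i j) (v k)) =
       ip n (\<lambda>i. (-1) * mv n ?E (v k) i) (\<lambda>i. (-1) * mv n ?E (v k) i)"
      using k by (intro ip_cong) (auto simp: mv_matrix_diff Ahv Avk)
    then show "ip n (mv n (\<lambda>i j. B i j - Ahat i j) (v k)) (mv n (\<lambda>i j. B i j - Ahat i j) (v k)) =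
       ip n (mv n ?E (v k)) (mv n ?E (v k))" by (simp only: ip_linear)
  next
    fix k assume k: "k \<in> ?N"
    then show "ip n (mv n (\<lambda>i j. B i j - Ahat i j) (v k)) (mv n (\<lambda>i j. B i j - Ahat i j) (v k)) =
       ip n (mv n B (v k)) (mv n B (v k))"
      by (intro ip_cong) (auto simp: mv_matrix_diff Ahv)
  qed
  also have "\<dots> \<le> real (card ?S) * \<tau>\<^sup>2 + (4 * real R * \<tau>\<^sup>2 + Dsq)"
  proof (rule add_mono)
    have "(\<Sum>k\<in>?S. ip n (mv n ?E (v k)) (mv n ?E (v k))) \<le> (\<Sum>k\<in>?S. \<tau>\<^sup>2)"
    proof (rule sum_mono)
      fix k assume "k \<in> ?S"
      then have "ip n (mv n ?E (v k)) (mv n ?E (v k)) \<le> \<theta>\<^sup>2" using Evk by auto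
      also have "\<dots> \<le> \<tau>\<^sup>2" using \<tau>0 \<theta> by (intro power_mono) auto
      finally show "ip n (mv n ?E (v k)) (mv n ?E (v k)) \<le> \<tau>\<^sup>2" .
    qed
    then show "(\<Sum>k\<in>?S. ip n (mv n ?E (v k)) (mv n ?E (v k))) \<le> real (card ?S) * \<tau>\<^sup>2" by simp
    have "(\<Sum>k\<in>?N. ip n (mv n B (v k)) (mv n B (v k))) =
      (\<Sum>k\<in>?N. ip n (?res k) (?res k)) + (\<Sum>r<R. \<Sum>k\<in>?N. (ip n (q r) (mv n B (v k)))\<^sup>2)"
      by (subst ip_self_residual[OF q]) (simp add: sum.distrib sum.swap[of _ "{..<R}"])
    also have "\<dots> \<le> Dsq + (\<Sum>r<R. 4 * \<tau>\<^sup>2)"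
    proof (rule add_mono)
      have "(\<Sum>k\<in>?N. ip n (?res k) (?res k)) \<le> (\<Sum>k<n. ip n (?res k) (?res k))"
        by (intro sum_mono2) auto
      then show "(\<Sum>k\<in>?N. ip n (?res k) (?res k)) \<le> Dsq" using resD by linarith
      show "(\<Sum>r<R. \<Sum>k\<in>?N. (ip n (q r) (mv n B (v k)))\<^sup>2) \<le> (\<Sum>r<R. 4 * \<tau>\<^sup>2)"
      proof (rule sum_mono)
        fix r assume "r \<in> {..<R}"
        then have "(\<Sum>k\<in>?N. (ip n (q r) (mv n B (v k)))\<^sup>2) \<le> (\<tau> + \<theta>)\<^sup>2" using qN by auto
        also have "\<dots> \<le> (2 * \<tau>)\<^sup>2" using \<tau>0 \<theta> by (intro power_mono) auto
        finally show "(\<Sum>k\<in>?N. (ip n (q r) (mv n B (v k)))\<^sup>2) \<le> 4 * \<tau>\<^sup>2" by (simp add: power_mult_distrib)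
      qed
    qed
    finally show "(\<Sum>k\<in>?N. ip n (mv n B (v k)) (mv n B (v k))) \<le> 4 * real R * \<tau>\<^sup>2 + Dsq" by simp
  qed
  also have "\<dots> \<le> 2 / \<epsilon> * (1 + 1 / (4 * \<epsilon>)) * (real R * \<tau>\<^sup>2 + Dsq) + 4 * (real R * \<tau>\<^sup>2 + Dsq)"
  proof (rule add_mono)
    have "1 / (2 * \<epsilon>) * (1 + 1 / (4 * \<epsilon>)) * (real R * \<tau>\<^sup>2 + Dsq) \<le> 2 / \<epsilon> * (1 + 1 / (4 * \<epsilon>)) * (real R * \<tau>\<^sup>2 + Dsq)"
      using \<epsilon>0 Dsq0 by (intro mult_right_mono) (auto simp: field_simps)
    then show "real (card ?S) * \<tau>\<^sup>2 \<le> 2 / \<epsilon> * (1 + 1 / (4 * \<epsilon>)) * (real R * \<tau>\<^sup>2 + Dsq)" using card by linarith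
  qed (use Dsq0 in simp)
  finally show ?thesis by (simp add: algebra_simps)
qed

text \<open>The feature vectors at the sample points may be linearly dependent or zero, hence only
  \<open>R \<le> card F\<close>. The thresholding bound depends on their span alone.\<close>

lemma Gram_Schmidt:
  fixes \<phi> :: "'b \<Rightarrow> nat \<Rightarrow> real"
  assumes "finite F"
  shows "\<exists>R q. R \<le> card F \<and> onf n R q \<and> (\<forall>a\<in>F. \<exists>b. \<forall>i<n. \<phi> a i = (\<Sum>r<R. b r * q r i))"
  using assms
proof (induction F)
  case empty
  show ?case by (intro exI[of _ 0]) (simp add: onf_def)
next
  case (insert a F)
  then obtain R q where R: "R \<le> card F" and q: "onf n R q"
    and span: "\<And>c. c \<in> F \<Longrightarrow> \<exists>b. \<forall>i<n. \<phi> c i = (\<Sum>r<R. b r * q r i)" by blast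
  let ?y = "residual n R q (\<phi> a)"
  show ?case
  proof (cases "ip n ?y ?y = 0")
    case True
    then have "\<forall>i<n. ?y i = 0" by (simp add: ip_self_eq_0_iff)
    then have "\<forall>i<n. \<phi> a i = (\<Sum>r<R. ip n (q r) (\<phi> a) * q r i)" by (simp add: residual_def)
    then show ?thesis using R q span insert by (intro exI[of _ R] exI[of _ q]) auto
  next
    case False
    define t where "t = sqrt (ip n ?y ?y)"
    have t: "t > 0" "t * t = ip n ?y ?y" using False ip_self_nonneg[of n ?y] unfolding t_def
      by (auto simp: less_le simp del: ip_self_nonneg)
    define q' where "q' = q(R := \<lambda>i. (1 / t) * ?y i)"
    have q'R: "q' R = (\<lambda>i. (1 / t) * ?y i)" and q'r: "r < R \<Longrightarrow> q' r = q r" for r by (auto simp: q'_def)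
    have "ip n (q' R) (q' R) = 1" unfolding q'R ip_linear using t by (simp flip: t(2))
    moreover have "ip n (q' r) (q' R) = 0" "ip n (q' R) (q' r) = 0" if "r < R" for r
      using that residual_orth[OF q that, of "\<phi> a"] ip_commute[of n "q' R" "q' r"]
      unfolding q'R q'r[OF that] by (simp_all only: ip_linear)
    ultimately have onf': "onf n (Suc R) q'" using q unfolding onf_def
      by (auto simp: less_Suc_eq q'r)
    have "\<exists>b. \<forall>i<n. \<phi> c i = (\<Sum>r<Suc R. b r * q' r i)" if c: "c \<in> insert a F" for c
    proof (cases "c = a")
      case True
      show ?thesis
        by (rule exI[of _ "\<lambda>r. if r < R then ip n (q r) (\<phi> a) else t"])
          (use t True in \<open>simp add: q'R q'r residual_def cong: sum.cong_simp\<close>)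
    next
      case False
      then obtain b where b: "\<forall>i<n. \<phi> c i = (\<Sum>r<R. b r * q r i)" using span c by blast
      then show ?thesis by (intro exI[of _ "\<lambda>r. if r < R then b r else 0"]) (simp add: q'r)
    qed
    then show ?thesis using R insert onf' by (intro exI[of _ "Suc R"] exI[of _ q']) auto
  qed
qed

section \<open>Even closed walks\<close>

fun pedges :: "'a list \<Rightarrow> 'a set list" where
  "pedges (x # y # zs) = {x, y} # pedges (y # zs)"
| "pedges _ = []"

lemma length_pedges: "length (pedges w) = length w - 1"
  by (induction w rule: pedges.induct) auto

lemma pedges_subset: "e \<in> set (pedges w) \<Longrightarrow> e \<subseteq> set w"
  by (induction w rule: pedges.induct) auto

lemma pedges_map: "pedges (map \<sigma> w) = map ((`) \<sigma>) (pedges w)"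
  by (induction w rule: pedges.induct) auto

text \<open>A walk is connected: read from its end, every new vertex arrives together with a new
  edge.\<close>

lemma card_vertices_le: "w \<noteq> [] \<Longrightarrow> card (set w) \<le> card (set (pedges w)) + 1"
proof (induction w rule: pedges.induct)
  case (1 x y zs)
  show ?case
  proof (cases "x \<in> set (y # zs)")
    case True
    then have "set (x # y # zs) = set (y # zs)" by auto
    moreover have "card (set (pedges (y # zs))) \<le> card (set (pedges (x # y # zs)))"
      by (intro card_mono) auto
    ultimately show ?thesis using 1 by simp
  next
    case False
    then have "{x, y} \<notin> set (pedges (y # zs))" using pedges_subset[of "{x, y}" "y # zs"] by auto
    then have "card (set (pedges (x # y # zs))) = Suc (card (set (pedges (y # zs))))" by simp
    moreover have "card (set (x # y # zs)) = Suc (card (set (y # zs)))" using False by simp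
    ultimately show ?thesis using 1 by simp
  qed
qed auto

section \<open>Walks that use every edge an even number of times\<close>

definition even_walk :: "'a list \<Rightarrow> bool" where
  "even_walk w \<longleftrightarrow> (\<forall>e. even (count_list (pedges w) e))"

text \<open>An edge that occurs at all occurs at least twice.\<close>

lemma card_edges_even_walk:
  assumes "even_walk w"
  shows "2 * card (set (pedges w)) \<le> length w - 1"
proof -
  have "2 * card (set (pedges w)) = (\<Sum>e\<in>set (pedges w). 2)" by simp
  also have "\<dots> \<le> (\<Sum>e\<in>set (pedges w). count_list (pedges w) e)"
  proof (rule sum_mono)
    fix e assume "e \<in> set (pedges w)"
    then have "count_list (pedges w) e \<noteq> 0" by (simp add: count_list_0_iff)
    moreover have "even (count_list (pedges w) e)" using assms by (simp add: even_walk_def)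
    ultimately show "2 \<le> count_list (pedges w) e" by presburger
  qed
  also have "\<dots> = length w - 1" by (simp add: sum_count_set length_pedges)
  finally show ?thesis .
qed

lemma even_walk_map:
  assumes "inj_on \<sigma> (set w)" "even_walk w"
  shows "even_walk (map \<sigma> w)"
  unfolding even_walk_def
proof
  fix e
  have inj: "inj_on ((`) \<sigma>) (set (pedges w))"
    using inj_on_image_Pow[OF assms(1)] by (rule inj_on_subset) (use pedges_subset in auto)
  show "even (count_list (pedges (map \<sigma> w)) e)"
  proof (cases "e \<in> (`) \<sigma> ` set (pedges w)")
    case True
    then obtain e' where e': "e' \<in> set (pedges w)" "e = \<sigma> ` e'" by blast
    then have "count_list (map ((`) \<sigma>) (pedges w)) (\<sigma> ` e') = count_list (pedges w) e'"
      by (intro count_list_inj_map inj)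
    then show ?thesis using assms(2) e' by (simp add: even_walk_def pedges_map)
  next
    case False
    then have "count_list (pedges (map \<sigma> w)) e = 0"
      by (subst count_list_0_iff) (simp add: pedges_map)
    then show ?thesis by simp
  qed
qed

definition closed_walks :: "nat \<Rightarrow> nat \<Rightarrow> nat list set" where
  "closed_walks n l = {w. length w = Suc l \<and> set w \<subseteq> {..<n} \<and> hd w = last w}"

lemma finite_closed_walks: "finite (closed_walks n l)"
  by (rule finite_subset[OF _ finite_lists_length_eq[of "{..<n}" "Suc l"]]) (auto simp: closed_walks_def)

definition even_walks :: "nat \<Rightarrow> nat \<Rightarrow> nat list set" where
  "even_walks n l = {w \<in> closed_walks n l. even_walk w}"

lemma finite_even_walks: "finite (even_walks n l)"
  using finite_closed_walks[of n l] by (simp add: even_walks_def)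

lemma card_set_even_walk:
  assumes "w \<in> even_walks n (2 * K)"
  shows "card (set w) \<le> K + 1" "1 \<le> card (set w)"
proof -
  have w: "length w = Suc (2 * K)" "even_walk w" "w \<noteq> []"
    using assms by (auto simp: even_walks_def closed_walks_def)
  show "card (set w) \<le> K + 1"
    using card_edges_even_walk[OF w(2)] card_vertices_le[OF w(3)] w(1) by simp
  show "1 \<le> card (set w)" using w(3) by (simp add: Suc_le_eq card_gt_0_iff)
qed

section \<open>Isomorphism types of even walks\<close>

definition isom :: "'a list \<Rightarrow> 'b list \<Rightarrow> bool" where
  "isom w w' \<longleftrightarrow> (\<exists>\<sigma>. inj_on \<sigma> (set w) \<and> w' = map \<sigma> w)"

lemma isom_sym: "isom w w' \<Longrightarrow> isom w' w"
proof -
  assume "isom w w'"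
  then obtain \<sigma> where s: "inj_on \<sigma> (set w)" "w' = map \<sigma> w" by (auto simp: isom_def)
  have "w = map (the_inv_into (set w) \<sigma>) w'"
    unfolding s(2) by (simp add: map_idI the_inv_into_f_f[OF s(1)])
  moreover have "inj_on (the_inv_into (set w) \<sigma>) (set w')"
    using inj_on_the_inv_into[OF s(1)] s(2) by simp
  ultimately show "isom w' w" unfolding isom_def by blast
qed

lemma isom_card: "isom w w' \<Longrightarrow> card (set w') = card (set w)"
  by (auto simp: isom_def card_image)

lemma map_closed_walk:
  assumes "w \<in> even_walks n l" "inj_on \<sigma> (set w)" "\<sigma> ` set w \<subseteq> {..<r}"
  shows "map \<sigma> w \<in> even_walks r l"
proof -
  have "w \<noteq> []" using assms(1) by (auto simp: even_walks_def closed_walks_def)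
  then show ?thesis
    using assms even_walk_map[OF assms(2)]
    by (auto simp: even_walks_def closed_walks_def hd_map last_map)
qed

text \<open>Each injection of the vertices into \<open>{..<r}\<close> yields a different walk. There
  are at most \<open>K + 1\<close> vertices, so \<open>i \<le> K\<close> in the falling product and
  every factor \<open>r - i\<close> is at least \<open>K + 1\<close>.\<close>

lemma card_isom_ge:
  assumes "w \<in> even_walks n (2 * K)" "2 * K + 2 \<le> r"
  shows "real (K + 1) ^ card (set w) \<le> real (card {w' \<in> even_walks r (2 * K). isom w w'})"
proof -
  let ?I = "{f \<in> set w \<rightarrow>\<^sub>E {..<r}. inj_on f (set w)}"
  have v: "card (set w) \<le> K + 1" using card_set_even_walk[OF assms(1)] by simp
  have "(K + 1) ^ card (set w) = (\<Prod>i\<in>{0..<card (set w)}. K + 1)" by simp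
  also have "\<dots> \<le> (\<Prod>i\<in>{0..<card (set w)}. r - i)"
    using v assms(2) by (intro prod_mono) auto
  also have "\<dots> = card ?I"
    using card_inj_on_subset_funcset[of "set w" "{..<r}" "set w"] by (simp add: atLeast0LessThan)
  also have "\<dots> = card ((\<lambda>f. map f w) ` ?I)"
    by (rule card_image[symmetric]) (auto simp: inj_on_def PiE_def extensional_def fun_eq_iff)
  also have "\<dots> \<le> card {w' \<in> even_walks r (2 * K). isom w w'}"
    using finite_even_walks[of r "2 * K"] map_closed_walk[OF assms(1)]
    by (intro card_mono) (auto simp: isom_def PiE_def Pi_def image_subset_iff)
  finally show ?thesis by (metis of_nat_le_iff of_nat_power)
qed

text \<open>A walk isomorphic to \<open>w'\<close> is determined by the images of the vertices of
  \<open>w'\<close>.\<close>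

lemma card_isom_le:
  "real (card {w \<in> even_walks n l. isom w w'}) \<le> real n ^ card (set w')"
proof -
  have "{w \<in> even_walks n l. isom w w'} \<subseteq> (\<lambda>f. map f w') ` (set w' \<rightarrow>\<^sub>E {..<n})"
  proof
    fix w assume w: "w \<in> {w \<in> even_walks n l. isom w w'}"
    then obtain \<sigma> where s: "inj_on \<sigma> (set w')" "w = map \<sigma> w'" using isom_sym[of w w'] by (auto simp: isom_def)
    have "w = map (restrict \<sigma> (set w')) w'" using s by simp
    moreover have "restrict \<sigma> (set w') \<in> set w' \<rightarrow>\<^sub>E {..<n}"
      using w s by (auto simp: even_walks_def closed_walks_def)
    ultimately show "w \<in> (\<lambda>f. map f w') ` (set w' \<rightarrow>\<^sub>E {..<n})" by blast
  qed
  then have "card {w \<in> even_walks n l. isom w w'} \<le> card ((\<lambda>f. map f w') ` (set w' \<rightarrow>\<^sub>E {..<n}))"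
    by (intro card_mono) (auto intro: finite_PiE)
  also have "\<dots> \<le> card (set w' \<rightarrow>\<^sub>E {..<n})" by (intro card_image_le) (auto intro: finite_PiE)
  also have "\<dots> = n ^ card (set w')" by (simp add: card_PiE)
  finally show ?thesis by (metis of_nat_le_iff of_nat_power)
qed

text \<open>Double counting of the isomorphic pairs of even walks: on \<open>r\<close> vertices every isomorphism
  type with \<open>v \<le> K + 1\<close> vertices occurs at least \<open>(K + 1)\<^sup>v\<close> times, and on \<open>n\<close> vertices at most
  \<open>n\<^sup>v\<close> times.\<close>

lemma even_walks_comparison:
  fixes q :: real
  assumes q: "0 \<le> q" "real n * q \<le> real (K + 1)" and r: "2 * K + 2 \<le> r"
  shows "(\<Sum>w\<in>even_walks n (2 * K). q ^ (card (set w) - 1)) \<le>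
    real n / real (K + 1) * real (card (even_walks r (2 * K)))"
proof -
  let ?v = "\<lambda>w :: nat list. card (set w)" and ?k = "real (K + 1)"
  let ?n = "even_walks n (2 * K)" and ?r = "even_walks r (2 * K)"
  have fin: "finite ?n" "finite ?r" by (auto simp: finite_even_walks)
  have "(\<Sum>w\<in>?n. q ^ (?v w - 1)) \<le> (\<Sum>w\<in>?n. \<Sum>w'\<in>{w' \<in> ?r. isom w w'}. q ^ (?v w - 1) / ?k ^ ?v w)"
  proof (rule sum_mono)
    fix w assume w: "w \<in> ?n"
    have "q ^ (?v w - 1) = ?k ^ ?v w * (q ^ (?v w - 1) / ?k ^ ?v w)" by simp
    also have "\<dots> \<le> real (card {w' \<in> ?r. isom w w'}) * (q ^ (?v w - 1) / ?k ^ ?v w)"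
      using q by (intro mult_right_mono card_isom_ge[OF w r]) auto
    finally show "q ^ (?v w - 1) \<le> (\<Sum>w'\<in>{w' \<in> ?r. isom w w'}. q ^ (?v w - 1) / ?k ^ ?v w)" by simp
  qed
  also have "\<dots> = (\<Sum>w'\<in>?r. \<Sum>w\<in>{w \<in> ?n. isom w w'}. q ^ (?v w - 1) / ?k ^ ?v w)"
    by (rule sum.swap_restrict[OF fin])
  also have "\<dots> = (\<Sum>w'\<in>?r. real (card {w \<in> ?n. isom w w'}) * (q ^ (?v w' - 1) / ?k ^ ?v w'))"
  proof (rule sum.cong[OF refl])
    fix w' assume "w' \<in> ?r"
    have "(\<Sum>w\<in>{w \<in> ?n. isom w w'}. q ^ (?v w - 1) / ?k ^ ?v w) =
      (\<Sum>w\<in>{w \<in> ?n. isom w w'}. q ^ (?v w' - 1) / ?k ^ ?v w')"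
      by (rule sum.cong) (auto simp: isom_card)
    then show "(\<Sum>w\<in>{w \<in> ?n. isom w w'}. q ^ (?v w - 1) / ?k ^ ?v w) =
      real (card {w \<in> ?n. isom w w'}) * (q ^ (?v w' - 1) / ?k ^ ?v w')" by simp
  qed
  also have "\<dots> \<le> (\<Sum>w'\<in>?r. real n / ?k)"
  proof (rule sum_mono)
    fix w' assume w': "w' \<in> ?r"
    have v1: "1 \<le> ?v w'" using card_set_even_walk[OF w'] by simp
    have "real (card {w \<in> ?n. isom w w'}) * (q ^ (?v w' - 1) / ?k ^ ?v w')
      \<le> real n ^ ?v w' * (q ^ (?v w' - 1) / ?k ^ ?v w')"
      using q by (intro mult_right_mono card_isom_le) auto
    \<comment> \<open>The weight has one factor \<open>q\<close> less than the count has factors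
      \<open>n\<close>: one \<open>n / (K + 1)\<close> is left over, and the rest is a power of
      \<open>n * q / (K + 1) \<le> 1\<close>.\<close>
    also have "\<dots> = real n / ?k * (real n * q / ?k) ^ (?v w' - 1)"
      using v1 by (cases "?v w'") (auto simp: power_divide power_mult_distrib)
    also have "\<dots> \<le> real n / ?k * 1"
      using q by (intro mult_left_mono power_le_one) (auto simp: divide_le_eq)
    finally show "real (card {w \<in> ?n. isom w w'}) * (q ^ (?v w' - 1) / ?k ^ ?v w') \<le> real n / ?k" by simp
  qed
  finally show ?thesis by (simp add: mult.commute)
qed

section \<open>Traces of matrix powers as sums over closed walks\<close>

definition path_weight :: "('a set \<Rightarrow> real) \<Rightarrow> 'a list \<Rightarrow> real" where
  "path_weight \<xi> w = prod_list (map \<xi> (pedges w))"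

definition unit_vec :: "nat \<Rightarrow> nat \<Rightarrow> real" where
  "unit_vec i j = of_bool (i = j)"

definition trace_pow :: "nat \<Rightarrow> rmatrix \<Rightarrow> nat \<Rightarrow> real" where
  "trace_pow n X l = (\<Sum>i<n. ip n (unit_vec i) ((mv n X ^^ l) (unit_vec i)))"

lemma ip_unit_vec: "i < n \<Longrightarrow> ip n (unit_vec i) x = x i"
  by (simp add: ip_def unit_vec_def of_bool_def if_distribR if_distrib cong: if_cong)

lemma lists_Suc_image:
  "{w. length w = Suc l \<and> set w \<subseteq> A} = (\<lambda>(j, w). j # w) ` (A \<times> {w. length w = l \<and> set w \<subseteq> A})"
  by (auto simp: length_Suc_conv image_iff)

lemma sum_lists_Suc:
  "(\<Sum>w\<in>{w. length w = Suc l \<and> set w \<subseteq> A}. g w) =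
   (\<Sum>j\<in>A. \<Sum>w\<in>{w. length w = l \<and> set w \<subseteq> A}. g (j # w))"
  unfolding lists_Suc_image
  by (subst sum.reindex) (auto simp: inj_on_def sum.cartesian_product intro!: sum.cong)

lemma mv_funpow_expansion:
  assumes "i < n"
  shows "(mv n (\<lambda>i j. \<xi> {i, j}) ^^ l) x i =
     (\<Sum>w\<in>{w. length w = l \<and> set w \<subseteq> {..<n}}. path_weight \<xi> (i # w) * x (last (i # w)))"
  using assms
proof (induction l arbitrary: i)
  case 0
  have "{w. length w = 0 \<and> set w \<subseteq> {..<n}} = {[]}" by auto
  then show ?case by (simp add: path_weight_def)
next
  case (Suc l)
  have "(mv n (\<lambda>i j. \<xi> {i, j}) ^^ Suc l) x i =
     (\<Sum>j<n. \<xi> {i, j} * (\<Sum>w\<in>{w. length w = l \<and> set w \<subseteq> {..<n}}. path_weight \<xi> (j # w) * x (last (j # w))))"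
    unfolding funpow.simps comp_def mv_def[of n _ "(mv n _ ^^ l) x"] using Suc.IH by simp
  then show ?case
    unfolding sum_lists_Suc by (simp add: sum_distrib_left path_weight_def mult.assoc)
qed

text \<open>Indexing entries by unordered pairs \<open>{i, j}\<close> makes the matrix symmetric and
  lets the multiplicity of an edge ignore the direction in which it is used.\<close>

lemma trace_pow_expansion:
  "trace_pow n (\<lambda>i j. \<xi> {i, j}) l = (\<Sum>w\<in>closed_walks n l. path_weight \<xi> w)"
proof -
  have fin: "finite {w :: nat list. length w = l \<and> set w \<subseteq> {..<n}}"
    using finite_lists_length_eq[of "{..<n}" l] by (simp add: conj_commute)
  have fin2: "finite {w :: nat list. length w = Suc l \<and> set w \<subseteq> {..<n}}"
    using finite_lists_length_eq[of "{..<n}" "Suc l"] by (simp add: conj_commute)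
  have "trace_pow n (\<lambda>i j. \<xi> {i, j}) l =
    (\<Sum>i<n. \<Sum>w\<in>{w. length w = l \<and> set w \<subseteq> {..<n}}. path_weight \<xi> (i # w) * of_bool (hd (i # w) = last (i # w)))"
    unfolding trace_pow_def
    by (intro sum.cong refl) (simp add: ip_unit_vec mv_funpow_expansion unit_vec_def)
  also have "\<dots> = (\<Sum>w\<in>{w. length w = Suc l \<and> set w \<subseteq> {..<n}}. path_weight \<xi> w * of_bool (hd w = last w))"
    unfolding sum_lists_Suc ..
  also have "\<dots> = (\<Sum>w\<in>{w. length w = Suc l \<and> set w \<subseteq> {..<n}}. if hd w = last w then path_weight \<xi> w else 0)"
    by (intro sum.cong refl) simp
  also have "\<dots> = (\<Sum>w\<in>closed_walks n l. path_weight \<xi> w)"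
    unfolding sum.inter_filter[OF fin2, symmetric] closed_walks_def by (intro sum.cong) auto
  finally show ?thesis .
qed

lemma path_weight_eq_prod:
  assumes "finite F" "set (pedges w) \<subseteq> F"
  shows "path_weight \<xi> w = (\<Prod>e\<in>F. \<xi> e ^ count_list (pedges w) e)"
proof -
  have "prod_list (map \<xi> es) = (\<Prod>e\<in>F. \<xi> e ^ count_list es e)" if "set es \<subseteq> F" for es
    using that
  proof (induction es)
    case (Cons a es)
    have "(\<Prod>e\<in>F. \<xi> e ^ count_list (a # es) e) = (\<Prod>e\<in>F. (if e = a then \<xi> e else 1) * \<xi> e ^ count_list es e)"
      by (intro prod.cong) auto
    also have "\<dots> = \<xi> a * (\<Prod>e\<in>F. \<xi> e ^ count_list es e)"
      using Cons.prems assms(1) by (simp add: prod.distrib)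
    finally show ?case using Cons by simp
  qed simp
  then show ?thesis using assms(2) by (simp add: path_weight_def)
qed

section \<open>Exponential moments of sums of random signs\<close>

lemma cosh_le_exp_half_square: "exp x + exp (- x) \<le> 2 * exp (x\<^sup>2 / 2)" for x :: real
proof -
  have *: "exp x + exp (- x) \<le> 2 * exp (x\<^sup>2 / 2)" if "0 \<le> x" for x :: real
  proof -
    \<comment> \<open>Hoeffding's lemma for two equally likely values at distance
      \<open>2 * x\<close>; the left side is the logarithm of cosh.\<close>
    have "- (2 * x) * (1 / 2) + ln (1 + 1 / 2 * (exp (2 * x) - 1)) \<le> (2 * x)\<^sup>2 / 8"
      using Hoeffdings_lemma_aux[of "2 * x" "1 / 2"] that by simp
    then have "ln (1 + 1 / 2 * (exp (2 * x) - 1)) \<le> x + x\<^sup>2 / 2"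
      by (simp add: power_mult_distrib)
    then have "exp (ln (1 + 1 / 2 * (exp (2 * x) - 1))) \<le> exp (x + x\<^sup>2 / 2)"
      unfolding exp_le_cancel_iff .
    moreover have "0 < 1 + 1 / 2 * (exp (2 * x) - 1)" using that by (intro add_pos_nonneg) auto
    ultimately have "1 + 1 / 2 * (exp (2 * x) - 1) \<le> exp x * exp (x\<^sup>2 / 2)"
      unfolding exp_add[symmetric] by (simp only: exp_ln)
    moreover have "exp (2 * x) = exp x * exp x" unfolding mult_2 by (rule exp_add)
    ultimately have "exp x * (exp x + exp (- x)) \<le> exp x * (2 * exp (x\<^sup>2 / 2))"
      by (simp add: algebra_simps exp_minus)
    then show ?thesis by simp
  qed
  show ?thesis using *[of x] *[of "- x"] by (cases "0 \<le> x") auto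
qed

text \<open>One term of the exponential series. For negative \<open>u\<close> the even power is that
  of \<open>- u\<close>, and \<open>exp (- u)\<close> takes over.\<close>

lemma power_le_fact_exp:
  fixes u :: real
  assumes "even l"
  shows "u ^ l \<le> fact l * (exp u + exp (- u))"
proof -
  have *: "u ^ l \<le> fact l * exp u" if "0 \<le> u" for u :: real
  proof -
    have s: "(\<lambda>k. u ^ k /\<^sub>R fact k) sums exp u" by (rule exp_converges)
    have "(\<Sum>k\<in>{l}. u ^ k /\<^sub>R fact k) \<le> (\<Sum>k. u ^ k /\<^sub>R fact k)"
      using that by (intro sum_le_suminf sums_summable[OF s]) auto
    also have "\<dots> = exp u" using s by (rule sums_unique[symmetric])
    finally show ?thesis by (simp add: field_simps)
  qed
  have "fact l * exp u \<le> fact l * (exp u + exp (- u))" "fact l * exp (- u) \<le> fact l * (exp u + exp (- u))"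
    by simp_all
  moreover have "(- u) ^ l = u ^ l" using assms by simp
  ultimately show ?thesis using *[of u] *[of "- u"] by linarith
qed

definition signs :: "'e set \<Rightarrow> ('e \<Rightarrow> real) set" where
  "signs F = F \<rightarrow>\<^sub>E {-1, 1}"

text \<open>The signs are independent, so the sum over sign vectors factorises into hyperbolic
  cosines.\<close>

lemma sum_signs_exp:
  assumes "finite F"
  shows "(\<Sum>\<xi>\<in>signs F. exp (\<Sum>e\<in>F. a e * \<xi> e)) \<le> 2 ^ card F * exp ((\<Sum>e\<in>F. (a e)\<^sup>2) / 2)"
proof -
  have "(\<Sum>\<xi>\<in>signs F. exp (\<Sum>e\<in>F. a e * \<xi> e)) = (\<Sum>\<xi>\<in>signs F. \<Prod>e\<in>F. exp (a e * \<xi> e))"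
    using assms by (simp add: exp_sum)
  also have "\<dots> = (\<Prod>e\<in>F. \<Sum>s\<in>{-1, 1}. exp (a e * s))"
    unfolding signs_def by (rule prod_sum_PiE[symmetric]) (use assms in auto)
  also have "\<dots> \<le> (\<Prod>e\<in>F. 2 * exp ((a e)\<^sup>2 / 2))"
    using cosh_le_exp_half_square by (intro prod_mono) (auto simp: add.commute add_nonneg_nonneg)
  also have "\<dots> = 2 ^ card F * exp ((\<Sum>e\<in>F. (a e)\<^sup>2) / 2)"
    using assms by (simp add: prod.distrib exp_sum sum_divide_distrib)
  finally show ?thesis .
qed

text \<open>Khintchine's inequality with the value \<open>t = sqrt (2 K)\<close> of the exponential parameter.\<close>

lemma sum_signs_power:
  assumes "finite F" "1 \<le> K" "(\<Sum>e\<in>F. (a e)\<^sup>2) \<le> 32"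
  shows "(\<Sum>\<xi>\<in>signs F. (\<Sum>e\<in>F. a e * \<xi> e) ^ (2 * K)) \<le> 2 * 2 ^ card F * (2 * real K * exp 32) ^ K"
proof -
  define t where "t = sqrt (2 * real K)"
  have t: "t > 0" "t\<^sup>2 = 2 * real K" using assms(2) by (auto simp: t_def)
  have E: "(\<Sum>\<xi>\<in>signs F. exp (\<Sum>e\<in>F. (c * t * a e) * \<xi> e)) \<le> 2 ^ card F * exp 32 ^ K" if "c\<^sup>2 = 1" for c
  proof -
    have "(\<Sum>\<xi>\<in>signs F. exp (\<Sum>e\<in>F. (c * t * a e) * \<xi> e)) \<le> 2 ^ card F * exp ((\<Sum>e\<in>F. (c * t * a e)\<^sup>2) / 2)"
      by (rule sum_signs_exp[OF assms(1)])
    also have "(\<Sum>e\<in>F. (c * t * a e)\<^sup>2) / 2 = real K * (\<Sum>e\<in>F. (a e)\<^sup>2)"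
      by (simp add: power_mult_distrib that t(2) sum_distrib_left sum_divide_distrib)
    also have "2 ^ card F * exp (real K * (\<Sum>e\<in>F. (a e)\<^sup>2)) \<le> 2 ^ card F * exp (real K * 32)"
      using assms(3) by (intro mult_left_mono) (auto intro: mult_left_mono)
    also have "exp (real K * 32) = exp 32 ^ K" by (simp add: exp_of_nat_mult)
    finally show ?thesis .
  qed
  have "t ^ (2 * K) * (\<Sum>\<xi>\<in>signs F. (\<Sum>e\<in>F. a e * \<xi> e) ^ (2 * K)) =
      (\<Sum>\<xi>\<in>signs F. (t * (\<Sum>e\<in>F. a e * \<xi> e)) ^ (2 * K))"
    by (subst sum_distrib_left) (simp only: power_mult_distrib)
  also have "\<dots> \<le> (\<Sum>\<xi>\<in>signs F. fact (2 * K) * (exp (t * (\<Sum>e\<in>F. a e * \<xi> e)) + exp (- (t * (\<Sum>e\<in>F. a e * \<xi> e)))))"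
    by (intro sum_mono power_le_fact_exp) simp
  also have "\<dots> = fact (2 * K) * ((\<Sum>\<xi>\<in>signs F. exp (\<Sum>e\<in>F. (1 * t * a e) * \<xi> e)) +
      (\<Sum>\<xi>\<in>signs F. exp (\<Sum>e\<in>F. (- 1 * t * a e) * \<xi> e)))"
    by (simp add: sum_distrib_left sum.distrib distrib_left mult.assoc flip: sum_negf)
  also have "\<dots> \<le> fact (2 * K) * (2 ^ card F * exp 32 ^ K + 2 ^ card F * exp 32 ^ K)"
    by (intro mult_left_mono add_mono E) auto
  \<comment> \<open>Half of the powers of \<open>2 * K\<close> that bound the factorial form
    \<open>t ^ (2 * K)\<close> and cancel; the other half is the growth \<open>(2 * K) ^ K\<close>
    of Khintchine's inequality.\<close>
  also have "\<dots> \<le> (2 * real K) ^ (2 * K) * (2 ^ card F * exp 32 ^ K + 2 ^ card F * exp 32 ^ K)"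
    using fact_le_power[of "2 * K", where 'a = real] by (intro mult_right_mono) auto
  also have "(2 * real K) ^ (2 * K) = t ^ (2 * K) * (2 * real K) ^ K"
  proof -
    have "t ^ (2 * K) = (2 * real K) ^ K" unfolding power_mult[of t] t(2) ..
    moreover have "x ^ (2 * K) = x ^ K * x ^ K" for x :: real by (simp only: mult_2 power_add)
    ultimately show ?thesis by metis
  qed
  finally have "t ^ (2 * K) * (\<Sum>\<xi>\<in>signs F. (\<Sum>e\<in>F. a e * \<xi> e) ^ (2 * K)) \<le>
     t ^ (2 * K) * (2 * 2 ^ card F * (2 * real K * exp 32) ^ K)"
    by (simp add: power_mult_distrib algebra_simps)
  then show ?thesis using t by simp
qed

section \<open>Random sign matrices and the number of even walks\<close>

definition edge_set :: "nat \<Rightarrow> nat set set" where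
  "edge_set r = (\<lambda>(i, j). {i, j}) ` ({..<r} \<times> {..<r})"

lemma finite_edge_set: "finite (edge_set r)"
  by (simp add: edge_set_def)

lemma pedges_edge_set: "set w \<subseteq> {..<r} \<Longrightarrow> set (pedges w) \<subseteq> edge_set r"
  by (induction w rule: pedges.induct) (auto simp: edge_set_def)

text \<open>A power of a random sign has mean 1 or 0 according to the parity of its exponent, so one
  edge of odd multiplicity annihilates the whole product.\<close>

lemma sum_signs_path_weight:
  assumes "w \<in> closed_walks r l"
  shows "(\<Sum>\<xi>\<in>signs (edge_set r). path_weight \<xi> w) = (if even_walk w then 2 ^ card (edge_set r) else 0)"
proof -
  let ?F = "edge_set r"
  have sub: "set (pedges w) \<subseteq> ?F" using assms pedges_edge_set[of w r] by (simp add: closed_walks_def)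
  have "(\<Sum>\<xi>\<in>signs ?F. path_weight \<xi> w) = (\<Sum>\<xi>\<in>signs ?F. \<Prod>e\<in>?F. \<xi> e ^ count_list (pedges w) e)"
    by (simp add: path_weight_eq_prod[OF finite_edge_set sub])
  also have "\<dots> = (\<Prod>e\<in>?F. \<Sum>s\<in>{-1, 1}. s ^ count_list (pedges w) e)"
    unfolding signs_def by (rule prod_sum_PiE[symmetric]) (auto simp: finite_edge_set)
  also have "\<dots> = (\<Prod>e\<in>?F. if even (count_list (pedges w) e) then 2 else 0)"
    by (intro prod.cong refl) (auto simp: uminus_power_if)
  also have "\<dots> = (if even_walk w then 2 ^ card ?F else 0)"
  proof (cases "even_walk w")
    case False
    then obtain e where e: "odd (count_list (pedges w) e)" by (auto simp: even_walk_def)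
    then have "e \<in> set (pedges w)" by (metis count_notin even_zero)
    then show ?thesis using sub e False finite_edge_set[of r] by (auto intro!: prod_zero)
  qed (simp add: even_walk_def)
  finally show ?thesis .
qed

text \<open>Turns the counting of walks into a question about the size of a random sign
  matrix.\<close>

lemma card_even_walks_signs:
  "2 ^ card (edge_set r) * real (card (even_walks r l)) =
     (\<Sum>\<xi>\<in>signs (edge_set r). trace_pow r (\<lambda>i j. \<xi> {i, j}) l)"
proof -
  have "(\<Sum>\<xi>\<in>signs (edge_set r). trace_pow r (\<lambda>i j. \<xi> {i, j}) l) =
      (\<Sum>w\<in>closed_walks r l. \<Sum>\<xi>\<in>signs (edge_set r). path_weight \<xi> w)"
    unfolding trace_pow_expansion by (rule sum.swap)
  also have "\<dots> = (\<Sum>w\<in>closed_walks r l. if even_walk w then 2 ^ card (edge_set r) else 0)"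
    by (intro sum.cong refl sum_signs_path_weight)
  also have "\<dots> = (\<Sum>w\<in>even_walks r l. 2 ^ card (edge_set r))"
    unfolding even_walks_def by (rule sum.inter_filter[symmetric, OF finite_closed_walks])
  finally show ?thesis by simp
qed

section \<open>A net of lattice points and the operator norm\<close>

lemma abs_le_square_int: "\<bar>a\<bar> \<le> a\<^sup>2" for a :: int
  using mult_left_mono[of 1 "\<bar>a\<bar>" "\<bar>a\<bar>"] by (cases "a = 0") (auto simp: power2_eq_square)

text \<open>The integer points of the ball of radius \<open>2 sqrt r\<close>: after rescaling, a net of the unit ball
  with exponentially many points.\<close>

definition lattice_net :: "nat \<Rightarrow> (nat \<Rightarrow> int) set" where
  "lattice_net r = {z \<in> {..<r} \<rightarrow>\<^sub>E {- int (4 * r)..int (4 * r)}. (\<Sum>i<r. (z i)\<^sup>2) \<le> 4 * int r}"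

lemma finite_lattice_net: "finite (lattice_net r)"
proof -
  have "finite ({..<r} \<rightarrow>\<^sub>E {- int (4 * r)..int (4 * r)})" by (intro finite_PiE) auto
  then show ?thesis unfolding lattice_net_def by (rule finite_subset[rotated]) blast
qed

lemma sum_half_power_abs: "(\<Sum>a\<in>{- int M..int M}. (1 / 2) ^ nat \<bar>a\<bar>) \<le> (3 :: real)"
proof -
  have "(\<Sum>a\<in>{- int M..int M}. (1 / 2) ^ nat \<bar>a\<bar>) = 3 - 2 * (1 / 2 :: real) ^ M"
  proof (induction M)
    case (Suc M)
    have "{- int (Suc M)..int (Suc M)} = insert (- int (Suc M)) (insert (int (Suc M)) {- int M..int M})"
      by auto
    then have "(\<Sum>a\<in>{- int (Suc M)..int (Suc M)}. (1 / 2) ^ nat \<bar>a\<bar>) =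
      2 * (1 / 2) ^ Suc M + (\<Sum>a\<in>{- int M..int M}. (1 / 2 :: real) ^ nat \<bar>a\<bar>)"
      by (simp add: nat_add_distrib)
    then show ?case unfolding Suc.IH by simp
  qed simp
  then show ?thesis by simp
qed

text \<open>Weigh a point by 1/2 to the power of its l1-norm. For integers that norm is at most the
  squared l2-norm, here at most \<open>4 * r\<close>, so each weight is at least
  \<open>(1 / 2) ^ (4 * r)\<close>, whereas the weights of the whole box sum to at most
  \<open>3 ^ r\<close>. This gives the base \<open>3 * 16 = 48\<close>.\<close>

lemma card_lattice_net: "real (card (lattice_net r)) \<le> 48 ^ r"
proof -
  let ?P = "{..<r} \<rightarrow>\<^sub>E {- int (4 * r)..int (4 * r)}"
  have fin: "finite ?P" by (intro finite_PiE) auto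
  have "(\<Sum>z\<in>lattice_net r. (1 / 2 :: real) ^ (4 * r)) \<le> (\<Sum>z\<in>lattice_net r. \<Prod>i<r. (1 / 2) ^ nat \<bar>z i\<bar>)"
  proof (rule sum_mono)
    fix z assume z: "z \<in> lattice_net r"
    have "(\<Sum>i<r. \<bar>z i\<bar>) \<le> (\<Sum>i<r. (z i)\<^sup>2)"
      by (intro sum_mono abs_le_square_int)
    then have "(\<Sum>i<r. \<bar>z i\<bar>) \<le> 4 * int r" using z by (simp add: lattice_net_def)
    moreover have "int (\<Sum>i<r. nat \<bar>z i\<bar>) = (\<Sum>i<r. \<bar>z i\<bar>)" unfolding of_nat_sum by (intro sum.cong) auto
    ultimately have "(\<Sum>i<r. nat \<bar>z i\<bar>) \<le> 4 * r" by linarith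
    then have "(1 / 2 :: real) ^ (4 * r) \<le> (1 / 2) ^ (\<Sum>i<r. nat \<bar>z i\<bar>)" by (intro power_decreasing) auto
    then show "(1 / 2 :: real) ^ (4 * r) \<le> (\<Prod>i<r. (1 / 2) ^ nat \<bar>z i\<bar>)" by (simp add: power_sum)
  qed
  also have "\<dots> \<le> (\<Sum>z\<in>?P. \<Prod>i<r. (1 / 2) ^ nat \<bar>z i\<bar>)"
  proof (rule sum_mono2[OF fin])
    show "lattice_net r \<subseteq> ?P" unfolding lattice_net_def by blast
    show "0 \<le> (\<Prod>i<r. (1 / 2 :: real) ^ nat \<bar>z i\<bar>)" for z :: "nat \<Rightarrow> int" by (intro prod_nonneg) simp
  qed
  also have "\<dots> = (\<Prod>i<r. \<Sum>a\<in>{- int (4 * r)..int (4 * r)}. (1 / 2) ^ nat \<bar>a\<bar>)"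
    by (rule prod_sum_PiE[symmetric]) auto
  also have "\<dots> \<le> (\<Prod>i<r. 3)"
    using sum_half_power_abs[of "4 * r"] by (intro prod_mono) (auto intro!: sum_nonneg)
  finally have "real (card (lattice_net r)) * (1 / 2) ^ (4 * r) \<le> 3 ^ r" by simp
  then have "real (card (lattice_net r)) \<le> 3 ^ r * 2 ^ (4 * r)" by (simp add: power_one_over field_simps)
  also have "\<dots> = 48 ^ r" unfolding power_mult power_mult_distrib[symmetric] by simp
  finally show ?thesis .
qed

lemma lattice_net_norm:
  assumes c: "\<And>z. z \<in> lattice_net r \<Longrightarrow> ip r (\<lambda>i. of_int (z i)) x \<le> c"
  shows "sqrt (real r) * sqrt (ip r x x) \<le> c"
proof (cases "ip r x x = 0")
  case True
  have "restrict (\<lambda>_. 0) {..<r} \<in> lattice_net r" by (auto simp: lattice_net_def)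
  from c[OF this] have "0 \<le> c" by (simp add: ip_def)
  then show ?thesis using True by simp
next
  case False
  define s where "s = sqrt (ip r x x)"
  have s: "s > 0" "s\<^sup>2 = ip r x x" using False ip_self_nonneg[of r x] by (auto simp: s_def less_le simp del: ip_self_nonneg)
  define w where "w = (\<lambda>i. (2 * sqrt (real r) / s) * x i)"
  \<comment> \<open>Rounding towards zero keeps the point in the ball. The rounding error has norm
    at most \<open>sqrt r\<close>, half of the norm \<open>2 * sqrt r\<close> of \<open>w\<close>,
    so the pairing with \<open>x\<close> keeps at least half of its size; hence the factor 2 in the
    radius.\<close>
  define z where "z = restrict (\<lambda>i. if 0 \<le> w i then \<lfloor>w i\<rfloor> else \<lceil>w i\<rceil>) {..<r}"
  have zw: "\<bar>of_int (z i)\<bar> \<le> \<bar>w i\<bar>" "\<bar>w i - of_int (z i)\<bar> \<le> 1" if "i < r" for i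
    using that by (auto simp: z_def) linarith+
  have ww: "ip r w w = 4 * real r"
    unfolding w_def ip_linear using s by (simp add: power2_eq_square flip: s(2))
  have "of_int (\<Sum>i<r. (z i)\<^sup>2) = (\<Sum>i<r. (of_int (z i))\<^sup>2 :: real)" by simp
  also have "\<dots> \<le> (\<Sum>i<r. (w i)\<^sup>2)"
    using zw(1) by (intro sum_mono) (simp add: abs_le_square_iff)
  also have "\<dots> = 4 * real r" using ww by (simp add: ip_def power2_eq_square)
  finally have z2: "(\<Sum>i<r. (z i)\<^sup>2) \<le> 4 * int r" by linarith
  have zb: "\<bar>z i\<bar> \<le> int (4 * r)" if i: "i < r" for i
  proof -
    have "\<bar>z i\<bar> \<le> (z i)\<^sup>2" by (rule abs_le_square_int)
    also have "\<dots> \<le> (\<Sum>i<r. (z i)\<^sup>2)" using i by (intro member_le_sum) auto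
    finally show ?thesis using z2 by simp
  qed
  have "z \<in> lattice_net r"
  proof -
    have "z \<in> extensional {..<r}" by (simp add: z_def)
    moreover have "- int (4 * r) \<le> z i \<and> z i \<le> int (4 * r)" if "i < r" for i
      using zb[OF that] by linarith
    ultimately show ?thesis unfolding lattice_net_def PiE_iff using z2 by auto
  qed
  from c[OF this] have "ip r (\<lambda>i. of_int (z i)) x \<le> c" .
  moreover have "ip r (\<lambda>i. of_int (z i)) x = ip r w x - ip r (\<lambda>i. w i - of_int (z i)) x"
    by (simp add: ip_linear)
  moreover have "ip r w x = 2 * sqrt (real r) * s"
    unfolding w_def ip_linear using s by (simp add: power2_eq_square flip: s(2))
  moreover have "ip r (\<lambda>i. w i - of_int (z i)) x \<le> sqrt (real r) * s"
  proof -
    have "ip r (\<lambda>i. w i - of_int (z i)) (\<lambda>i. w i - of_int (z i)) \<le> (\<Sum>i<r. 1)"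
      unfolding ip_def using zw(2) by (intro sum_mono) (simp add: abs_square_le_1 flip: power2_eq_square)
    then have "sqrt (ip r (\<lambda>i. w i - of_int (z i)) (\<lambda>i. w i - of_int (z i))) \<le> sqrt (real r)" by simp
    then have "sqrt (ip r (\<lambda>i. w i - of_int (z i)) (\<lambda>i. w i - of_int (z i))) * s \<le> sqrt (real r) * s"
      using s by (intro mult_right_mono) auto
    then show ?thesis using abs_ip_le[of r "\<lambda>i. w i - of_int (z i)" x] by (simp add: s_def)
  qed
  ultimately show ?thesis by (simp add: s_def)
qed

lemma ip_mv_symmetric:
  assumes "\<And>i j. Y i j = Y j i"
  shows "ip n x (mv n Y y) = ip n (mv n Y x) y"
proof -
  have "ip n x (mv n Y y) = (\<Sum>i<n. \<Sum>j<n. x i * Y i j * y j)"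
    by (simp add: ip_def mv_def sum_distrib_left mult.assoc)
  also have "\<dots> = (\<Sum>j<n. \<Sum>i<n. x i * Y i j * y j)" by (rule sum.swap)
  also have "\<dots> = ip n (mv n Y x) y"
    using assms by (simp add: ip_def mv_def sum_distrib_right sum_distrib_left mult_ac)
  finally show ?thesis .
qed

text \<open>The net is applied once to each argument of the bilinear form; symmetry of
  \<open>Y\<close> moves the matrix from one argument to the other in between.\<close>

lemma op_le_lattice_net:
  assumes sym: "\<And>i j. Y i j = Y j i" and r: "0 < r"
    and b: "\<And>z z'. z \<in> lattice_net r \<Longrightarrow> z' \<in> lattice_net r \<Longrightarrow>
       ip r (\<lambda>i. of_int (z' i)) (mv r Y (\<lambda>i. of_int (z i))) \<le> real r * b"
  shows "op_le r Y b"
  unfolding op_le_def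
proof
  fix x
  let ?t = "sqrt (real r)"
  have t: "?t > 0" "?t * ?t = real r" using r by auto
  have 1: "sqrt (ip r (mv r Y (\<lambda>i. of_int (z i))) (mv r Y (\<lambda>i. of_int (z i)))) \<le> ?t * b" if "z \<in> lattice_net r" for z
  proof -
    have "?t * sqrt (ip r (mv r Y (\<lambda>i. of_int (z i))) (mv r Y (\<lambda>i. of_int (z i)))) \<le> ?t * (?t * b)"
      using lattice_net_norm[of r "mv r Y (\<lambda>i. of_int (z i))" "real r * b"] b that t(2)
      by (simp add: mult.assoc[symmetric])
    then show ?thesis using t by simp
  qed
  have "?t * sqrt (ip r (mv r Y x) (mv r Y x)) \<le> ?t * b * sqrt (ip r x x)"
  proof (rule lattice_net_norm)
    fix z assume z: "z \<in> lattice_net r"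
    have "ip r (\<lambda>i. of_int (z i)) (mv r Y x) = ip r (mv r Y (\<lambda>i. of_int (z i))) x"
      by (rule ip_mv_symmetric[OF sym])
    also have "\<dots> \<le> sqrt (ip r (mv r Y (\<lambda>i. of_int (z i))) (mv r Y (\<lambda>i. of_int (z i)))) * sqrt (ip r x x)"
      using abs_ip_le by (rule order_trans[OF abs_ge_self])
    also have "\<dots> \<le> ?t * b * sqrt (ip r x x)" using 1[OF z] by (intro mult_right_mono) auto
    finally show "ip r (\<lambda>i. of_int (z i)) (mv r Y x) \<le> ?t * b * sqrt (ip r x x)" .
  qed
  then have "sqrt (ip r (mv r Y x) (mv r Y x)) \<le> b * sqrt (ip r x x)" using t by (simp add: mult.assoc)
  then have "(sqrt (ip r (mv r Y x) (mv r Y x)))\<^sup>2 \<le> (b * sqrt (ip r x x))\<^sup>2" by (intro power_mono) auto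
  then show "ip r (mv r Y x) (mv r Y x) \<le> b\<^sup>2 * ip r x x" by (simp add: power_mult_distrib)
qed

lemma trace_pow_le:
  assumes "op_le r Y b" "0 \<le> b"
  shows "trace_pow r Y l \<le> real r * b ^ l"
proof -
  have norm: "sqrt (ip r ((mv r Y ^^ l) x) ((mv r Y ^^ l) x)) \<le> b ^ l * sqrt (ip r x x)" for x
  proof (induction l)
    case (Suc l)
    have "sqrt (ip r ((mv r Y ^^ Suc l) x) ((mv r Y ^^ Suc l) x)) \<le> b * sqrt (ip r ((mv r Y ^^ l) x) ((mv r Y ^^ l) x))"
      using op_leD[OF assms] by simp
    also have "\<dots> \<le> b * (b ^ l * sqrt (ip r x x))" using Suc assms(2) by (intro mult_left_mono) auto
    finally show ?case by (simp add: mult.assoc)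
  qed simp
  have "trace_pow r Y l \<le> (\<Sum>i<r. b ^ l)"
    unfolding trace_pow_def
  proof (rule sum_mono)
    fix i assume "i \<in> {..<r}"
    then have e: "ip r (unit_vec i) (unit_vec i) = 1" by (simp add: ip_unit_vec) (simp add: unit_vec_def)
    show "ip r (unit_vec i) ((mv r Y ^^ l) (unit_vec i)) \<le> b ^ l"
      using abs_ip_le[of r "unit_vec i" "(mv r Y ^^ l) (unit_vec i)"] norm[of "unit_vec i"] e by simp
  qed
  then show ?thesis by simp
qed

text \<open>The form is linear in the independent signs. An edge collects at most the two ordered
  pairs \<open>(i, j)\<close> and \<open>(j, i)\<close>, which costs a factor 2, and the squared
  products of coordinates sum to at most \<open>(4 * r) * (4 * r)\<close>; after division by
  \<open>r\<^sup>2\<close> the bound is \<open>2 * 16 = 32\<close>.\<close>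

lemma edge_coefficients:
  assumes "z \<in> lattice_net r" "z' \<in> lattice_net r" "0 < r"
  shows "\<exists>a. (\<forall>\<xi>. ip r (\<lambda>i. of_int (z' i)) (mv r (\<lambda>i j. \<xi> {i, j}) (\<lambda>i. of_int (z i))) / real r
       = (\<Sum>e\<in>edge_set r. a e * \<xi> e)) \<and> (\<Sum>e\<in>edge_set r. (a e)\<^sup>2) \<le> 32"
proof -
  let ?P = "{..<r} \<times> {..<r}" and ?pe = "\<lambda>(i, j). {i, j :: nat}"
  define g where "g = (\<lambda>(i, j). of_int (z' i) * of_int (z j) / real r)"
  define a where "a = (\<lambda>e. \<Sum>p\<in>{p \<in> ?P. ?pe p = e}. g p)"
  have group: "(\<Sum>e\<in>edge_set r. \<Sum>p\<in>{p \<in> ?P. ?pe p = e}. h p) = sum h ?P" for h :: "nat \<times> nat \<Rightarrow> real"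
    by (rule sum.group) (auto simp: edge_set_def)
  have "ip r (\<lambda>i. of_int (z' i)) (mv r (\<lambda>i j. \<xi> {i, j}) (\<lambda>i. of_int (z i))) / real r
       = (\<Sum>e\<in>edge_set r. a e * \<xi> e)" for \<xi> :: "nat set \<Rightarrow> real"
  proof -
    have "ip r (\<lambda>i. of_int (z' i)) (mv r (\<lambda>i j. \<xi> {i, j}) (\<lambda>i. of_int (z i))) / real r
       = (\<Sum>i<r. \<Sum>j<r. g (i, j) * \<xi> {i, j})"
      by (simp add: ip_def mv_def sum_distrib_left sum_divide_distrib g_def mult_ac)
    also have "\<dots> = (\<Sum>p\<in>?P. g p * \<xi> (?pe p))"
      by (subst sum.cartesian_product) (simp add: case_prod_unfold)
    also have "\<dots> = (\<Sum>e\<in>edge_set r. \<Sum>p\<in>{p \<in> ?P. ?pe p = e}. g p * \<xi> (?pe p))"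
      by (rule group[symmetric])
    also have "\<dots> = (\<Sum>e\<in>edge_set r. a e * \<xi> e)"
      unfolding a_def sum_distrib_right by (intro sum.cong refl) auto
    finally show ?thesis .
  qed
  moreover have "(\<Sum>e\<in>edge_set r. (a e)\<^sup>2) \<le> 32"
  proof -
    have "(\<Sum>e\<in>edge_set r. (a e)\<^sup>2) \<le> (\<Sum>e\<in>edge_set r. 2 * (\<Sum>p\<in>{p \<in> ?P. ?pe p = e}. (g p)\<^sup>2))"
    proof (rule sum_mono)
      fix e assume "e \<in> edge_set r"
      then obtain i j where e: "e = {i, j}" by (auto simp: edge_set_def)
      have "{p \<in> ?P. ?pe p = e} \<subseteq> {(i, j), (j, i)}"
      proof
        fix p assume "p \<in> {p \<in> ?P. ?pe p = e}"
        then have "{fst p, snd p} = {i, j}" by (simp add: e case_prod_unfold)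
        then show "p \<in> {(i, j), (j, i)}" by (cases p) (auto simp: doubleton_eq_iff)
      qed
      then have "card {p \<in> ?P. ?pe p = e} \<le> card {(i, j), (j, i)}" by (rule card_mono[rotated]) simp
      also have "\<dots> \<le> 2" using card_length[of "[(i, j), (j, i)]"] by simp
      finally have c2: "card {p \<in> ?P. ?pe p = e} \<le> 2" .
      have "(a e)\<^sup>2 = (\<Sum>p\<in>{p \<in> ?P. ?pe p = e}. 1 * g p)\<^sup>2" by (simp add: a_def)
      also have "\<dots> \<le> (\<Sum>p\<in>{p \<in> ?P. ?pe p = e}. 1\<^sup>2) * (\<Sum>p\<in>{p \<in> ?P. ?pe p = e}. (g p)\<^sup>2)"
        by (rule Cauchy_Schwarz_ineq_sum)
      also have "\<dots> \<le> 2 * (\<Sum>p\<in>{p \<in> ?P. ?pe p = e}. (g p)\<^sup>2)"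
        using c2 by (intro mult_right_mono) (auto intro: sum_nonneg)
      finally show "(a e)\<^sup>2 \<le> 2 * (\<Sum>p\<in>{p \<in> ?P. ?pe p = e}. (g p)\<^sup>2)" .
    qed
    also have "\<dots> = 2 * (\<Sum>p\<in>?P. (g p)\<^sup>2)" by (simp add: group flip: sum_distrib_left)
    also have "(\<Sum>p\<in>?P. (g p)\<^sup>2) = (\<Sum>i<r. \<Sum>j<r. (of_int (z' i))\<^sup>2 * (of_int (z j))\<^sup>2) / (real r)\<^sup>2"
      unfolding sum.cartesian_product sum_divide_distrib
      by (intro sum.cong refl) (auto simp: g_def power_mult_distrib power_divide)
    also have "\<dots> = of_int (\<Sum>i<r. (z' i)\<^sup>2) * of_int (\<Sum>i<r. (z i)\<^sup>2) / (real r)\<^sup>2"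
      by (simp add: sum_product)
    also have "\<dots> \<le> (4 * real r) * (4 * real r) / (real r)\<^sup>2"
    proof (intro divide_right_mono mult_mono)
      have "of_int (\<Sum>i<r. (z i)\<^sup>2) \<le> (of_int (4 * int r) :: real)" "of_int (\<Sum>i<r. (z' i)\<^sup>2) \<le> (of_int (4 * int r) :: real)"
        using assms unfolding of_int_le_iff lattice_net_def by auto
      then show "of_int (\<Sum>i<r. (z i)\<^sup>2) \<le> 4 * real r" "of_int (\<Sum>i<r. (z' i)\<^sup>2) \<le> 4 * real r" by auto
    qed (auto intro: sum_nonneg)
    also have "\<dots> = 16" using assms(3) by (simp add: power2_eq_square)
    finally show ?thesis by simp
  qed
  ultimately show ?thesis by blast
qed

text \<open>The trace is at most \<open>r\<close> times the largest value of the form on the net to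
  the power \<open>2 * K\<close>, and this maximum is at most the sum over all pairs of net points.
  The number of pairs, at most \<open>(48 ^ r)\<^sup>2\<close>, is harmless only because
  \<open>r\<close> is of order \<open>K\<close>.\<close>

lemma card_even_walks_le:
  assumes K: "1 \<le> K" and r: "r = 2 * K + 2"
  shows "real (card (even_walks r (2 * K))) \<le> real r * (48 ^ r)\<^sup>2 * (2 * (2 * real K * exp 32) ^ K)"
proof -
  let ?N = "lattice_net r" and ?F = "edge_set r"
  have r0: "0 < r" using r by simp
  define T where "T = (\<lambda>\<xi> z z'. ip r (\<lambda>i. of_int (z' i)) (mv r (\<lambda>i j. \<xi> {i, j :: nat}) (\<lambda>i. of_int (z i))) / real r)"
  have tr: "trace_pow r (\<lambda>i j. \<xi> {i, j}) (2 * K) \<le> real r * (\<Sum>z\<in>?N. \<Sum>z'\<in>?N. (T \<xi> z z') ^ (2 * K))" for \<xi> :: "nat set \<Rightarrow> real"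
  proof -
    let ?V = "(\<lambda>(z, z'). \<bar>T \<xi> z z'\<bar>) ` (?N \<times> ?N)"
    have "restrict (\<lambda>_. 0) {..<r} \<in> ?N" by (auto simp: lattice_net_def)
    then have ne: "?V \<noteq> {}" by auto
    have fin: "finite ?V" by (simp add: finite_lattice_net)
    have "Max ?V \<in> ?V" by (rule Max_in[OF fin ne])
    then obtain z0 z0' where z0: "z0 \<in> ?N" "z0' \<in> ?N" "Max ?V = \<bar>T \<xi> z0 z0'\<bar>" by auto
    have "op_le r (\<lambda>i j. \<xi> {i, j}) (Max ?V)"
    proof (rule op_le_lattice_net)
      fix z z' assume z: "z \<in> ?N" "z' \<in> ?N"
      then have "\<bar>T \<xi> z z'\<bar> \<le> Max ?V" by (intro Max_ge fin) auto
      then have "T \<xi> z z' \<le> Max ?V" by simp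
      then show "ip r (\<lambda>i. of_int (z' i)) (mv r (\<lambda>i j. \<xi> {i, j}) (\<lambda>i. of_int (z i))) \<le> real r * Max ?V"
        using r0 by (simp add: T_def divide_le_eq mult.commute)
    qed (use r0 in \<open>auto simp: insert_commute\<close>)
    then have "trace_pow r (\<lambda>i j. \<xi> {i, j}) (2 * K) \<le> real r * Max ?V ^ (2 * K)"
      by (rule trace_pow_le) (simp add: z0)
    also have "Max ?V ^ (2 * K) = (T \<xi> z0 z0') ^ (2 * K)" by (simp add: z0(3) power_even_abs)
    also have "\<dots> \<le> (\<Sum>z'\<in>?N. (T \<xi> z0 z') ^ (2 * K))"
      using z0 by (intro member_le_sum) (auto simp: finite_lattice_net)
    also have "\<dots> \<le> (\<Sum>z\<in>?N. \<Sum>z'\<in>?N. (T \<xi> z z') ^ (2 * K))"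
      using z0 by (intro member_le_sum[of z0 _ "\<lambda>z. \<Sum>z'\<in>?N. (T \<xi> z z') ^ (2 * K)"]) (auto simp: finite_lattice_net intro!: sum_nonneg)
    finally show ?thesis by (simp add: mult_left_mono)
  qed
  let ?B = "2 * 2 ^ card ?F * (2 * real K * exp 32) ^ K"
  have mom: "(\<Sum>\<xi>\<in>signs ?F. (T \<xi> z z') ^ (2 * K)) \<le> ?B" if z: "z \<in> ?N" "z' \<in> ?N" for z z'
  proof -
    obtain a where a: "\<And>\<xi>. T \<xi> z z' = (\<Sum>e\<in>?F. a e * \<xi> e)" "(\<Sum>e\<in>?F. (a e)\<^sup>2) \<le> 32"
      using edge_coefficients[OF z r0] unfolding T_def by blast
    show ?thesis unfolding a(1) by (rule sum_signs_power[OF finite_edge_set K a(2)])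
  qed
  have "2 ^ card ?F * real (card (even_walks r (2 * K))) =
     (\<Sum>\<xi>\<in>signs ?F. trace_pow r (\<lambda>i j. \<xi> {i, j}) (2 * K))" by (rule card_even_walks_signs)
  also have "\<dots> \<le> (\<Sum>\<xi>\<in>signs ?F. real r * (\<Sum>z\<in>?N. \<Sum>z'\<in>?N. (T \<xi> z z') ^ (2 * K)))"
    by (intro sum_mono tr)
  also have "\<dots> = real r * (\<Sum>z\<in>?N. \<Sum>\<xi>\<in>signs ?F. \<Sum>z'\<in>?N. (T \<xi> z z') ^ (2 * K))"
    unfolding sum_distrib_left[symmetric] by (subst sum.swap) (rule refl)
  also have "\<dots> = real r * (\<Sum>z\<in>?N. \<Sum>z'\<in>?N. \<Sum>\<xi>\<in>signs ?F. (T \<xi> z z') ^ (2 * K))"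
    by (intro arg_cong2[of _ _ _ _ "(*)"] refl sum.cong sum.swap)
  also have "\<dots> \<le> real r * (\<Sum>z\<in>?N. \<Sum>z'\<in>?N. ?B)"
    by (intro mult_left_mono sum_mono mom) auto
  also have "\<dots> = 2 ^ card ?F * (real r * (real (card ?N))\<^sup>2 * (2 * (2 * real K * exp 32) ^ K))"
    by (simp add: power2_eq_square)
  also have "\<dots> \<le> 2 ^ card ?F * (real r * (48 ^ r)\<^sup>2 * (2 * (2 * real K * exp 32) ^ K))"
    using card_lattice_net[of r] by (intro mult_left_mono mult_right_mono power_mono) auto
  finally show ?thesis by simp
qed

section \<open>The operator norm of the noise\<close>

lemma funpow_mv_linear:
  assumes "j < n"
  shows "(mv n X ^^ k) x j = (\<Sum>i<n. x i * (mv n X ^^ k) (unit_vec i) j)"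
  using assms
proof (induction k arbitrary: j)
  case 0
  then show ?case by (simp add: unit_vec_def of_bool_def if_distribR if_distrib cong: if_cong)
next
  case (Suc k)
  have "(mv n X ^^ Suc k) x j = (\<Sum>l<n. X j l * (\<Sum>i<n. x i * (mv n X ^^ k) (unit_vec i) l))"
    unfolding funpow.simps comp_def mv_def[of n _ "(mv n _ ^^ k) x"] using Suc.IH by simp
  also have "\<dots> = (\<Sum>l<n. \<Sum>i<n. x i * (X j l * (mv n X ^^ k) (unit_vec i) l))"
    by (simp add: sum_distrib_left mult_ac)
  also have "\<dots> = (\<Sum>i<n. \<Sum>l<n. x i * (X j l * (mv n X ^^ k) (unit_vec i) l))" by (rule sum.swap)
  finally show ?case
    by (simp add: mv_def[of n _ "(mv n _ ^^ k) _"] sum_distrib_left)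
qed

lemma funpow_mv_symmetric:
  assumes "\<And>i j. X i j = X j i"
  shows "ip n ((mv n X ^^ k) x) y = ip n x ((mv n X ^^ k) y)"
proof (induction k arbitrary: y)
  case (Suc k)
  have "ip n ((mv n X ^^ Suc k) x) y = ip n ((mv n X ^^ k) x) (mv n X y)"
    by (simp add: ip_mv_symmetric[of X, OF assms])
  also have "\<dots> = ip n x ((mv n X ^^ k) (mv n X y))" by (rule Suc)
  finally show ?case by (simp add: funpow_swap1)
qed simp

lemma ip_funpow_mv:
  assumes "\<And>i j. X i j = X j i"
  shows "ip n ((mv n X ^^ k) x) ((mv n X ^^ k) x) = ip n x ((mv n X ^^ (2 * k)) x)"
  unfolding funpow_mv_symmetric[of X, OF assms] by (simp add: mult_2 funpow_add)

lemma trace_pow_even: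
  assumes "\<And>i j. X i j = X j i"
  shows "trace_pow n X (2 * k) = (\<Sum>i<n. ip n ((mv n X ^^ k) (unit_vec i)) ((mv n X ^^ k) (unit_vec i)))"
  unfolding trace_pow_def by (simp add: ip_funpow_mv[of X, OF assms])

lemma trace_pow_even_nonneg: "(\<And>i j. X i j = X j i) \<Longrightarrow> 0 \<le> trace_pow n X (2 * k)"
  by (simp add: trace_pow_even sum_nonneg)

text \<open>The operator norm of the \<open>k\<close>-th power is at most its Frobenius norm, whose
  square is the trace of the power \<open>2 * k\<close> by symmetry.\<close>

lemma ip_funpow_le_trace:
  assumes "\<And>i j. X i j = X j i"
  shows "ip n ((mv n X ^^ k) x) ((mv n X ^^ k) x) \<le> ip n x x * trace_pow n X (2 * k)"
proof -
  have "ip n ((mv n X ^^ k) x) ((mv n X ^^ k) x) = (\<Sum>j<n. (\<Sum>i<n. x i * (mv n X ^^ k) (unit_vec i) j)\<^sup>2)"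
    unfolding ip_def using funpow_mv_linear[of _ n k X x] by (simp add: power2_eq_square)
  also have "\<dots> \<le> (\<Sum>j<n. (\<Sum>i<n. (x i)\<^sup>2) * (\<Sum>i<n. ((mv n X ^^ k) (unit_vec i) j)\<^sup>2))"
    by (intro sum_mono Cauchy_Schwarz_ineq_sum)
  also have "\<dots> = (\<Sum>i<n. (x i)\<^sup>2) * (\<Sum>j<n. \<Sum>i<n. ((mv n X ^^ k) (unit_vec i) j)\<^sup>2)"
    by (simp add: sum_distrib_left)
  also have "(\<Sum>j<n. \<Sum>i<n. ((mv n X ^^ k) (unit_vec i) j)\<^sup>2) = (\<Sum>i<n. \<Sum>j<n. ((mv n X ^^ k) (unit_vec i) j)\<^sup>2)"
    by (rule sum.swap)
  also have "\<dots> = trace_pow n X (2 * k)"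
    unfolding trace_pow_even[of X, OF assms] by (simp add: ip_def power2_eq_square)
  finally show ?thesis by (simp add: ip_def power2_eq_square)
qed

text \<open>Repeated use of \<open>\<parallel>X\<^sup>k x\<parallel>\<^sup>2 = \<langle>x, X\<^sup>2\<^sup>k x\<rangle> \<le> \<parallel>x\<parallel> \<parallel>X\<^sup>2\<^sup>k x\<parallel>\<close>, which is why
  the exponent is a power of two.\<close>

lemma ip_mv_power_le_trace:
  assumes sym: "\<And>i j. X i j = X j i" and N: "N = 2 ^ m"
  shows "(ip n (mv n X x) (mv n X x)) ^ N \<le> (ip n x x) ^ N * trace_pow n X (2 * N)"
proof (cases "ip n x x = 0")
  case True
  then have "mv n X x = (\<lambda>_. 0)" by (simp add: mv_def ip_self_eq_0_iff)
  then have "ip n (mv n X x) (mv n X x) = 0" by (simp add: ip_def)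
  moreover have "N \<noteq> 0" using N by simp
  ultimately show ?thesis using True by (simp add: power_0_left)
next
  case False
  define b where "b = ip n x x"
  define a where "a k = ip n ((mv n X ^^ k) x) ((mv n X ^^ k) x)" for k
  have b: "b > 0" using False ip_self_nonneg[of n x] by (auto simp: b_def less_le simp del: ip_self_nonneg)
  have a0: "0 \<le> a k" for k by (simp add: a_def)
  have step: "(a k)\<^sup>2 \<le> b * a (2 * k)" for k
  proof -
    have "a k = ip n x ((mv n X ^^ (2 * k)) x)" unfolding a_def by (rule ip_funpow_mv) (rule sym)
    then show ?thesis using ip_Cauchy_Schwarz[of n x "(mv n X ^^ (2 * k)) x"] by (simp add: a_def b_def)
  qed
  \<comment> \<open>The factor \<open>b\<close> on the left stands for the exponent
    \<open>2 ^ m - 1\<close> on the right and keeps the induction free of subtraction.\<close>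
  have "b * a 1 ^ (2 ^ m) \<le> b ^ (2 ^ m) * a (2 ^ m)"
  proof (induction m)
    case (Suc m)
    let ?M = "2 ^ m :: nat"
    have "b * (b * a 1 ^ (2 * ?M)) = (b * a 1 ^ ?M)\<^sup>2"
      by (simp add: power2_eq_square mult_2 power_add)
    also have "\<dots> \<le> (b ^ ?M * a ?M)\<^sup>2" using Suc b a0 by (intro power_mono) auto
    also have "\<dots> = b ^ (2 * ?M) * (a ?M)\<^sup>2" by (simp add: power2_eq_square mult_2 power_add)
    also have "\<dots> \<le> b ^ (2 * ?M) * (b * a (2 * ?M))" using step b by (intro mult_left_mono) auto
    finally have "b * (b * a 1 ^ (2 * ?M)) \<le> b * (b ^ (2 * ?M) * a (2 * ?M))" by (simp add: mult_ac)
    then show ?case using b by simp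
  qed simp
  also have "\<dots> \<le> b ^ (2 ^ m) * (b * trace_pow n X (2 * N))"
    using ip_funpow_le_trace[of X n N x, OF sym] b N by (intro mult_left_mono) (auto simp: a_def b_def)
  finally have "b * a 1 ^ N \<le> b * (b ^ N * trace_pow n X (2 * N))" by (simp add: N mult_ac)
  then show ?thesis using b by (simp add: a_def b_def)
qed

section \<open>Independence and Jensen's inequality for finitely supported distributions\<close>

lemma expectation_prod_Pi_pmf_finite:
  fixes f :: "'a \<Rightarrow> 'b \<Rightarrow> real"
  assumes "finite A" "\<And>x. x \<in> A \<Longrightarrow> finite (set_pmf (p x))"
  shows "measure_pmf.expectation (Pi_pmf A dflt p) (\<lambda>y. \<Prod>x\<in>A. f x (y x)) =
    (\<Prod>x\<in>A. measure_pmf.expectation (p x) (f x))"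
proof -
  let ?P = "measure_pmf (Pi_pmf A dflt p)"
  have int: "integrable ?P (\<lambda>y. f x (y x))" if x: "x \<in> A" for x
  proof -
    have "integrable (measure_pmf (map_pmf (\<lambda>y. y x) (Pi_pmf A dflt p))) (f x)"
      using assms x by (simp add: Pi_pmf_component integrable_measure_pmf_finite)
    then show ?thesis unfolding map_pmf_rep_eq by (subst (asm) integrable_distr_eq) auto
  qed
  have ind: "prob_space.indep_vars ?P (\<lambda>_. borel) (\<lambda>x y. f x (y x)) A"
    by (rule prob_space.indep_vars_compose2[OF measure_pmf.prob_space_axioms indep_vars_Pi_pmf[OF assms(1)]]) auto
  have "measure_pmf.expectation (Pi_pmf A dflt p) (\<lambda>y. \<Prod>x\<in>A. f x (y x)) =
      (\<Prod>x\<in>A. measure_pmf.expectation (Pi_pmf A dflt p) (\<lambda>y. f x (y x)))"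
    by (rule prob_space.indep_vars_lebesgue_integral[OF measure_pmf.prob_space_axioms assms(1) ind int])
  also have "\<dots> = (\<Prod>x\<in>A. measure_pmf.expectation (p x) (f x))"
  proof (rule prod.cong[OF refl])
    fix x assume x: "x \<in> A"
    have "measure_pmf.expectation (map_pmf (\<lambda>y. y x) (Pi_pmf A dflt p)) (f x) = measure_pmf.expectation (p x) (f x)"
      using assms x by (simp add: Pi_pmf_component)
    then show "measure_pmf.expectation (Pi_pmf A dflt p) (\<lambda>y. f x (y x)) = measure_pmf.expectation (p x) (f x)"
      by simp
  qed
  finally show ?thesis .
qed

lemma finite_set_Pi_pmf_bool: "finite A \<Longrightarrow> finite (set_pmf (Pi_pmf A False p))"
  by (rule finite_subset[OF set_Pi_pmf_subset' finite_PiE_dflt]) auto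

text \<open>Jensen's inequality for an even power, by repeated use of the nonnegativity of the
  variance. Exponents that are powers of two suit this argument as well.\<close>

lemma expectation_power_two_power:
  fixes Z :: "'a \<Rightarrow> real"
  assumes "finite (set_pmf Q)"
  shows "(measure_pmf.expectation Q Z) ^ (2 ^ m) \<le> measure_pmf.expectation Q (\<lambda>x. Z x ^ (2 ^ m))"
proof (induction m arbitrary: Z)
  case (Suc m)
  have int: "integrable (measure_pmf Q) h" for h :: "'a \<Rightarrow> real" by (rule integrable_measure_pmf_finite[OF assms])
  have "0 \<le> measure_pmf.variance Q Z" by (rule measure_pmf.variance_positive)
  then have "(measure_pmf.expectation Q Z)\<^sup>2 \<le> measure_pmf.expectation Q (\<lambda>x. (Z x)\<^sup>2)"
    by (subst (asm) measure_pmf.variance_eq[OF int int]) simp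
  then have "((measure_pmf.expectation Q Z)\<^sup>2) ^ (2 ^ m) \<le> (measure_pmf.expectation Q (\<lambda>x. (Z x)\<^sup>2)) ^ (2 ^ m)"
    by (intro power_mono) auto
  also have "\<dots> \<le> measure_pmf.expectation Q (\<lambda>x. ((Z x)\<^sup>2) ^ (2 ^ m))" by (rule Suc)
  finally show ?case by (simp add: power_mult[symmetric])
qed simp

section \<open>Symmetrisation of the noise\<close>

definition pairs :: "nat \<Rightarrow> (nat \<times> nat) set" where
  "pairs n = {(i, j). i < j \<and> j < n}"

lemma finite_pairs: "finite (pairs n)"
  by (rule finite_subset[of _ "{..<n} \<times> {..<n}"]) (auto simp: pairs_def)

abbreviation edge_pmf :: "nat \<Rightarrow> (nat \<times> nat \<Rightarrow> real) \<Rightarrow> (nat \<times> nat \<Rightarrow> bool) pmf" where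
  "edge_pmf n p \<equiv> Pi_pmf (pairs n) False (\<lambda>e. bernoulli_pmf (p e))"

definition mean_matrix :: "(nat \<times> nat \<Rightarrow> real) \<Rightarrow> rmatrix" where
  "mean_matrix p i j = (if i < j then p (i, j) else if j < i then p (j, i) else 0)"

text \<open>Defined on unordered pairs so that the walk expansion of traces applies; singletons
  stand for the diagonal.\<close>

definition edge_diff :: "(nat \<times> nat \<Rightarrow> bool) \<Rightarrow> (nat \<times> nat \<Rightarrow> bool) \<Rightarrow> nat set \<Rightarrow> real" where
  "edge_diff E E' s = (if card s = 2 then of_bool (E (Min s, Max s)) - of_bool (E' (Min s, Max s)) else 0)"

lemma edge_diff_matrix: "adj_matrix E i j - adj_matrix E' i j = edge_diff E E' {i, j}"
  by (auto simp: adj_matrix_def edge_diff_def min_def max_def)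

lemma edge_diff_pair: "i < j \<Longrightarrow> edge_diff E E' {i, j} = of_bool (E (i, j)) - of_bool (E' (i, j))"
  by (simp add: edge_diff_def min_def max_def)

context
  fixes n :: nat and p :: "nat \<times> nat \<Rightarrow> real" and q :: real
  assumes p: "\<And>e. e \<in> pairs n \<Longrightarrow> 0 \<le> p e" "\<And>e. e \<in> pairs n \<Longrightarrow> p e \<le> 1"
    and q: "0 \<le> q" "q \<le> 1" "\<And>e. e \<in> pairs n \<Longrightarrow> 2 * p e * (1 - p e) \<le> q"
begin

lemma finite_set_edge_pmf: "finite (set_pmf (edge_pmf n p))"
  by (rule finite_set_Pi_pmf_bool[OF finite_pairs])

lemma integrable_edge_pmf: "integrable (measure_pmf (edge_pmf n p)) (h :: _ \<Rightarrow> real)"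
  by (rule integrable_measure_pmf_finite[OF finite_set_edge_pmf])

text \<open>The difference of two independent copies is symmetric with values in {-1, 0, 1}: odd
  moments vanish and all positive even moments coincide. Centring by the mean alone would not kill
  the odd moments.\<close>

lemma bernoulli_difference_moment:
  assumes "e \<in> pairs n"
  shows "measure_pmf.expectation (bernoulli_pmf (p e)) (\<lambda>a. measure_pmf.expectation (bernoulli_pmf (p e))
     (\<lambda>a'. (of_bool a - of_bool a' :: real) ^ c)) = (if c = 0 then 1 else if even c then 2 * p e * (1 - p e) else 0)"
  using p[OF assms] by (auto simp: algebra_simps power_0_left)

text \<open>For an even walk only the number of distinct edges counts. It is at least
  \<open>card (set w) - 1\<close>, and as \<open>q \<le> 1\<close> the exponent may be lowered to
  that value.\<close>

lemma expectation_path_weight: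
  assumes w: "w \<in> closed_walks n l"
  shows "measure_pmf.expectation (edge_pmf n p) (\<lambda>E. measure_pmf.expectation (edge_pmf n p) (\<lambda>E'. path_weight (edge_diff E E') w))
    \<le> (if even_walk w then q ^ (card (set w) - 1) else 0)"
proof -
  let ?pe = "\<lambda>(i, j). {i, j :: nat}" and ?c = "\<lambda>e. count_list (pedges w) e"
  let ?F = "?pe ` pairs n"
  have wn: "set w \<subseteq> {..<n}" "w \<noteq> []" using w by (auto simp: closed_walks_def)
  have inj: "inj_on ?pe (pairs n)" by (auto simp: inj_on_def pairs_def doubleton_eq_iff)
  show ?thesis
  proof (cases "set (pedges w) \<subseteq> ?F")
    \<comment> \<open>The walk uses a loop, where adjacency matrices have the entry 0.\<close>
    case False
    then obtain e where e: "e \<in> set (pedges w)" "e \<notin> ?F" by blast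
    then obtain i j where ij: "e = {i, j}" "i < n" "j < n"
      using pedges_edge_set[OF wn(1)] by (auto simp: edge_set_def)
    have "i = j"
    proof (rule ccontr)
      assume "i \<noteq> j"
      then have "e = ?pe (i, j) \<and> (i, j) \<in> pairs n \<or> e = ?pe (j, i) \<and> (j, i) \<in> pairs n"
        using ij by (auto simp: pairs_def)
      then show False using e(2) by blast
    qed
    then have "edge_diff E E' e = 0" for E E' by (simp add: edge_diff_def ij)
    then have "path_weight (edge_diff E E') w = 0" for E E'
      using e(1) unfolding path_weight_def by (auto simp: prod_list_zero_iff image_iff) 
    then show ?thesis using q by simp
  next
    case True
    have pw: "path_weight (edge_diff E E') w = (\<Prod>e\<in>pairs n. (of_bool (E e) - of_bool (E' e)) ^ ?c (?pe e))" for E E'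
    proof -
      have "path_weight (edge_diff E E') w = (\<Prod>e\<in>?F. edge_diff E E' e ^ ?c e)"
        by (rule path_weight_eq_prod[OF _ True]) (simp add: finite_pairs)
      also have "\<dots> = (\<Prod>e\<in>pairs n. edge_diff E E' (?pe e) ^ ?c (?pe e))"
        by (simp add: prod.reindex[OF inj])
      also have "\<dots> = (\<Prod>e\<in>pairs n. (of_bool (E e) - of_bool (E' e)) ^ ?c (?pe e))"
        by (intro prod.cong refl) (auto simp: pairs_def edge_diff_pair)
      finally show ?thesis .
    qed
    have fin: "finite (set_pmf (bernoulli_pmf (p e)))" for e by (rule finite_subset[of _ UNIV]) auto
    have "measure_pmf.expectation (edge_pmf n p) (\<lambda>E. measure_pmf.expectation (edge_pmf n p) (\<lambda>E'. path_weight (edge_diff E E') w)) =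
      (\<Prod>e\<in>pairs n. measure_pmf.expectation (bernoulli_pmf (p e)) (\<lambda>a. measure_pmf.expectation (bernoulli_pmf (p e))
         (\<lambda>a'. (of_bool a - of_bool a') ^ ?c (?pe e))))"
    proof -
      have "measure_pmf.expectation (edge_pmf n p) (\<lambda>E'. path_weight (edge_diff E E') w) =
        (\<Prod>e\<in>pairs n. measure_pmf.expectation (bernoulli_pmf (p e)) (\<lambda>a'. (of_bool (E e) - of_bool a') ^ ?c (?pe e)))" for E
        unfolding pw by (rule expectation_prod_Pi_pmf_finite[OF finite_pairs fin])
      then show ?thesis by (simp only: expectation_prod_Pi_pmf_finite[OF finite_pairs fin,
          where f = "\<lambda>e a. measure_pmf.expectation (bernoulli_pmf (p e)) (\<lambda>a'. (of_bool a - of_bool a' :: real) ^ ?c (?pe e))"])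
    qed
    also have "\<dots> = (\<Prod>e\<in>pairs n. if ?c (?pe e) = 0 then 1 else if even (?c (?pe e)) then 2 * p e * (1 - p e) else 0)"
      by (intro prod.cong refl bernoulli_difference_moment)
    also have "\<dots> \<le> (if even_walk w then q ^ (card (set w) - 1) else 0)"
    proof (cases "even_walk w")
      case ev: True
      have "(\<Prod>e\<in>pairs n. if ?c (?pe e) = 0 then 1 else if even (?c (?pe e)) then 2 * p e * (1 - p e) else 0)
        \<le> (\<Prod>e\<in>pairs n. if ?c (?pe e) = 0 then 1 else q)"
        using p q ev by (intro prod_mono) (auto simp: even_walk_def)
      also have "\<dots> = (\<Prod>e\<in>?F. if ?c e = 0 then 1 else q)" by (simp add: prod.reindex[OF inj])
      also have "\<dots> = (\<Prod>e\<in>set (pedges w). q)"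
        using True by (intro prod.mono_neutral_cong_right) (auto simp: finite_pairs count_list_0_iff)
      also have "\<dots> = q ^ card (set (pedges w))" by simp
      also have "\<dots> \<le> q ^ (card (set w) - 1)"
        using q card_vertices_le[OF wn(2)] by (intro power_decreasing) auto
      finally show ?thesis using ev by simp
    next
      case False
      then obtain e where e: "odd (?c e)" by (auto simp: even_walk_def)
      then have "e \<in> set (pedges w)" by (metis count_notin even_zero)
      then obtain e' where "e' \<in> pairs n" "e = ?pe e'" using True by blast
      then have "\<exists>e\<in>pairs n. (if ?c (?pe e) = 0 then 1 else if even (?c (?pe e)) then 2 * p e * (1 - p e) else 0) = 0"
        using e by (intro bexI[of _ e']) (auto intro: odd_pos)
      then have "(\<Prod>e\<in>pairs n. if ?c (?pe e) = 0 then 1 else if even (?c (?pe e)) then 2 * p e * (1 - p e) else 0) = 0"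
        by (rule prod_zero[OF finite_pairs])
      then show ?thesis using False by simp
    qed
    finally show ?thesis .
  qed
qed

lemma expectation_trace_pow:
  "measure_pmf.expectation (edge_pmf n p) (\<lambda>E. measure_pmf.expectation (edge_pmf n p) (\<lambda>E'.
      trace_pow n (\<lambda>i j. adj_matrix E i j - adj_matrix E' i j) l))
    \<le> (\<Sum>w\<in>even_walks n l. q ^ (card (set w) - 1))"
proof -
  have "measure_pmf.expectation (edge_pmf n p) (\<lambda>E. measure_pmf.expectation (edge_pmf n p) (\<lambda>E'.
      trace_pow n (\<lambda>i j. adj_matrix E i j - adj_matrix E' i j) l)) =
    (\<Sum>w\<in>closed_walks n l. measure_pmf.expectation (edge_pmf n p) (\<lambda>E. measure_pmf.expectation (edge_pmf n p) (\<lambda>E'. path_weight (edge_diff E E') w)))"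
    unfolding edge_diff_matrix trace_pow_expansion
    by (simp add: Bochner_Integration.integral_sum integrable_edge_pmf)
  also have "\<dots> \<le> (\<Sum>w\<in>closed_walks n l. if even_walk w then q ^ (card (set w) - 1) else 0)"
    by (intro sum_mono expectation_path_weight)
  also have "\<dots> = (\<Sum>w\<in>even_walks n l. q ^ (card (set w) - 1))"
    unfolding even_walks_def by (rule sum.inter_filter[symmetric, OF finite_closed_walks])
  finally show ?thesis .
qed

lemma expectation_adj_matrix:
  assumes "i < n" "j < n"
  shows "measure_pmf.expectation (edge_pmf n p) (\<lambda>E. adj_matrix E i j) = mean_matrix p i j"
proof -
  have *: "measure_pmf.expectation (edge_pmf n p) (\<lambda>E. of_bool (E e)) = p e" if e: "e \<in> pairs n" for e
  proof -
    have "measure_pmf.expectation (map_pmf (\<lambda>y. y e) (edge_pmf n p)) of_bool = (p e :: real)"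
      using p[OF e] by (simp add: Pi_pmf_component[OF finite_pairs] e)
    then show ?thesis by simp
  qed
  consider "i < j" | "j < i" | "i = j" by linarith
  then show ?thesis
    by cases (use assms *[of "(i, j)"] *[of "(j, i)"] in \<open>auto simp: adj_matrix_def mean_matrix_def pairs_def\<close>)
qed

text \<open>The matrix of an independent \<open>E'\<close> has mean \<open>mean_matrix p\<close>, so
  the form of the deviation of \<open>E\<close> at a bad vector is a mean over \<open>E'\<close> of
  forms of differences. Jensen's inequality moves the even power inside this mean.\<close>

lemma bad_event_moment:
  assumes K: "K = 2 ^ m" and \<theta>: "0 \<le> \<theta>"
    and bad: "\<not> op_le n (\<lambda>i j. adj_matrix E i j - mean_matrix p i j) \<theta>"
  shows "(\<theta>\<^sup>2) ^ K \<le> measure_pmf.expectation (edge_pmf n p) (\<lambda>E'. trace_pow n (\<lambda>i j. adj_matrix E i j - adj_matrix E' i j) (2 * K))"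
    (is "_ \<le> ?T")
proof -
  let ?X = "\<lambda>i j. adj_matrix E i j - mean_matrix p i j"
  let ?D = "\<lambda>E' i j. adj_matrix E i j - adj_matrix E' i j"
  have symD: "?D E' i j = ?D E' j i" for E' i j by (auto simp: adj_matrix_def)
  obtain v where v: "\<theta>\<^sup>2 * ip n v v < ip n (mv n ?X v) (mv n ?X v)"
    using bad by (auto simp: op_le_def not_le)
  define u where "u = mv n ?X v"
  define a where "a = ip n u u"
  define b where "b = ip n v v"
  have ab: "\<theta>\<^sup>2 * b < a" "0 \<le> b" using v by (auto simp: a_def b_def u_def)
  then have a: "a > 0" by (smt (verit) mult_nonneg_nonneg zero_le_power2)
  have b: "b > 0"
  proof (rule ccontr)
    assume "\<not> b > 0"
    then have "b = 0" using ab(2) by linarith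
    then have "ip n v v = 0" by (simp add: b_def)
    then have "u = (\<lambda>_. 0)" unfolding u_def by (simp add: mv_def ip_self_eq_0_iff)
    then show False using a by (simp add: a_def ip_def)
  qed
  have "a = measure_pmf.expectation (edge_pmf n p) (\<lambda>E'. ip n u (mv n (?D E') v))"
  proof -
    have "measure_pmf.expectation (edge_pmf n p) (\<lambda>E'. ip n u (mv n (?D E') v)) =
       (\<Sum>i<n. \<Sum>j<n. u i * (measure_pmf.expectation (edge_pmf n p) (\<lambda>E'. ?D E' i j) * v j))"
      by (simp add: ip_def mv_def sum_distrib_left Bochner_Integration.integral_sum integrable_edge_pmf del: Bochner_Integration.integral_diff)
    also have "\<dots> = (\<Sum>i<n. \<Sum>j<n. u i * (?X i j * v j))"
      by (intro sum.cong refl) (simp add: integrable_edge_pmf expectation_adj_matrix)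
    also have "\<dots> = ip n u u" by (simp add: u_def ip_def mv_def sum_distrib_left)
    finally show ?thesis by (simp add: a_def)
  qed
  then have "a ^ (2 * K) = (measure_pmf.expectation (edge_pmf n p) (\<lambda>E'. ip n u (mv n (?D E') v))) ^ (2 ^ Suc m)"
    using K by simp
  also have "\<dots> \<le> measure_pmf.expectation (edge_pmf n p) (\<lambda>E'. (ip n u (mv n (?D E') v)) ^ (2 ^ Suc m))"
    by (rule expectation_power_two_power[OF finite_set_edge_pmf])
  also have "\<dots> \<le> measure_pmf.expectation (edge_pmf n p) (\<lambda>E'. a ^ K * (b ^ K * trace_pow n (?D E') (2 * K)))"
  proof (rule integral_mono[OF integrable_edge_pmf integrable_edge_pmf])
    fix E'
    have "(ip n u (mv n (?D E') v)) ^ (2 ^ Suc m) = ((ip n u (mv n (?D E') v))\<^sup>2) ^ K"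
      using K by (simp add: power_mult[symmetric])
    also have "\<dots> \<le> (a * ip n (mv n (?D E') v) (mv n (?D E') v)) ^ K"
      unfolding a_def by (intro power_mono ip_Cauchy_Schwarz) simp
    also have "\<dots> \<le> a ^ K * (b ^ K * trace_pow n (?D E') (2 * K))"
      unfolding power_mult_distrib b_def using a
      by (intro mult_left_mono ip_mv_power_le_trace[of "?D E'", OF symD K]) auto
    finally show "(ip n u (mv n (?D E') v)) ^ (2 ^ Suc m) \<le> a ^ K * (b ^ K * trace_pow n (?D E') (2 * K))" .
  qed
  also have "\<dots> = a ^ K * (b ^ K * ?T)" by simp
  finally have "a ^ K * a ^ K \<le> a ^ K * (b ^ K * ?T)" by (simp add: mult_2 power_add)
  then have "a ^ K \<le> b ^ K * ?T" using a by simp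
  moreover have "(\<theta>\<^sup>2 * b) ^ K \<le> a ^ K" using ab b by (intro power_mono) auto
  ultimately have "b ^ K * (\<theta>\<^sup>2) ^ K \<le> b ^ K * ?T" by (simp add: power_mult_distrib mult.commute)
  then show ?thesis using b by simp
qed

text \<open>Markov's inequality for the symmetrised trace moment, followed by the comparison with
  \<open>2 * K + 2\<close> vertices.\<close>

lemma prob_bad_event:
  assumes K: "K = 2 ^ m" and \<theta>: "0 < \<theta>" and nq: "real n * q \<le> real K"
  shows "measure_pmf.prob (edge_pmf n p) {E. \<not> op_le n (\<lambda>i j. adj_matrix E i j - mean_matrix p i j) \<theta>}
     \<le> 4 * 48 ^ 4 * real n * (2 * 48 ^ 4 * exp 32 * real K / \<theta>\<^sup>2) ^ K"
proof -
  let ?B = "{E. \<not> op_le n (\<lambda>i j. adj_matrix E i j - mean_matrix p i j) \<theta>}"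
  let ?T = "\<lambda>E. measure_pmf.expectation (edge_pmf n p) (\<lambda>E'. trace_pow n (\<lambda>i j. adj_matrix E i j - adj_matrix E' i j) (2 * K))"
  define r where "r = 2 * K + 2"
  have K1: "1 \<le> K" using K by simp
  have T0: "0 \<le> ?T E" for E
    by (intro Bochner_Integration.integral_nonneg trace_pow_even_nonneg) (auto simp: adj_matrix_def)
  have "(\<theta>\<^sup>2) ^ K * measure_pmf.prob (edge_pmf n p) ?B = measure_pmf.expectation (edge_pmf n p) (\<lambda>E. (\<theta>\<^sup>2) ^ K * indicator ?B E)"
    by simp
  also have "\<dots> \<le> measure_pmf.expectation (edge_pmf n p) ?T"
    using bad_event_moment[OF K] \<theta> T0
    by (intro integral_mono[OF integrable_edge_pmf integrable_edge_pmf]) (auto simp: indicator_def)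
  also have "\<dots> \<le> (\<Sum>w\<in>even_walks n (2 * K). q ^ (card (set w) - 1))" by (rule expectation_trace_pow)
  also have "\<dots> \<le> real n / real (K + 1) * real (card (even_walks r (2 * K)))"
    using q nq by (intro even_walks_comparison) (auto simp: r_def)
  also have "\<dots> \<le> real n / real (K + 1) * (real r * (48 ^ r)\<^sup>2 * (2 * (2 * real K * exp 32) ^ K))"
    by (intro mult_left_mono card_even_walks_le K1) (auto simp: r_def)
  \<comment> \<open>Since \<open>2 * r = 4 * K + 4\<close>, the number of net pairs splits into a
    constant \<open>48 ^ 4\<close> and a factor \<open>48 ^ 4\<close> per unit of \<open>K\<close>.
    The leading 4 is the ratio \<open>r / (K + 1) = 2\<close> times the 2 of the moment
    bound.\<close>
  also have "\<dots> = 4 * 48 ^ 4 * real n * ((48 ^ 4) ^ K * (2 * real K * exp 32) ^ K)"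
  proof -
    have "real r / real (K + 1) = 2" by (simp add: r_def field_simps)
    moreover have "(48 ^ r)\<^sup>2 = (48 ^ 4 * (48 ^ 4) ^ K :: real)"
      by (simp only: r_def power_mult[symmetric] power_add[symmetric]) (rule arg_cong[of _ _ "(^) 48"], simp)
    ultimately show ?thesis by (simp add: field_simps)
  qed
  also have "(48 ^ 4) ^ K * (2 * real K * exp 32) ^ K = (2 * 48 ^ 4 * exp 32 * real K) ^ K"
    unfolding power_mult_distrib[symmetric] by (simp add: mult_ac)
  finally show ?thesis using \<theta> by (simp add: power_divide field_simps)
qed

end

section \<open>Taylor approximation on a grid\<close>

text \<open>Half-open in every coordinate, so that the cells partition the half-open cube
  exactly.\<close>

definition cell :: "nat \<Rightarrow> ('d \<Rightarrow> nat) \<Rightarrow> (real ^ 'd::finite) set" where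
  "cell m c = {x. \<forall>i. real (c i) \<le> real m * x $ i \<and> real m * x $ i < real (c i) + 1}"

definition corner :: "nat \<Rightarrow> ('d \<Rightarrow> nat) \<Rightarrow> real ^ 'd::finite" where
  "corner m c = (\<chi> i. real (c i) / real m)"

definition cell_indices :: "nat \<Rightarrow> ('d::finite \<Rightarrow> nat) set" where
  "cell_indices m = {c. \<forall>i. c i < m}"

text \<open>Bounding each coordinate degree separately accommodates both the Taylor polynomials of
  total degree \<open>l\<close> and the tensor polynomials of the Sobolev case.\<close>

definition degrees :: "nat \<Rightarrow> ('d::finite \<Rightarrow> nat) set" where
  "degrees l = {k. \<forall>i. k i \<le> l}"

definition feature :: "nat \<Rightarrow> ('d::finite \<Rightarrow> nat) \<times> ('d \<Rightarrow> nat) \<Rightarrow> real ^ 'd \<Rightarrow> real" where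
  "feature m = (\<lambda>(c, k) x. of_bool (x \<in> cell m c) * (\<Prod>i\<in>UNIV. (real m * x $ i - real (c i)) ^ k i))"

definition feature_indices :: "nat \<Rightarrow> nat \<Rightarrow> (('d::finite \<Rightarrow> nat) \<times> ('d \<Rightarrow> nat)) set" where
  "feature_indices m l = cell_indices m \<times> degrees l"

lemma cell_indices_PiE: "cell_indices m = UNIV \<rightarrow>\<^sub>E {..<m}" and degrees_PiE: "degrees l = UNIV \<rightarrow>\<^sub>E {..l}"
  by (auto simp: cell_indices_def degrees_def PiE_def Pi_def)

lemma finite_cell_indices: "finite (cell_indices m :: ('d::finite \<Rightarrow> nat) set)"
  and finite_degrees: "finite (degrees l :: ('d::finite \<Rightarrow> nat) set)"
  unfolding cell_indices_PiE degrees_PiE by (intro finite_PiE; simp)+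

lemma finite_feature_indices: "finite (feature_indices m l)"
  by (simp add: feature_indices_def finite_cell_indices finite_degrees)

lemma card_feature_indices:
  "card (feature_indices m l :: (('d::finite \<Rightarrow> nat) \<times> ('d \<Rightarrow> nat)) set) = (m * Suc l) ^ CARD('d)"
  unfolding power_mult_distrib
  by (simp add: feature_indices_def card_cartesian_product cell_indices_PiE degrees_PiE card_PiE)

lemma cell_unique: "x \<in> cell m c \<Longrightarrow> x \<in> cell m c' \<Longrightarrow> c = c'"
proof
  fix i assume "x \<in> cell m c" "x \<in> cell m c'"
  then have "real (c i) \<le> real m * x $ i" "real m * x $ i < real (c i) + 1"
    "real (c' i) \<le> real m * x $ i" "real m * x $ i < real (c' i) + 1" by (auto simp: cell_def)
  then have "real (c i) < real (c' i + 1)" "real (c' i) < real (c i + 1)" by simp_all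
  then show "c i = c' i" unfolding of_nat_less_iff by simp
qed

lemma cell_exists:
  assumes "x \<in> cube" "0 < m"
  shows "\<exists>c\<in>cell_indices m. x \<in> cell m c"
proof
  let ?c = "\<lambda>i. nat \<lfloor>real m * x $ i\<rfloor>"
  have x: "0 \<le> real m * x $ i" "real m * x $ i < real m" for i using assms by (auto simp: cube_def)
  show "x \<in> cell m ?c" unfolding cell_def using x by (auto simp: of_nat_nat) 
  have "\<lfloor>real m * x $ i\<rfloor> < int m" for i using x[of i] by (simp add: floor_less_iff)
  then show "?c \<in> cell_indices m" using x assms(2) by (simp add: cell_indices_def nat_less_iff)
qed

lemma cell_subset_cube: "c \<in> cell_indices m \<Longrightarrow> 0 < m \<Longrightarrow> cell m c \<subseteq> cube"
proof
  fix x assume c: "c \<in> cell_indices m" "0 < m" and x: "x \<in> cell m c"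
  have "0 \<le> x $ i \<and> x $ i < 1" for i
  proof -
    have "real (c i) \<le> real m * x $ i" "real m * x $ i < real (c i) + 1" using x by (auto simp: cell_def)
    moreover have "real (c i) + 1 \<le> real m" using c by (auto simp: cell_indices_def) (metis Suc_leI of_nat_Suc of_nat_mono add.commute)
    ultimately have "0 \<le> real m * x $ i" "real m * x $ i < real m * 1" by linarith+
    then show ?thesis using c(2) by (simp add: zero_le_mult_iff)
  qed
  then show "x \<in> cube" by (simp add: cube_def)
qed

lemma corner_in_cell: "0 < m \<Longrightarrow> corner m c \<in> cell m c"
  by (simp add: corner_def cell_def)

lemma cell_corner_dist:
  assumes "x \<in> cell m c" "0 < m"
  shows "0 \<le> x $ i - corner m c $ i" "x $ i - corner m c $ i \<le> 1 / real m"
proof -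
  have "real (c i) \<le> real m * x $ i" "real m * x $ i < real (c i) + 1" using assms by (auto simp: cell_def)
  then show "0 \<le> x $ i - corner m c $ i" "x $ i - corner m c $ i \<le> 1 / real m"
    using assms(2) by (auto simp: corner_def pos_divide_le_eq pos_le_divide_eq right_diff_distrib mult.commute)
qed

lemma feature_sum_on_cell:
  fixes a :: "('d::finite \<Rightarrow> nat) \<times> ('d \<Rightarrow> nat) \<Rightarrow> real"
  assumes "x \<in> cell m c" "c \<in> cell_indices m"
  shows "(\<Sum>F\<in>feature_indices m l. a F * feature m F x) =
    (\<Sum>k\<in>degrees l. a (c, k) * (\<Prod>i\<in>UNIV. (real m * x $ i - real (c i)) ^ k i))"
proof -
  have "(\<Sum>F\<in>feature_indices m l. a F * feature m F x) =
     (\<Sum>c'\<in>cell_indices m. \<Sum>k\<in>degrees l. a (c', k) * feature m (c', k) x)"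
    unfolding feature_indices_def by (simp add: sum.cartesian_product)
  also have "\<dots> = (\<Sum>c'\<in>cell_indices m. if c' = c then \<Sum>k\<in>degrees l. a (c', k) * (\<Prod>i\<in>UNIV. (real m * x $ i - real (c' i)) ^ k i) else 0)"
  proof (rule sum.cong[OF refl])
    fix c'
    show "(\<Sum>k\<in>degrees l. a (c', k) * feature m (c', k) x) =
      (if c' = c then \<Sum>k\<in>degrees l. a (c', k) * (\<Prod>i\<in>UNIV. (real m * x $ i - real (c' i)) ^ k i) else 0)"
    proof (cases "c' = c")
      case False
      then have "x \<notin> cell m c'" using cell_unique[OF assms(1)] by blast
      then show ?thesis using False by (simp add: feature_def)
    qed (use assms(1) in \<open>simp add: feature_def\<close>)
  qed
  also have "\<dots> = (\<Sum>k\<in>degrees l. a (c, k) * (\<Prod>i\<in>UNIV. (real m * x $ i - real (c i)) ^ k i))"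
    by (subst sum.delta[OF finite_cell_indices]) (simp add: assms(2))
  finally show ?thesis .
qed

section \<open>Taylor polynomials of a family of partial derivatives\<close>

definition monomial :: "('d::finite \<Rightarrow> nat) \<Rightarrow> real ^ 'd \<Rightarrow> real" where
  "monomial k x = (\<Prod>i\<in>UNIV. x $ i ^ k i / fact (k i))"

lemma monomial_0: "monomial k 0 = of_bool (k = (\<lambda>_. 0))"
proof (cases "k = (\<lambda>_. 0)")
  case False
  then obtain i where "k i \<noteq> 0" by auto
  then have "\<exists>i\<in>UNIV. (0 :: real ^ 'a) $ i ^ k i / fact (k i) = 0" by (intro bexI[of _ i]) (auto simp: power_0_left)
  then have "monomial k (0 :: real ^ 'a) = 0" unfolding monomial_def by (intro prod_zero) auto
  then show ?thesis using False by simp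
qed (simp add: monomial_def)

lemma monomial_derivative:
  "((\<lambda>t. monomial k (y + t *\<^sub>R axis i 1)) has_real_derivative
     (if k i = 0 then 0 else monomial (k(i := k i - 1)) y)) (at 0 within S)"
proof -
  define R where "R = (\<Prod>j\<in>UNIV - {i}. y $ j ^ k j / fact (k j))"
  have eq: "monomial k (y + t *\<^sub>R axis i 1) = (y $ i + t) ^ k i / fact (k i) * R" for t
    unfolding monomial_def R_def
    by (subst prod.remove[of _ i]) (auto simp: axis_def intro!: prod.cong)
  have "((\<lambda>t. (y $ i + t) ^ k i / fact (k i) * R) has_real_derivative
     real (k i) * (y $ i) ^ (k i - 1) / fact (k i) * R) (at 0 within S)"
    by (auto intro!: derivative_eq_intros)
  moreover have "real (k i) * (y $ i) ^ (k i - 1) / fact (k i) * R = (if k i = 0 then 0 else monomial (k(i := k i - 1)) y)"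
  proof (cases "k i")
    case (Suc j)
    have "monomial (k(i := k i - 1)) y = (y $ i) ^ j / fact j * R"
      unfolding monomial_def R_def
      by (subst prod.remove[of _ i]) (auto simp: Suc intro!: prod.cong)
    moreover have "real (Suc j) / fact (Suc j) = 1 / fact j" by (simp del: of_nat_Suc)
    ultimately show ?thesis using Suc by (simp add: field_simps del: of_nat_Suc fact_Suc)
  qed simp
  ultimately show ?thesis unfolding eq by simp
qed

lemma mi_size_upd: "mi_size (k(i := Suc (k i))) = Suc (mi_size k)"
proof -
  have "mi_size (k(i := Suc (k i))) = Suc (k i) + (\<Sum>j\<in>UNIV - {i}. k j)"
    unfolding mi_size_def by (subst sum.remove[of _ i]) (auto intro!: sum.cong)
  moreover have "mi_size k = k i + (\<Sum>j\<in>UNIV - {i}. k j)"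
    unfolding mi_size_def by (subst sum.remove[of _ i]) auto
  ultimately show ?thesis by simp
qed

lemma finite_mi_size_le: "finite {k :: 'd::finite multi_index. mi_size k \<le> N}"
proof -
  have "{k :: 'd multi_index. mi_size k \<le> N} = (\<Union>m\<le>N. {k. mi_size k = m})" by auto
  then show ?thesis by (simp add: finite_mi_size)
qed

text \<open>Every member of the family gets its own Taylor polynomial, of order reduced by
  \<open>mi_size \<kappa>\<close>, so that the result is again a family of partial derivatives. By
  truncated subtraction a member of order beyond \<open>l\<close> is the constant
  \<open>D \<kappa> x0\<close>, hence agreement at the center holds for all
  \<open>\<kappa>\<close>.\<close>

definition taylor :: "('d::finite multi_index \<Rightarrow> real ^ 'd \<Rightarrow> real) \<Rightarrow> nat \<Rightarrow> real ^ 'd \<Rightarrow> 'd multi_index \<Rightarrow> real ^ 'd \<Rightarrow> real" where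
  "taylor D l x0 \<kappa> x = (\<Sum>k | mi_size k \<le> l - mi_size \<kappa>. D (\<lambda>i. \<kappa> i + k i) x0 * monomial k (x - x0))"

lemma taylor_partial_derivs:
  fixes D :: "'d::finite multi_index \<Rightarrow> real ^ 'd \<Rightarrow> real"
  shows "partial_derivs l S (taylor D l x0)"
  unfolding partial_derivs_def
proof (intro allI ballI impI)
  fix \<kappa> :: "'d multi_index" and i x assume \<kappa>: "mi_size \<kappa> < l"
  let ?N = "l - mi_size \<kappa>" and ?W = "{t. x + t *\<^sub>R axis i 1 \<in> S}"
  let ?A = "{k :: 'd multi_index. mi_size k \<le> ?N}" and ?B = "{k :: 'd multi_index. mi_size k \<le> ?N - 1}"
  have "((\<lambda>t. \<Sum>k\<in>?A. D (\<lambda>i. \<kappa> i + k i) x0 * monomial k ((x - x0) + t *\<^sub>R axis i 1)) has_real_derivative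
    (\<Sum>k\<in>?A. D (\<lambda>i. \<kappa> i + k i) x0 * (if k i = 0 then 0 else monomial (k(i := k i - 1)) (x - x0)))) (at 0 within ?W)"
    by (intro DERIV_sum DERIV_cmult monomial_derivative)
  moreover have "(\<Sum>k\<in>?A. D (\<lambda>i. \<kappa> i + k i) x0 * (if k i = 0 then 0 else monomial (k(i := k i - 1)) (x - x0)))
    = taylor D l x0 (\<kappa>(i := Suc (\<kappa> i))) x"
  proof -
    let ?up = "\<lambda>k :: 'd multi_index. k(i := Suc (k i))"
    have "(\<Sum>k\<in>?A. D (\<lambda>i. \<kappa> i + k i) x0 * (if k i = 0 then 0 else monomial (k(i := k i - 1)) (x - x0)))
      = (\<Sum>k\<in>?up ` ?B. D (\<lambda>i. \<kappa> i + k i) x0 * (if k i = 0 then 0 else monomial (k(i := k i - 1)) (x - x0)))"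
    proof (rule sum.mono_neutral_right[OF finite_mi_size_le])
      show "?up ` ?B \<subseteq> ?A" using \<kappa> by (auto simp: mi_size_upd)
      show "\<forall>k\<in>?A - ?up ` ?B. D (\<lambda>i. \<kappa> i + k i) x0 * (if k i = 0 then 0 else monomial (k(i := k i - 1)) (x - x0)) = 0"
      proof
        fix k assume k: "k \<in> ?A - ?up ` ?B"
        have "k i = 0"
        proof (rule ccontr)
          assume "k i \<noteq> 0"
          then have up: "k = ?up (k(i := k i - 1))" by auto
          then have "mi_size k = Suc (mi_size (k(i := k i - 1)))" by (metis mi_size_upd)
          then have "k(i := k i - 1) \<in> ?B" using k by auto
          then show False using k up by blast
        qed
        then show "D (\<lambda>i. \<kappa> i + k i) x0 * (if k i = 0 then 0 else monomial (k(i := k i - 1)) (x - x0)) = 0" by simp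
      qed
    qed
    also have "\<dots> = (\<Sum>k\<in>?B. D (\<lambda>j. \<kappa> j + (?up k) j) x0 * monomial k (x - x0))"
    proof (subst sum.reindex)
      show "inj_on ?up ?B" by (auto simp: inj_on_def fun_eq_iff split: if_splits)
    qed simp
    also have "\<dots> = taylor D l x0 (\<kappa>(i := Suc (\<kappa> i))) x"
    proof -
      have "(\<lambda>j. \<kappa> j + (?up k) j) = (\<lambda>j. (\<kappa>(i := Suc (\<kappa> i))) j + k j)" for k by auto
      then show ?thesis unfolding taylor_def mi_size_upd by simp
    qed
    finally show ?thesis .
  qed
  moreover have "taylor D l x0 \<kappa> (x + t *\<^sub>R axis i 1) =
      (\<Sum>k\<in>?A. D (\<lambda>i. \<kappa> i + k i) x0 * monomial k ((x - x0) + t *\<^sub>R axis i 1))" for t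
    unfolding taylor_def by (simp add: algebra_simps)
  ultimately show "((\<lambda>t. taylor D l x0 \<kappa> (x + t *\<^sub>R axis i 1)) has_real_derivative taylor D l x0 (\<kappa>(i := Suc (\<kappa> i))) x)
     (at 0 within ?W)" by simp
qed

lemma taylor_center:
  fixes \<kappa> :: "'d::finite multi_index"
  shows "taylor D l x0 \<kappa> x0 = D \<kappa> x0"
proof -
  have "taylor D l x0 \<kappa> x0 = (\<Sum>k :: 'd multi_index | mi_size k \<le> l - mi_size \<kappa>. if k = (\<lambda>_. 0) then D \<kappa> x0 else 0)"
    unfolding taylor_def by (intro sum.cong refl) (simp add: monomial_0)
  also have "\<dots> = D \<kappa> x0" by (simp add: finite_mi_size_le) (simp add: mi_size_def)
  finally show ?thesis .
qed

lemma taylor_top: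
  fixes \<kappa> :: "'d::finite multi_index"
  assumes "mi_size \<kappa> = l"
  shows "taylor D l x0 \<kappa> x = D \<kappa> x0"
proof -
  have "{k :: 'd multi_index. mi_size k \<le> l - mi_size \<kappa>} = {\<lambda>_. 0}" using assms by (auto simp: mi_size_def)
  then show ?thesis by (simp add: taylor_def monomial_def)
qed

lemma partial_derivs_diff:
  "partial_derivs l S D \<Longrightarrow> partial_derivs l S D' \<Longrightarrow> partial_derivs l S (\<lambda>\<kappa> x. D \<kappa> x - D' \<kappa> x)"
  unfolding partial_derivs_def by (auto intro!: DERIV_diff)

lemma partial_derivs_subset:
  "partial_derivs l S D \<Longrightarrow> T \<subseteq> S \<Longrightarrow> partial_derivs l T D"
  unfolding partial_derivs_def by (blast intro: DERIV_subset)

text \<open>A family of derivatives that vanishes at the corner of a cell is controlled by its members of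
  the highest order: move from the corner to the point one coordinate at a time.\<close>

lemma partial_derivs_cell_bound:
  fixes G :: "'d::finite multi_index \<Rightarrow> real ^ 'd \<Rightarrow> real"
  assumes G: "partial_derivs l (cell m c) G" and m: "0 < m"
    and zero: "\<And>\<kappa>. G \<kappa> (corner m c) = 0"
    and top: "\<And>\<kappa> x. mi_size \<kappa> = l \<Longrightarrow> x \<in> cell m c \<Longrightarrow> \<bar>G \<kappa> x\<bar> \<le> \<epsilon>"
    and x: "x \<in> cell m c" and \<kappa>: "mi_size \<kappa> + j = l"
  shows "\<bar>G \<kappa> x\<bar> \<le> (real CARD('d) / real m) ^ j * \<epsilon>"
  using x \<kappa>
proof (induction j arbitrary: x \<kappa>)
  case 0 then show ?case using top by simp
next
  case (Suc j)
  let ?B = "(real CARD('d) / real m) ^ j * \<epsilon>" and ?x0 = "corner m c"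
  have IH: "\<bar>G (\<kappa>(i := Suc (\<kappa> i))) y\<bar> \<le> ?B" if "y \<in> cell m c" for y i
  proof (rule Suc.IH[OF that])
    show "mi_size (\<kappa>(i := Suc (\<kappa> i))) + j = l" unfolding mi_size_upd using Suc.prems by simp
  qed
  have B0: "0 \<le> ?B" using IH[OF corner_in_cell[OF m]] by (rule order_trans[OF abs_ge_zero])
  \<comment> \<open>\<open>partial_derivs\<close> gives no joint differentiability, so the mean
    value theorem is available only on segments parallel to an axis; the \<open>pt A\<close> are the
    ends of such segments.\<close>
  define pt where "pt A = (\<chi> i. if i \<in> A then x $ i else ?x0 $ i)" for A
  have "\<bar>G \<kappa> (pt A)\<bar> \<le> real (card A) * (?B / real m)" for A :: "'d set"
  proof (induction A rule: infinite_finite_induct)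
    case empty
    have "pt {} = ?x0" by (simp add: pt_def vec_eq_iff)
    then show ?case by (simp add: zero)
  next
    case (insert i A)
    define y where "y t = (\<chi> j. if j = i then t else pt A $ j)" for t
    let ?I = "{t. real (c i) \<le> real m * t \<and> real m * t < real (c i) + 1}"
    have x0: "?x0 \<in> cell m c" by (rule corner_in_cell[OF m])
    have yc: "y t \<in> cell m c" if "t \<in> ?I" for t
      using that Suc.prems(1) x0 by (auto simp: cell_def y_def pt_def)
    have yt: "y t = y s + (t - s) *\<^sub>R axis i 1" for t s
      by (auto simp: y_def vec_eq_iff axis_def)
    have conv: "convex ?I"
    proof -
      have "?I = {real (c i) / real m..<(real (c i) + 1) / real m}" using m by (auto simp: field_simps)
      then show ?thesis by simp
    qed
    have der: "((\<lambda>t. G \<kappa> (y t)) has_real_derivative G (\<kappa>(i := Suc (\<kappa> i))) (y s)) (at s within ?I)" if s: "s \<in> ?I" for s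
    proof -
      let ?g = "\<lambda>u. G \<kappa> (y s + u *\<^sub>R axis i 1)"
      have "(?g has_real_derivative G (\<kappa>(i := Suc (\<kappa> i))) (y s)) (at 0 within {u. y s + u *\<^sub>R axis i 1 \<in> cell m c})"
        using G[unfolded partial_derivs_def, rule_format, OF yc[OF s]] Suc.prems by simp
      then have "(?g has_real_derivative G (\<kappa>(i := Suc (\<kappa> i))) (y s)) (at (s - s) within (\<lambda>t. t - s) ` ?I)"
        unfolding diff_self
      proof (rule DERIV_subset)
        show "(\<lambda>t. t - s) ` ?I \<subseteq> {u. y s + u *\<^sub>R axis i 1 \<in> cell m c}"
          using yc by (auto simp only: yt[of _ s, symmetric] image_subset_iff mem_Collect_eq)
      qed
      moreover have "((\<lambda>t. t - s) has_real_derivative 1) (at s within ?I)" by (auto intro!: derivative_eq_intros)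
      ultimately have "(?g \<circ> (\<lambda>t. t - s) has_real_derivative G (\<kappa>(i := Suc (\<kappa> i))) (y s) * 1) (at s within ?I)"
        by (rule DERIV_image_chain)
      moreover have "?g \<circ> (\<lambda>t. t - s) = (\<lambda>t. G \<kappa> (y t))" unfolding comp_def yt[of _ s, symmetric] ..
      ultimately show ?thesis by simp
    qed
    have xi: "x $ i \<in> ?I" "?x0 $ i \<in> ?I" using Suc.prems(1) x0 by (auto simp: cell_def)
    have "norm (G \<kappa> (y (x $ i)) - G \<kappa> (y (?x0 $ i))) \<le> ?B * norm (x $ i - ?x0 $ i)"
      by (rule field_differentiable_bound[OF conv der]) (use IH yc xi in auto)
    also have "\<dots> \<le> ?B * (1 / real m)"
      using cell_corner_dist[OF Suc.prems(1) m, of i] B0 by (intro mult_left_mono) auto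
    finally have "\<bar>G \<kappa> (pt (insert i A)) - G \<kappa> (pt A)\<bar> \<le> ?B / real m"
    proof -
      have "y (x $ i) = pt (insert i A)" "y (?x0 $ i) = pt A"
        using insert.hyps by (auto simp: y_def pt_def vec_eq_iff)
      moreover assume "norm (G \<kappa> (y (x $ i)) - G \<kappa> (y (?x0 $ i))) \<le> ?B * (1 / real m)"
      ultimately show ?thesis by simp
    qed
    then have "\<bar>G \<kappa> (pt (insert i A))\<bar> \<le> ?B / real m + real (card A) * (?B / real m)"
      using insert.IH by linarith
    then show ?case using insert.hyps by (simp add: distrib_right add_divide_distrib)
  qed simp
  from this[of UNIV] have "\<bar>G \<kappa> x\<bar> \<le> real CARD('d) * (?B / real m)" by (simp add: pt_def)
  then show ?case by (simp add: mult_ac)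
qed

lemma sfloor_less: "0 < \<alpha> \<Longrightarrow> real (sfloor \<alpha>) < \<alpha>"
  using less_iff_le_sfloor[of \<alpha> "sfloor \<alpha>"] by simp

lemma hoelder_approximation:
  fixes g :: "real ^ 'd::finite \<Rightarrow> real"
  assumes g: "g \<in> hoelder_class \<alpha> L" and \<alpha>: "0 < \<alpha>" and m: "0 < m"
  shows "\<exists>a. \<forall>x\<in>cube. \<bar>g x - (\<Sum>F\<in>feature_indices m (sfloor \<alpha>). a F * feature m F x)\<bar> \<le>
     real CARD('d) ^ sfloor \<alpha> * (\<Sum>k | mi_size (k :: 'd multi_index) = sfloor \<alpha>. mi_fact k) * L * real m powr (- \<alpha>)"
proof -
  let ?l = "sfloor \<alpha>"
  let ?Bf = "\<Sum>k | mi_size (k :: 'd multi_index) = ?l. mi_fact k"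
  obtain D where D0: "\<And>x. x \<in> cube \<Longrightarrow> D (\<lambda>_. 0) x = g x" and D: "partial_derivs ?l cube D"
    and DL: "\<And>x x'. x \<in> cube \<Longrightarrow> x' \<in> cube \<Longrightarrow>
         (\<Sum>\<kappa> | mi_size \<kappa> = ?l. 1 / mi_fact \<kappa> * \<bar>D \<kappa> x - D \<kappa> x'\<bar>)
           \<le> L * infnorm (x - x') powr (\<alpha> - real ?l)"
    using g by (auto simp: hoelder_class_def)
  have fact0: "0 < mi_fact k" for k :: "'d multi_index" by (auto simp: mi_fact_def intro!: prod_pos)
  \<comment> \<open>The class allows any real \<open>L\<close>; two distinct points of the cube
    force it to be nonnegative.\<close>
  have L0: "0 \<le> L"
  proof -
    have z: "(0 :: real ^ 'd) \<in> cube" "((\<chi> i. 1 / 2) :: real ^ 'd) \<in> cube" by (auto simp: cube_def)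
    have "0 \<le> L * infnorm ((\<chi> i. 1 / 2) - (0 :: real ^ 'd)) powr (\<alpha> - real ?l)"
    proof (rule order_trans[OF _ DL[OF z(2,1)]])
      show "0 \<le> (\<Sum>\<kappa> | mi_size \<kappa> = ?l. 1 / mi_fact \<kappa> * \<bar>D \<kappa> (\<chi> i. 1 / 2) - D \<kappa> 0\<bar>)"
        by (intro sum_nonneg mult_nonneg_nonneg) (auto simp: less_imp_le[OF fact0])
    qed
    moreover have "0 < infnorm ((\<chi> i. 1 / 2) - (0 :: real ^ 'd))"
      unfolding infnorm_pos_lt by (simp add: vec_eq_iff)
    ultimately show ?thesis by (simp add: zero_le_mult_iff)
  qed
  \<comment> \<open>Taylor coefficients at the corner, converted to coordinates in which the cell
    has side 1; this divides by \<open>m\<close> once per degree.\<close>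
  define a where "a = (\<lambda>(c, k). if mi_size k \<le> ?l then D k (corner m c) / mi_fact k * (1 / real m) ^ mi_size k else 0)"
  show ?thesis
  proof (intro exI[of _ a] ballI)
    fix x :: "real ^ 'd" assume x: "x \<in> cube"
    obtain c where c: "c \<in> cell_indices m" "x \<in> cell m c" using cell_exists[OF x m] by blast
    let ?x0 = "corner m c"
    \<comment> \<open>\<open>?Bf\<close> absorbs the factor \<open>mi_fact \<kappa>\<close> that
      appears when one term is extracted from the weighted sum in the class.\<close>
    let ?\<epsilon> = "?Bf * (L * (1 / real m) powr (\<alpha> - real ?l))"
    have sub: "cell m c \<subseteq> cube" by (rule cell_subset_cube[OF c(1) m])
    have top: "\<bar>D \<kappa> y - D \<kappa> ?x0\<bar> \<le> ?\<epsilon>" if \<kappa>: "mi_size \<kappa> = ?l" and y: "y \<in> cell m c" for \<kappa> y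
    proof -
      have y': "y \<in> cube" "?x0 \<in> cube" using y sub corner_in_cell[OF m] by auto
      have "1 / mi_fact \<kappa> * \<bar>D \<kappa> y - D \<kappa> ?x0\<bar> \<le> (\<Sum>\<kappa> | mi_size \<kappa> = ?l. 1 / mi_fact \<kappa> * \<bar>D \<kappa> y - D \<kappa> ?x0\<bar>)"
        using \<kappa> fact0 by (intro member_le_sum[of \<kappa> _ "\<lambda>\<kappa>. 1 / mi_fact \<kappa> * \<bar>D \<kappa> y - D \<kappa> ?x0\<bar>"]) (auto simp: finite_mi_size less_imp_le)
      also have "\<dots> \<le> L * infnorm (y - ?x0) powr (\<alpha> - real ?l)" by (rule DL[OF y'])
      also have "\<dots> \<le> L * (1 / real m) powr (\<alpha> - real ?l)"
      proof (intro mult_left_mono powr_mono2 L0)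
        show "infnorm (y - ?x0) \<le> 1 / real m"
        proof (unfold infnorm_cart, rule cSup_least)
          fix t assume "t \<in> {\<bar>(y - ?x0) $ i\<bar> |i. i \<in> UNIV}"
          then obtain i where "t = \<bar>y $ i - ?x0 $ i\<bar>" by auto
          then show "t \<le> 1 / real m" using cell_corner_dist[OF y m, of i] by linarith
        qed auto
      qed (use sfloor_less[OF \<alpha>] infnorm_pos_le in auto)
      finally have "\<bar>D \<kappa> y - D \<kappa> ?x0\<bar> \<le> mi_fact \<kappa> * (L * (1 / real m) powr (\<alpha> - real ?l))"
        using fact0[of \<kappa>] by (simp add: field_simps)
      also have "\<dots> \<le> ?\<epsilon>"
        using \<kappa> fact0 L0 by (intro mult_right_mono member_le_sum) (auto simp: finite_mi_size less_imp_le)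
      finally show ?thesis .
    qed
    have "partial_derivs ?l (cell m c) (\<lambda>\<kappa> x. D \<kappa> x - taylor D ?l ?x0 \<kappa> x)"
      by (intro partial_derivs_diff taylor_partial_derivs partial_derivs_subset[OF D sub])
    from partial_derivs_cell_bound[OF this m, where x = x and \<kappa> = "\<lambda>_. 0" and j = ?l and \<epsilon> = ?\<epsilon>]
    have "\<bar>D (\<lambda>_. 0) x - taylor D ?l ?x0 (\<lambda>_. 0) x\<bar> \<le> (real CARD('d) / real m) ^ ?l * ?\<epsilon>"
      using top c(2) by (simp add: taylor_center taylor_top mi_size_def)
    also have "(real CARD('d) / real m) ^ ?l * ?\<epsilon> = real CARD('d) ^ ?l * ?Bf * L * real m powr (- \<alpha>)"
    proof -
      have "(1 / real m) ^ ?l * (1 / real m) powr (\<alpha> - real ?l) = (1 / real m) powr \<alpha>"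
        using m by (simp add: powr_realpow[symmetric] powr_add[symmetric])
      also have "\<dots> = real m powr (- \<alpha>)" using m by (simp add: powr_divide powr_minus_divide)
      finally have e: "real m powr (- \<alpha>) = (1 / real m) ^ ?l * (1 / real m) powr (\<alpha> - real ?l)" ..
      show ?thesis unfolding e by (simp add: power_divide)
    qed
    also have "taylor D ?l ?x0 (\<lambda>_. 0) x = (\<Sum>F\<in>feature_indices m ?l. a F * feature m F x)"
    proof -
      have mono: "monomial k (x - ?x0) = 1 / mi_fact k * (1 / real m) ^ mi_size k * (\<Prod>i\<in>UNIV. (real m * x $ i - real (c i)) ^ k i)" for k
      proof -
        have "monomial k (x - ?x0) = (\<Prod>i\<in>UNIV. (1 / fact (k i)) * ((1 / real m) ^ k i) * (real m * x $ i - real (c i)) ^ k i)"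
          unfolding monomial_def
        proof (intro prod.cong refl)
          fix i
          have "(x - ?x0) $ i = (1 / real m) * (real m * x $ i - real (c i))" using m by (simp add: corner_def field_simps)
          then show "(x - ?x0) $ i ^ k i / fact (k i) = (1 / fact (k i)) * ((1 / real m) ^ k i) * (real m * x $ i - real (c i)) ^ k i"
            by (simp only: power_mult_distrib) simp
        qed
        also have "\<dots> = 1 / mi_fact k * (1 / real m) ^ mi_size k * (\<Prod>i\<in>UNIV. (real m * x $ i - real (c i)) ^ k i)"
          unfolding prod.distrib mi_fact_def mi_size_def power_sum by (simp add: prod_dividef)
        finally show ?thesis .
      qed
      have "taylor D ?l ?x0 (\<lambda>_. 0) x = (\<Sum>k | mi_size k \<le> ?l. a (c, k) * (\<Prod>i\<in>UNIV. (real m * x $ i - real (c i)) ^ k i))"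
        unfolding taylor_def by (intro sum.cong) (auto simp: mono a_def mi_size_def mult_ac)
      also have "\<dots> = (\<Sum>k\<in>degrees ?l. a (c, k) * (\<Prod>i\<in>UNIV. (real m * x $ i - real (c i)) ^ k i))"
      proof (rule sum.mono_neutral_left[OF finite_degrees])
        show "{k :: 'd multi_index. mi_size k \<le> ?l} \<subseteq> degrees ?l"
        proof
          fix k :: "'d multi_index" assume k: "k \<in> {k. mi_size k \<le> ?l}"
          have "k i \<le> mi_size k" for i unfolding mi_size_def by (rule member_le_sum) auto
          then show "k \<in> degrees ?l" using k unfolding degrees_def by (auto intro: order_trans)
        qed
      qed (auto simp: a_def)
      also have "\<dots> = (\<Sum>F\<in>feature_indices m ?l. a F * feature m F x)"
        by (rule feature_sum_on_cell[OF c(2,1), symmetric])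
      finally show ?thesis .
    qed
    finally show "\<bar>g x - (\<Sum>F\<in>feature_indices m ?l. a F * feature m F x)\<bar> \<le> real CARD('d) ^ ?l * ?Bf * L * real m powr (- \<alpha>)"
      using D0[OF x] by simp
  qed
qed

section \<open>Smooth test functions on the line\<close>

text \<open>Phrased with the total function \<open>deriv\<close>, so that higher derivatives are the
  plain iterates \<open>deriv ^^ k\<close>.\<close>

primrec diffn :: "nat \<Rightarrow> (real \<Rightarrow> real) \<Rightarrow> bool" where
  "diffn 0 f \<longleftrightarrow> True"
| "diffn (Suc n) f \<longleftrightarrow> (\<forall>x. (f has_real_derivative deriv f x) (at x)) \<and> diffn n (deriv f)"

definition smooth :: "(real \<Rightarrow> real) \<Rightarrow> bool" where
  "smooth f \<longleftrightarrow> (\<forall>n. diffn n f)"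

lemma deriv_eqI: "(\<And>x. (f has_real_derivative g x) (at x)) \<Longrightarrow> deriv f = g"
  using DERIV_imp_deriv by blast

lemma diffn_SucI: "(\<And>x. (f has_real_derivative g x) (at x)) \<Longrightarrow> diffn n g \<Longrightarrow> diffn (Suc n) f"
  using deriv_eqI[of f g] by simp

lemma diffn_Suc_imp: "diffn (Suc n) f \<Longrightarrow> diffn n f"
  by (induction n arbitrary: f) auto

lemma smooth_deriv: "smooth f \<Longrightarrow> smooth (deriv f)"
  unfolding smooth_def by (metis diffn.simps(2))

lemma smooth_DERIV: "smooth f \<Longrightarrow> (f has_real_derivative deriv f x) (at x)"
  unfolding smooth_def by (metis diffn.simps(2))

lemma smoothI: "(\<And>x. (f has_real_derivative g x) (at x)) \<Longrightarrow> smooth g \<Longrightarrow> smooth f"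
  unfolding smooth_def by (metis diffn_SucI diffn_Suc_imp)

lemma smooth_derivs: "smooth f \<Longrightarrow> smooth ((deriv ^^ k) f)"
  by (induction k) (auto intro: smooth_deriv)

lemma smooth_continuous: "smooth f \<Longrightarrow> continuous_on S f"
  by (meson DERIV_isCont continuous_at_imp_continuous_on smooth_DERIV)

lemma diffn_const: "diffn n (\<lambda>_. c)"
  by (induction n arbitrary: c) (auto intro!: diffn_SucI[of _ "\<lambda>_. 0"] simp del: diffn.simps(2))

lemma diffn_add: "diffn n f \<Longrightarrow> diffn n g \<Longrightarrow> diffn n (\<lambda>x. f x + g x)"
proof (induction n arbitrary: f g)
  case (Suc n)
  then show ?case
    by (intro diffn_SucI[of _ "\<lambda>x. deriv f x + deriv g x"] DERIV_add) auto
qed simp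

lemma diffn_mult: "diffn n f \<Longrightarrow> diffn n g \<Longrightarrow> diffn n (\<lambda>x. f x * g x)"
proof (induction n arbitrary: f g)
  case (Suc n)
  have "diffn n f" "diffn n g" using Suc.prems diffn_Suc_imp by blast+
  then show ?case using Suc
    by (intro diffn_SucI[of _ "\<lambda>x. f x * deriv g x + deriv f x * g x"] DERIV_mult' diffn_add Suc.IH) auto
qed simp

lemma diffn_affine: "diffn n f \<Longrightarrow> diffn n (\<lambda>x. f (c * x + d))"
proof (induction n arbitrary: f)
  case (Suc n)
  show ?case
  proof (rule diffn_SucI)
    fix x
    have "(f has_real_derivative deriv f (c * x + d)) (at (c * x + d))" using Suc.prems by simp
    moreover have "((\<lambda>x. c * x + d) has_real_derivative c) (at x)" by (auto intro!: derivative_eq_intros)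
    ultimately show "((\<lambda>x. f (c * x + d)) has_real_derivative deriv f (c * x + d) * c) (at x)"
      by (rule DERIV_chain2)
  next
    show "diffn n (\<lambda>x. deriv f (c * x + d) * c)"
      using Suc by (intro diffn_mult diffn_const Suc.IH) auto
  qed
qed simp

lemma smooth_const: "smooth (\<lambda>_. c)"
  and smooth_add: "smooth f \<Longrightarrow> smooth g \<Longrightarrow> smooth (\<lambda>x. f x + g x)"
  and smooth_mult: "smooth f \<Longrightarrow> smooth g \<Longrightarrow> smooth (\<lambda>x. f x * g x)"
  and smooth_affine: "smooth f \<Longrightarrow> smooth (\<lambda>x. f (c * x + d))"
  by (simp_all add: smooth_def diffn_const diffn_add diffn_mult diffn_affine)

lemma smooth_cmult: "smooth f \<Longrightarrow> smooth (\<lambda>x. c * f x)"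
  by (intro smooth_mult smooth_const)

lemma smooth_diff: "smooth f \<Longrightarrow> smooth g \<Longrightarrow> smooth (\<lambda>x. f x - g x)"
  using smooth_add[of f "\<lambda>x. (- 1) * g x"] smooth_cmult[of g "- 1"] by simp

lemma derivs_diff:
  "smooth f \<Longrightarrow> smooth g \<Longrightarrow> (deriv ^^ k) (\<lambda>x. f x - g x) = (\<lambda>x. (deriv ^^ k) f x - (deriv ^^ k) g x)"
proof (induction k)
  case (Suc k)
  have "deriv (\<lambda>x. (deriv ^^ k) f x - (deriv ^^ k) g x) = (\<lambda>x. (deriv ^^ Suc k) f x - (deriv ^^ Suc k) g x)"
    by (rule deriv_eqI) (use Suc.prems in \<open>auto intro!: DERIV_diff smooth_DERIV smooth_derivs\<close>)
  then show ?case using Suc by simp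
qed simp

lemma derivs_cmult: "smooth f \<Longrightarrow> (deriv ^^ k) (\<lambda>x. c * f x) = (\<lambda>x. c * (deriv ^^ k) f x)"
proof (induction k)
  case (Suc k)
  have "deriv (\<lambda>x. c * (deriv ^^ k) f x) = (\<lambda>x. c * (deriv ^^ Suc k) f x)"
    by (rule deriv_eqI) (use Suc.prems in \<open>auto intro!: DERIV_cmult smooth_DERIV smooth_derivs\<close>)
  then show ?case using Suc by simp
qed simp

lemma derivs_affine: "smooth f \<Longrightarrow> (deriv ^^ k) (\<lambda>x. f (c * x + d)) = (\<lambda>x. c ^ k * (deriv ^^ k) f (c * x + d))"
proof (induction k)
  case (Suc k)
  have "deriv (\<lambda>x. c ^ k * (deriv ^^ k) f (c * x + d)) = (\<lambda>x. c ^ Suc k * (deriv ^^ Suc k) f (c * x + d))"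
  proof (rule deriv_eqI)
    fix x
    have "((deriv ^^ k) f has_real_derivative deriv ((deriv ^^ k) f) (c * x + d)) (at (c * x + d))"
      using Suc.prems by (intro smooth_DERIV smooth_derivs)
    moreover have "((\<lambda>x. c * x + d) has_real_derivative c) (at x)" by (auto intro!: derivative_eq_intros)
    ultimately have "((\<lambda>x. (deriv ^^ k) f (c * x + d)) has_real_derivative deriv ((deriv ^^ k) f) (c * x + d) * c) (at x)"
      by (rule DERIV_chain2)
    from DERIV_cmult[OF this, of "c ^ k"]
    show "((\<lambda>x. c ^ k * (deriv ^^ k) f (c * x + d)) has_real_derivative c ^ Suc k * (deriv ^^ Suc k) f (c * x + d)) (at x)"
      by (simp add: mult_ac)
  qed
  then show ?case using Suc by simp
qed simp

section \<open>Bump functions built from exp (- 1 / x)\<close>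

definition flat_exp :: "real poly \<Rightarrow> real \<Rightarrow> real" where
  "flat_exp p x = (if 0 < x then poly p (1 / x) * exp (- 1 / x) else 0)"

lemma poly_times_exp_tendsto_0: "((\<lambda>s. poly p s * exp (- s)) \<longlongrightarrow> (0 :: real)) at_top"
proof -
  have "((\<lambda>s. \<Sum>i\<le>degree p. coeff p i * (s ^ i / exp s)) \<longlongrightarrow> (\<Sum>i\<le>degree p. coeff p i * 0)) at_top"
    by (intro tendsto_sum tendsto_mult tendsto_const tendsto_power_div_exp_0)
  then show ?thesis by (simp add: poly_altdef sum_divide_distrib exp_minus field_simps)
qed

text \<open>With a polynomial in \<open>1 / x\<close> carried along, the family is closed under
  differentiation, so this single step gives smoothness of all orders. At 0 exponential decay beats
  the polynomial.\<close>

lemma flat_exp_DERIV: "(flat_exp p has_real_derivative flat_exp ([:0, 0, 1:] * (p - pderiv p)) x) (at x)"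
proof -
  consider "x > 0" | "x < 0" | "x = 0" by linarith
  then show ?thesis
  proof cases
    case 1
    have "((\<lambda>x. poly p (1 / x) * exp (- 1 / x)) has_real_derivative flat_exp ([:0, 0, 1:] * (p - pderiv p)) x) (at x)"
      using 1 by (auto intro!: derivative_eq_intros poly_DERIV[THEN DERIV_chain2] simp: flat_exp_def field_simps power2_eq_square)
    then show ?thesis
      by (rule has_field_derivative_transform_within_open[of _ _ _ "{0<..}"]) (use 1 in \<open>auto simp: flat_exp_def\<close>)
  next
    case 2
    have "((\<lambda>x. 0) has_real_derivative flat_exp ([:0, 0, 1:] * (p - pderiv p)) x) (at x)"
      using 2 by (simp add: flat_exp_def)
    then show ?thesis
      by (rule has_field_derivative_transform_within_open[of _ _ _ "{..<0}"]) (use 2 in \<open>auto simp: flat_exp_def\<close>)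
  next
    case 3
    have "((\<lambda>s. poly ([:0, 1:] * p) s * exp (- s)) \<longlongrightarrow> 0) at_top" by (rule poly_times_exp_tendsto_0)
    then have "((\<lambda>y. poly ([:0, 1:] * p) (inverse y) * exp (- inverse y)) \<longlongrightarrow> 0) (at_right 0)"
      by (rule filterlim_compose[OF _ filterlim_inverse_at_top_right])
    then have "((\<lambda>y. (flat_exp p y - flat_exp p 0) / (y - 0)) \<longlongrightarrow> 0) (at_right 0)"
      by (rule Lim_transform_eventually)
        (auto simp: eventually_at_right_field flat_exp_def field_simps intro!: exI[of _ 1])
    moreover have "((\<lambda>y. (flat_exp p y - flat_exp p 0) / (y - 0)) \<longlongrightarrow> 0) (at_left 0)"
      by (rule Lim_transform_eventually[OF tendsto_const])
        (auto simp: eventually_at_left_field flat_exp_def intro!: exI[of _ "- 1"])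
    ultimately have "((\<lambda>y. (flat_exp p y - flat_exp p 0) / (y - 0)) \<longlongrightarrow> 0) (at 0)"
      by (simp add: filterlim_split_at_real)
    then show ?thesis using 3 by (simp add: has_field_derivative_iff flat_exp_def)
  qed
qed

lemma smooth_flat_exp: "smooth (flat_exp p)"
proof -
  have "diffn n (flat_exp p)" for n
    by (induction n arbitrary: p) (auto intro!: diffn_SucI[OF flat_exp_DERIV] simp del: diffn.simps(2))
  then show ?thesis by (simp add: smooth_def)
qed

text \<open>\<open>plateau n a b\<close> tends to the indicator of \<open>(a, b)\<close> as \<open>n \<rightarrow> \<infinity>\<close>, from within
  \<open>[a + 1/n, b - 1/n]\<close>.\<close>

definition plateau :: "nat \<Rightarrow> real \<Rightarrow> real \<Rightarrow> real \<Rightarrow> real" where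
  "plateau n a b x = flat_exp 1 (real n * (x - a) - 1) * flat_exp 1 (real n * (b - x) - 1)"

lemma flat_exp_1_bounds: "0 \<le> flat_exp 1 x" "flat_exp 1 x \<le> 1"
  by (auto simp: flat_exp_def)

lemma plateau_bounds: "0 \<le> plateau n a b x" "plateau n a b x \<le> 1"
  unfolding plateau_def by (auto intro!: mult_nonneg_nonneg mult_le_one simp: flat_exp_1_bounds)

lemma smooth_plateau: "smooth (plateau n a b)"
proof -
  have "plateau n a b = (\<lambda>x. flat_exp 1 (real n * x + (- real n * a - 1)) * flat_exp 1 ((- real n) * x + (real n * b - 1)))"
    by (auto simp: plateau_def algebra_simps)
  then show ?thesis by (simp only:) (intro smooth_mult smooth_affine smooth_flat_exp)
qed

lemma plateau_support: "0 < n \<Longrightarrow> x \<notin> {a + 1 / real n..b - 1 / real n} \<Longrightarrow> plateau n a b x = 0"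
  by (auto simp: plateau_def flat_exp_def not_le field_simps)

lemma plateau_tendsto: "(\<lambda>n. plateau n a b x) \<longlonglongrightarrow> indicator {a<..<b} x"
proof (cases "x \<in> {a<..<b}")
  case True
  have *: "(\<lambda>n. flat_exp 1 (real n * y - 1)) \<longlonglongrightarrow> 1" if "y > 0" for y
  proof -
    have lim: "filterlim (\<lambda>n. real n * y - 1) at_top sequentially"
      using that by real_asymp
    have "(\<lambda>n. exp (- inverse (real n * y - 1))) \<longlonglongrightarrow> exp (- 0)"
      by (intro tendsto_exp tendsto_minus filterlim_compose[OF tendsto_inverse_0_at_top lim] tendsto_inverse_0_at_top lim)
    then have "(\<lambda>n. exp (- inverse (real n * y - 1))) \<longlonglongrightarrow> 1" by simp
    then show ?thesis
    proof (rule Lim_transform_eventually)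
      show "\<forall>\<^sub>F n in sequentially. exp (- inverse (real n * y - 1)) = flat_exp 1 (real n * y - 1)"
        using filterlim_at_top_dense[THEN iffD1, OF lim, rule_format, of 0]
        by eventually_elim (auto simp: flat_exp_def inverse_eq_divide)
    qed
  qed
  show ?thesis
    using tendsto_mult[OF *[of "x - a"] *[of "b - x"]] True by (simp add: plateau_def)
next
  case False
  then have "plateau n a b x = 0" for n
    by (auto simp: plateau_def flat_exp_def not_less mult_le_0_iff intro: order_trans[of _ 0 1])
      (smt (verit) mult_nonneg_nonpos of_nat_0_le_iff)+
  then show ?thesis using False by simp
qed

section \<open>Test functions on an interval\<close>

definition test_fun :: "real \<Rightarrow> real \<Rightarrow> (real \<Rightarrow> real) \<Rightarrow> bool" where
  "test_fun a b f \<longleftrightarrow> smooth f \<and> (\<exists>a'>a. \<exists>b'<b. \<forall>x. x \<notin> {a'..b'} \<longrightarrow> f x = 0)"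

lemma test_fun_smooth: "test_fun a b f \<Longrightarrow> smooth f"
  by (simp add: test_fun_def)

lemma test_fun_continuous: "test_fun a b f \<Longrightarrow> continuous_on S f"
  by (intro smooth_continuous test_fun_smooth)

lemma test_fun_outside: "test_fun a b f \<Longrightarrow> x \<le> a \<or> b \<le> x \<Longrightarrow> f x = 0"
  by (force simp: test_fun_def)

lemma test_fun_combine:
  assumes "test_fun a b f" "test_fun a b g" "smooth k" "\<And>x. f x = 0 \<Longrightarrow> g x = 0 \<Longrightarrow> k x = 0"
  shows "test_fun a b k"
proof -
  obtain a1 b1 a2 b2 where 1: "a1 > a" "b1 < b" "\<And>x. x \<notin> {a1..b1} \<Longrightarrow> f x = 0"
    and 2: "a2 > a" "b2 < b" "\<And>x. x \<notin> {a2..b2} \<Longrightarrow> g x = 0"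
    using assms(1,2) unfolding test_fun_def by blast
  have "\<forall>x. x \<notin> {min a1 a2..max b1 b2} \<longrightarrow> k x = 0"
    using 1(3) 2(3) assms(4) by (auto simp: min_def max_def split: if_splits)
  then show ?thesis unfolding test_fun_def using assms(3) 1 2
    by (intro conjI exI[of _ "min a1 a2"] exI[of _ "max b1 b2"]) auto
qed

lemma test_fun_diff: "test_fun a b f \<Longrightarrow> test_fun a b g \<Longrightarrow> test_fun a b (\<lambda>x. f x - g x)"
  by (rule test_fun_combine[of a b f g]) (auto intro: smooth_diff test_fun_smooth)

lemma test_fun_cmult: "test_fun a b f \<Longrightarrow> test_fun a b (\<lambda>x. c * f x)"
  by (rule test_fun_combine[of a b f f]) (auto intro: smooth_cmult test_fun_smooth)

lemma test_fun_mult_const: "test_fun a b f \<Longrightarrow> test_fun a b (\<lambda>x. f x * c)"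
  using test_fun_cmult[of a b f c] by (simp add: mult.commute)

lemma test_fun_add: "test_fun a b f \<Longrightarrow> test_fun a b g \<Longrightarrow> test_fun a b (\<lambda>x. f x + g x)"
  by (rule test_fun_combine[of a b f g]) (auto intro: smooth_add test_fun_smooth)

lemma test_fun_0: "a < b \<Longrightarrow> test_fun a b (\<lambda>_. 0)"
  unfolding test_fun_def by (intro conjI exI[of _ "a + (b - a) / 3"] exI[of _ "b - (b - a) / 3"]) (auto simp: smooth_const)

lemma test_fun_sum:
  assumes "a < b" "finite R" "\<And>r. r \<in> R \<Longrightarrow> test_fun a b (f r)"
  shows "test_fun a b (\<lambda>x. \<Sum>r\<in>R. f r x)"
  using assms(2,3) by (induction R) (auto intro!: test_fun_0[OF assms(1)] test_fun_add)

lemma test_fun_deriv: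
  assumes "test_fun a b f"
  shows "test_fun a b (deriv f)"
proof -
  obtain a1 b1 where 1: "a1 > a" "b1 < b" "\<And>x. x \<notin> {a1..b1} \<Longrightarrow> f x = 0"
    using assms unfolding test_fun_def by blast
  have "deriv f x = 0" if "x \<notin> {a1..b1}" for x
  proof -
    have "(f has_real_derivative 0) (at x)"
      by (rule has_field_derivative_transform_within_open[of "\<lambda>_. 0" _ _ "- {a1..b1}"])
        (use that 1(3) in \<open>auto intro: open_Compl\<close>)
    then show ?thesis by (rule DERIV_imp_deriv)
  qed
  then show ?thesis unfolding test_fun_def
    using smooth_deriv[OF test_fun_smooth[OF assms]] 1 by blast
qed

lemma test_fun_derivs: "test_fun a b f \<Longrightarrow> test_fun a b ((deriv ^^ k) f)"
  by (induction k) (auto intro: test_fun_deriv)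

lemma test_fun_integrable: "test_fun a b f \<Longrightarrow> f integrable_on {u..v}"
  by (intro integrable_continuous_real test_fun_continuous)

definition std_bump :: "real \<Rightarrow> real" where
  "std_bump x = (1 / integral {0..1} (plateau 4 0 1)) * plateau 4 0 1 x"

definition bump :: "real \<Rightarrow> real \<Rightarrow> real \<Rightarrow> real" where
  "bump a h x = (1 / h) * std_bump ((1 / h) * x + (- a / h))"

lemma plateau_integral_pos: "0 < integral {0..1} (plateau 4 0 1)"
proof -
  have c: "continuous_on {0..1} (plateau 4 0 1)" by (intro smooth_continuous smooth_plateau)
  have "integral {0..1} (plateau 4 0 1) \<noteq> 0"
  proof
    assume "integral {0..1} (plateau 4 0 1) = 0"
    then have "((plateau 4 0 1) has_integral 0) (cbox 0 1)"
      using integrable_continuous_real[OF c] by (simp add: has_integral_integral)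
    then have "plateau 4 0 1 (1 / 2) = 0"
      using c by (intro has_integral_0_cbox_imp_0) (auto simp: plateau_bounds)
    then show False by (simp add: plateau_def flat_exp_def)
  qed
  moreover have "0 \<le> integral {0..1} (plateau 4 0 1)"
    by (intro integral_nonneg integrable_continuous_real c) (simp add: plateau_bounds)
  ultimately show ?thesis by simp
qed

lemma smooth_std_bump: "smooth std_bump"
  unfolding std_bump_def[abs_def] by (intro smooth_cmult smooth_plateau)

lemma std_bump_outside: "x \<notin> {1/4..3/4} \<Longrightarrow> std_bump x = 0"
  using plateau_support[of 4 x 0 1] by (simp add: std_bump_def)

lemma std_bump_nonneg: "0 \<le> std_bump x"
  using plateau_integral_pos plateau_bounds(1) by (simp add: std_bump_def)

lemma test_fun_std_bump: "test_fun 0 1 std_bump"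
  unfolding test_fun_def using smooth_std_bump std_bump_outside
  by (intro conjI exI[of _ "1/4"] exI[of _ "3/4"]) auto

lemma smooth_bump: "smooth (bump a h)"
  unfolding bump_def[abs_def] by (intro smooth_cmult smooth_affine smooth_std_bump)

lemma bump_nonneg: "0 < h \<Longrightarrow> 0 \<le> bump a h x"
  by (simp add: bump_def std_bump_nonneg)

lemma test_fun_bump:
  assumes "0 < h"
  shows "test_fun a (a + h) (bump a h)"
proof -
  have "bump a h x = 0" if "x \<notin> {a + h / 4..a + h * (3 / 4)}" for x
  proof -
    have "(1 / h) * x + (- a / h) \<notin> {1/4..3/4}" using assms that by (auto simp: field_simps)
    then show ?thesis by (simp add: bump_def std_bump_outside)
  qed
  then show ?thesis unfolding test_fun_def using assms smooth_bump
    by (intro conjI exI[of _ "a + h / 4"] exI[of _ "a + h * (3 / 4)"]) auto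
qed

lemma integral_bump:
  assumes "0 < h"
  shows "integral {a..a + h} (bump a h) = 1"
proof -
  have "integral {0..1} std_bump = 1"
    using plateau_integral_pos by (simp add: std_bump_def[abs_def])
  then have "(std_bump has_integral 1) (cbox 0 1)"
    using test_fun_integrable[OF test_fun_std_bump, of 0 1] by (simp add: has_integral_integral)
  from has_integral_affinity[OF this, of "1 / h" "- a / h"]
  have "((\<lambda>x. std_bump ((1 / h) * x + (- a / h))) has_integral h) ((\<lambda>x. h * x + a) ` {0..1})"
    using assms by simp
  moreover have "(\<lambda>x. h * x + a) ` {0..1} = {a..a + h}"
    using assms image_affinity_atLeastAtMost[of h a 0 1] by (simp add: add.commute)
  ultimately have "((\<lambda>x. std_bump ((1 / h) * x + (- a / h))) has_integral h) {a..a + h}" by simp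
  from integral_unique[OF has_integral_mult_right[OF this, of "1 / h"]]
  have "integral {a..a + h} (\<lambda>x. 1 / h * std_bump ((1 / h) * x + (- a / h))) = 1 / h * h" .
  also have "1 / h * h = 1" using assms by simp
  finally show ?thesis unfolding bump_def[abs_def] .
qed

lemma derivs_std_bump_bounded: "\<exists>B. \<forall>j x. \<bar>(deriv ^^ j) std_bump x\<bar> \<le> B j"
proof -
  have "\<forall>j. \<exists>B. \<forall>x. \<bar>(deriv ^^ j) std_bump x\<bar> \<le> B"
  proof
    fix j
    have t: "test_fun 0 1 ((deriv ^^ j) std_bump)" by (intro test_fun_derivs test_fun_std_bump)
    have "compact ((deriv ^^ j) std_bump ` {0..1})"
      by (intro compact_continuous_image test_fun_continuous[OF t] compact_Icc)
    then have "\<exists>B. \<forall>y\<in>(deriv ^^ j) std_bump ` {0..1}. norm y \<le> B"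
      unfolding bounded_iff[symmetric] by (rule compact_imp_bounded)
    then obtain B where B: "\<forall>y\<in>(deriv ^^ j) std_bump ` {0..1}. norm y \<le> B" ..
    then have B: "\<bar>(deriv ^^ j) std_bump x\<bar> \<le> B" if "x \<in> {0..1}" for x using that by auto
    have "\<bar>(deriv ^^ j) std_bump x\<bar> \<le> max B 0" for x
      using B[of x] test_fun_outside[OF t, of x] by (cases "x \<in> {0..1}") auto
    then show "\<exists>B. \<forall>x. \<bar>(deriv ^^ j) std_bump x\<bar> \<le> B" by blast
  qed
  then show ?thesis by (rule choice)
qed

text \<open>Chosen once for the standard bump, so that all later constants are the same for every
  cell.\<close>

definition bump_const :: "nat \<Rightarrow> real" where
  "bump_const = (SOME B. \<forall>j x. \<bar>(deriv ^^ j) std_bump x\<bar> \<le> B j)"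

text \<open>Rescaling costs one factor \<open>1 / h\<close> for each derivative and one more for
  keeping unit mass.\<close>

lemma derivs_bump_le:
  assumes "0 < h"
  shows "\<bar>(deriv ^^ j) (bump a h) x\<bar> \<le> bump_const j * (1 / h) ^ Suc j"
proof -
  have "\<bar>(deriv ^^ j) std_bump y\<bar> \<le> bump_const j" for y
    using someI_ex[OF derivs_std_bump_bounded] unfolding bump_const_def by blast
  moreover have "(deriv ^^ j) (bump a h) x = (1 / h) * ((1 / h) ^ j * (deriv ^^ j) std_bump ((1 / h) * x + (- a / h)))"
    unfolding bump_def[abs_def]
    by (simp only: derivs_cmult[OF smooth_affine[OF smooth_std_bump]] derivs_affine[OF smooth_std_bump])
  ultimately show ?thesis using assms
    by (simp add: abs_mult power_abs divide_right_mono)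
qed

lemma bump_const_nonneg: "0 \<le> bump_const j"
  using derivs_bump_le[of 1 j 0 0] by simp

section \<open>Antiderivatives of test functions with mean zero\<close>

definition antideriv :: "real \<Rightarrow> (real \<Rightarrow> real) \<Rightarrow> real \<Rightarrow> real" where
  "antideriv a f x = integral {a..x} f"

lemma antideriv_DERIV:
  assumes "continuous_on UNIV f" "\<And>x. x \<le> a \<Longrightarrow> f x = 0"
  shows "(antideriv a f has_real_derivative f x) (at x)"
proof -
  define A where "A = min a x - 1"
  have int: "f integrable_on {u..v}" for u v
    using assms(1) by (intro integrable_continuous_real) (auto intro: continuous_on_subset)
  have zero: "integral {A..y} f = 0" if "y \<le> a" for y
    using that assms(2) by (subst integral_cong[of _ _ "\<lambda>_. 0"]) auto
  have "((\<lambda>y. integral {A..y} f) has_real_derivative f x) (at x within {A..x + 1})"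
    using assms(1) by (intro integral_has_real_derivative) (auto intro: continuous_on_subset simp: A_def)
  then have "((\<lambda>y. integral {A..y} f) has_real_derivative f x) (at x)"
    by (subst (asm) at_within_Icc_at) (auto simp: A_def)
  then show ?thesis
  proof (rule has_field_derivative_transform_within_open[of _ _ _ "{A<..}"])
    fix y assume "y \<in> {A<..}"
    show "integral {A..y} f = antideriv a f y"
    proof (cases "y < a")
      case False
      have "integral {A..a} f + integral {a..y} f = integral {A..y} f"
        using False by (intro Henstock_Kurzweil_Integration.integral_combine int) (auto simp: A_def)
      then show ?thesis by (simp add: antideriv_def zero)
    qed (simp add: zero antideriv_def)
  qed (auto simp: A_def)
qed

text \<open>Mean zero makes the antiderivative vanish again to the right of the support. A
  degenerate interval admits only the zero function.\<close>

lemma test_fun_antideriv: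
  assumes f: "test_fun a b f" and 0: "integral {a..b} f = 0"
  shows "test_fun a b (antideriv a f)" "deriv (antideriv a f) = f"
proof -
  have D: "(antideriv a f has_real_derivative f x) (at x)" for x
    using f by (intro antideriv_DERIV test_fun_continuous) (auto simp: test_fun_outside)
  show "deriv (antideriv a f) = f" by (rule deriv_eqI[OF D])
  obtain a1 b1 where 1: "a1 > a" "b1 < b" "\<And>x. x \<notin> {a1..b1} \<Longrightarrow> f x = 0"
    using f unfolding test_fun_def by blast
  have "antideriv a f x = 0" if "x < a1" for x
    unfolding antideriv_def using that 1(3) by (subst integral_cong[of _ _ "\<lambda>_. 0"]) auto
  moreover have "antideriv a f x = 0" if x: "x > max a b1" for x
  proof -
    have z: "integral {u..v} f = 0" if "u > b1" for u v
      using that 1(3) by (subst integral_cong[of _ _ "\<lambda>_. 0"]) auto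
    show ?thesis
    proof (cases "a \<le> b")
      case True
      consider "x \<le> b" | "b \<le> x" by linarith
      then show ?thesis
      proof cases
        case 1
        have "integral {a..x} f + integral {x..b} f = integral {a..b} f"
          using x 1 by (intro Henstock_Kurzweil_Integration.integral_combine test_fun_integrable[OF f]) auto
        then show ?thesis using 0 z[of x b] x by (simp add: antideriv_def)
      next
        case 2
        have "integral {a..b} f + integral {b..x} f = integral {a..x} f"
          using True 2 by (intro Henstock_Kurzweil_Integration.integral_combine test_fun_integrable[OF f]) auto
        then show ?thesis using 0 z[of b x] 1(2) by (simp add: antideriv_def)
      qed
    next
      case False
      have "f y = 0" for y by (rule test_fun_outside[OF f]) (use False in linarith)
      then have "f = (\<lambda>_. 0)" by blast
      then show ?thesis by (simp add: antideriv_def)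
    qed
  qed
  ultimately have outside: "antideriv a f x = 0" if "x \<notin> {a1..max a b1}" for x
    using that by (metis atLeastAtMost_iff not_le)
  have "smooth (antideriv a f)" by (rule smoothI[OF D test_fun_smooth[OF f]])
  moreover have "\<exists>b'<b. \<forall>x. x \<notin> {a1..b'} \<longrightarrow> antideriv a f x = 0"
  proof (cases "a < b")
    case True
    then show ?thesis using outside 1(2)
      by (intro exI[of _ "max a b1"]) auto
  next
    case False
    have "f y = 0" for y by (rule test_fun_outside[OF f]) (use False in linarith)
    then have "f = (\<lambda>_. 0)" by blast
    then show ?thesis by (intro exI[of _ "b - 1"]) (simp add: antideriv_def)
  qed
  ultimately show "test_fun a b (antideriv a f)" unfolding test_fun_def using 1(1) by blast
qed

text \<open>Cauchy-Schwarz against the constant 1, as nonnegativity of the variance.\<close>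

lemma integral_square_le:
  fixes f :: "real \<Rightarrow> real"
  assumes "continuous_on {a..b} f" "a \<le> b"
  shows "(integral {a..b} f)\<^sup>2 \<le> (b - a) * integral {a..b} (\<lambda>x. (f x)\<^sup>2)"
proof (cases "a = b")
  case False
  define c where "c = integral {a..b} f / (b - a)"
  have ab: "b - a > 0" using assms False by simp
  have i1: "f integrable_on {a..b}" and i2: "(\<lambda>x. (f x)\<^sup>2) integrable_on {a..b}"
    using assms by (auto intro!: integrable_continuous_real continuous_intros)
  have "0 \<le> integral {a..b} (\<lambda>x. (f x - c)\<^sup>2)"
    using assms by (intro integral_nonneg integrable_continuous_real continuous_intros) auto
  also have "integral {a..b} (\<lambda>x. (f x - c)\<^sup>2) = integral {a..b} (\<lambda>x. (f x)\<^sup>2 - 2 * c * f x + c\<^sup>2)"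
    by (simp add: power2_diff algebra_simps)
  also have "\<dots> = integral {a..b} (\<lambda>x. (f x)\<^sup>2) - 2 * c * integral {a..b} f + c\<^sup>2 * (b - a)"
  proof (rule integral_unique)
    have "((\<lambda>x. c\<^sup>2) has_integral c\<^sup>2 * (b - a)) {a..b}"
      using has_integral_const_real[of "c\<^sup>2" a b] assms(2) by (simp add: mult.commute)
    then show "((\<lambda>x. (f x)\<^sup>2 - 2 * c * f x + c\<^sup>2) has_integral
        (integral {a..b} (\<lambda>x. (f x)\<^sup>2) - 2 * c * integral {a..b} f + c\<^sup>2 * (b - a))) {a..b}"
      by (intro has_integral_add has_integral_diff has_integral_mult_right integrable_integral i1 i2)
  qed
  also have "integral {a..b} f = c * (b - a)" using ab by (simp add: c_def)
  finally have "c\<^sup>2 * (b - a) \<le> integral {a..b} (\<lambda>x. (f x)\<^sup>2)" by (simp add: power2_eq_square algebra_simps)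
  then have "(b - a) * (c\<^sup>2 * (b - a)) \<le> (b - a) * integral {a..b} (\<lambda>x. (f x)\<^sup>2)"
    using ab by (intro mult_left_mono) auto
  moreover have "(integral {a..b} f)\<^sup>2 = (b - a) * (c\<^sup>2 * (b - a))"
    using ab by (simp add: c_def power2_eq_square)
  ultimately show ?thesis by simp
qed simp

section \<open>Iterated antiderivatives of test functions\<close>

text \<open>The constant bounds the square of the L2 operator norm, so constants of compositions
  multiply without roots.\<close>

definition bounded_op :: "real \<Rightarrow> real \<Rightarrow> real \<Rightarrow> ((real \<Rightarrow> real) \<Rightarrow> real \<Rightarrow> real) \<Rightarrow> bool" where
  "bounded_op a b C T \<longleftrightarrow>
     (\<forall>f. test_fun a b f \<longrightarrow> test_fun a b (T f) \<and>
        integral {a..b} (\<lambda>x. (T f x)\<^sup>2) \<le> C * integral {a..b} (\<lambda>x. (f x)\<^sup>2)) \<and>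
     (\<forall>f g c. test_fun a b f \<longrightarrow> test_fun a b g \<longrightarrow> T (\<lambda>x. f x + c * g x) = (\<lambda>x. T f x + c * T g x))"

lemma bounded_op_sum:
  assumes T: "bounded_op a b C T" and ab: "a < b" and R: "finite R" "\<And>r. r \<in> R \<Longrightarrow> test_fun a b (f r)"
  shows "T (\<lambda>x. \<Sum>r\<in>R. c r * f r x) = (\<lambda>x. \<Sum>r\<in>R. c r * T (f r) x)"
proof -
  have add: "T (\<lambda>x. f x + c * g x) = (\<lambda>x. T f x + c * T g x)" if "test_fun a b f" "test_fun a b g" for f g c
    using T that by (simp add: bounded_op_def)
  have "T (\<lambda>x. 0) = (\<lambda>x. T (\<lambda>x. 0) x + T (\<lambda>x. 0) x)"
    using add[of "\<lambda>_. 0" "\<lambda>_. 0" 1] test_fun_0[OF ab] by simp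
  then have 0: "T (\<lambda>x. 0) = (\<lambda>x. 0)" by (auto simp: fun_eq_iff)
  show ?thesis using R
  proof (induction R)
    case (insert r R)
    have "T (\<lambda>x. (\<Sum>r\<in>R. c r * f r x) + c r * f r x) = (\<lambda>x. T (\<lambda>x. \<Sum>r\<in>R. c r * f r x) x + c r * T (f r) x)"
      using insert by (intro add test_fun_sum[OF ab] test_fun_cmult) auto
    then show ?case using insert by (simp add: add.commute)
  qed (simp add: 0)
qed

lemma bounded_op_id: "bounded_op a b 1 (\<lambda>f. f)"
  by (simp add: bounded_op_def)

lemma bounded_op_compose:
  assumes "bounded_op a b C T" "bounded_op a b C' T'" "0 \<le> C"
  shows "bounded_op a b (C * C') (\<lambda>f. T (T' f))"
proof -
  have "integral {a..b} (\<lambda>x. (T (T' f) x)\<^sup>2) \<le> C * C' * integral {a..b} (\<lambda>x. (f x)\<^sup>2)" if f: "test_fun a b f" for f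
  proof -
    have "integral {a..b} (\<lambda>x. (T (T' f) x)\<^sup>2) \<le> C * integral {a..b} (\<lambda>x. (T' f x)\<^sup>2)"
      using assms f by (simp add: bounded_op_def)
    also have "\<dots> \<le> C * (C' * integral {a..b} (\<lambda>x. (f x)\<^sup>2))"
      using assms f by (intro mult_left_mono) (auto simp: bounded_op_def)
    finally show ?thesis by (simp add: mult.assoc)
  qed
  then show ?thesis using assms by (simp add: bounded_op_def)
qed

text \<open>The projection onto mean zero along the bump: it makes the next antiderivative a test
  function again.\<close>

definition center :: "real \<Rightarrow> real \<Rightarrow> (real \<Rightarrow> real) \<Rightarrow> real \<Rightarrow> real" where
  "center a h f x = f x - bump a h x * integral {a..a + h} f"

primrec iter_antideriv :: "real \<Rightarrow> real \<Rightarrow> nat \<Rightarrow> (real \<Rightarrow> real) \<Rightarrow> real \<Rightarrow> real" where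
  "iter_antideriv a h 0 f = f"
| "iter_antideriv a h (Suc k) f = antideriv a (center a h (iter_antideriv a h k f))"

text \<open>The part of \<open>f\<close> that obstructs it from being a \<open>k\<close>-th
  derivative of a test function. It has the moments of \<open>f\<close> of order below
  \<open>k\<close> and depends on \<open>f\<close> through \<open>k\<close> numbers only.\<close>

definition smoothing :: "real \<Rightarrow> real \<Rightarrow> nat \<Rightarrow> (real \<Rightarrow> real) \<Rightarrow> real \<Rightarrow> real" where
  "smoothing a h k f x = (\<Sum>j<k. (deriv ^^ j) (bump a h) x * integral {a..a + h} (iter_antideriv a h j f))"

definition center_const :: real where
  "center_const = 2 + 2 * (bump_const 0)\<^sup>2"

text \<open>Independent of \<open>h\<close>: the derivatives of the bump lose exactly the powers of
  \<open>h\<close> that the iterated antiderivatives gain.\<close>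

definition smoothing_const :: "nat \<Rightarrow> real" where
  "smoothing_const k = 1 + real k * (\<Sum>j<k. (bump_const j)\<^sup>2 * center_const ^ j)"

lemma center_const_ge: "2 \<le> center_const"
  by (simp add: center_const_def)

lemma smoothing_const_ge: "1 \<le> smoothing_const k"
  unfolding smoothing_const_def using center_const_ge
  by (auto intro!: mult_nonneg_nonneg sum_nonneg)

context
  fixes a h :: real
  assumes h: "0 < h"
begin

lemma test_fun_center: "test_fun a (a + h) f \<Longrightarrow> test_fun a (a + h) (center a h f)"
  unfolding center_def[abs_def] using h by (intro test_fun_diff test_fun_mult_const test_fun_bump)

lemma integral_center:
  assumes "test_fun a (a + h) f"
  shows "integral {a..a + h} (center a h f) = 0"
proof -
  have "integral {a..a + h} (center a h f) = integral {a..a + h} f - integral {a..a + h} (\<lambda>x. bump a h x * integral {a..a + h} f)"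
    unfolding center_def[abs_def] using assms h
    by (intro integral_diff test_fun_integrable[of a "a + h"] test_fun_mult_const test_fun_bump)
  then show ?thesis using integral_bump[OF h] by simp
qed

lemma integral_derivs_bump_square:
  "integral {a..a + h} (\<lambda>x. ((deriv ^^ j) (bump a h) x)\<^sup>2) \<le> (bump_const j)\<^sup>2 * (1 / h) ^ (2 * j + 1)"
proof -
  have "integral {a..a + h} (\<lambda>x. ((deriv ^^ j) (bump a h) x)\<^sup>2) \<le> integral {a..a + h} (\<lambda>x. (bump_const j * (1 / h) ^ Suc j)\<^sup>2)"
  proof (rule integral_le)
    show "(\<lambda>x. ((deriv ^^ j) (bump a h) x)\<^sup>2) integrable_on {a..a + h}"
      by (intro integrable_continuous_real continuous_intros smooth_continuous smooth_derivs smooth_bump)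
    show "((deriv ^^ j) (bump a h) x)\<^sup>2 \<le> (bump_const j * (1 / h) ^ Suc j)\<^sup>2" for x
      by (rule abs_le_square_iff[THEN iffD1]) (rule order_trans[OF derivs_bump_le[OF h] abs_ge_self])
  qed auto
  also have "\<dots> = h * (bump_const j * (1 / h) ^ Suc j)\<^sup>2" using h by simp
  also have "\<dots> = (bump_const j)\<^sup>2 * (1 / h) ^ (2 * j + 1)"
  proof -
    have "(1 / h) ^ (2 * j + 1) = (1 / h) ^ j * (1 / h) ^ j * (1 / h)"
      by (simp only: power_add mult_2 power_one_right)
    moreover have "h * (B * (1 / h * P))\<^sup>2 = B\<^sup>2 * (P * P * (1 / h))" for B P
      using h by (simp add: power2_eq_square)
    ultimately show ?thesis by (simp only: power_Suc)
  qed
  finally show ?thesis .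
qed

lemma bounded_op_center: "bounded_op a (a + h) center_const (center a h)"
  unfolding bounded_op_def
proof (intro conjI allI impI test_fun_center)
  fix f assume f: "test_fun a (a + h) f"
  let ?I = "integral {a..a + h}"
  have ints: "(\<lambda>x. (g x)\<^sup>2) integrable_on {a..a + h}" if "test_fun a (a + h) g" for g
    using that by (intro integrable_continuous_real continuous_intros test_fun_continuous)
  have b: "(\<lambda>x. (bump a h x)\<^sup>2) integrable_on {a..a + h}" by (intro ints test_fun_bump h)
  have "?I (\<lambda>x. (center a h f x)\<^sup>2) \<le> ?I (\<lambda>x. 2 * (f x)\<^sup>2 + (bump a h x)\<^sup>2 * (2 * (?I f)\<^sup>2))"
  proof (rule integral_le)
    fix x
    have "0 \<le> (f x + bump a h x * ?I f)\<^sup>2" by simp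
    then show "(center a h f x)\<^sup>2 \<le> 2 * (f x)\<^sup>2 + (bump a h x)\<^sup>2 * (2 * (?I f)\<^sup>2)"
      unfolding center_def power2_diff power2_sum by (simp add: power_mult_distrib)
  qed (intro ints test_fun_center f integrable_add integrable_on_mult_right integrable_on_mult_left b)+
  also have "\<dots> = 2 * ?I (\<lambda>x. (f x)\<^sup>2) + ?I (\<lambda>x. (bump a h x)\<^sup>2) * (2 * (?I f)\<^sup>2)"
    using ints[OF f] b by (simp add: integral_add integrable_on_mult_right integrable_on_mult_left)
  also have "\<dots> \<le> 2 * ?I (\<lambda>x. (f x)\<^sup>2) + ((bump_const 0)\<^sup>2 * (1 / h)) * (2 * (h * ?I (\<lambda>x. (f x)\<^sup>2)))"
  proof (intro add_left_mono mult_mono)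
    show "?I (\<lambda>x. (bump a h x)\<^sup>2) \<le> (bump_const 0)\<^sup>2 * (1 / h)" using integral_derivs_bump_square[of 0] by simp
    show "(?I f)\<^sup>2 \<le> h * ?I (\<lambda>x. (f x)\<^sup>2)"
      using integral_square_le[of a "a + h" f] test_fun_continuous[OF f] h by simp
  qed (use h in auto)
  also have "\<dots> = center_const * ?I (\<lambda>x. (f x)\<^sup>2)" using h by (simp add: center_const_def field_simps)
  finally show "?I (\<lambda>x. (center a h f x)\<^sup>2) \<le> center_const * ?I (\<lambda>x. (f x)\<^sup>2)" .
next
  fix f g c assume "test_fun a (a + h) f" "test_fun a (a + h) g"
  then have "integral {a..a + h} (\<lambda>x. f x + c * g x) = integral {a..a + h} f + c * integral {a..a + h} g"
    by (simp add: integral_add test_fun_integrable integrable_on_mult_right)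
  then show "center a h (\<lambda>x. f x + c * g x) = (\<lambda>x. center a h f x + c * center a h g x)"
    by (auto simp: center_def algebra_simps)
qed

text \<open>Integration over an interval of length \<open>h\<close> gains a factor \<open>h\<close>
  in norm; these factors become the rate of approximation.\<close>

lemma bounded_op_antideriv_center:
  "bounded_op a (a + h) (h\<^sup>2 * center_const) (\<lambda>f. antideriv a (center a h f))"
  unfolding bounded_op_def
proof (intro conjI allI impI)
  fix f assume f: "test_fun a (a + h) f"
  let ?I = "integral {a..a + h}"
  let ?g = "center a h f"
  have g: "test_fun a (a + h) ?g" by (rule test_fun_center[OF f])
  show t: "test_fun a (a + h) (antideriv a ?g)" by (intro test_fun_antideriv g integral_center f)
  have i2: "(\<lambda>x. (?g x)\<^sup>2) integrable_on {u..v}" for u v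
    by (intro integrable_continuous_real continuous_intros test_fun_continuous[OF g])
  have "?I (\<lambda>x. (antideriv a ?g x)\<^sup>2) \<le> ?I (\<lambda>x. h * ?I (\<lambda>x. (?g x)\<^sup>2))"
  proof (rule integral_le)
    fix x assume x: "x \<in> {a..a + h}"
    have "(antideriv a ?g x)\<^sup>2 \<le> (x - a) * integral {a..x} (\<lambda>x. (?g x)\<^sup>2)"
      unfolding antideriv_def using x by (intro integral_square_le test_fun_continuous[OF g]) auto
    also have "\<dots> \<le> h * ?I (\<lambda>x. (?g x)\<^sup>2)"
      using x i2 by (intro mult_mono integral_subset_le integral_nonneg) auto
    finally show "(antideriv a ?g x)\<^sup>2 \<le> h * ?I (\<lambda>x. (?g x)\<^sup>2)" .
  qed (auto intro!: integrable_continuous_real continuous_intros test_fun_continuous[OF t])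
  also have "\<dots> = h\<^sup>2 * ?I (\<lambda>x. (?g x)\<^sup>2)" using h by (simp add: power2_eq_square)
  also have "\<dots> \<le> h\<^sup>2 * (center_const * ?I (\<lambda>x. (f x)\<^sup>2))"
    using bounded_op_center f by (intro mult_left_mono) (auto simp: bounded_op_def)
  finally show "?I (\<lambda>x. (antideriv a ?g x)\<^sup>2) \<le> h\<^sup>2 * center_const * ?I (\<lambda>x. (f x)\<^sup>2)" by (simp add: mult.assoc)
next
  fix f g c assume fg: "test_fun a (a + h) f" "test_fun a (a + h) g"
  have "center a h (\<lambda>x. f x + c * g x) = (\<lambda>x. center a h f x + c * center a h g x)"
    using bounded_op_center fg by (simp add: bounded_op_def)
  then show "antideriv a (center a h (\<lambda>x. f x + c * g x)) = (\<lambda>x. antideriv a (center a h f) x + c * antideriv a (center a h g) x)"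
    using test_fun_integrable[OF test_fun_center[OF fg(1)]] test_fun_integrable[OF test_fun_center[OF fg(2)]]
    by (auto simp: antideriv_def integral_add integrable_on_mult_right)
qed

lemma bounded_op_iter_antideriv: "bounded_op a (a + h) ((h\<^sup>2 * center_const) ^ k) (iter_antideriv a h k)"
proof (induction k)
  case 0
  have "iter_antideriv a h 0 = (\<lambda>f. f)" by auto
  then show ?case using bounded_op_id[of a "a + h"] by simp
next
  case (Suc k)
  have "iter_antideriv a h (Suc k) = (\<lambda>f. antideriv a (center a h (iter_antideriv a h k f)))" by auto
  then show ?case
    using bounded_op_compose[OF bounded_op_antideriv_center Suc] center_const_ge by simp
qed

lemma test_fun_iter_antideriv: "test_fun a (a + h) f \<Longrightarrow> test_fun a (a + h) (iter_antideriv a h k f)"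
  using bounded_op_iter_antideriv[of k] by (simp add: bounded_op_def)

text \<open>Each centring step splits off one summand of \<open>smoothing\<close>. The second form
  stops before the last integration and thus concerns a function with mean zero, which the
  fractional case exploits.\<close>

lemma derivs_iter_antideriv:
  assumes f: "test_fun a (a + h) f"
  shows "(deriv ^^ k) (iter_antideriv a h k f) = (\<lambda>x. f x - smoothing a h k f x)"
    and "(deriv ^^ k) (center a h (iter_antideriv a h k f)) = (\<lambda>x. f x - smoothing a h (Suc k) f x)"
proof -
  have D: "(deriv ^^ k) (center a h (iter_antideriv a h k f)) =
      (\<lambda>x. (deriv ^^ k) (iter_antideriv a h k f) x - (deriv ^^ k) (bump a h) x * integral {a..a + h} (iter_antideriv a h k f))" for k
  proof -
    let ?c = "integral {a..a + h} (iter_antideriv a h k f)"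
    have s: "smooth (iter_antideriv a h k f)" by (intro test_fun_smooth[OF test_fun_iter_antideriv] f)
    have "(deriv ^^ k) (\<lambda>x. iter_antideriv a h k f x - ?c * bump a h x) =
       (\<lambda>x. (deriv ^^ k) (iter_antideriv a h k f) x - ?c * (deriv ^^ k) (bump a h) x)"
      by (simp only: derivs_diff[OF s smooth_cmult[OF smooth_bump]] derivs_cmult[OF smooth_bump])
    then show ?thesis by (simp add: center_def[abs_def] mult.commute)
  qed
  show 1: "(deriv ^^ k) (iter_antideriv a h k f) = (\<lambda>x. f x - smoothing a h k f x)" for k
  proof (induction k)
    case (Suc k)
    have "deriv (iter_antideriv a h (Suc k) f) = center a h (iter_antideriv a h k f)"
      using test_fun_antideriv(2)[OF test_fun_center[OF test_fun_iter_antideriv[OF f]] integral_center[OF test_fun_iter_antideriv[OF f]]]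
      by simp
    then show ?case unfolding funpow_Suc_right comp_def using D[of k] Suc by (simp add: smoothing_def algebra_simps)
  qed (simp add: smoothing_def)
  show "(deriv ^^ k) (center a h (iter_antideriv a h k f)) = (\<lambda>x. f x - smoothing a h (Suc k) f x)"
    unfolding D 1 by (simp add: smoothing_def algebra_simps)
qed

lemma bounded_op_smoothing: "bounded_op a (a + h) (smoothing_const k) (smoothing a h k)"
  unfolding bounded_op_def
proof (intro conjI allI impI)
  fix f assume f: "test_fun a (a + h) f"
  let ?I = "integral {a..a + h}" and ?U = "\<lambda>j. iter_antideriv a h j f"
  show t: "test_fun a (a + h) (smoothing a h k f)"
    unfolding smoothing_def[abs_def] using h
    by (intro test_fun_sum test_fun_mult_const test_fun_derivs test_fun_bump) auto
  have db: "(\<lambda>x. ((deriv ^^ j) (bump a h) x)\<^sup>2) integrable_on {a..a + h}" for j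
    by (intro integrable_continuous_real continuous_intros smooth_continuous smooth_derivs smooth_bump)
  have f0: "0 \<le> ?I (\<lambda>x. (f x)\<^sup>2)"
    by (intro integral_nonneg integrable_continuous_real continuous_intros test_fun_continuous[OF f]) auto
  have "?I (\<lambda>x. (smoothing a h k f x)\<^sup>2) \<le> ?I (\<lambda>x. real k * (\<Sum>j<k. ((deriv ^^ j) (bump a h) x)\<^sup>2 * (?I (?U j))\<^sup>2))"
  proof (rule integral_le)
    show "(\<lambda>x. (smoothing a h k f x)\<^sup>2) integrable_on {a..a + h}"
      by (intro integrable_continuous_real continuous_intros test_fun_continuous[OF t])
    show "(\<lambda>x. real k * (\<Sum>j<k. ((deriv ^^ j) (bump a h) x)\<^sup>2 * (?I (?U j))\<^sup>2)) integrable_on {a..a + h}"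
      by (intro integrable_on_mult_right integrable_sum integrable_on_mult_left db) auto
    fix x
    have "(\<Sum>j<k. 1 * ((deriv ^^ j) (bump a h) x * ?I (?U j)))\<^sup>2 \<le>
      (\<Sum>j<k. 1\<^sup>2) * (\<Sum>j<k. ((deriv ^^ j) (bump a h) x * ?I (?U j))\<^sup>2)" by (rule Cauchy_Schwarz_ineq_sum)
    then show "(smoothing a h k f x)\<^sup>2 \<le> real k * (\<Sum>j<k. ((deriv ^^ j) (bump a h) x)\<^sup>2 * (?I (?U j))\<^sup>2)"
      by (simp add: smoothing_def power_mult_distrib)
  qed
  also have "\<dots> = real k * (\<Sum>j<k. ?I (\<lambda>x. ((deriv ^^ j) (bump a h) x)\<^sup>2) * (?I (?U j))\<^sup>2)"
    using db by (simp add: integral_sum integrable_on_mult_left)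
  also have "\<dots> \<le> real k * (\<Sum>j<k. ((bump_const j)\<^sup>2 * (1 / h) ^ (2 * j + 1)) * (h * ((h\<^sup>2 * center_const) ^ j * ?I (\<lambda>x. (f x)\<^sup>2))))"
  proof (intro mult_left_mono sum_mono mult_mono integral_derivs_bump_square)
    fix j
    have "(?I (?U j))\<^sup>2 \<le> h * ?I (\<lambda>x. (?U j x)\<^sup>2)"
      using integral_square_le[of a "a + h" "?U j"] test_fun_continuous[OF test_fun_iter_antideriv[OF f]] h by simp
    also have "\<dots> \<le> h * ((h\<^sup>2 * center_const) ^ j * ?I (\<lambda>x. (f x)\<^sup>2))"
      using bounded_op_iter_antideriv[of j] f h by (intro mult_left_mono) (auto simp: bounded_op_def)
    finally show "(?I (?U j))\<^sup>2 \<le> h * ((h\<^sup>2 * center_const) ^ j * ?I (\<lambda>x. (f x)\<^sup>2))" .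
  qed (use h in auto)
  also have "\<dots> = real k * (\<Sum>j<k. (bump_const j)\<^sup>2 * center_const ^ j) * ?I (\<lambda>x. (f x)\<^sup>2)"
  proof -
    have "((bump_const j)\<^sup>2 * (1 / h) ^ (2 * j + 1)) * (h * ((h\<^sup>2 * center_const) ^ j * ?I (\<lambda>x. (f x)\<^sup>2)))
       = (bump_const j)\<^sup>2 * center_const ^ j * ?I (\<lambda>x. (f x)\<^sup>2)" for j
    proof -
      have e: "(1 / h) ^ (2 * j + 1) * h * (h\<^sup>2) ^ j = 1"
        using h by (simp add: power_mult[symmetric] power_divide field_simps)
      have "((bump_const j)\<^sup>2 * (1 / h) ^ (2 * j + 1)) * (h * ((h\<^sup>2 * center_const) ^ j * ?I (\<lambda>x. (f x)\<^sup>2)))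
        = (bump_const j)\<^sup>2 * center_const ^ j * ?I (\<lambda>x. (f x)\<^sup>2) * ((1 / h) ^ (2 * j + 1) * h * (h\<^sup>2) ^ j)"
        unfolding power_mult_distrib[of "h\<^sup>2"] by (simp only: mult_ac)
      then show ?thesis unfolding e by simp
    qed
    then show ?thesis by (simp add: sum_distrib_right mult.assoc)
  qed
  also have "\<dots> \<le> smoothing_const k * ?I (\<lambda>x. (f x)\<^sup>2)"
    using f0 by (intro mult_right_mono) (auto simp: smoothing_const_def)
  finally show "?I (\<lambda>x. (smoothing a h k f x)\<^sup>2) \<le> smoothing_const k * ?I (\<lambda>x. (f x)\<^sup>2)" .
next
  fix f g c assume fg: "test_fun a (a + h) f" "test_fun a (a + h) g"
  have "integral {a..a + h} (iter_antideriv a h j (\<lambda>x. f x + c * g x)) =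
     integral {a..a + h} (iter_antideriv a h j f) + c * integral {a..a + h} (iter_antideriv a h j g)" for j
  proof -
    have "iter_antideriv a h j (\<lambda>x. f x + c * g x) = (\<lambda>x. iter_antideriv a h j f x + c * iter_antideriv a h j g x)"
      using bounded_op_iter_antideriv[of j] fg by (simp add: bounded_op_def)
    then show ?thesis
      using test_fun_integrable[OF test_fun_iter_antideriv[OF fg(1)]] test_fun_integrable[OF test_fun_iter_antideriv[OF fg(2)]]
      by (simp add: integral_add integrable_on_mult_right)
  qed
  then show "smoothing a h k (\<lambda>x. f x + c * g x) = (\<lambda>x. smoothing a h k f x + c * smoothing a h k g x)"
    by (auto simp: smoothing_def algebra_simps sum.distrib sum_distrib_left)
qed

text \<open>The functional \<open>f \<mapsto> \<integral> iter_antideriv j f\<close> is integration against a polynomial of degree \<open>j\<close>,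
  obtained by \<open>j\<close> integrations by parts.\<close>

definition parts :: "(real \<Rightarrow> real) \<Rightarrow> real \<Rightarrow> real" where
  "parts q t = integral {a..a + h} (\<lambda>s. antideriv a q s * bump a h s) - antideriv a q t"

lemma antideriv_within:
  assumes "continuous_on {a..a + h} q" "t \<in> {a..a + h}"
  shows "(antideriv a q has_real_derivative q t) (at t within {a..a + h})"
  unfolding antideriv_def[abs_def] by (rule integral_has_real_derivative[OF assms])

lemma continuous_antideriv:
  "continuous_on {a..a + h} q \<Longrightarrow> continuous_on {a..a + h} (antideriv a q)"
  by (rule DERIV_continuous_on[OF antideriv_within])

lemma continuous_parts: "continuous_on {a..a + h} q \<Longrightarrow> continuous_on {a..a + h} (parts q)"
  unfolding parts_def[abs_def] by (intro continuous_intros continuous_antideriv)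

text \<open>\<open>parts\<close> is the adjoint of one step of centring and integrating. The
  boundary terms vanish because the antiderivative is a test function.\<close>

lemma integral_antideriv_parts:
  assumes q: "continuous_on {a..a + h} q" and f: "test_fun a (a + h) f"
  shows "integral {a..a + h} (\<lambda>t. q t * antideriv a (center a h f) t) = integral {a..a + h} (\<lambda>t. parts q t * f t)"
proof -
  let ?I = "integral {a..a + h}" and ?G = "antideriv a (center a h f)" and ?Q = "antideriv a q"
  note cf = test_fun_center[OF f]
  note G = test_fun_antideriv[OF cf integral_center[OF f]]
  have cQ: "continuous_on {a..a + h} ?Q" by (rule continuous_antideriv[OF q])
  have "((\<lambda>t. ?Q t * ?G t) has_real_derivative q t * ?G t + ?Q t * center a h f t) (at t within {a..a + h})"
    if t: "t \<in> {a..a + h}" for t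
  proof -
    have "(?G has_real_derivative center a h f t) (at t within {a..a + h})"
      using smooth_DERIV[OF test_fun_smooth[OF G(1)], of t] G(2) by (auto intro: has_field_derivative_at_within)
    from DERIV_mult[OF antideriv_within[OF q t] this] show ?thesis by (simp add: algebra_simps)
  qed
  then have "((\<lambda>t. q t * ?G t + ?Q t * center a h f t) has_integral (?Q (a + h) * ?G (a + h) - ?Q a * ?G a)) {a..a + h}"
    using h by (intro fundamental_theorem_of_calculus) (auto simp: has_real_derivative_iff_has_vector_derivative)
  then have 0: "?I (\<lambda>t. q t * ?G t + ?Q t * center a h f t) = 0"
    using test_fun_outside[OF G(1)] by (simp add: integral_unique)
  have int: "(\<lambda>t. p t * g t) integrable_on {a..a + h}" if "continuous_on {a..a + h} p" "test_fun a (a + h) g" for p g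
    by (intro integrable_continuous_real continuous_on_mult that test_fun_continuous[OF that(2)])
  have bb: "test_fun a (a + h) (bump a h)" by (rule test_fun_bump[OF h])
  have "?I (\<lambda>t. ?Q t * center a h f t) = ?I (\<lambda>t. ?Q t * f t - (?Q t * bump a h t) * ?I f)"
    by (simp add: center_def algebra_simps)
  also have "\<dots> = ?I (\<lambda>t. ?Q t * f t) - ?I (\<lambda>t. ?Q t * bump a h t) * ?I f"
    using int[OF cQ f] int[OF cQ bb] by (simp add: integral_diff integrable_on_mult_left)
  also have "\<dots> = - ?I (\<lambda>t. parts q t * f t)"
  proof -
    have "?I (\<lambda>t. parts q t * f t) = ?I (\<lambda>t. ?I (\<lambda>s. ?Q s * bump a h s) * f t - ?Q t * f t)"
      by (simp add: parts_def left_diff_distrib)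
    also have "\<dots> = ?I (\<lambda>s. ?Q s * bump a h s) * ?I f - ?I (\<lambda>t. ?Q t * f t)"
      using int[OF cQ f] test_fun_integrable[OF f, of a "a + h"] by (simp add: integral_diff integrable_on_mult_right)
    finally show ?thesis by simp
  qed
  finally have "?I (\<lambda>t. ?Q t * center a h f t) = - ?I (\<lambda>t. parts q t * f t)" .
  moreover have "?I (\<lambda>t. q t * ?G t + ?Q t * center a h f t) = ?I (\<lambda>t. q t * ?G t) + ?I (\<lambda>t. ?Q t * center a h f t)"
    by (intro integral_add int q cQ G(1) cf)
  ultimately show ?thesis using 0 by simp
qed

lemma continuous_parts_iter: "continuous_on {a..a + h} q \<Longrightarrow> continuous_on {a..a + h} ((parts ^^ j) q)"
  by (induction j) (auto intro: continuous_parts)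

lemma integral_iter_antideriv:
  assumes f: "test_fun a (a + h) f"
  shows "continuous_on {a..a + h} q \<Longrightarrow>
    integral {a..a + h} (\<lambda>t. q t * iter_antideriv a h j f t) = integral {a..a + h} (\<lambda>t. (parts ^^ j) q t * f t)"
proof (induction j arbitrary: q)
  case (Suc j)
  have "integral {a..a + h} (\<lambda>t. q t * iter_antideriv a h (Suc j) f t) = integral {a..a + h} (\<lambda>t. parts q t * iter_antideriv a h j f t)"
    using integral_antideriv_parts[OF Suc.prems test_fun_iter_antideriv[OF f]] by simp
  also have "\<dots> = integral {a..a + h} (\<lambda>t. (parts ^^ j) (parts q) t * f t)"
    by (rule Suc.IH[OF continuous_parts[OF Suc.prems]])
  finally show ?case by (simp add: funpow_swap1)
qed simp

text \<open>\<open>parts q t\<close> is a weighted mean of a primitive of \<open>q\<close> minus its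
  value at \<open>t\<close>, and the primitive varies by at most \<open>h * B\<close>.\<close>

lemma parts_le:
  assumes q: "continuous_on {a..a + h} q" and b: "\<And>t. t \<in> {a..a + h} \<Longrightarrow> \<bar>q t\<bar> \<le> B" and t: "t \<in> {a..a + h}"
  shows "\<bar>parts q t\<bar> \<le> h * B"
proof -
  let ?I = "integral {a..a + h}" and ?Q = "antideriv a q"
  have B0: "0 \<le> B" using b[OF t] by simp
  have lip: "\<bar>?Q s - ?Q t\<bar> \<le> h * B" if s: "s \<in> {a..a + h}" for s
  proof -
    have "norm (?Q s - ?Q t) \<le> B * norm (s - t)"
      by (rule field_differentiable_bound[OF _ antideriv_within[OF q]]) (use b s t in auto)
    also have "\<dots> \<le> B * h" using s t B0 by (intro mult_left_mono) auto
    finally show ?thesis by (simp add: mult.commute)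
  qed
  have int: "(\<lambda>s. ?Q s * bump a h s) integrable_on {a..a + h}" "bump a h integrable_on {a..a + h}"
    by (intro integrable_continuous_real continuous_intros continuous_antideriv q smooth_continuous smooth_bump)+
  have "parts q t = ?I (\<lambda>s. ?Q s * bump a h s) - ?I (\<lambda>s. ?Q t * bump a h s)"
    using integral_bump[OF h] by (simp add: parts_def)
  also have "\<dots> = ?I (\<lambda>s. (?Q s - ?Q t) * bump a h s)"
    using int by (simp add: left_diff_distrib integral_diff integrable_on_mult_right)
  finally have "\<bar>parts q t\<bar> = \<bar>?I (\<lambda>s. (?Q s - ?Q t) * bump a h s)\<bar>" by simp
  also have "\<dots> \<le> ?I (\<lambda>s. h * B * bump a h s)"
  proof -
    have "norm (?I (\<lambda>s. (?Q s - ?Q t) * bump a h s)) \<le> ?I (\<lambda>s. h * B * bump a h s)"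
    proof (rule integral_norm_bound_integral)
      show "(\<lambda>s. (?Q s - ?Q t) * bump a h s) integrable_on {a..a + h}"
        by (intro integrable_continuous_real continuous_intros continuous_antideriv q smooth_continuous smooth_bump)
      show "(\<lambda>s. h * B * bump a h s) integrable_on {a..a + h}" using int by (intro integrable_on_mult_right)
      show "norm ((?Q s - ?Q t) * bump a h s) \<le> h * B * bump a h s" if "s \<in> {a..a + h}" for s
        using lip[OF that] bump_nonneg[OF h] by (simp add: abs_mult mult_right_mono)
    qed
    then show ?thesis by simp
  qed
  also have "\<dots> = h * B" using integral_bump[OF h] by simp
  finally show ?thesis .
qed

lemma parts_polynomial:
  assumes "\<And>t. t \<in> {a..a + h} \<Longrightarrow> q t = (\<Sum>s\<le>D. c s * ((t - a) / h) ^ s)"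
  shows "\<exists>c'. \<forall>t\<in>{a..a + h}. parts q t = (\<Sum>s\<le>Suc D. c' s * ((t - a) / h) ^ s)"
proof -
  let ?P = "\<lambda>t. \<Sum>s\<le>D. c s * h / real (Suc s) * ((t - a) / h) ^ Suc s"
  have Q: "antideriv a q t = ?P t" if t: "t \<in> {a..a + h}" for t
  proof -
    have "(q has_integral (?P t - ?P a)) {a..t}"
    proof (rule fundamental_theorem_of_calculus)
      fix x assume x: "x \<in> {a..t}"
      have "(?P has_real_derivative (\<Sum>s\<le>D. c s * ((x - a) / h) ^ s)) (at x within {a..t})"
      proof (rule DERIV_sum)
        fix s
        have "((\<lambda>t. (t - a) / h) has_real_derivative 1 / h) (at x within {a..t})"
          using h by (auto intro!: derivative_eq_intros)
        from DERIV_cmult[OF DERIV_power[OF this, of "Suc s"], of "c s * h / real (Suc s)"]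
        show "((\<lambda>t. c s * h / real (Suc s) * ((t - a) / h) ^ Suc s) has_real_derivative c s * ((x - a) / h) ^ s) (at x within {a..t})"
        proof (rule DERIV_cong)
          have "c s * h / n * (n * (1 / h * y)) = c s * y" if "n \<noteq> 0" for n y :: real using h that by simp
          from this[of "real (Suc s)" "((x - a) / h) ^ s"]
          show "c s * h / real (Suc s) * (real (Suc s) * (1 / h * ((x - a) / h) ^ (Suc s - Suc 0))) = c s * ((x - a) / h) ^ s"
            by (simp only: diff_Suc_Suc diff_zero)
        qed
      qed
      then show "(?P has_vector_derivative q x) (at x within {a..t})"
        using assms[of x] x t by (simp add: has_real_derivative_iff_has_vector_derivative)
    qed (use t in auto)
    then show ?thesis by (simp add: antideriv_def integral_unique)
  qed
  let ?z = "integral {a..a + h} (\<lambda>s. antideriv a q s * bump a h s)"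
  show ?thesis
    by (rule exI[of _ "\<lambda>s. if s = 0 then ?z else - (c (s - 1) * h / real s)"])
      (simp add: parts_def Q sum.atMost_Suc_shift sum_negf del: sum.atMost_Suc)
qed

definition moment_poly :: "nat \<Rightarrow> real \<Rightarrow> real" where
  "moment_poly j = (parts ^^ j) (\<lambda>_. 1)"

lemma integral_iter_antideriv_moment:
  "test_fun a (a + h) f \<Longrightarrow>
    integral {a..a + h} (iter_antideriv a h j f) = integral {a..a + h} (\<lambda>t. moment_poly j t * f t)"
  using integral_iter_antideriv[of f "\<lambda>_. 1" j] by (simp add: moment_poly_def)

lemma continuous_moment_poly: "continuous_on {a..a + h} (moment_poly j)"
  unfolding moment_poly_def by (intro continuous_parts_iter continuous_intros)

lemma moment_poly_le: "t \<in> {a..a + h} \<Longrightarrow> \<bar>moment_poly j t\<bar> \<le> h ^ j"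
proof (induction j arbitrary: t)
  case (Suc j)
  have "\<bar>parts (moment_poly j) t\<bar> \<le> h * h ^ j"
    by (rule parts_le[OF continuous_moment_poly Suc.IH Suc.prems])
  then show ?case by (simp add: moment_poly_def)
qed (simp add: moment_poly_def)

lemma moment_poly_polynomial:
  "\<exists>c. \<forall>t\<in>{a..a + h}. moment_poly j t = (\<Sum>s\<le>j. c s * ((t - a) / h) ^ s)"
proof (induction j)
  case 0 then show ?case by (intro exI[of _ "\<lambda>_. 1"]) (simp add: moment_poly_def)
next
  case (Suc j)
  then obtain c where "\<And>t. t \<in> {a..a + h} \<Longrightarrow> moment_poly j t = (\<Sum>s\<le>j. c s * ((t - a) / h) ^ s)" by blast
  from parts_polynomial[OF this] show ?case by (simp add: moment_poly_def)
qed

end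

section \<open>Tensor products of test functions\<close>

lemma borel_measurable_coordinate [measurable]: "(\<lambda>x :: real ^ 'd::finite. x $ i) \<in> borel_measurable borel"
  by (intro borel_measurable_continuous_onI continuous_intros)

definition set_coord :: "real ^ 'd \<Rightarrow> 'd \<Rightarrow> real \<Rightarrow> real ^ 'd::finite" where
  "set_coord x i t = (\<chi> j. if j = i then t else x $ j)"

lemma set_coord_nth [simp]: "set_coord x i t $ j = (if j = i then t else x $ j)"
  by (simp add: set_coord_def)

lemma set_coord_eq: "set_coord x i t = x + (t - x $ i) *\<^sub>R axis i 1"
  by (auto simp: vec_eq_iff axis_def)

lemma borel_measurable_set_coord [measurable]:
  "(\<lambda>(x, t). set_coord x i t) \<in> borel \<Otimes>\<^sub>M borel \<rightarrow>\<^sub>M borel"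
  unfolding borel_prod set_coord_eq case_prod_unfold
  by (intro borel_measurable_continuous_onI continuous_intros)

text \<open>Fubini for a single coordinate without writing the space as a product. The line integral
  does not depend on the \<open>i\<close>-th coordinate of \<open>x\<close>, so by translation
  invariance a slab of width \<open>h\<close> recovers the full integral \<open>h\<close>
  times.\<close>

lemma nn_integral_set_coord:
  fixes F :: "real ^ 'd::finite \<Rightarrow> ennreal"
  assumes [measurable]: "F \<in> borel_measurable borel" and "0 \<le> h"
  shows "(\<integral>\<^sup>+x. indicator {a..a + h} (x $ i) * (\<integral>\<^sup>+t. F (set_coord x i t) \<partial>lborel) \<partial>lborel) =
    ennreal h * (\<integral>\<^sup>+x. F x \<partial>lborel)"
proof -
  have [measurable]: "(\<lambda>z :: (real ^ 'd) \<times> real. fst z + snd z *\<^sub>R axis i 1) \<in> borel_measurable (borel \<Otimes>\<^sub>M borel)"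
    unfolding borel_prod by (intro borel_measurable_continuous_onI continuous_intros)
  have m1: "(\<lambda>s. F (x + s *\<^sub>R axis i 1)) \<in> borel_measurable borel" for x
    using measurable_compose[of "\<lambda>s :: real. x + s *\<^sub>R axis i 1" borel borel F borel]
    by (auto intro!: borel_measurable_continuous_onI continuous_intros)
  have inner: "(\<integral>\<^sup>+t. F (set_coord x i t) \<partial>lborel) = (\<integral>\<^sup>+s. F (x + s *\<^sub>R axis i 1) \<partial>lborel)" for x
    unfolding set_coord_eq
    by (subst nn_integral_real_affine[of "\<lambda>s. F (x + s *\<^sub>R axis i 1)" 1 "- x $ i", OF m1]) (auto simp: add.commute)
  have "(\<integral>\<^sup>+x. indicator {a..a + h} (x $ i) * (\<integral>\<^sup>+t. F (set_coord x i t) \<partial>lborel) \<partial>lborel) =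
    (\<integral>\<^sup>+x. (\<integral>\<^sup>+s. indicator {a..a + h} (x $ i) * F (x + s *\<^sub>R axis i 1) \<partial>lborel) \<partial>lborel)"
    unfolding inner by (intro nn_integral_cong) (auto simp: nn_integral_cmult m1)
  also have "\<dots> = (\<integral>\<^sup>+s. (\<integral>\<^sup>+x. indicator {a..a + h} (x $ i) * F (x + s *\<^sub>R axis i 1) \<partial>lborel) \<partial>lborel)"
    by (rule lborel_pair.Fubini') (simp add: case_prod_unfold)
  also have "\<dots> = (\<integral>\<^sup>+s. (\<integral>\<^sup>+x. indicator {a..a + h} (x $ i - s) * F x \<partial>lborel) \<partial>lborel)"
  proof (rule nn_integral_cong)
    fix s
    have "(\<integral>\<^sup>+x. indicator {a..a + h} (x $ i - s) * F x \<partial>lborel) =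
      (\<integral>\<^sup>+x. indicator {a..a + h} (x $ i - s) * F x \<partial>distr lborel borel ((+) (s *\<^sub>R axis i 1)))"
      by (simp add: lborel_distr_plus)
    also have "\<dots> = (\<integral>\<^sup>+x. indicator {a..a + h} (x $ i) * F (x + s *\<^sub>R axis i 1) \<partial>lborel)"
      by (subst nn_integral_distr) (auto simp: add.commute axis_def)
    finally show "(\<integral>\<^sup>+x. indicator {a..a + h} (x $ i) * F (x + s *\<^sub>R axis i 1) \<partial>lborel) =
      (\<integral>\<^sup>+x. indicator {a..a + h} (x $ i - s) * F x \<partial>lborel)" ..
  qed
  also have "\<dots> = (\<integral>\<^sup>+x. (\<integral>\<^sup>+s. indicator {a..a + h} (x $ i - s) * F x \<partial>lborel) \<partial>lborel)"
    by (rule lborel_pair.Fubini'[symmetric]) (simp add: case_prod_unfold)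
  also have "\<dots> = (\<integral>\<^sup>+x. ennreal h * F x \<partial>lborel)"
  proof (rule nn_integral_cong)
    fix x :: "real ^ 'd"
    have "(\<integral>\<^sup>+s. indicator {a..a + h} (x $ i - s) * F x \<partial>lborel) = (\<integral>\<^sup>+s. indicator {x $ i - a - h..x $ i - a} s \<partial>lborel) * F x"
      by (subst nn_integral_multc[symmetric]) (auto intro!: nn_integral_cong split: split_indicator)
    then show "(\<integral>\<^sup>+s. indicator {a..a + h} (x $ i - s) * F x \<partial>lborel) = ennreal h * F x"
      using assms(2) by simp
  qed
  also have "\<dots> = ennreal h * (\<integral>\<^sup>+x. F x \<partial>lborel)" by (simp add: nn_integral_cmult)
  finally show ?thesis .
qed

lemma bij_axis_Basis: "bij_betw (\<lambda>i. axis i 1) UNIV (Basis :: (real ^ 'd::finite) set)"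
  by (auto simp: bij_betw_def inj_on_def axis_eq_axis Basis_vec_def)

lemma integral_lborel_prod_vec:
  fixes u :: "'d::finite \<Rightarrow> real \<Rightarrow> real"
  assumes "\<And>i. integrable lborel (u i)"
  shows "(LINT x|(lborel :: (real ^ 'd) measure). (\<Prod>i\<in>UNIV. u i (x $ i))) = (\<Prod>i\<in>UNIV. LINT t|lborel. u i t)"
proof -
  interpret product_sigma_finite "\<lambda>_ :: real ^ 'd. lborel :: real measure" ..
  let ?inv = "inv_into UNIV (\<lambda>i :: 'd. axis i (1 :: real))"
  have inv: "?inv (axis i 1) = i" for i
    by (rule inv_into_f_f) (auto simp: inj_on_def axis_eq_axis)
  have reix: "(\<Prod>b\<in>(Basis :: (real ^ 'd) set). g (?inv b)) = (\<Prod>i\<in>UNIV. g i)" for g :: "'d \<Rightarrow> real"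
    using prod.reindex_bij_betw[OF bij_axis_Basis, of "\<lambda>b. g (?inv b)"] by (simp add: inv)
  have um[measurable]: "u i \<in> borel_measurable borel" for i using assms[of i] by (simp add: borel_measurable_integrable)
  have "(LINT x|(lborel :: (real ^ 'd) measure). (\<Prod>i\<in>UNIV. u i (x $ i))) =
    (LINT f|(\<Pi>\<^sub>M b\<in>Basis. lborel). (\<Prod>i\<in>UNIV. u i ((\<Sum>b\<in>(Basis :: (real ^ 'd) set). f b *\<^sub>R b) $ i)))"
    unfolding lborel_eq[where 'a = "real ^ 'd"] by (subst integral_distr) auto
  also have "\<dots> = (LINT f|(\<Pi>\<^sub>M b\<in>(Basis :: (real ^ 'd) set). lborel). (\<Prod>b\<in>Basis. u (?inv b) (f b)))"
  proof (rule Bochner_Integration.integral_cong[OF refl])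
    fix f :: "real ^ 'd \<Rightarrow> real"
    have "(\<Sum>b\<in>(Basis :: (real ^ 'd) set). f b *\<^sub>R b) $ i = f (axis i 1)" for i
    proof -
      have "(\<Sum>b\<in>(Basis :: (real ^ 'd) set). f b *\<^sub>R b) $ i = (\<Sum>b\<in>(Basis :: (real ^ 'd) set). f b *\<^sub>R b) \<bullet> axis i 1"
        by (simp add: inner_axis)
      also have "\<dots> = f (axis i 1)" by (rule inner_sum_left_Basis) (simp add: axis_in_Basis_iff)
      finally show ?thesis .
    qed
    moreover have "axis (?inv b) 1 = b" if "b \<in> (Basis :: (real ^ 'd) set)" for b
      using that bij_axis_Basis by (intro f_inv_into_f) (auto simp: bij_betw_def)
    ultimately have "(\<Prod>b\<in>Basis. u (?inv b) (f b)) = (\<Prod>b\<in>(Basis :: (real ^ 'd) set). u (?inv b) ((\<Sum>b\<in>Basis. f b *\<^sub>R b) $ ?inv b))"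
      by (intro prod.cong refl) simp
    then show "(\<Prod>i\<in>UNIV. u i ((\<Sum>b\<in>(Basis :: (real ^ 'd) set). f b *\<^sub>R b) $ i)) = (\<Prod>b\<in>Basis. u (?inv b) (f b))"
      using reix[of "\<lambda>i. u i ((\<Sum>b\<in>Basis. f b *\<^sub>R b) $ i)"] by simp
  qed
  also have "\<dots> = (\<Prod>b\<in>(Basis :: (real ^ 'd) set). LINT t|lborel. u (?inv b) t)"
    by (rule product_integral_prod) (auto simp: assms)
  also have "\<dots> = (\<Prod>i\<in>UNIV. LINT t|lborel. u i t)" by (rule reix)
  finally show ?thesis .
qed

lemma lborel_integral_Icc:
  fixes f :: "real \<Rightarrow> real"
  assumes "continuous_on {a..b} f" "\<And>x. x \<notin> {a..b} \<Longrightarrow> f x = 0"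
  shows "integrable lborel f" "(LINT x|lborel. f x) = integral {a..b} f"
proof -
  have f: "f = (\<lambda>x. indicator {a..b} x *\<^sub>R f x)" using assms(2) by (force simp: indicator_def)
  have i: "set_integrable lborel {a..b} f" by (rule borel_integrable_atLeastAtMost') fact
  then show "integrable lborel f" by (subst f) (simp add: set_integrable_def)
  have "(LINT x|lborel. f x) = (LINT x:{a..b}|lborel. f x)"
    by (subst f) (simp add: set_lebesgue_integral_def)
  then show "(LINT x|lborel. f x) = integral {a..b} f" using set_borel_integral_eq_integral(2)[OF i] by simp
qed

lemma test_fun_lborel:
  assumes "test_fun a b f"
  shows "integrable lborel f" "(LINT x|lborel. f x) = integral {a..b} f"
proof -
  have "f x = 0" if "x \<notin> {a..b}" for x using test_fun_outside[OF assms, of x] that by auto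
  note * = lborel_integral_Icc[OF test_fun_continuous[OF assms] this]
  show "integrable lborel f" "(LINT x|lborel. f x) = integral {a..b} f" using * by blast+
qed

lemma test_fun_nn_square:
  assumes f: "test_fun a b f"
  shows "(\<integral>\<^sup>+x. ennreal ((f x)\<^sup>2) \<partial>lborel) = ennreal (integral {a..b} (\<lambda>x. (f x)\<^sup>2))"
proof -
  have c: "continuous_on {a..b} (\<lambda>x. (f x)\<^sup>2)" by (intro continuous_intros test_fun_continuous[OF f])
  have o: "(f x)\<^sup>2 = 0" if "x \<notin> {a..b}" for x using test_fun_outside[OF f, of x] that by auto
  show ?thesis
    using nn_integral_eq_integral[OF lborel_integral_Icc(1)[OF c o]] lborel_integral_Icc(2)[OF c o] by simp
qed

section \<open>Tensor products of one-dimensional test functions\<close>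

definition tensor :: "nat \<Rightarrow> (nat \<Rightarrow> 'd \<Rightarrow> real \<Rightarrow> real) \<Rightarrow> real ^ 'd::finite \<Rightarrow> real" where
  "tensor N b x = (\<Sum>r<N. \<Prod>i\<in>UNIV. b r i (x $ i))"

text \<open>Acts on a representation as a sum of products, not on the function; on each fibre the
  linearity of \<open>T\<close> connects the two.\<close>

definition tensor_op :: "((real \<Rightarrow> real) \<Rightarrow> real \<Rightarrow> real) \<Rightarrow> 'd \<Rightarrow> (nat \<Rightarrow> 'd \<Rightarrow> real \<Rightarrow> real) \<Rightarrow> nat \<Rightarrow> 'd \<Rightarrow> real \<Rightarrow> real" where
  "tensor_op T i b r j = (if j = i then T (b r j) else b r j)"

definition tensor_test :: "('d::finite \<Rightarrow> real) \<Rightarrow> real \<Rightarrow> nat \<Rightarrow> (nat \<Rightarrow> 'd \<Rightarrow> real \<Rightarrow> real) \<Rightarrow> bool" where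
  "tensor_test a h N b \<longleftrightarrow> (\<forall>r<N. \<forall>i. test_fun (a i) (a i + h) (b r i))"

definition open_cell :: "('d \<Rightarrow> real) \<Rightarrow> real \<Rightarrow> (real ^ 'd::finite) set" where
  "open_cell a h = {x. \<forall>i. a i < x $ i \<and> x $ i < a i + h}"

lemma tensor_op_test:
  "tensor_test a h N b \<Longrightarrow> bounded_op (a i) (a i + h) C T \<Longrightarrow> tensor_test a h N (tensor_op T i b)"
  by (auto simp: tensor_test_def tensor_op_def bounded_op_def)

lemma tensor_set_coord:
  "tensor N b (set_coord x i t) = (\<Sum>r<N. (\<Prod>j\<in>UNIV - {i}. b r j (x $ j)) * b r i t)"
  unfolding tensor_def
proof (intro sum.cong refl)
  fix r
  have "(\<Prod>j\<in>UNIV. b r j (set_coord x i t $ j)) = b r i t * (\<Prod>j\<in>UNIV - {i}. b r j (set_coord x i t $ j))"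
    by (subst prod.remove[of _ i]) auto
  also have "(\<Prod>j\<in>UNIV - {i}. b r j (set_coord x i t $ j)) = (\<Prod>j\<in>UNIV - {i}. b r j (x $ j))"
    by (intro prod.cong) auto
  finally show "(\<Prod>j\<in>UNIV. b r j (set_coord x i t $ j)) = (\<Prod>j\<in>UNIV - {i}. b r j (x $ j)) * b r i t"
    by (simp add: mult.commute)
qed

lemma tensor_continuous:
  assumes "tensor_test a h N b"
  shows "continuous_on S (tensor N b)"
  unfolding tensor_def
proof (intro continuous_on_sum continuous_on_prod)
  fix r i assume "r \<in> {..<N}"
  then have "test_fun (a i) (a i + h) (b r i)" using assms by (simp add: tensor_test_def)
  then show "continuous_on S (\<lambda>x. b r i (x $ i))"
    by (intro continuous_on_compose2[OF test_fun_continuous[of _ _ "b r i" UNIV]] continuous_intros) auto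
qed

lemma tensor_measurable: "tensor_test a h N b \<Longrightarrow> tensor N b \<in> borel_measurable borel"
  by (intro borel_measurable_continuous_onI tensor_continuous)

lemma tensor_outside:
  assumes "tensor_test a h N b" "x \<notin> open_cell a h"
  shows "tensor N b x = 0"
  unfolding tensor_def
proof (rule sum.neutral, rule ballI)
  fix r assume r: "r \<in> {..<N}"
  obtain i where i: "x $ i \<le> a i \<or> a i + h \<le> x $ i" using assms(2) by (auto simp: open_cell_def not_less)
  have "b r i (x $ i) = 0"
    using assms(1) r i by (intro test_fun_outside[of "a i" "a i + h"]) (auto simp: tensor_test_def)
  then show "(\<Prod>i\<in>UNIV. b r i (x $ i)) = 0" by (intro prod_zero) auto
qed

lemma open_cell_box: "open_cell a h = box (\<chi> i. a i) (\<chi> i. a i + h)"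
  by (auto simp: open_cell_def mem_box_cart)

lemma compact_continuous_integrable:
  fixes f :: "real ^ 'd::finite \<Rightarrow> real"
  assumes "continuous_on UNIV f" "\<And>x. x \<notin> open_cell a h \<Longrightarrow> f x = 0"
  shows "integrable lborel f"
proof -
  have "integrable lborel (\<lambda>x. indicator (cbox (\<chi> i. a i) (\<chi> i. a i + h)) x *\<^sub>R f x)"
    using assms(1) by (intro borel_integrable_compact) (auto intro: continuous_on_subset)
  moreover have "(\<lambda>x. indicator (cbox (\<chi> i. a i) (\<chi> i. a i + h)) x *\<^sub>R f x) = f"
    using assms(2) box_subset_cbox[of "\<chi> i. a i" "\<chi> i. a i + h"] unfolding open_cell_box
    by (auto simp: indicator_def fun_eq_iff)
  ultimately show ?thesis by simp
qed

lemma tensor_integrable: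
  assumes "tensor_test a h N b"
  shows "integrable lborel (tensor N b)" "integrable lborel (\<lambda>x. (tensor N b x)\<^sup>2)"
  using assms by (auto intro!: compact_continuous_integrable[of _ a h] continuous_intros tensor_continuous simp: tensor_outside)

text \<open>On each line parallel to the \<open>i\<close>-th axis the tensor is a test function of
  one variable, to which \<open>T\<close> applies by linearity. The one-dimensional bound is then
  integrated over all lines.\<close>

lemma tensor_op_nn_square:
  assumes t: "tensor_test a h N b" and T: "bounded_op (a i) (a i + h) C T" and h: "0 < h" and C: "0 \<le> C"
  shows "(\<integral>\<^sup>+x. ennreal ((tensor N (tensor_op T i b) x)\<^sup>2) \<partial>lborel) \<le>
    ennreal C * (\<integral>\<^sup>+x. ennreal ((tensor N b x)\<^sup>2) \<partial>lborel)"
proof -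
  let ?b = "tensor_op T i b"
  have t': "tensor_test a h N ?b" by (rule tensor_op_test[OF t T])
  have [measurable]: "tensor N b \<in> borel_measurable borel" "tensor N ?b \<in> borel_measurable borel"
    using t t' by (auto intro: tensor_measurable)
  have fibre: "(\<integral>\<^sup>+t. ennreal ((tensor N ?b (set_coord x i t))\<^sup>2) \<partial>lborel) \<le>
     ennreal C * (\<integral>\<^sup>+t. ennreal ((tensor N b (set_coord x i t))\<^sup>2) \<partial>lborel)" for x
  proof -
    let ?c = "\<lambda>r. \<Prod>j\<in>UNIV - {i}. b r j (x $ j)"
    let ?g = "\<lambda>t. \<Sum>r<N. ?c r * b r i t"
    have bt: "test_fun (a i) (a i + h) (b r i)" if "r \<in> {..<N}" for r using t that by (simp add: tensor_test_def)
    have g: "test_fun (a i) (a i + h) ?g"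
      using h bt by (intro test_fun_sum test_fun_cmult) auto
    have Tg: "T ?g = (\<lambda>t. \<Sum>r<N. ?c r * T (b r i) t)"
      using h bt by (intro bounded_op_sum[OF T]) auto
    have eq: "tensor N ?b (set_coord x i t) = T ?g t" for t
    proof -
      have "(\<Prod>j\<in>UNIV - {i}. ?b r j (x $ j)) = ?c r" for r by (intro prod.cong) (auto simp: tensor_op_def)
      then show ?thesis unfolding tensor_set_coord Tg by (simp add: tensor_op_def)
    qed
    have "(\<integral>\<^sup>+t. ennreal ((T ?g t)\<^sup>2) \<partial>lborel) = ennreal (integral {a i..a i + h} (\<lambda>t. (T ?g t)\<^sup>2))"
      using T g by (intro test_fun_nn_square) (simp add: bounded_op_def)
    also have "\<dots> \<le> ennreal (C * integral {a i..a i + h} (\<lambda>t. (?g t)\<^sup>2))"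
      using T g by (intro ennreal_leI) (simp add: bounded_op_def)
    also have "\<dots> = ennreal C * (\<integral>\<^sup>+t. ennreal ((?g t)\<^sup>2) \<partial>lborel)"
      using C by (simp add: ennreal_mult' test_fun_nn_square[OF g])
    finally show ?thesis unfolding eq tensor_set_coord[of N b] .
  qed
  have "ennreal h * (\<integral>\<^sup>+x. ennreal ((tensor N ?b x)\<^sup>2) \<partial>lborel) =
     (\<integral>\<^sup>+x. indicator {a i..a i + h} (x $ i) * (\<integral>\<^sup>+t. ennreal ((tensor N ?b (set_coord x i t))\<^sup>2) \<partial>lborel) \<partial>lborel)"
    using h by (intro nn_integral_set_coord[symmetric]) auto
  also have "\<dots> \<le> (\<integral>\<^sup>+x. ennreal C * (indicator {a i..a i + h} (x $ i) * (\<integral>\<^sup>+t. ennreal ((tensor N b (set_coord x i t))\<^sup>2) \<partial>lborel)) \<partial>lborel)"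
    using fibre by (intro nn_integral_mono) (auto simp: indicator_def)
  also have "\<dots> = ennreal C * (\<integral>\<^sup>+x. indicator {a i..a i + h} (x $ i) * (\<integral>\<^sup>+t. ennreal ((tensor N b (set_coord x i t))\<^sup>2) \<partial>lborel) \<partial>lborel)"
  proof (rule nn_integral_cmult)
    have "(\<lambda>x. \<integral>\<^sup>+t. ennreal ((tensor N b (set_coord x i t))\<^sup>2) \<partial>lborel) \<in> borel_measurable borel"
      using lborel.borel_measurable_nn_integral[of "\<lambda>x t. ennreal ((tensor N b (set_coord x i t))\<^sup>2)" borel] by measurable
    then show "(\<lambda>x. indicator {a i..a i + h} (x $ i) * (\<integral>\<^sup>+t. ennreal ((tensor N b (set_coord x i t))\<^sup>2) \<partial>lborel)) \<in> borel_measurable lborel"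
      by measurable
  qed
  also have "(\<integral>\<^sup>+x. indicator {a i..a i + h} (x $ i) * (\<integral>\<^sup>+t. ennreal ((tensor N b (set_coord x i t))\<^sup>2) \<partial>lborel) \<partial>lborel)
     = ennreal h * (\<integral>\<^sup>+x. ennreal ((tensor N b x)\<^sup>2) \<partial>lborel)"
    using h by (intro nn_integral_set_coord) auto
  finally have "ennreal h * (\<integral>\<^sup>+x. ennreal ((tensor N ?b x)\<^sup>2) \<partial>lborel) \<le>
    ennreal h * (ennreal C * (\<integral>\<^sup>+x. ennreal ((tensor N b x)\<^sup>2) \<partial>lborel))" by (simp add: mult.left_commute)
  then show ?thesis using h by (subst (asm) ennreal_mult_le_mult_iff) auto
qed

lemma tensor_op_square:
  assumes t: "tensor_test a h N b" and T: "bounded_op (a i) (a i + h) C T" and h: "0 < h" and C: "0 \<le> C"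
  shows "(LINT x|lborel. (tensor N (tensor_op T i b) x)\<^sup>2) \<le> C * (LINT x|lborel. (tensor N b x)\<^sup>2)"
proof -
  have "ennreal (LINT x|lborel. (tensor N (tensor_op T i b) x)\<^sup>2) \<le> ennreal C * ennreal (LINT x|lborel. (tensor N b x)\<^sup>2)"
    using tensor_op_nn_square[OF assms]
    by (simp add: nn_integral_eq_integral tensor_integrable(2)[OF t] tensor_integrable(2)[OF tensor_op_test[OF t T]])
  then show ?thesis using C by (simp add: ennreal_mult'[symmetric] ennreal_le_iff)
qed

lemma interior_cube: "interior cube = {x :: real ^ 'd::finite. \<forall>i. 0 < x $ i \<and> x $ i < 1}"
proof
  have "cube \<subseteq> cbox (0 :: real ^ 'd) (\<chi> i. 1)" by (auto simp: cube_def mem_box_cart less_imp_le)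
  then have "interior cube \<subseteq> interior (cbox (0 :: real ^ 'd) (\<chi> i. 1))" by (rule interior_mono)
  then show "interior cube \<subseteq> {x :: real ^ 'd. \<forall>i. 0 < x $ i \<and> x $ i < 1}"
    unfolding interior_cbox by (auto simp: mem_box_cart)
  have "{x :: real ^ 'd. \<forall>i. 0 < x $ i \<and> x $ i < 1} = box 0 (\<chi> i. 1)" by (auto simp: mem_box_cart)
  then show "{x :: real ^ 'd. \<forall>i. 0 < x $ i \<and> x $ i < 1} \<subseteq> interior cube"
    by (intro interior_maximal) (auto simp: cube_def mem_box_cart less_imp_le)
qed

definition tensor_derivs :: "nat \<Rightarrow> (nat \<Rightarrow> 'd \<Rightarrow> real \<Rightarrow> real) \<Rightarrow> 'd multi_index \<Rightarrow> real ^ 'd::finite \<Rightarrow> real" where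
  "tensor_derivs N b \<kappa> = tensor N (\<lambda>r i. (deriv ^^ \<kappa> i) (b r i))"

lemma tensor_compact_support:
  assumes t: "tensor_test a h N b" and sub: "open_cell a h \<subseteq> S"
  shows "\<exists>K. compact K \<and> K \<subseteq> S \<and> (\<forall>x. x \<notin> K \<longrightarrow> tensor N b x = 0)"
proof -
  have "\<forall>r i. r < N \<longrightarrow> (\<exists>l u. l > a i \<and> u < a i + h \<and> (\<forall>t. t \<notin> {l..u} \<longrightarrow> b r i t = 0))"
    using t unfolding tensor_test_def test_fun_def by blast
  then obtain l u where lu: "\<And>r i. r < N \<Longrightarrow> l r i > a i \<and> u r i < a i + h \<and> (\<forall>t. t \<notin> {l r i..u r i} \<longrightarrow> b r i t = 0)"
    by metis
  let ?K = "\<Union>r<N. cbox (\<chi> i. l r i) (\<chi> i. u r i)"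
  have "?K \<subseteq> open_cell a h"
    unfolding open_cell_def mem_box_cart by (auto simp: mem_box_cart) (meson lu less_le_trans le_less_trans)+
  moreover have "compact ?K" by (intro compact_UN) auto
  moreover have "tensor N b x = 0" if x: "x \<notin> ?K" for x
    unfolding tensor_def
  proof (rule sum.neutral, rule ballI)
    fix r assume r: "r \<in> {..<N}"
    then have "x \<notin> cbox (\<chi> i. l r i) (\<chi> i. u r i)" using x by blast
    then obtain i where "x $ i \<notin> {l r i..u r i}" by (auto simp: mem_box_cart)
    then have "b r i (x $ i) = 0" using lu[of r i] r by blast
    then show "(\<Prod>i\<in>UNIV. b r i (x $ i)) = 0" by (intro prod_zero) auto
  qed
  ultimately show ?thesis using sub by blast
qed

lemma tensor_test_family:
  assumes t: "tensor_test a h N b" and sub: "open_cell a h \<subseteq> interior cube"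
  shows "test_family (tensor_derivs N b)"
  unfolding test_family_def
proof (intro conjI allI)
  have td: "tensor_test a h N (\<lambda>r i. (deriv ^^ \<kappa> i) (b r i))" for \<kappa>
    using t by (auto simp: tensor_test_def intro: test_fun_derivs)
  show "continuous_on UNIV (tensor_derivs N b \<kappa>)" for \<kappa>
    unfolding tensor_derivs_def by (rule tensor_continuous[OF td])
  show "\<exists>K. compact K \<and> K \<subseteq> interior cube \<and> (\<forall>x. x \<notin> K \<longrightarrow> tensor_derivs N b (\<lambda>_. 0) x = 0)"
    using tensor_compact_support[OF t sub] by (simp add: tensor_derivs_def)
  show "partial_derivs m UNIV (tensor_derivs N b)" for m
    unfolding partial_derivs_def
  proof (intro allI ballI impI)
    fix \<kappa> :: "'a multi_index" and i and x :: "real ^ 'a"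
    let ?\<kappa> = "\<kappa>(i := Suc (\<kappa> i))"
    let ?c = "\<lambda>r. \<Prod>j\<in>UNIV - {i}. (deriv ^^ \<kappa> j) (b r j) (x $ j)"
    have line: "x + t *\<^sub>R axis i 1 = set_coord x i (x $ i + t)" for t by (simp add: set_coord_eq)
    have "((\<lambda>t. \<Sum>r<N. ?c r * (deriv ^^ \<kappa> i) (b r i) (x $ i + t)) has_real_derivative
       (\<Sum>r<N. ?c r * (deriv ^^ Suc (\<kappa> i)) (b r i) (x $ i))) (at 0)"
    proof (intro DERIV_sum DERIV_cmult)
      fix r assume "r \<in> {..<N}"
      then have "smooth ((deriv ^^ \<kappa> i) (b r i))" using t by (auto simp: tensor_test_def intro: smooth_derivs test_fun_smooth)
      then have "((deriv ^^ \<kappa> i) (b r i) has_real_derivative deriv ((deriv ^^ \<kappa> i) (b r i)) (x $ i)) (at (0 + x $ i))"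
        using smooth_DERIV[of "(deriv ^^ \<kappa> i) (b r i)" "x $ i"] by simp
      then show "((\<lambda>t. (deriv ^^ \<kappa> i) (b r i) (x $ i + t)) has_real_derivative (deriv ^^ Suc (\<kappa> i)) (b r i) (x $ i)) (at 0)"
        unfolding DERIV_shift by (simp add: add.commute)
    qed
    moreover have "tensor_derivs N b ?\<kappa> x = (\<Sum>r<N. ?c r * (deriv ^^ Suc (\<kappa> i)) (b r i) (x $ i))"
    proof -
      have "x = set_coord x i (x $ i)" by (simp add: vec_eq_iff)
      then have "tensor_derivs N b ?\<kappa> x = tensor_derivs N b ?\<kappa> (set_coord x i (x $ i))" by simp
      moreover have "(\<Prod>j\<in>UNIV - {i}. (deriv ^^ ?\<kappa> j) (b r j) (x $ j)) = ?c r" for r by (intro prod.cong) auto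
      ultimately show ?thesis unfolding tensor_derivs_def tensor_set_coord by simp
    qed
    ultimately show "((\<lambda>t. tensor_derivs N b \<kappa> (x + t *\<^sub>R axis i 1)) has_real_derivative tensor_derivs N b ?\<kappa> x)
       (at 0 within {t. x + t *\<^sub>R axis i 1 \<in> UNIV})"
      unfolding line tensor_derivs_def tensor_set_coord by simp
  qed
qed

section \<open>Density of tensor products in L2\<close>

definition sq_dist :: "(real ^ 'd::finite \<Rightarrow> real) \<Rightarrow> (real ^ 'd \<Rightarrow> real) \<Rightarrow> ennreal" where
  "sq_dist u v = (\<integral>\<^sup>+x. ennreal ((u x - v x)\<^sup>2) \<partial>lborel)"

lemma square_sum_le: "(x + y)\<^sup>2 \<le> 2 * x\<^sup>2 + 2 * y\<^sup>2" for x y :: real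
  using sum_squares_bound[of x y] by (simp add: power2_sum)

lemma sq_dist_add:
  assumes [measurable]: "u \<in> borel_measurable borel" "v \<in> borel_measurable borel"
    "u' \<in> borel_measurable borel" "v' \<in> borel_measurable borel"
  shows "sq_dist (\<lambda>x. u x + v x) (\<lambda>x. u' x + v' x) \<le> 2 * sq_dist u u' + 2 * sq_dist v v'"
proof -
  have "sq_dist (\<lambda>x. u x + v x) (\<lambda>x. u' x + v' x) \<le>
     (\<integral>\<^sup>+x. 2 * ennreal ((u x - u' x)\<^sup>2) + 2 * ennreal ((v x - v' x)\<^sup>2) \<partial>lborel)"
    unfolding sq_dist_def
  proof (rule nn_integral_mono)
    fix x
    have "((u x + v x) - (u' x + v' x))\<^sup>2 \<le> 2 * (u x - u' x)\<^sup>2 + 2 * (v x - v' x)\<^sup>2"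
      using square_sum_le[of "u x - u' x" "v x - v' x"] by (simp add: algebra_simps)
    then have "ennreal (((u x + v x) - (u' x + v' x))\<^sup>2) \<le> ennreal (2 * (u x - u' x)\<^sup>2 + 2 * (v x - v' x)\<^sup>2)"
      by (rule ennreal_leI)
    then show "ennreal (((u x + v x) - (u' x + v' x))\<^sup>2) \<le> 2 * ennreal ((u x - u' x)\<^sup>2) + 2 * ennreal ((v x - v' x)\<^sup>2)"
      by (simp add: ennreal_mult')
  qed
  also have "\<dots> = 2 * sq_dist u u' + 2 * sq_dist v v'"
    unfolding sq_dist_def by (subst nn_integral_add) (auto simp: nn_integral_cmult)
  finally show ?thesis .
qed

lemma sq_dist_cmult:
  assumes [measurable]: "u \<in> borel_measurable borel" "v \<in> borel_measurable borel"
  shows "sq_dist (\<lambda>x. c * u x) (\<lambda>x. c * v x) = ennreal (c\<^sup>2) * sq_dist u v"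
  unfolding sq_dist_def
  by (subst nn_integral_cmult[symmetric])
    (auto simp: power_mult_distrib ennreal_mult' right_diff_distrib[symmetric])

lemma tensor_measurable' [measurable (raw)]:
  "tensor_test a h N b \<Longrightarrow> tensor N b \<in> borel_measurable borel"
  by (rule tensor_measurable)

definition approximable :: "('d::finite \<Rightarrow> real) \<Rightarrow> real \<Rightarrow> (real ^ 'd \<Rightarrow> real) \<Rightarrow> bool" where
  "approximable a h u \<longleftrightarrow> u \<in> borel_measurable borel \<and>
     (\<forall>\<epsilon>>0. \<exists>N b. tensor_test a h N b \<and> sq_dist u (tensor N b) \<le> ennreal \<epsilon>)"

lemma tensor_add:
  assumes "tensor_test a h N b" "tensor_test a h N' b'"
  shows "\<exists>M c. tensor_test a h M c \<and> tensor M c = (\<lambda>x. tensor N b x + tensor N' b' x)"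
proof (intro exI conjI)
  let ?c = "\<lambda>r. if r < N then b r else b' (r - N)"
  show "tensor_test a h (N + N') ?c" using assms by (auto simp: tensor_test_def)
  have "(\<Sum>r<N + N'. \<Prod>i\<in>UNIV. ?c r i (x $ i)) = tensor N b x + tensor N' b' x" for x
  proof -
    have "(\<Sum>r<N + N'. \<Prod>i\<in>UNIV. ?c r i (x $ i)) = (\<Sum>r<N. \<Prod>i\<in>UNIV. ?c r i (x $ i)) + (\<Sum>r<N'. \<Prod>i\<in>UNIV. ?c (N + r) i (x $ i))"
      using sum.atLeastLessThan_concat[of 0 N "N + N'" "\<lambda>r. \<Prod>i\<in>UNIV. ?c r i (x $ i)"]
        sum.shift_bounds_nat_ivl[of "\<lambda>r. \<Prod>i\<in>UNIV. ?c r i (x $ i)" 0 N N']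
      by (simp add: atLeast0LessThan add.commute)
    then show ?thesis by (simp add: tensor_def)
  qed
  then show "tensor (N + N') ?c = (\<lambda>x. tensor N b x + tensor N' b' x)" by (auto simp: tensor_def)
qed

lemma tensor_cmult:
  assumes "tensor_test a h N (b :: nat \<Rightarrow> 'd::finite \<Rightarrow> real \<Rightarrow> real)"
  shows "\<exists>M c. tensor_test a h M c \<and> tensor M c = (\<lambda>x. k * tensor N b x)"
proof (intro exI conjI)
  \<comment> \<open>Any coordinate will do: the scalar has to enter exactly one factor of each
    product.\<close>
  let ?i = "undefined :: 'd"
  let ?c = "\<lambda>r i. if i = ?i then (\<lambda>t. k * b r i t) else b r i"
  show "tensor_test a h N ?c" using assms by (auto simp: tensor_test_def intro: test_fun_cmult)
  have "(\<Prod>i\<in>UNIV. ?c r i (x $ i)) = k * (\<Prod>i\<in>UNIV. b r i (x $ i))" for r x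
  proof -
    have "(\<Prod>i\<in>UNIV. ?c r i (x $ i)) = ?c r ?i (x $ ?i) * (\<Prod>i\<in>UNIV - {?i}. ?c r i (x $ i))"
      by (rule prod.remove) auto
    also have "(\<Prod>i\<in>UNIV - {?i}. ?c r i (x $ i)) = (\<Prod>i\<in>UNIV - {?i}. b r i (x $ i))" by (intro prod.cong) auto
    also have "?c r ?i (x $ ?i) * (\<Prod>i\<in>UNIV - {?i}. b r i (x $ i)) = k * (b r ?i (x $ ?i) * (\<Prod>i\<in>UNIV - {?i}. b r i (x $ i)))" by simp
    also have "b r ?i (x $ ?i) * (\<Prod>i\<in>UNIV - {?i}. b r i (x $ i)) = (\<Prod>i\<in>UNIV. b r i (x $ i))"
      by (rule prod.remove[symmetric]) auto
    finally show ?thesis .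
  qed
  then show "tensor N ?c = (\<lambda>x. k * tensor N b x)" by (auto simp: tensor_def sum_distrib_left)
qed

lemma ennreal_four_quarters: "0 < \<epsilon> \<Longrightarrow> 2 * ennreal (\<epsilon> / 4) + 2 * ennreal (\<epsilon> / 4) = ennreal \<epsilon>"
proof -
  assume \<epsilon>: "0 < \<epsilon>"
  have "2 * ennreal (\<epsilon> / 4) = ennreal (2 * (\<epsilon> / 4))"
    using ennreal_mult'[of 2 "\<epsilon> / 4"] by simp
  moreover have "ennreal (2 * (\<epsilon> / 4)) + ennreal (2 * (\<epsilon> / 4)) = ennreal (2 * (\<epsilon> / 4) + 2 * (\<epsilon> / 4))"
    using \<epsilon> by (intro ennreal_plus[symmetric]) auto
  ultimately show ?thesis by (simp only:) (rule arg_cong[of _ _ ennreal], simp)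
qed

lemma approximable_add:
  assumes "approximable a h u" "approximable a h v"
  shows "approximable a h (\<lambda>x. u x + v x)"
  unfolding approximable_def
proof (intro conjI allI impI)
  have [measurable]: "u \<in> borel_measurable borel" "v \<in> borel_measurable borel"
    using assms by (auto simp: approximable_def)
  show "(\<lambda>x. u x + v x) \<in> borel_measurable borel" by measurable
  fix \<epsilon> :: real assume "\<epsilon> > 0"
  then have "\<epsilon> / 4 > 0" by simp
  then obtain N b N' b' where t: "tensor_test a h N b" "tensor_test a h N' b'"
    and d: "sq_dist u (tensor N b) \<le> ennreal (\<epsilon> / 4)" "sq_dist v (tensor N' b') \<le> ennreal (\<epsilon> / 4)"
    using assms unfolding approximable_def by metis
  obtain M c where c: "tensor_test a h M c" "tensor M c = (\<lambda>x. tensor N b x + tensor N' b' x)"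
    using tensor_add[OF t] by blast
  have "sq_dist (\<lambda>x. u x + v x) (tensor M c) \<le> 2 * sq_dist u (tensor N b) + 2 * sq_dist v (tensor N' b')"
    unfolding c(2) using t by (intro sq_dist_add) (auto intro: tensor_measurable)
  also have "\<dots> \<le> 2 * ennreal (\<epsilon> / 4) + 2 * ennreal (\<epsilon> / 4)" using d by (intro add_mono mult_left_mono) auto
  also have "\<dots> = ennreal \<epsilon>" by (rule ennreal_four_quarters[OF \<open>\<epsilon> > 0\<close>])
  finally show "\<exists>N b. tensor_test a h N b \<and> sq_dist (\<lambda>x. u x + v x) (tensor N b) \<le> ennreal \<epsilon>" using c(1) by auto
qed

lemma approximable_cmult:
  assumes "approximable a h u"
  shows "approximable a h (\<lambda>x. k * u x)"
  unfolding approximable_def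
proof (intro conjI allI impI)
  have [measurable]: "u \<in> borel_measurable borel" using assms by (auto simp: approximable_def)
  show "(\<lambda>x. k * u x) \<in> borel_measurable borel" by measurable
  fix \<epsilon> :: real assume \<epsilon>: "\<epsilon> > 0"
  have k: "k\<^sup>2 + 1 > 0" by (simp add: add_nonneg_pos)
  then have "\<epsilon> / (k\<^sup>2 + 1) > 0" using \<epsilon> by simp
  then obtain N b where t: "tensor_test a h N b" and d: "sq_dist u (tensor N b) \<le> ennreal (\<epsilon> / (k\<^sup>2 + 1))"
    using assms unfolding approximable_def by metis
  obtain M c where c: "tensor_test a h M c" "tensor M c = (\<lambda>x. k * tensor N b x)"
    using tensor_cmult[OF t] by blast
  have "sq_dist (\<lambda>x. k * u x) (tensor M c) = ennreal (k\<^sup>2) * sq_dist u (tensor N b)"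
    unfolding c(2) using t by (intro sq_dist_cmult) (auto intro: tensor_measurable)
  also have "\<dots> \<le> ennreal (k\<^sup>2) * ennreal (\<epsilon> / (k\<^sup>2 + 1))" using d by (intro mult_left_mono) auto
  also have "\<dots> = ennreal (k\<^sup>2 * (\<epsilon> / (k\<^sup>2 + 1)))" by (rule ennreal_mult'[symmetric]) simp
  also have "\<dots> \<le> ennreal \<epsilon>"
    using \<epsilon> k by (intro ennreal_leI) (simp add: pos_divide_le_eq algebra_simps)
  finally show "\<exists>N b. tensor_test a h N b \<and> sq_dist (\<lambda>x. k * u x) (tensor N b) \<le> ennreal \<epsilon>" using c(1) by auto
qed

lemma open_cell_measurable [measurable]: "open_cell a h \<in> sets borel"
  unfolding open_cell_box by simp

lemma emeasure_open_cell_finite: "emeasure lborel (open_cell a h) < \<infinity>"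
  unfolding open_cell_box by (rule emeasure_lborel_box_finite)

lemma measure_open_cell:
  assumes "0 < h"
  shows "measure lborel (open_cell a h :: (real ^ 'd::finite) set) = h ^ CARD('d)"
proof -
  let ?l = "(\<chi> i. a i) :: real ^ 'd" and ?u = "(\<chi> i. a i + h) :: real ^ 'd"
  have "measure lborel (box ?l ?u) = measure lborel (cbox ?l ?u)"
    by (simp add: measure_lborel_box_eq measure_lborel_cbox_eq)
  also have "\<dots> = (\<Prod>i\<in>UNIV. ?u $ i - ?l $ i)"
    using assms by (intro content_cbox_cart) (auto simp: interval_ne_empty_cart)
  finally show ?thesis unfolding open_cell_box by simp
qed

text \<open>Closure under dominated pointwise limits carries approximability from boxes through
  Borel sets to bounded functions. The cell has finite measure, so a constant is an integrable
  majorant.\<close>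

lemma approximable_limit:
  assumes U: "\<And>n. approximable a h (U n)" and u: "u \<in> borel_measurable borel"
    and dom: "\<And>n x. \<bar>U n x - u x\<bar> \<le> M * indicator (open_cell a h) x"
    and lim: "\<And>x. (\<lambda>n. U n x) \<longlonglongrightarrow> u x"
  shows "approximable a h u"
  unfolding approximable_def
proof (intro conjI allI impI u)
  fix \<epsilon> :: real assume \<epsilon>: "\<epsilon> > 0"
  have [measurable]: "u \<in> borel_measurable borel" "U n \<in> borel_measurable borel" for n
    using u U by (auto simp: approximable_def)
  have "(\<lambda>n. sq_dist u (U n)) \<longlonglongrightarrow> (\<integral>\<^sup>+(x :: real ^ 'a). 0 \<partial>lborel)"
    unfolding sq_dist_def
  proof (rule nn_integral_dominated_convergence[of _ _ _ "\<lambda>x. ennreal (M\<^sup>2) * indicator (open_cell a h) x"])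
    show "(\<integral>\<^sup>+x. ennreal (M\<^sup>2) * indicator (open_cell a h) x \<partial>lborel) < \<infinity>"
      using emeasure_open_cell_finite[of a h] by (simp add: nn_integral_cmult ennreal_mult_less_top)
    show "AE x in lborel. ennreal ((u x - U n x)\<^sup>2) \<le> ennreal (M\<^sup>2) * indicator (open_cell a h) x" for n
    proof (rule AE_I2)
      fix x
      have "\<bar>u x - U n x\<bar> \<le> \<bar>M * indicator (open_cell a h) x\<bar>" using dom[of n x] by linarith
      then have "(u x - U n x)\<^sup>2 \<le> (M * indicator (open_cell a h) x)\<^sup>2" by (simp only: abs_le_square_iff)
      then have "ennreal ((u x - U n x)\<^sup>2) \<le> ennreal ((M * indicator (open_cell a h) x)\<^sup>2)" by (rule ennreal_leI)
      then show "ennreal ((u x - U n x)\<^sup>2) \<le> ennreal (M\<^sup>2) * indicator (open_cell a h) x"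
        by (auto simp: indicator_def split: if_splits)
    qed
    show "AE x in lborel. (\<lambda>n. ennreal ((u x - U n x)\<^sup>2)) \<longlonglongrightarrow> 0"
    proof (rule AE_I2)
      fix x
      have "(\<lambda>n. ennreal ((u x - U n x)\<^sup>2)) \<longlonglongrightarrow> ennreal ((u x - u x)\<^sup>2)"
        by (intro tendsto_ennrealI tendsto_intros lim)
      then show "(\<lambda>n. ennreal ((u x - U n x)\<^sup>2)) \<longlonglongrightarrow> 0" by simp
    qed
  qed measurable
  then have "(\<lambda>n. sq_dist u (U n)) \<longlonglongrightarrow> 0" by simp
  then have "eventually (\<lambda>n. sq_dist u (U n) < ennreal (\<epsilon> / 4)) sequentially"
    by (rule order_tendstoD) (use \<epsilon> in simp)
  then obtain n where n: "sq_dist u (U n) < ennreal (\<epsilon> / 4)" by (auto simp: eventually_sequentially)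
  have "\<epsilon> / 4 > 0" using \<epsilon> by simp
  then obtain N b where t: "tensor_test a h N b" and d: "sq_dist (U n) (tensor N b) \<le> ennreal (\<epsilon> / 4)"
    using U[of n] unfolding approximable_def by blast
  have [measurable]: "tensor N b \<in> borel_measurable borel" by (rule tensor_measurable[OF t])
  have "sq_dist u (tensor N b) = sq_dist (\<lambda>x. u x + U n x) (\<lambda>x. U n x + tensor N b x)"
    by (simp add: sq_dist_def)
  also have "\<dots> \<le> 2 * sq_dist u (U n) + 2 * sq_dist (U n) (tensor N b)"
    by (intro sq_dist_add) measurable
  also have "\<dots> \<le> 2 * ennreal (\<epsilon> / 4) + 2 * ennreal (\<epsilon> / 4)"
    using n d by (intro add_mono mult_left_mono) auto
  also have "\<dots> = ennreal \<epsilon>" by (rule ennreal_four_quarters[OF \<epsilon>])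
  finally show "\<exists>N b. tensor_test a h N b \<and> sq_dist u (tensor N b) \<le> ennreal \<epsilon>" using t by auto
qed

lemma approximable_tensor: "tensor_test a h N b \<Longrightarrow> approximable a h (tensor N b)"
  unfolding approximable_def
  by (intro conjI allI impI tensor_measurable) (auto simp: sq_dist_def intro!: exI[of _ N] exI[of _ b])

lemma test_fun_plateau:
  assumes "0 < n" "a \<le> l" "u \<le> b"
  shows "test_fun a b (plateau n l u)"
  unfolding test_fun_def using smooth_plateau plateau_support[OF assms(1), of _ l u] assms
  by (intro conjI exI[of _ "l + 1 / real n"] exI[of _ "u - 1 / real n"])
    (auto intro: add_pos_pos le_less_trans less_le_trans[of _ u] simp: add_strict_increasing2)

text \<open>A product of plateaus converges to the indicator of a box. The box is first clipped to
  the cell, so the plateaus are test functions there.\<close>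

lemma approximable_box:
  fixes l u :: "real ^ 'd::finite"
  shows "approximable a h (indicator (box l u \<inter> open_cell a h))"
proof -
  define l' where "l' i = max (l $ i) (a i)" for i
  define u' where "u' i = min (u $ i) (a i + h)" for i
  have box: "x \<in> box l u \<inter> open_cell a h \<longleftrightarrow> (\<forall>i. l' i < x $ i \<and> x $ i < u' i)" for x
    by (auto simp: mem_box_cart open_cell_def l'_def u'_def)
  define U where "U n = tensor 1 (\<lambda>_ i. plateau (Suc n) (l' i) (u' i))" for n
  have U: "U n x = (\<Prod>i\<in>UNIV. plateau (Suc n) (l' i) (u' i) (x $ i))" for n x
    by (simp add: U_def tensor_def)
  have ind: "indicator (box l u \<inter> open_cell a h) x = (\<Prod>i\<in>UNIV. indicator {l' i<..<u' i} (x $ i) :: real)" for x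
  proof (cases "x \<in> box l u \<inter> open_cell a h")
    case False
    then obtain i where "x $ i \<notin> {l' i<..<u' i}" using box by auto
    then have "(\<Prod>i\<in>UNIV. indicator {l' i<..<u' i} (x $ i) :: real) = 0"
      by (intro prod_zero bexI[of _ i]) auto
    then show ?thesis using False by simp
  qed (use box in simp)
  have tt: "tensor_test a h 1 (\<lambda>_ i. plateau (Suc n) (l' i) (u' i))" for n
    by (auto simp: tensor_test_def l'_def u'_def intro!: test_fun_plateau)
  show ?thesis
  proof (rule approximable_limit[where U = U and M = 1])
    show "approximable a h (U n)" for n unfolding U_def by (rule approximable_tensor[OF tt])
    show "(\<lambda>n. U n x) \<longlonglongrightarrow> indicator (box l u \<inter> open_cell a h) x" for x
      unfolding U ind by (intro tendsto_prod LIMSEQ_Suc plateau_tendsto)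
    fix n x
    have U01: "0 \<le> U n x" "U n x \<le> 1" unfolding U by (auto intro!: prod_nonneg prod_le_1 simp: plateau_bounds)
    show "\<bar>U n x - indicator (box l u \<inter> open_cell a h) x\<bar> \<le> 1 * indicator (open_cell a h) x"
    proof (cases "x \<in> open_cell a h")
      case False
      then have "U n x = 0" unfolding U_def by (intro tensor_outside[OF tt])
      then show ?thesis using False by simp
    qed (use U01 in \<open>auto simp: indicator_def abs_le_iff\<close>)
  qed measurable
qed

text \<open>Dynkin's argument: boxes are an intersection-stable generator, so complements within the
  cell and disjoint unions suffice.\<close>

lemma approximable_indicator:
  assumes A: "A \<in> sets borel"
  shows "approximable a h (indicator (A \<inter> open_cell a h) :: real ^ 'd::finite \<Rightarrow> real)"
proof -
  let ?Q = "open_cell a h :: (real ^ 'd) set"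
  have Q: "approximable a h (indicator ?Q :: real ^ 'd \<Rightarrow> real)"
    using approximable_box[of a h "\<chi> i. a i" "\<chi> i. a i + h"] unfolding open_cell_box by simp
  have "Int_stable (range (\<lambda>(a, b). box a b :: (real ^ 'd) set))"
    by (auto simp: Int_stable_def box_Int_box)
  moreover have "range (\<lambda>(a, b). box a b :: (real ^ 'd) set) \<subseteq> Pow UNIV" by auto
  moreover have "A \<in> sigma_sets UNIV (range (\<lambda>(a, b). box a b))"
    using A unfolding borel_eq_box by simp
  ultimately show ?thesis
  proof (induction rule: sigma_sets_induct_disjoint)
    case (basic A)
    then show ?case by (auto simp: approximable_box)
  next
    case empty
    have "tensor_test a h 0 (\<lambda>_ _ _. 0 :: real)" by (simp add: tensor_test_def)
    from approximable_tensor[OF this] show ?case by (simp add: tensor_def[abs_def] indicator_def)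
  next
    case (compl A)
    have "approximable a h (\<lambda>x. indicator ?Q x + (- 1) * indicator (A \<inter> ?Q) x)"
      by (intro approximable_add Q approximable_cmult compl)
    moreover have "(\<lambda>x. indicator ?Q x + (- 1) * indicator (A \<inter> ?Q) x) = (indicator ((UNIV - A) \<inter> ?Q) :: _ \<Rightarrow> real)"
      by (auto simp: indicator_def fun_eq_iff)
    ultimately show ?case by simp
  next
    case (union F)
    have F: "F i \<in> sets borel" for i using union(2) by (auto simp: borel_eq_box)
    let ?U = "\<lambda>n x. \<Sum>i<n. indicator (F i \<inter> ?Q) x :: real"
    have part: "?U n x = indicator ((\<Union>i<n. F i) \<inter> ?Q) x" for n x
    proof -
      have "indicator (\<Union>i\<in>{..<n}. F i \<inter> ?Q) x = (\<Sum>i<n. indicator (F i \<inter> ?Q) x :: real)"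
        using union(1) by (intro indicator_UN_disjoint) (auto simp: disjoint_family_on_def)
      moreover have "(\<Union>i\<in>{..<n}. F i \<inter> ?Q) = (\<Union>i<n. F i) \<inter> ?Q" by auto
      ultimately show ?thesis by simp
    qed
    show ?case
    proof (rule approximable_limit[where U = ?U and M = 1])
      show "approximable a h (?U n)" for n
      proof (induction n)
        case 0
        have "tensor_test a h 0 (\<lambda>_ _ _. 0 :: real)" by (simp add: tensor_test_def)
        from approximable_tensor[OF this] show ?case by (simp add: tensor_def[abs_def])
      qed (auto intro: approximable_add union.IH)
      show "(\<lambda>n. ?U n x) \<longlonglongrightarrow> indicator ((\<Union>i. F i) \<inter> ?Q) x" for x
      proof (cases "x \<in> (\<Union>i. F i) \<inter> ?Q")
        case True
        then obtain i where i: "x \<in> F i" "x \<in> ?Q" by blast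
        have "eventually (\<lambda>n. ?U n x = 1) sequentially"
          unfolding part using i by (auto simp: eventually_sequentially indicator_def intro!: exI[of _ "Suc i"])
        then have "(\<lambda>n. ?U n x) \<longlonglongrightarrow> 1" by (rule tendsto_eventually)
        then show ?thesis using True by simp
      next
        case False
        then have "?U n x = 0" for n unfolding part by (auto simp: indicator_def)
        then show ?thesis using False by simp
      qed
      show "\<bar>?U n x - indicator ((\<Union>i. F i) \<inter> ?Q) x\<bar> \<le> 1 * indicator ?Q x" for n x
        unfolding part by (auto simp: indicator_def)
      have "(\<Union>i. F i) \<inter> ?Q \<in> sets borel" using F by auto
      then show "indicator ((\<Union>i. F i) \<inter> ?Q) \<in> borel_measurable borel" by measurable
    qed
  qed
qed

lemma approximable_nonneg:
  fixes u :: "real ^ 'd::finite \<Rightarrow> real"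
  assumes u: "u \<in> borel_measurable borel" "\<And>x. 0 \<le> u x" and "\<And>x. u x \<le> M"
  shows "approximable a h (\<lambda>x. u x * indicator (open_cell a h) x)"
proof -
  \<comment> \<open>Boundedness is a premise inside the induction statement because it has to pass
    to the simpler functions from which \<open>u\<close> is built.\<close>
  have "(\<exists>M. \<forall>x. u x \<le> M) \<longrightarrow> approximable a h (\<lambda>x. u x * indicator (open_cell a h) x)"
    using u
  proof (induction rule: borel_measurable_induct_real)
    case (set A)
    then have "approximable a h (indicator (A \<inter> open_cell a h) :: real ^ 'd \<Rightarrow> real)"
      by (intro approximable_indicator) simp
    moreover have "(indicator (A \<inter> open_cell a h) :: real ^ 'd \<Rightarrow> real) = (\<lambda>x. indicator A x * indicator (open_cell a h) x)"
      by (auto simp: indicator_def fun_eq_iff)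
    ultimately show ?case by simp
  next
    case (mult u c)
    show ?case
    proof
      assume "\<exists>M. \<forall>x. c * u x \<le> M"
      then obtain M where M: "\<And>x. c * u x \<le> M" by blast
      show "approximable a h (\<lambda>x. c * u x * indicator (open_cell a h) x)"
      proof (cases "c = 0")
        case True
        have "tensor_test a h 0 (\<lambda>_ _ _. 0 :: real)" by (simp add: tensor_test_def)
        from approximable_tensor[OF this] show ?thesis using True by (simp add: tensor_def[abs_def])
      next
        case False
        then have "u x \<le> M / c" for x using M[of x] mult.hyps(1) by (simp add: pos_le_divide_eq mult.commute)
        then have "approximable a h (\<lambda>x. u x * indicator (open_cell a h) x)" using mult by blast
        from approximable_cmult[OF this, of c] show ?thesis by (simp add: mult.assoc)
      qed
    qed
  next
    case (add u v)
    show ?case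
    proof
      assume "\<exists>M. \<forall>x. v x + u x \<le> M"
      then obtain M where M: "\<And>x. v x + u x \<le> M" by blast
      have "u x \<le> M" "v x \<le> M" for x using M[of x] add.hyps(2)[of x] add.hyps(4)[of x] by linarith+
      then have "approximable a h (\<lambda>x. u x * indicator (open_cell a h) x)" "approximable a h (\<lambda>x. v x * indicator (open_cell a h) x)"
        using add by blast+
      from approximable_add[OF this(2,1)] show "approximable a h (\<lambda>x. (v x + u x) * indicator (open_cell a h) x)"
        by (simp add: distrib_right)
    qed
  next
    case (seq U)
    show ?case
    proof
      assume "\<exists>M. \<forall>x. u x \<le> M"
      then obtain M where M: "\<And>x. u x \<le> M" by blast
      have le: "U i x \<le> u x" for i x
        using seq.hyps(3) seq.hyps(4)[of x] by (intro incseq_le) (auto simp: incseq_def le_fun_def)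
      show "approximable a h (\<lambda>x. u x * indicator (open_cell a h) x)"
      proof (rule approximable_limit[where U = "\<lambda>n x. U n x * indicator (open_cell a h) x" and M = M])
        show "approximable a h (\<lambda>x. U n x * indicator (open_cell a h) x)" for n
          using seq.IH[of n] le[of n] M by (meson order_trans)
        have [measurable]: "u \<in> borel_measurable borel" by (rule u(1))
        show "(\<lambda>x. u x * indicator (open_cell a h) x) \<in> borel_measurable borel" by measurable
        show "(\<lambda>n. U n x * indicator (open_cell a h) x) \<longlonglongrightarrow> u x * indicator (open_cell a h) x" for x
          by (intro tendsto_mult tendsto_const seq.hyps(4)) simp
        show "\<bar>U n x * indicator (open_cell a h) x - u x * indicator (open_cell a h) x\<bar> \<le> M * indicator (open_cell a h) x" for n x
          using le[of n x] seq.hyps(2)[of n x] M[of x] by (auto simp: indicator_def abs_le_iff)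
      qed
    qed
  qed
  then show ?thesis using assms(3) by blast
qed

lemma approximable_bounded:
  fixes w :: "real ^ 'd::finite \<Rightarrow> real"
  assumes [measurable]: "w \<in> borel_measurable borel" and "\<And>x. \<bar>w x\<bar> \<le> M" and "\<And>x. x \<notin> open_cell a h \<Longrightarrow> w x = 0"
  shows "approximable a h w"
proof -
  have b: "max 0 (w x) \<le> M" "max 0 (- w x) \<le> M" for x using assms(2)[of x] by (auto simp: abs_le_iff)
  have "approximable a h (\<lambda>x. max 0 (w x) * indicator (open_cell a h) x)"
    "approximable a h (\<lambda>x. max 0 (- w x) * indicator (open_cell a h) x)"
    by (rule approximable_nonneg[where M = M]; use b in simp)+
  then have "approximable a h (\<lambda>x. max 0 (w x) * indicator (open_cell a h) x + (- 1) * (max 0 (- w x) * indicator (open_cell a h) x))"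
    by (intro approximable_add approximable_cmult)
  moreover have "(\<lambda>x. max 0 (w x) * indicator (open_cell a h) x + (- 1) * (max 0 (- w x) * indicator (open_cell a h) x)) = w"
    using assms(3) by (auto simp: fun_eq_iff indicator_def max_def)
  ultimately show ?thesis by simp
qed

lemma bounded_cell_integrable:
  fixes w :: "real ^ 'd::finite \<Rightarrow> real"
  assumes "w \<in> borel_measurable borel" "\<And>x. \<bar>w x\<bar> \<le> M" "\<And>x. x \<notin> open_cell a h \<Longrightarrow> w x = 0"
  shows "integrable lborel w"
  by (rule integrableI_bounded_set[where A = "open_cell a h" and B = M])
    (use assms emeasure_open_cell_finite[of a h] in auto)

lemma tensor_bounded:
  assumes "tensor_test a h N b"
  shows "\<exists>B. \<forall>x. \<bar>tensor N b x\<bar> \<le> B"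
proof -
  let ?K = "cbox (\<chi> i. a i) (\<chi> i. a i + h)"
  have "compact (tensor N b ` ?K)" by (intro compact_continuous_image tensor_continuous[OF assms] compact_cbox)
  then have "\<exists>B. \<forall>y\<in>tensor N b ` ?K. norm y \<le> B" unfolding bounded_iff[symmetric] by (rule compact_imp_bounded)
  then obtain B where B: "\<And>x. x \<in> ?K \<Longrightarrow> \<bar>tensor N b x\<bar> \<le> B" by auto
  have "\<bar>tensor N b x\<bar> \<le> max B 0" for x
  proof (cases "x \<in> ?K")
    case False
    then have "x \<notin> open_cell a h" unfolding open_cell_box using box_subset_cbox by blast
    then show ?thesis by (simp add: tensor_outside[OF assms])
  qed (use B[of x] in auto)
  then show ?thesis by blast
qed

text \<open>If the tensor were \<open>w\<close> itself, the hypothesis would say that twice the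
  squared norm of \<open>w\<close> is at most \<open>B\<close> plus that squared norm. Density
  brings tensors arbitrarily close to \<open>w\<close>.\<close>

lemma tensor_duality:
  fixes w :: "real ^ 'd::finite \<Rightarrow> real"
  assumes w: "w \<in> borel_measurable borel" "\<And>x. \<bar>w x\<bar> \<le> M" "\<And>x. x \<notin> open_cell a h \<Longrightarrow> w x = 0"
    and dual: "\<And>N b. tensor_test a h N b \<Longrightarrow>
      2 * (LINT x|lborel. w x * tensor N b x) \<le> B + (LINT x|lborel. (tensor N b x)\<^sup>2)"
  shows "(LINT x|lborel. (w x)\<^sup>2) \<le> B"
proof (rule field_le_epsilon)
  fix \<epsilon> :: real assume \<epsilon>: "0 < \<epsilon>"
  have [measurable]: "w \<in> borel_measurable borel" by (rule w(1))
  obtain N b where t: "tensor_test a h N b" and d: "sq_dist w (tensor N b) \<le> ennreal \<epsilon>"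
    using approximable_bounded[OF w] \<epsilon> unfolding approximable_def by blast
  have [measurable]: "tensor N b \<in> borel_measurable borel" by (rule tensor_measurable[OF t])
  obtain K where K: "\<And>x. \<bar>tensor N b x\<bar> \<le> K" using tensor_bounded[OF t] by blast
  have M0: "0 \<le> M" using w(2)[of 0] by simp
  have i1: "integrable lborel (\<lambda>x. w x * tensor N b x)"
    by (rule bounded_cell_integrable[where M = "M * K" and a = a and h = h])
      (use w K M0 in \<open>auto simp: abs_mult intro!: mult_mono\<close>)
  have i2: "integrable lborel (\<lambda>x. (w x - tensor N b x)\<^sup>2)"
  proof (rule bounded_cell_integrable[where M = "(M + K)\<^sup>2" and a = a and h = h])
    fix x
    have "\<bar>w x - tensor N b x\<bar> \<le> M + K" using w(2)[of x] K[of x] by linarith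
    then have "(w x - tensor N b x)\<^sup>2 \<le> (M + K)\<^sup>2" by (rule power2_le_iff_abs_le[THEN iffD2, rotated]) (use M0 K[of x] in linarith)
    then show "\<bar>(w x - tensor N b x)\<^sup>2\<bar> \<le> (M + K)\<^sup>2" by simp
  qed (use w(3) tensor_outside[OF t] in auto)
  have "(LINT x|lborel. (w x - tensor N b x)\<^sup>2) \<le> \<epsilon>"
    using d \<epsilon> unfolding sq_dist_def by (simp add: nn_integral_eq_integral[OF i2] ennreal_le_iff)
  moreover have "(LINT x|lborel. (w x)\<^sup>2) = (LINT x|lborel. 2 * (w x * tensor N b x) - (tensor N b x)\<^sup>2 + (w x - tensor N b x)\<^sup>2)"
    by (intro Bochner_Integration.integral_cong refl) (simp add: power2_eq_square algebra_simps)
  moreover have "\<dots> = 2 * (LINT x|lborel. w x * tensor N b x) - (LINT x|lborel. (tensor N b x)\<^sup>2) + (LINT x|lborel. (w x - tensor N b x)\<^sup>2)"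
    using i1 i2 tensor_integrable(2)[OF t] by simp
  ultimately show "(LINT x|lborel. (w x)\<^sup>2) \<le> B + \<epsilon>" using dual[OF t] by linarith
qed

section \<open>Polynomial approximation of Sobolev functions\<close>

definition poly_coeff :: "('d::finite \<Rightarrow> real) \<Rightarrow> real \<Rightarrow> (real ^ 'd \<Rightarrow> real) \<Rightarrow> ('d \<Rightarrow> nat) \<Rightarrow> real" where
  "poly_coeff a h g j = (LINT z|lborel. g z * (\<Prod>i\<in>UNIV. (deriv ^^ j i) (bump (a i) h) (z $ i)))"

text \<open>The adjoint of \<open>smoothing\<close> of order \<open>Suc l\<close> in all
  coordinates, applied to \<open>g\<close>: the derivatives of the bump become averages of
  \<open>g\<close>, and the functionals of the iterated antiderivatives become the polynomials
  \<open>moment_poly\<close>.\<close>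

definition poly_approx :: "('d::finite \<Rightarrow> real) \<Rightarrow> real \<Rightarrow> nat \<Rightarrow> (real ^ 'd \<Rightarrow> real) \<Rightarrow> real ^ 'd \<Rightarrow> real" where
  "poly_approx a h l g x = (\<Sum>j\<in>degrees l. (\<Prod>i\<in>UNIV. moment_poly (a i) h (j i) (x $ i)) * poly_coeff a h g j)"

lemma product_tensor: "(\<Prod>i\<in>UNIV. b i (x $ i)) = tensor 1 (\<lambda>_. b) x"
  by (simp add: tensor_def)

definition smooth_all :: "('d \<Rightarrow> real) \<Rightarrow> real \<Rightarrow> nat \<Rightarrow> 'd set \<Rightarrow> (nat \<Rightarrow> 'd \<Rightarrow> real \<Rightarrow> real) \<Rightarrow> nat \<Rightarrow> 'd \<Rightarrow> real \<Rightarrow> real" where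
  "smooth_all a h k A b r i = (if i \<in> A then smoothing (a i) h k (b r i) else b r i)"

context
  fixes a :: "'d::finite \<Rightarrow> real" and h :: real and g :: "real ^ 'd \<Rightarrow> real"
  assumes h: "0 < h" and g: "g \<in> borel_measurable borel" "\<And>x. \<bar>g x\<bar> \<le> 1"
begin

lemma g_tensor_integrable: "tensor_test a h N b \<Longrightarrow> integrable lborel (\<lambda>x. g x * tensor N b x)"
proof -
  assume t: "tensor_test a h N b"
  have [measurable]: "g \<in> borel_measurable borel" "tensor N b \<in> borel_measurable borel"
    using g(1) t by (auto intro: tensor_measurable)
  obtain K where K: "\<And>x. \<bar>tensor N b x\<bar> \<le> K" using tensor_bounded[OF t] by blast
  show ?thesis
  proof (rule bounded_cell_integrable[where M = "1 * K" and a = a and h = h])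
    show "\<bar>g x * tensor N b x\<bar> \<le> 1 * K" for x
      unfolding abs_mult using g(2) K by (intro mult_mono) auto
  qed (use tensor_outside[OF t] in auto)
qed

lemma derivs_bump_tensor_test: "tensor_test a h 1 (\<lambda>_ i. (deriv ^^ j i) (bump (a i) h))"
  using h by (auto simp: tensor_test_def intro!: test_fun_derivs test_fun_bump)

lemma abs_poly_coeff_le: "\<bar>poly_coeff a h g j\<bar> \<le> (\<Prod>i\<in>UNIV. bump_const (j i) * (1 / h) ^ j i)"
proof -
  let ?B = "\<Prod>i\<in>UNIV. bump_const (j i) * (1 / h) ^ Suc (j i)"
  let ?t = "tensor 1 (\<lambda>_ i. (deriv ^^ j i) (bump (a i) h))"
  have eq: "poly_coeff a h g j = (LINT x|lborel. g x * ?t x)" by (simp add: poly_coeff_def tensor_def)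
  have "\<bar>poly_coeff a h g j\<bar> \<le> (LINT x|lborel. \<bar>g x * ?t x\<bar>)"
    unfolding eq by (rule integral_abs_bound)
  also have "\<dots> \<le> (LINT x|lborel. ?B * indicator (open_cell a h) x)"
  proof (rule integral_mono)
    show "integrable lborel (\<lambda>x. \<bar>g x * ?t x\<bar>)"
      by (intro integrable_abs g_tensor_integrable derivs_bump_tensor_test)
    show "integrable lborel (\<lambda>x. ?B * indicator (open_cell a h) x)"
      using emeasure_open_cell_finite[of a h] by (intro integrable_mult_right integrable_real_indicator) auto
    fix x
    show "\<bar>g x * ?t x\<bar> \<le> ?B * indicator (open_cell a h) x"
    proof (cases "x \<in> open_cell a h")
      case True
      have "\<bar>?t x\<bar> \<le> ?B"
        unfolding product_tensor[symmetric] abs_prod by (intro prod_mono conjI abs_ge_zero derivs_bump_le[OF h])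
      then have "\<bar>g x\<bar> * \<bar>?t x\<bar> \<le> 1 * ?B" using g(2) by (intro mult_mono) auto
      then show ?thesis using True by (simp add: abs_mult)
    next
      case False
      then have "?t x = 0" by (rule tensor_outside[OF derivs_bump_tensor_test])
      then show ?thesis using False by (simp only:) simp
    qed
  qed
  also have "\<dots> = ?B * h ^ CARD('d)"
    by (simp add: measure_open_cell h)
  also have "\<dots> = (\<Prod>i\<in>UNIV. bump_const (j i) * (1 / h) ^ j i)"
  proof -
    have "?B * h ^ CARD('d) = ?B * (\<Prod>i\<in>(UNIV :: 'd set). h)" by simp
    also have "\<dots> = (\<Prod>i\<in>UNIV. bump_const (j i) * (1 / h) ^ Suc (j i) * h)"
      by (rule prod.distrib[symmetric])
    also have "\<dots> = (\<Prod>i\<in>UNIV. bump_const (j i) * (1 / h) ^ j i)" using h by (intro prod.cong) auto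
    finally show ?thesis .
  qed
  finally show ?thesis .
qed

text \<open>The powers \<open>h ^ j i\<close> and \<open>(1 / h) ^ j i\<close> cancel, so the bound
  is the same on all cells; it later controls the diagonal entries.\<close>

lemma abs_poly_approx_le:
  assumes "\<And>i. x $ i \<in> {a i..a i + h}"
  shows "\<bar>poly_approx a h l g x\<bar> \<le> (\<Sum>j\<in>(degrees l :: ('d \<Rightarrow> nat) set). \<Prod>i\<in>UNIV. bump_const (j i))"
proof -
  have "\<bar>poly_approx a h l g x\<bar> \<le> (\<Sum>j\<in>(degrees l :: ('d \<Rightarrow> nat) set). \<bar>(\<Prod>i\<in>UNIV. moment_poly (a i) h (j i) (x $ i)) * poly_coeff a h g j\<bar>)"
    unfolding poly_approx_def by (rule sum_abs)
  also have "\<dots> \<le> (\<Sum>j\<in>(degrees l :: ('d \<Rightarrow> nat) set). \<Prod>i\<in>UNIV. bump_const (j i))"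
  proof (rule sum_mono)
    fix j :: "'d \<Rightarrow> nat"
    have "\<bar>(\<Prod>i\<in>UNIV. moment_poly (a i) h (j i) (x $ i)) * poly_coeff a h g j\<bar> \<le>
      (\<Prod>i\<in>UNIV. h ^ j i) * (\<Prod>i\<in>UNIV. bump_const (j i) * (1 / h) ^ j i)"
      unfolding abs_mult abs_prod using assms h
      by (intro mult_mono prod_mono abs_poly_coeff_le) (auto simp: moment_poly_le intro!: prod_nonneg)
    also have "\<dots> = (\<Prod>i\<in>UNIV. bump_const (j i))"
      unfolding prod.distrib[symmetric] using h by (intro prod.cong refl) (simp add: power_divide)
    finally show "\<bar>(\<Prod>i\<in>UNIV. moment_poly (a i) h (j i) (x $ i)) * poly_coeff a h g j\<bar> \<le> (\<Prod>i\<in>UNIV. bump_const (j i))" .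
  qed
  finally show ?thesis .
qed

lemma poly_approx_adjoint:
  assumes t: "tensor_test a h N b"
  shows "integrable lborel (\<lambda>x. poly_approx a h l g x * tensor N b x)"
    and "(LINT x|lborel. poly_approx a h l g x * tensor N b x) =
      (LINT x|lborel. g x * tensor N (smooth_all a h (Suc l) UNIV b) x)"
proof -
  let ?I = "\<lambda>i. integral {a i..a i + h}"
  have bt: "test_fun (a i) (a i + h) (b r i)" if "r < N" for r i using t that by (simp add: tensor_test_def)
  have one: "integrable lborel (\<lambda>s. moment_poly (a i) h j s * b r i s)"
    "(LINT s|lborel. moment_poly (a i) h j s * b r i s) = ?I i (iter_antideriv (a i) h j (b r i))" if r: "r < N" for r i j
  proof -
    have c: "continuous_on {a i..a i + h} (\<lambda>s. moment_poly (a i) h j s * b r i s)"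
      by (intro continuous_on_mult continuous_moment_poly[OF h] test_fun_continuous[OF bt[OF r]])
    have o: "moment_poly (a i) h j s * b r i s = 0" if "s \<notin> {a i..a i + h}" for s
      using test_fun_outside[OF bt[OF r, of i], of s] that by auto
    show "integrable lborel (\<lambda>s. moment_poly (a i) h j s * b r i s)" by (rule lborel_integral_Icc(1)[OF c o])
    show "(LINT s|lborel. moment_poly (a i) h j s * b r i s) = ?I i (iter_antideriv (a i) h j (b r i))"
      unfolding integral_iter_antideriv_moment[OF h bt[OF r]] by (rule lborel_integral_Icc(2)[OF c o])
  qed
  \<comment> \<open>Extended by 0 to \<open>r \<ge> N\<close>, so that integrability holds for every
    index.\<close>
  let ?p = "\<lambda>r j i s. if r < N then moment_poly (a i) h (j i) s * b r i s else 0"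
  have pint: "integrable lborel (?p r j i)" for r j i   proof (cases "r < N")
    case True
    have "integrable lborel (\<lambda>s. moment_poly (a i) h (j i) s * b r i s)" by (rule one(1)[OF True])
    then show ?thesis using True by simp
  qed simp
  have pprod: "integrable lborel (\<lambda>x. \<Prod>i\<in>UNIV. ?p r j i (x $ i))" for r and j :: "'d \<Rightarrow> nat"
  proof (cases "r < N")
    case r: True
    have [measurable]: "?p r j i \<in> borel_measurable borel" for i using borel_measurable_integrable[OF pint[of r i j]] by simp
    have t1: "tensor_test a h 1 (\<lambda>_. b r)" using bt[OF r] by (simp add: tensor_test_def)
    obtain K where K: "\<And>x. \<bar>tensor 1 (\<lambda>_. b r) x\<bar> \<le> K" using tensor_bounded[OF t1] by blast
    have eq: "(\<Prod>i\<in>UNIV. ?p r j i (x $ i)) = (\<Prod>i\<in>UNIV. moment_poly (a i) h (j i) (x $ i)) * tensor 1 (\<lambda>_. b r) x" for x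
      using r by (simp add: prod.distrib tensor_def)
    show ?thesis
    proof (rule bounded_cell_integrable[where M = "(\<Prod>i\<in>UNIV. h ^ j i) * K" and a = a and h = h])
      show "(\<lambda>x. \<Prod>i\<in>UNIV. ?p r j i (x $ i)) \<in> borel_measurable borel" by measurable
      show z: "(\<Prod>i\<in>UNIV. ?p r j i (x $ i)) = 0" if "x \<notin> open_cell a h" for x
        unfolding eq using tensor_outside[OF t1 that] by simp
      have K0: "0 \<le> K" using K[of 0] by linarith
      show "\<bar>\<Prod>i\<in>UNIV. ?p r j i (x $ i)\<bar> \<le> (\<Prod>i\<in>UNIV. h ^ j i) * K" for x
      proof (cases "x \<in> open_cell a h")
        case True
        then have "\<bar>\<Prod>i\<in>UNIV. moment_poly (a i) h (j i) (x $ i)\<bar> \<le> (\<Prod>i\<in>UNIV. h ^ j i)"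
          unfolding abs_prod using h by (intro prod_mono) (auto simp: open_cell_def less_imp_le intro!: moment_poly_le)
        then show ?thesis unfolding eq abs_mult using K h by (intro mult_mono) (auto intro: prod_nonneg)
      next
        case False
        have "0 \<le> (\<Prod>i\<in>(UNIV :: 'd set). h ^ j i) * K" using K0 h by (auto intro!: mult_nonneg_nonneg prod_nonneg)
        then show ?thesis unfolding z[OF False] by (simp only: abs_zero)
      qed
    qed
  next
    case False
    have "(\<lambda>x :: real ^ 'd. \<Prod>i\<in>UNIV. ?p r j i (x $ i)) = (\<lambda>_. 0)" using False by (auto intro!: prod_zero)
    then show ?thesis by simp
  qed
  have split: "poly_approx a h l g x * tensor N b x =
     (\<Sum>r<N. \<Sum>j\<in>degrees l. poly_coeff a h g j * (\<Prod>i\<in>UNIV. ?p r j i (x $ i)))" for x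
  proof -
    have "poly_approx a h l g x * tensor N b x = (\<Sum>r<N. poly_approx a h l g x * (\<Prod>i\<in>UNIV. b r i (x $ i)))"
      unfolding tensor_def by (rule sum_distrib_left)
    also have "\<dots> = (\<Sum>r<N. \<Sum>j\<in>degrees l. poly_coeff a h g j * (\<Prod>i\<in>UNIV. ?p r j i (x $ i)))"
      unfolding poly_approx_def sum_distrib_right by (intro sum.cong refl) (simp add: prod.distrib mult_ac)
    finally show ?thesis .
  qed
  show "integrable lborel (\<lambda>x. poly_approx a h l g x * tensor N b x)"
    unfolding split by (intro Bochner_Integration.integrable_sum integrable_mult_right pprod)
  have "(LINT x|lborel. poly_approx a h l g x * tensor N b x) =
    (\<Sum>r<N. \<Sum>j\<in>degrees l. poly_coeff a h g j * (LINT x|lborel. (\<Prod>i\<in>UNIV. ?p r j i (x $ i))))"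
    unfolding split by (simp only: Bochner_Integration.integral_sum Bochner_Integration.integrable_sum integrable_mult_right pprod
      Bochner_Integration.integral_mult_right_zero)
  also have "\<dots> = (\<Sum>r<N. \<Sum>j\<in>degrees l. poly_coeff a h g j * (\<Prod>i\<in>UNIV. ?I i (iter_antideriv (a i) h (j i) (b r i))))"
  proof (intro sum.cong refl arg_cong2[of _ _ _ _ "(*)"])
    fix r j assume r: "r \<in> {..<N}"
    have "(LINT x|lborel. (\<Prod>i\<in>UNIV. ?p r j i (x $ i))) = (\<Prod>i\<in>UNIV. LINT t|lborel. ?p r j i t)"
      by (rule integral_lborel_prod_vec) (rule pint)
    then show "(LINT x|lborel. (\<Prod>i\<in>UNIV. ?p r j i (x $ i))) = (\<Prod>i\<in>UNIV. ?I i (iter_antideriv (a i) h (j i) (b r i)))"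
      using r by (simp add: one(2))
  qed
  also have "\<dots> = (\<Sum>r<N. \<Sum>j\<in>degrees l. (LINT z|lborel. g z *
      ((\<Prod>i\<in>UNIV. (deriv ^^ j i) (bump (a i) h) (z $ i)) * (\<Prod>i\<in>UNIV. ?I i (iter_antideriv (a i) h (j i) (b r i))))))"
    unfolding poly_coeff_def by (simp only: mult.assoc[symmetric] Bochner_Integration.integral_mult_left_zero)
  also have "\<dots> = (LINT z|lborel. (\<Sum>r<N. \<Sum>j\<in>degrees l. g z *
      ((\<Prod>i\<in>UNIV. (deriv ^^ j i) (bump (a i) h) (z $ i)) * (\<Prod>i\<in>UNIV. ?I i (iter_antideriv (a i) h (j i) (b r i))))))"
  proof -
    have "integrable lborel (\<lambda>z. g z * ((\<Prod>i\<in>UNIV. (deriv ^^ j i) (bump (a i) h) (z $ i)) * C))" for j :: "'d \<Rightarrow> nat" and C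
    proof -
      have "integrable lborel (\<lambda>z. g z * (\<Prod>i\<in>UNIV. (deriv ^^ j i) (bump (a i) h) (z $ i)))"
        using g_tensor_integrable[OF derivs_bump_tensor_test[of j]] by (simp add: tensor_def)
      from integrable_mult_left[OF this, of C] show ?thesis by (simp only: mult.assoc)
    qed
    then show ?thesis by (simp only: Bochner_Integration.integral_sum Bochner_Integration.integrable_sum)
  qed
  also have "\<dots> = (LINT x|lborel. g x * tensor N (smooth_all a h (Suc l) UNIV b) x)"
  proof (intro Bochner_Integration.integral_cong refl)
    fix z :: "real ^ 'd"
    have "(\<Sum>j\<in>degrees l. (\<Prod>i\<in>UNIV. (deriv ^^ j i) (bump (a i) h) (z $ i)) * (\<Prod>i\<in>UNIV. ?I i (iter_antideriv (a i) h (j i) (b r i))))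
       = (\<Prod>i\<in>UNIV. smooth_all a h (Suc l) UNIV b r i (z $ i))" for r
    proof -
      have "(\<Prod>i\<in>UNIV. smooth_all a h (Suc l) UNIV b r i (z $ i)) =
        (\<Prod>i\<in>UNIV. \<Sum>s\<in>{..l}. (deriv ^^ s) (bump (a i) h) (z $ i) * ?I i (iter_antideriv (a i) h s (b r i)))"
        by (simp add: smooth_all_def smoothing_def lessThan_Suc_atMost)
      \<comment> \<open>Multiplying out one sum per coordinate produces exactly the multi-indices
        with every \<open>j i \<le> l\<close>.\<close>
      also have "\<dots> = (\<Sum>j\<in>degrees l. \<Prod>i\<in>UNIV. (deriv ^^ j i) (bump (a i) h) (z $ i) * ?I i (iter_antideriv (a i) h (j i) (b r i)))"
        unfolding degrees_PiE by (rule prod_sum_PiE) auto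
      finally show ?thesis by (simp add: prod.distrib)
    qed
    then show "(\<Sum>r<N. \<Sum>j\<in>degrees l. g z *
      ((\<Prod>i\<in>UNIV. (deriv ^^ j i) (bump (a i) h) (z $ i)) * (\<Prod>i\<in>UNIV. ?I i (iter_antideriv (a i) h (j i) (b r i))))) =
      g z * tensor N (smooth_all a h (Suc l) UNIV b) z"
      by (simp add: tensor_def sum_distrib_left[symmetric])
  qed
  finally show "(LINT x|lborel. poly_approx a h l g x * tensor N b x) =
      (LINT x|lborel. g x * tensor N (smooth_all a h (Suc l) UNIV b) x)" .
qed

text \<open>The smoothing operators are introduced one coordinate at a time, so that only pure
  derivatives of \<open>g\<close> are needed to bound the \<open>e i\<close>.\<close>

lemma poly_approx_error:
  assumes H: "\<And>i N b. tensor_test a h N b \<Longrightarrow>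
      2 * (LINT x|lborel. g x * (tensor N b x - tensor N (tensor_op (smoothing (a i) h (Suc l)) i b) x))
        \<le> e i + \<eta> * (LINT x|lborel. (tensor N b x)\<^sup>2)"
    and \<eta>: "0 \<le> \<eta>" "real CARD('d) * \<eta> * smoothing_const (Suc l) ^ CARD('d) \<le> 1"
    and pm: "(\<lambda>x. poly_approx a h l g x * indicator (open_cell a h) x) \<in> borel_measurable borel"
  shows "(LINT x|lborel. ((g x - poly_approx a h l g x) * indicator (open_cell a h) x)\<^sup>2) \<le> (\<Sum>i\<in>UNIV. e i)"
proof -
  let ?k = "Suc l" and ?CS = "smoothing_const (Suc l)" and ?Q = "open_cell a h"
  let ?KP = "\<Sum>j\<in>(degrees l :: ('d \<Rightarrow> nat) set). \<Prod>i\<in>UNIV. bump_const (j i)"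
  have [measurable]: "g \<in> borel_measurable borel" by (rule g(1))
  have bop: "bounded_op (a i) (a i + h) ?CS (smoothing (a i) h ?k)" for i by (rule bounded_op_smoothing[OF h])
  have CS: "1 \<le> ?CS" by (rule smoothing_const_ge)
  have sa: "smooth_all a h ?k (insert i A) b = tensor_op (smoothing (a i) h ?k) i (smooth_all a h ?k A b)" if "i \<notin> A" for i A b
    using that by (auto simp: smooth_all_def tensor_op_def fun_eq_iff)
  have step: "tensor_test a h N (smooth_all a h ?k A b) \<and>
      (LINT x|lborel. (tensor N (smooth_all a h ?k A b) x)\<^sup>2) \<le> ?CS ^ card A * (LINT x|lborel. (tensor N b x)\<^sup>2)"
    if t: "tensor_test a h N b" for A N b
  proof (induction A rule: infinite_finite_induct)
    case empty
    have "smooth_all a h ?k {} b = b" by (auto simp: smooth_all_def fun_eq_iff)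
    then show ?case using t by simp
  next
    case (insert i A)
    have "(LINT x|lborel. (tensor N (smooth_all a h ?k (insert i A) b) x)\<^sup>2) \<le>
      ?CS * (LINT x|lborel. (tensor N (smooth_all a h ?k A b) x)\<^sup>2)"
      unfolding sa[OF insert.hyps(2)] using insert.IH CS by (intro tensor_op_square[OF _ bop h]) auto
    also have "\<dots> \<le> ?CS * (?CS ^ card A * (LINT x|lborel. (tensor N b x)\<^sup>2))"
      using insert.IH CS by (intro mult_left_mono) auto
    finally show ?case using insert tensor_op_test[OF conjunct1[OF insert.IH] bop[of i]] by (simp add: sa mult.assoc)
  qed simp
  \<comment> \<open>Telescoping over the coordinates in \<open>A\<close>: inserting \<open>i\<close>
    costs \<open>e i\<close> and a multiple of a norm inflated by the earlier smoothings. The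
    condition on \<open>\<eta>\<close> keeps the total of the inflated terms below one squared
    norm.\<close>
  have tele: "2 * (LINT x|lborel. g x * (tensor N b x - tensor N (smooth_all a h ?k A b) x)) \<le>
     (\<Sum>i\<in>A. e i) + real (card A) * (\<eta> * ?CS ^ CARD('d) * (LINT x|lborel. (tensor N b x)\<^sup>2))"
    if t: "tensor_test a h N b" for A N b
  proof (induction A rule: infinite_finite_induct)
    case empty
    have "smooth_all a h ?k {} b = b" by (auto simp: smooth_all_def fun_eq_iff)
    then show ?case by simp
  next
    case (insert i A)
    let ?bA = "smooth_all a h ?k A b" and ?bi = "smooth_all a h ?k (insert i A) b"
    let ?n = "LINT x|lborel. (tensor N b x)\<^sup>2"
    have n0: "0 \<le> ?n" by simp
    note i1 = g_tensor_integrable[OF t] and i2 = g_tensor_integrable[OF conjunct1[OF step[OF t, of A]]]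
      and i3 = g_tensor_integrable[OF conjunct1[OF step[OF t, of "insert i A"]]]
    have "(LINT x|lborel. g x * (tensor N b x - tensor N ?bi x)) =
       (LINT x|lborel. g x * (tensor N b x - tensor N ?bA x)) + (LINT x|lborel. g x * (tensor N ?bA x - tensor N ?bi x))"
      using i1 i2 i3 by (simp add: right_diff_distrib)
    moreover have "2 * (LINT x|lborel. g x * (tensor N ?bA x - tensor N ?bi x)) \<le> e i + \<eta> * (LINT x|lborel. (tensor N ?bA x)\<^sup>2)"
      unfolding sa[OF insert.hyps(2)] by (rule H) (use step[OF t] in blast)
    moreover have "\<eta> * (LINT x|lborel. (tensor N ?bA x)\<^sup>2) \<le> \<eta> * (?CS ^ CARD('d) * ?n)"
    proof (intro mult_left_mono \<eta>)
      have "(LINT x|lborel. (tensor N ?bA x)\<^sup>2) \<le> ?CS ^ card A * ?n" using step[OF t] by blast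
      also have "\<dots> \<le> ?CS ^ CARD('d) * ?n" using CS n0 by (intro mult_right_mono power_increasing card_mono) auto
      finally show "(LINT x|lborel. (tensor N ?bA x)\<^sup>2) \<le> ?CS ^ CARD('d) * ?n" .
    qed
    ultimately show ?case using insert by (simp add: algebra_simps)
  qed simp
  show ?thesis
  proof (rule tensor_duality[where M = "1 + ?KP" and a = a and h = h])
    have "(\<lambda>x. g x * indicator ?Q x - poly_approx a h l g x * indicator ?Q x) \<in> borel_measurable borel"
      using pm by measurable
    then show "(\<lambda>x. (g x - poly_approx a h l g x) * indicator ?Q x) \<in> borel_measurable borel" by (simp add: left_diff_distrib)
    show "\<bar>(g x - poly_approx a h l g x) * indicator ?Q x\<bar> \<le> 1 + ?KP" for x
    proof (cases "x \<in> ?Q")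
      case True
      then have "\<bar>poly_approx a h l g x\<bar> \<le> ?KP" by (intro abs_poly_approx_le) (auto simp: open_cell_def less_imp_le)
      then show ?thesis using True g(2)[of x] by simp
    next
      case False
      have "0 \<le> ?KP" by (intro sum_nonneg prod_nonneg) (simp add: bump_const_nonneg)
      then show ?thesis using False by simp
    qed
    fix N and b :: "nat \<Rightarrow> 'd \<Rightarrow> real \<Rightarrow> real" assume t: "tensor_test a h N b"
    have "(LINT x|lborel. (g x - poly_approx a h l g x) * indicator ?Q x * tensor N b x) =
      (LINT x|lborel. g x * tensor N b x - poly_approx a h l g x * tensor N b x)"
      using tensor_outside[OF t] by (intro Bochner_Integration.integral_cong) (auto simp: indicator_def algebra_simps)
    also have "\<dots> = (LINT x|lborel. g x * (tensor N b x - tensor N (smooth_all a h ?k UNIV b) x))"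
      using g_tensor_integrable[OF t] poly_approx_adjoint[OF t] g_tensor_integrable[OF conjunct1[OF step[OF t, of UNIV]]]
      by (simp add: right_diff_distrib)
    finally have "2 * (LINT x|lborel. (g x - poly_approx a h l g x) * indicator ?Q x * tensor N b x) \<le>
      (\<Sum>i\<in>UNIV. e i) + real CARD('d) * (\<eta> * ?CS ^ CARD('d) * (LINT x|lborel. (tensor N b x)\<^sup>2))"
      using tele[OF t, of UNIV] by simp
    also have "real CARD('d) * (\<eta> * ?CS ^ CARD('d) * (LINT x|lborel. (tensor N b x)\<^sup>2)) \<le> 1 * (LINT x|lborel. (tensor N b x)\<^sup>2)"
      unfolding mult.assoc[symmetric] using \<eta>(2) by (intro mult_right_mono) auto
    finally show "2 * (LINT x|lborel. (g x - poly_approx a h l g x) * indicator ?Q x * tensor N b x) \<le>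
      (\<Sum>i\<in>UNIV. e i) + (LINT x|lborel. (tensor N b x)\<^sup>2)" by simp
  qed simp
qed

end

text \<open>\<open>P\<close> is the same for all \<open>g\<close>, so the feature coefficients
  depend on \<open>g\<close> only through \<open>poly_coeff\<close>. Their measurability in the
  second argument of the graphon rests on this.\<close>

lemma poly_approx_features:
  fixes a :: "'d::finite \<Rightarrow> real"
  assumes h: "0 < h"
  shows "\<exists>P. \<forall>g x. (\<forall>i. x $ i \<in> {a i..a i + h}) \<longrightarrow> poly_approx a h l g x =
    (\<Sum>k\<in>degrees l. (\<Sum>j\<in>degrees l. P j k * poly_coeff a h g j) * (\<Prod>i\<in>UNIV. ((x $ i - a i) / h) ^ k i))"
proof -
  have "\<forall>i j. \<exists>c. \<forall>t\<in>{a i..a i + h}. moment_poly (a i) h j t = (\<Sum>s\<le>j. c s * ((t - a i) / h) ^ s)"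
    using moment_poly_polynomial[OF h] by blast
  then obtain c where c: "\<And>i j t. t \<in> {a i..a i + h} \<Longrightarrow> moment_poly (a i) h j t = (\<Sum>s\<le>j. c i j s * ((t - a i) / h) ^ s)"
    by metis
  define c' where "c' i j s = (if s \<le> j then c i j s else 0)" for i j s
  have c': "moment_poly (a i) h j t = (\<Sum>s\<le>l. c' i j s * ((t - a i) / h) ^ s)"
    if "t \<in> {a i..a i + h}" "j \<le> l" for i j t
    unfolding c[OF that(1)] using that(2)
    by (intro sum.mono_neutral_cong_left) (auto simp: c'_def)
  show ?thesis
  proof (intro exI[of _ "\<lambda>j k. \<Prod>i\<in>UNIV. c' i (j i) (k i)"] allI impI)
    fix g x assume x: "\<forall>i. x $ i \<in> {a i..a i + h}"
    have pr: "(\<Prod>i\<in>UNIV. moment_poly (a i) h (j i) (x $ i)) =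
      (\<Sum>k\<in>degrees l. (\<Prod>i\<in>UNIV. c' i (j i) (k i)) * (\<Prod>i\<in>UNIV. ((x $ i - a i) / h) ^ k i))" if j: "j \<in> degrees l" for j
    proof -
      have "(\<Prod>i\<in>UNIV. moment_poly (a i) h (j i) (x $ i)) = (\<Prod>i\<in>UNIV. \<Sum>s\<in>{..l}. c' i (j i) s * ((x $ i - a i) / h) ^ s)"
        using x j by (intro prod.cong refl c') (auto simp: degrees_def)
      also have "\<dots> = (\<Sum>k\<in>degrees l. \<Prod>i\<in>UNIV. c' i (j i) (k i) * ((x $ i - a i) / h) ^ k i)"
        unfolding degrees_PiE by (rule prod_sum_PiE) auto
      finally show ?thesis by (simp add: prod.distrib)
    qed
    have "poly_approx a h l g x = (\<Sum>j\<in>degrees l. \<Sum>k\<in>degrees l.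
        (\<Prod>i\<in>UNIV. c' i (j i) (k i)) * (\<Prod>i\<in>UNIV. ((x $ i - a i) / h) ^ k i) * poly_coeff a h g j)"
      unfolding poly_approx_def by (intro sum.cong refl) (simp add: pr sum_distrib_right)
    also have "\<dots> = (\<Sum>k\<in>degrees l. \<Sum>j\<in>degrees l.
        (\<Prod>i\<in>UNIV. c' i (j i) (k i)) * (\<Prod>i\<in>UNIV. ((x $ i - a i) / h) ^ k i) * poly_coeff a h g j)"
      by (rule sum.swap)
    also have "\<dots> = (\<Sum>k\<in>degrees l. (\<Sum>j\<in>degrees l. (\<Prod>i\<in>UNIV. c' i (j i) (k i)) * poly_coeff a h g j) * (\<Prod>i\<in>UNIV. ((x $ i - a i) / h) ^ k i))"
      by (intro sum.cong refl, subst sum_distrib_right) (intro sum.cong refl, simp only: mult_ac)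
    finally show "poly_approx a h l g x = (\<Sum>k\<in>degrees l. (\<Sum>j\<in>degrees l. (\<Prod>i\<in>UNIV. c' i (j i) (k i)) * poly_coeff a h g j) * (\<Prod>i\<in>UNIV. ((x $ i - a i) / h) ^ k i))" .
  qed
qed

lemma poly_approx_measurable:
  fixes a :: "'d::finite \<Rightarrow> real"
  assumes "0 < h"
  shows "(\<lambda>x. poly_approx a h l g x * indicator (open_cell a h) x) \<in> borel_measurable borel"
proof -
  obtain P where P: "\<And>x. (\<forall>i. x $ i \<in> {a i..a i + h}) \<Longrightarrow> poly_approx a h l g x =
    (\<Sum>k\<in>degrees l. (\<Sum>j\<in>degrees l. P j k * poly_coeff a h g j) * (\<Prod>i\<in>UNIV. ((x $ i - a i) / h) ^ k i))"
    using poly_approx_features[OF assms, of a l] by blast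
  let ?p = "\<lambda>x. \<Sum>k\<in>degrees l. (\<Sum>j\<in>degrees l. P j k * poly_coeff a h g j) * (\<Prod>i\<in>UNIV. ((x $ i - a i) / h) ^ k i)"
  have "continuous_on UNIV ?p" using assms by (intro continuous_intros) auto
  then have [measurable]: "?p \<in> borel_measurable borel" by (rule borel_measurable_continuous_onI)
  have "(\<lambda>x. poly_approx a h l g x * indicator (open_cell a h) x) = (\<lambda>x. ?p x * indicator (open_cell a h) x)"
  proof
    fix x
    show "poly_approx a h l g x * indicator (open_cell a h) x = ?p x * indicator (open_cell a h) x"
    proof (cases "x \<in> open_cell a h")
      case True
      then have "\<forall>i. x $ i \<in> {a i..a i + h}" by (auto simp: open_cell_def less_imp_le)
      then have e: "poly_approx a h l g x = ?p x" by (rule P)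
      show ?thesis unfolding e ..
    qed simp
  qed
  then show ?thesis by simp
qed

section \<open>Weak derivatives paired with tensor products\<close>

lemma locally_integrable_measurable:
  fixes D :: "real ^ 'd::finite \<Rightarrow> real"
  assumes "locally_integrable D"
  shows "(\<lambda>x. indicator (interior cube) x * D x) \<in> borel_measurable borel"
proof (rule borel_measurable_LIMSEQ_real)
  \<comment> \<open>Compact boxes that exhaust the open cube; on each of them local integrability
    includes measurability.\<close>
  let ?K = "\<lambda>n. cbox (\<chi> i. 1 / (real n + 3)) (\<chi> i. 1 - 1 / (real n + 3)) :: (real ^ 'd) set"
  have K: "x \<in> ?K n \<longleftrightarrow> (\<forall>i. 1 / (real n + 3) \<le> x $ i \<and> x $ i \<le> 1 - 1 / (real n + 3))" for n x
    by (simp add: mem_box_cart)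
  have sub: "?K n \<subseteq> interior cube" for n
  proof
    fix x assume x: "x \<in> ?K n"
    have "0 < x $ i \<and> x $ i < 1" for i
    proof -
      have "1 / (real n + 3) > 0" by simp
      then show ?thesis using x[unfolded K] by (smt (verit))
    qed
    then show "x \<in> interior cube" by (simp add: interior_cube)
  qed
  show "(\<lambda>x. indicator (?K n) x * D x) \<in> borel_measurable borel" for n
  proof -
    have "set_integrable lborel (?K n) D" using assms sub[of n] by (simp add: locally_integrable_def)
    then show ?thesis unfolding set_integrable_def by (auto dest: borel_measurable_integrable)
  qed
  show "(\<lambda>n. indicator (?K n) x * D x) \<longlonglongrightarrow> indicator (interior cube) x * D x" for x
  proof (cases "x \<in> interior cube")
    case True
    then have x: "0 < x $ i" "x $ i < 1" for i by (auto simp: interior_cube)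
    define \<epsilon> where "\<epsilon> = Min (range (\<lambda>i. min (x $ i) (1 - x $ i)))"
    have \<epsilon>: "\<epsilon> > 0" unfolding \<epsilon>_def using x by (subst Min_gr_iff) auto
    have le: "\<epsilon> \<le> min (x $ i) (1 - x $ i)" for i unfolding \<epsilon>_def by (intro Min_le) auto
    obtain N where N: "1 / \<epsilon> < real N" using reals_Archimedean2 by blast
    have "eventually (\<lambda>n. indicator (?K n) x * D x = D x) sequentially"
      unfolding eventually_sequentially
    proof (intro exI[of _ N] allI impI)
      fix n assume "N \<le> n"
      then have "1 / \<epsilon> < real n + 3" using N by linarith
      then have "1 / (real n + 3) < \<epsilon>" using \<epsilon> by (simp add: field_simps)
      then have "1 / (real n + 3) \<le> x $ i \<and> x $ i \<le> 1 - 1 / (real n + 3)" for i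
        using le[of i] by linarith
      then have "x \<in> ?K n" unfolding K by blast
      then show "indicator (?K n) x * D x = D x" by simp
    qed
    then show ?thesis using True by (simp add: tendsto_eventually)
  next
    case False
    then have "x \<notin> ?K n" for n using sub by blast
    then show ?thesis using False by simp
  qed
qed

definition pure_index :: "'d \<Rightarrow> nat \<Rightarrow> 'd multi_index" where
  "pure_index i k = (\<lambda>j. if j = i then k else 0)"

lemma mi_size_pure_index: "mi_size (pure_index i k :: 'd::finite multi_index) = k"
  by (simp add: mi_size_def pure_index_def)

lemma tensor_derivs_pure_index:
  fixes b :: "nat \<Rightarrow> 'd::finite \<Rightarrow> real \<Rightarrow> real"
  assumes t: "tensor_test a h N b"
    and T: "\<And>f. test_fun (a i) (a i + h) f \<Longrightarrow> (deriv ^^ k) (T f) = (\<lambda>x. f x - S f x)"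
  shows "tensor_derivs N (tensor_op T i b) (pure_index i k) x = tensor N b x - tensor N (tensor_op S i b) x"
proof -
  let ?c = "\<lambda>r. \<Prod>j\<in>UNIV - {i}. b r j (x $ j)"
  have x: "x = set_coord x i (x $ i)" by (simp add: vec_eq_iff)
  have e: "tensor N (\<lambda>r j. if j = i then w r else b r j) x = (\<Sum>r<N. ?c r * w r (x $ i))" for w
  proof -
    have "(\<Prod>j\<in>UNIV - {i}. (if j = i then w r else b r j) (x $ j)) = ?c r" for r by (intro prod.cong) auto
    then show ?thesis by (subst x, subst tensor_set_coord) simp
  qed
  have "tensor_derivs N (tensor_op T i b) (pure_index i k) x =
     tensor N (\<lambda>r j. if j = i then (deriv ^^ k) (T (b r i)) else b r j) x"
    unfolding tensor_derivs_def tensor_def by (intro sum.cong prod.cong refl) (auto simp: pure_index_def tensor_op_def)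
  also have "\<dots> = (\<Sum>r<N. ?c r * (b r i (x $ i) - S (b r i) (x $ i)))"
    unfolding e using t by (intro sum.cong refl) (simp add: T tensor_test_def)
  also have "\<dots> = (\<Sum>r<N. ?c r * b r i (x $ i)) - (\<Sum>r<N. ?c r * S (b r i) (x $ i))"
    by (simp add: right_diff_distrib sum_subtractf)
  also have "(\<Sum>r<N. ?c r * b r i (x $ i)) = tensor N b x" by (subst (2) x, subst tensor_set_coord) simp
  also have "(\<Sum>r<N. ?c r * S (b r i) (x $ i)) = tensor N (tensor_op S i b) x"
  proof -
    have "tensor_op S i b = (\<lambda>r j. if j = i then S (b r i) else b r j)"
      by (auto simp: tensor_op_def fun_eq_iff)
    then show ?thesis by (simp only: e)
  qed
  finally show ?thesis .
qed

text \<open>In coordinate \<open>i\<close> the defect \<open>f - S f\<close> is the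
  \<open>k\<close>-th derivative of the test function \<open>T f\<close>, so the weak derivative
  applies. The absolute values hide the sign \<open>(- 1) ^ k\<close>.\<close>

lemma weak_deriv_tensor:
  fixes g0 g D :: "real ^ 'd::finite \<Rightarrow> real"
  assumes wd: "weak_deriv g0 (pure_index i k) D" and t: "tensor_test a h N b"
    and sub: "open_cell a h \<subseteq> interior cube" and g: "\<And>x. x \<in> cube \<Longrightarrow> g x = g0 x"
    and T: "bounded_op (a i) (a i + h) C T"
      "\<And>f. test_fun (a i) (a i + h) f \<Longrightarrow> (deriv ^^ k) (T f) = (\<lambda>x. f x - S f x)"
    and S: "bounded_op (a i) (a i + h) C' S"
  shows "\<bar>LINT x|lborel. g x * (tensor N b x - tensor N (tensor_op S i b) x)\<bar> =
    \<bar>LINT x|lborel. (indicator (interior cube) x * D x) * tensor N (tensor_op T i b) x\<bar>"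
proof -
  have t': "tensor_test a h N (tensor_op T i b)" "tensor_test a h N (tensor_op S i b)"
    using tensor_op_test[OF t T(1)] tensor_op_test[OF t S] .
  have "(LINT x:interior cube|lborel. g0 x * tensor_derivs N (tensor_op T i b) (pure_index i k) x) =
     (- 1) ^ mi_size (pure_index i k) * (LINT x:interior cube|lborel. D x * tensor_derivs N (tensor_op T i b) (\<lambda>_. 0) x)"
    using wd tensor_test_family[OF t'(1) sub] unfolding weak_deriv_def by blast
  moreover have "(LINT x:interior cube|lborel. g0 x * tensor_derivs N (tensor_op T i b) (pure_index i k) x) =
     (LINT x|lborel. g x * (tensor N b x - tensor N (tensor_op S i b) x))"
  proof -
    have pt: "indicator (interior cube) x *\<^sub>R (g0 x * (tensor N b x - tensor N (tensor_op S i b) x)) =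
      g x * (tensor N b x - tensor N (tensor_op S i b) x)" for x
    proof (cases "x \<in> interior cube")
      case True
      then have "x \<in> cube" using interior_subset by blast
      then show ?thesis using True g by simp
    next
      case False
      then have "x \<notin> open_cell a h" using sub by blast
      then show ?thesis using False tensor_outside[OF t] tensor_outside[OF t'(2)] by simp
    qed
    have td: "tensor_derivs N (tensor_op T i b) (pure_index i k) x = tensor N b x - tensor N (tensor_op S i b) x" for x
      by (rule tensor_derivs_pure_index[OF t T(2)])
    show ?thesis by (simp only: set_lebesgue_integral_def td pt)
  qed
  moreover have "(LINT x:interior cube|lborel. D x * tensor_derivs N (tensor_op T i b) (\<lambda>_. 0) x) =
     (LINT x|lborel. (indicator (interior cube) x * D x) * tensor N (tensor_op T i b) x)"
    unfolding set_lebesgue_integral_def by (intro Bochner_Integration.integral_cong refl) (simp add: tensor_derivs_def)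
  ultimately show ?thesis by (simp add: abs_mult power_abs)
qed

lemma locally_integrable_tensor:
  fixes D :: "real ^ 'd::finite \<Rightarrow> real"
  assumes D: "locally_integrable D" and t: "tensor_test a h N b" and sub: "open_cell a h \<subseteq> interior cube"
  shows "integrable lborel (\<lambda>x. (indicator (interior cube) x * D x) * tensor N b x)"
proof -
  have [measurable]: "(\<lambda>x. indicator (interior cube) x * D x) \<in> borel_measurable borel" "tensor N b \<in> borel_measurable borel"
    using locally_integrable_measurable[OF D] tensor_measurable[OF t] by blast+
  obtain K where K: "compact K" "K \<subseteq> interior cube" "\<And>x. x \<notin> K \<Longrightarrow> tensor N b x = 0"
    using tensor_compact_support[OF t sub] by blast
  obtain B where B: "\<And>x. \<bar>tensor N b x\<bar> \<le> B" using tensor_bounded[OF t] by blast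
  have "integrable lborel (\<lambda>x. indicator K x *\<^sub>R D x)"
    using D K unfolding locally_integrable_def set_integrable_def by blast
  then have "integrable lborel (\<lambda>x. (indicator K x *\<^sub>R D x) * B)" by (rule integrable_mult_left)
  then show ?thesis
  proof (rule Bochner_Integration.integrable_bound)
    show "AE x in lborel. norm ((indicator (interior cube) x * D x) * tensor N b x) \<le> norm ((indicator K x *\<^sub>R D x) * B)"
    proof (rule AE_I2)
      fix x
      show "norm ((indicator (interior cube) x * D x) * tensor N b x) \<le> norm ((indicator K x *\<^sub>R D x) * B)"
      proof (cases "x \<in> K")
        case True
        then have "x \<in> interior cube" using K(2) by blast
        then show ?thesis using True B[of x] by (auto simp: abs_mult intro!: mult_left_mono order_trans[OF B abs_ge_self])
      qed (simp add: K(3))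
    qed
  qed measurable
qed

text \<open>A weighted arithmetic-geometric mean inequality under the integral instead of
  Cauchy-Schwarz, because \<open>tensor_duality\<close> asks for an additive bound.\<close>

lemma pairing_bound:
  fixes u :: "real ^ 'd::finite \<Rightarrow> real"
  assumes u[measurable]: "u \<in> borel_measurable borel" and t: "tensor_test a h N b"
    and int: "integrable lborel (\<lambda>x. u x * tensor N b x)"
    and E: "(\<integral>\<^sup>+x. indicator (open_cell a h) x * ennreal ((u x)\<^sup>2) \<partial>lborel) \<le> ennreal E" and E0: "0 \<le> E" and s: "0 < s"
  shows "2 * \<bar>LINT x|lborel. u x * tensor N b x\<bar> \<le> s * E + 1 / s * (LINT x|lborel. (tensor N b x)\<^sup>2)"
proof -
  let ?v = "\<lambda>x. indicator (open_cell a h) x * (u x)\<^sup>2"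
  have nn: "(\<integral>\<^sup>+x. ennreal (?v x) \<partial>lborel) \<le> ennreal E"
    using E by (simp add: ennreal_mult' ennreal_indicator)
  have iv: "integrable lborel ?v"
  proof (rule integrableI_nonneg)
    show "(\<integral>\<^sup>+x. ennreal (?v x) \<partial>lborel) < \<infinity>" using nn by (rule le_less_trans) simp
  qed auto
  have vE: "(LINT x|lborel. ?v x) \<le> E"
    using nn E0 by (subst (asm) nn_integral_eq_integral[OF iv]) (auto simp: ennreal_le_iff)
  have "2 * \<bar>LINT x|lborel. u x * tensor N b x\<bar> \<le> 2 * (LINT x|lborel. \<bar>u x * tensor N b x\<bar>)"
    using integral_abs_bound[of lborel "\<lambda>x. u x * tensor N b x"] by simp
  also have "\<dots> = (LINT x|lborel. 2 * \<bar>u x * tensor N b x\<bar>)" by simp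
  also have "\<dots> \<le> (LINT x|lborel. s * ?v x + 1 / s * (tensor N b x)\<^sup>2)"
  proof (rule integral_mono)
    show "integrable lborel (\<lambda>x. 2 * \<bar>u x * tensor N b x\<bar>)" using int by auto
    show "integrable lborel (\<lambda>x. s * ?v x + 1 / s * (tensor N b x)\<^sup>2)" using iv tensor_integrable(2)[OF t] by auto
    fix x
    show "2 * \<bar>u x * tensor N b x\<bar> \<le> s * ?v x + 1 / s * (tensor N b x)\<^sup>2"
    proof (cases "x \<in> open_cell a h")
      case True
      have "s * (u x)\<^sup>2 + 1 / s * (tensor N b x)\<^sup>2 - 2 * (\<bar>u x\<bar> * \<bar>tensor N b x\<bar>) = (s * \<bar>u x\<bar> - \<bar>tensor N b x\<bar>)\<^sup>2 / s"
        using s by (simp add: power2_eq_square field_simps)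
      moreover have "0 \<le> (s * \<bar>u x\<bar> - \<bar>tensor N b x\<bar>)\<^sup>2 / s" using s by simp
      ultimately have "2 * (\<bar>u x\<bar> * \<bar>tensor N b x\<bar>) \<le> s * (u x)\<^sup>2 + 1 / s * (tensor N b x)\<^sup>2" by linarith
      then show ?thesis using True by (simp add: abs_mult)
    qed (simp add: tensor_outside[OF t])
  qed
  also have "\<dots> = s * (LINT x|lborel. ?v x) + 1 / s * (LINT x|lborel. (tensor N b x)\<^sup>2)"
    using iv tensor_integrable(2)[OF t] by simp
  also have "\<dots> \<le> s * E + 1 / s * (LINT x|lborel. (tensor N b x)\<^sup>2)" using vE s by simp
  finally show ?thesis .
qed

text \<open>Against a tensor of mean 0 any constant may be subtracted from \<open>u\<close>.
  Subtracting \<open>u y\<close> and averaging over \<open>y\<close> in the cell produces the double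
  integral, divided by the volume of the cell.\<close>

lemma pairing_bound_mean_zero:
  fixes u :: "real ^ 'd::finite \<Rightarrow> real"
  assumes u[measurable]: "u \<in> borel_measurable borel" and t: "tensor_test a h N b" and h: "0 < h"
    and int: "integrable lborel (\<lambda>x. u x * tensor N b x)" and zero: "(LINT x|lborel. tensor N b x) = 0"
    and E: "(\<integral>\<^sup>+y. indicator (open_cell a h) y * (\<integral>\<^sup>+x. indicator (open_cell a h) x * ennreal ((u x - u y)\<^sup>2) \<partial>lborel) \<partial>lborel) \<le> ennreal E"
    and E0: "0 \<le> E" and s: "0 < s"
  shows "2 * \<bar>LINT x|lborel. u x * tensor N b x\<bar> \<le> s * E / h ^ CARD('d) + 1 / s * (LINT x|lborel. (tensor N b x)\<^sup>2)"
proof -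
  let ?Q = "open_cell a h" and ?n = "1 / s * (LINT x|lborel. (tensor N b x)\<^sup>2)"
  let ?X = "2 * \<bar>LINT x|lborel. u x * tensor N b x\<bar>"
  define G where "G y = (\<integral>\<^sup>+x. indicator ?Q x * ennreal ((u x - u y)\<^sup>2) \<partial>lborel)" for y
  have [measurable]: "G \<in> borel_measurable borel"
    unfolding G_def using lborel.borel_measurable_nn_integral[of "\<lambda>y x. indicator ?Q x * ennreal ((u x - u y)\<^sup>2)" borel] by measurable
  have n0: "0 \<le> ?n" using s by simp
  \<comment> \<open>\<open>E\<close> controls \<open>G\<close> only after integration, so
    \<open>G y\<close> may be infinite at some \<open>y\<close>; there the bound is trivial.\<close>
  have each: "ennreal ?X \<le> ennreal s * G y + ennreal ?n" for y
  proof (cases "G y = \<infinity>")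
    case True
    then show ?thesis using s by (simp add: ennreal_mult_top)
  next
    case False
    then obtain r where r: "G y = ennreal r" "0 \<le> r" by (cases "G y") auto
    have i: "integrable lborel (\<lambda>x. (u x - u y) * tensor N b x)"
      unfolding left_diff_distrib using int tensor_integrable(1)[OF t] by auto
    have "(LINT x|lborel. (u x - u y) * tensor N b x) = (LINT x|lborel. u x * tensor N b x)"
      unfolding left_diff_distrib using int tensor_integrable(1)[OF t] zero by simp
    moreover have "2 * \<bar>LINT x|lborel. (u x - u y) * tensor N b x\<bar> \<le> s * r + ?n"
      by (rule pairing_bound[OF _ t i _ r(2) s]) (use r(1) in \<open>auto simp: G_def\<close>)
    ultimately have "?X \<le> s * r + ?n" by simp
    then have "ennreal ?X \<le> ennreal (s * r + ?n)" by (rule ennreal_leI)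
    also have "\<dots> = ennreal s * G y + ennreal ?n"
      using s r n0 by (simp add: ennreal_plus ennreal_mult del: ennreal_plus[symmetric])
    finally show ?thesis .
  qed
  have eQ: "emeasure lborel ?Q = ennreal (h ^ CARD('d))"
    using measure_open_cell[OF h, of a] emeasure_open_cell_finite[of a h] by (simp add: emeasure_eq_ennreal_measure)
  have "ennreal (?X * h ^ CARD('d)) = (\<integral>\<^sup>+y. ennreal ?X * indicator ?Q y \<partial>lborel)"
    using h by (simp add: nn_integral_cmult eQ ennreal_mult')
  also have "\<dots> \<le> (\<integral>\<^sup>+y. ennreal s * (indicator ?Q y * G y) + ennreal ?n * indicator ?Q y \<partial>lborel)"
    using each by (intro nn_integral_mono) (auto simp: indicator_def)
  also have "\<dots> = ennreal s * (\<integral>\<^sup>+y. indicator ?Q y * G y \<partial>lborel) + ennreal ?n * ennreal (h ^ CARD('d))"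
    by (subst nn_integral_add) (auto simp: nn_integral_cmult eQ)
  also have "\<dots> \<le> ennreal s * ennreal E + ennreal ?n * ennreal (h ^ CARD('d))"
    using E by (intro add_mono mult_left_mono) (auto simp: G_def)
  also have "\<dots> = ennreal (s * E + ?n * h ^ CARD('d))"
    using s E0 n0 h by (simp only: ennreal_mult'[symmetric] less_imp_le ennreal_plus[symmetric] mult_nonneg_nonneg zero_le_power)
  finally have "?X * h ^ CARD('d) \<le> s * E + ?n * h ^ CARD('d)"
    using s E0 n0 h by (subst (asm) ennreal_le_iff) (auto intro!: add_nonneg_nonneg mult_nonneg_nonneg)
  then have "?X \<le> (s * E + ?n * h ^ CARD('d)) / h ^ CARD('d)" using h by (simp add: pos_le_divide_eq)
  also have "\<dots> = s * E / h ^ CARD('d) + ?n" using h by (simp add: add_divide_distrib)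
  finally show ?thesis .
qed

text \<open>One factor of mean 0 in each product is enough.\<close>

lemma tensor_op_mean_zero:
  fixes b :: "nat \<Rightarrow> 'd::finite \<Rightarrow> real \<Rightarrow> real"
  assumes t: "tensor_test a h N b" and T: "bounded_op (a i) (a i + h) C T"
    and z: "\<And>f. test_fun (a i) (a i + h) f \<Longrightarrow> integral {a i..a i + h} (T f) = 0"
  shows "(LINT x|lborel. tensor N (tensor_op T i b) x) = 0"
proof -
  let ?b = "tensor_op T i b"
  have t': "tensor_test a h N ?b" by (rule tensor_op_test[OF t T])
  have bt: "test_fun (a j) (a j + h) (?b r j)" if "r < N" for r j using t' that by (simp add: tensor_test_def)
  have int: "integrable lborel (\<lambda>x. \<Prod>j\<in>UNIV. ?b r j (x $ j))" if "r < N" for r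
  proof -
    have "tensor_test a h 1 (\<lambda>_. ?b r)" using bt[OF that] by (simp add: tensor_test_def)
    from tensor_integrable(1)[OF this] show ?thesis by (simp add: tensor_def[abs_def])
  qed
  have "(LINT x|lborel. tensor N ?b x) = (\<Sum>r<N. LINT x|lborel. (\<Prod>j\<in>UNIV. ?b r j (x $ j)))"
    unfolding tensor_def using int by (intro Bochner_Integration.integral_sum) auto
  also have "\<dots> = 0"
  proof (rule sum.neutral, rule ballI)
    fix r assume r: "r \<in> {..<N}"
    have "(LINT x|lborel. (\<Prod>j\<in>UNIV. ?b r j (x $ j))) = (\<Prod>j\<in>UNIV. LINT s|lborel. ?b r j s)"
      by (rule integral_lborel_prod_vec) (use r in \<open>auto intro: test_fun_lborel(1)[OF bt]\<close>)
    also have "\<dots> = 0"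
    proof (rule prod_zero)
      have "(LINT s|lborel. ?b r i s) = integral {a i..a i + h} (?b r i)" using r by (intro test_fun_lborel(2)[OF bt]) auto
      also have "\<dots> = 0" using z[of "b r i"] t r by (simp add: tensor_op_def tensor_test_def)
      finally show "\<exists>j\<in>UNIV. (LINT s|lborel. ?b r j s) = 0" by blast
    qed simp
    finally show "(LINT x|lborel. (\<Prod>j\<in>UNIV. ?b r j (x $ j))) = 0" .
  qed
  finally show ?thesis .
qed

section \<open>The error on one cell\<close>

definition sobolev_const :: "'d::finite itself \<Rightarrow> nat \<Rightarrow> real" where
  "sobolev_const _ l = real CARD('d) * smoothing_const (Suc l) ^ CARD('d) * center_const ^ Suc l"

lemma sobolev_const_pos: "0 < sobolev_const TYPE('d::finite) l"
  unfolding sobolev_const_def using smoothing_const_ge[of "Suc l"] center_const_ge by (intro mult_pos_pos) auto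

context
  fixes a :: "'d::finite \<Rightarrow> real" and h :: real and l :: nat and g0 g :: "real ^ 'd \<Rightarrow> real"
    and D :: "'d \<Rightarrow> real ^ 'd \<Rightarrow> real" and E :: "'d \<Rightarrow> real"
  assumes h: "0 < h" and sub: "open_cell a h \<subseteq> interior cube"
    and g: "g \<in> borel_measurable borel" "\<And>x. \<bar>g x\<bar> \<le> 1" "\<And>x. x \<in> cube \<Longrightarrow> g x = g0 x"
    and E0: "\<And>i. 0 \<le> E i"
begin

abbreviation "Dint i x \<equiv> indicator (interior cube) x * D i x"

text \<open>In the integer case \<open>\<alpha> = l + 1\<close> the test function is the \<open>(l + 1)\<close>-fold antiderivative; in
  the fractional case it is the derivative of that function, which has mean zero.\<close>

lemma cell_error_integer:
  assumes wd: "\<And>i. weak_deriv g0 (pure_index i (Suc l)) (D i)"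
    and E: "\<And>i. (\<integral>\<^sup>+x. indicator (open_cell a h) x * ennreal ((Dint i x)\<^sup>2) \<partial>lborel) \<le> ennreal (E i)"
  shows "(LINT x|lborel. ((g x - poly_approx a h l g x) * indicator (open_cell a h) x)\<^sup>2) \<le>
    sobolev_const TYPE('d) l * h ^ (2 * Suc l) * (\<Sum>i\<in>UNIV. E i)"
proof -
  \<comment> \<open>\<open>1 / ?W\<close> is the value of \<open>\<eta>\<close> that
    \<open>poly_approx_error\<close> can afford. The weight \<open>?C * ?W\<close> in the pairing
    cancels the operator bound \<open>?C\<close> and leaves just that.\<close>
  let ?W = "real CARD('d) * smoothing_const (Suc l) ^ CARD('d)" and ?C = "(h\<^sup>2 * center_const) ^ Suc l"
  have W: "?W > 0" using smoothing_const_ge[of "Suc l"] by (intro mult_pos_pos) auto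
  have C: "?C > 0" using h center_const_ge by simp
  have cancel: "1 / (c * w) * (c * n) = 1 / w * n" if "0 < c" for c w n :: real using that by simp
  have "(LINT x|lborel. ((g x - poly_approx a h l g x) * indicator (open_cell a h) x)\<^sup>2) \<le> (\<Sum>i\<in>UNIV. (?C * ?W) * E i)"
  proof (rule poly_approx_error[OF h g(1,2)])
    fix i N and b :: "nat \<Rightarrow> 'd \<Rightarrow> real \<Rightarrow> real" assume t: "tensor_test a h N b"
    let ?T = "iter_antideriv (a i) h (Suc l)" and ?S = "smoothing (a i) h (Suc l)"
    let ?n = "LINT x|lborel. (tensor N b x)\<^sup>2"
    have T: "bounded_op (a i) (a i + h) ?C ?T" by (rule bounded_op_iter_antideriv[OF h])
    have t': "tensor_test a h N (tensor_op ?T i b)" by (rule tensor_op_test[OF t T])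
    have Dl: "locally_integrable (D i)" using wd by (simp add: weak_deriv_def)
    have "2 * (LINT x|lborel. g x * (tensor N b x - tensor N (tensor_op ?S i b) x)) \<le>
        2 * \<bar>LINT x|lborel. g x * (tensor N b x - tensor N (tensor_op ?S i b) x)\<bar>" by simp
    also have "\<dots> = 2 * \<bar>LINT x|lborel. Dint i x * tensor N (tensor_op ?T i b) x\<bar>"
      by (simp only: weak_deriv_tensor[OF wd t sub g(3) T derivs_iter_antideriv(1)[OF h] bounded_op_smoothing[OF h]])
    also have "\<dots> \<le> (?C * ?W) * E i + 1 / (?C * ?W) * (LINT x|lborel. (tensor N (tensor_op ?T i b) x)\<^sup>2)"
      by (rule pairing_bound[OF locally_integrable_measurable[OF Dl] t' locally_integrable_tensor[OF Dl t' sub] E E0 mult_pos_pos[OF C W]])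
    also have "\<dots> \<le> (?C * ?W) * E i + 1 / (?C * ?W) * (?C * ?n)"
      by (intro add_left_mono mult_left_mono tensor_op_square[OF t T h] less_imp_le[OF C] divide_nonneg_nonneg
          zero_le_one less_imp_le[OF mult_pos_pos[OF C W]])
    also have "1 / (?C * ?W) * (?C * ?n) = 1 / ?W * ?n" by (rule cancel[OF C])
    finally show "2 * (LINT x|lborel. g x * (tensor N b x - tensor N (tensor_op ?S i b) x)) \<le> (?C * ?W) * E i + 1 / ?W * ?n" .
  next
    show "0 \<le> 1 / ?W" using W by simp
    show "real CARD('d) * (1 / ?W) * smoothing_const (Suc l) ^ CARD('d) \<le> 1"
      using smoothing_const_ge[of "Suc l"] by simp
    show "(\<lambda>x. poly_approx a h l g x * indicator (open_cell a h) x) \<in> borel_measurable borel"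
      by (rule poly_approx_measurable[OF h])
  qed
  also have "\<dots> = sobolev_const TYPE('d) l * h ^ (2 * Suc l) * (\<Sum>i\<in>UNIV. E i)"
    unfolding sum_distrib_left[symmetric] sobolev_const_def power_mult_distrib power_mult by (simp only: mult_ac)
  finally show ?thesis .
qed

lemma cell_error_fractional:
  assumes wd: "\<And>i. weak_deriv g0 (pure_index i l) (D i)"
    and E: "\<And>i. (\<integral>\<^sup>+y. indicator (open_cell a h) y * (\<integral>\<^sup>+x. indicator (open_cell a h) x *
       ennreal ((Dint i x - Dint i y)\<^sup>2) \<partial>lborel) \<partial>lborel) \<le> ennreal (E i)"
  shows "(LINT x|lborel. ((g x - poly_approx a h l g x) * indicator (open_cell a h) x)\<^sup>2) \<le>
    sobolev_const TYPE('d) l * h ^ (2 * l) / h ^ CARD('d) * (\<Sum>i\<in>UNIV. E i)"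
proof -
  \<comment> \<open>One centring is not followed by an integration: \<open>?C\<close> has
    \<open>l\<close> factors \<open>h\<^sup>2\<close> but \<open>l + 1\<close> factors
    \<open>center_const\<close>.\<close>
  let ?W = "real CARD('d) * smoothing_const (Suc l) ^ CARD('d)" and ?C = "center_const * (h\<^sup>2 * center_const) ^ l"
  have W: "?W > 0" using smoothing_const_ge[of "Suc l"] by (intro mult_pos_pos) auto
  have C: "?C > 0" using h center_const_ge by (intro mult_pos_pos zero_less_power) auto
  have cancel: "1 / (c * w) * (c * n) = 1 / w * n" if "0 < c" for c w n :: real using that by simp
  have "(LINT x|lborel. ((g x - poly_approx a h l g x) * indicator (open_cell a h) x)\<^sup>2) \<le> (\<Sum>i\<in>UNIV. (?C * ?W) * E i / h ^ CARD('d))"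
  proof (rule poly_approx_error[OF h g(1,2)])
    fix i N and b :: "nat \<Rightarrow> 'd \<Rightarrow> real \<Rightarrow> real" assume t: "tensor_test a h N b"
    let ?T = "\<lambda>f. center (a i) h (iter_antideriv (a i) h l f)" and ?S = "smoothing (a i) h (Suc l)"
    let ?n = "LINT x|lborel. (tensor N b x)\<^sup>2"
    have T: "bounded_op (a i) (a i + h) ?C ?T"
      by (rule bounded_op_compose[OF bounded_op_center[OF h] bounded_op_iter_antideriv[OF h]])
        (use center_const_ge in simp)
    have t': "tensor_test a h N (tensor_op ?T i b)" by (rule tensor_op_test[OF t T])
    have z: "(LINT x|lborel. tensor N (tensor_op ?T i b) x) = 0"
      by (rule tensor_op_mean_zero[OF t T]) (intro integral_center[OF h] test_fun_iter_antideriv[OF h])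
    have Dl: "locally_integrable (D i)" using wd by (simp add: weak_deriv_def)
    have "2 * (LINT x|lborel. g x * (tensor N b x - tensor N (tensor_op ?S i b) x)) \<le>
        2 * \<bar>LINT x|lborel. g x * (tensor N b x - tensor N (tensor_op ?S i b) x)\<bar>" by simp
    also have "\<dots> = 2 * \<bar>LINT x|lborel. Dint i x * tensor N (tensor_op ?T i b) x\<bar>"
      by (simp only: weak_deriv_tensor[OF wd t sub g(3) T derivs_iter_antideriv(2)[OF h] bounded_op_smoothing[OF h]])
    also have "\<dots> \<le> (?C * ?W) * E i / h ^ CARD('d) + 1 / (?C * ?W) * (LINT x|lborel. (tensor N (tensor_op ?T i b) x)\<^sup>2)"
      by (rule pairing_bound_mean_zero[OF locally_integrable_measurable[OF Dl] t' h locally_integrable_tensor[OF Dl t' sub] z E E0 mult_pos_pos[OF C W]])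
    also have "\<dots> \<le> (?C * ?W) * E i / h ^ CARD('d) + 1 / (?C * ?W) * (?C * ?n)"
      by (intro add_left_mono mult_left_mono tensor_op_square[OF t T h] less_imp_le[OF C] divide_nonneg_nonneg
          zero_le_one less_imp_le[OF mult_pos_pos[OF C W]])
    also have "1 / (?C * ?W) * (?C * ?n) = 1 / ?W * ?n" by (rule cancel[OF C])
    finally show "2 * (LINT x|lborel. g x * (tensor N b x - tensor N (tensor_op ?S i b) x)) \<le> (?C * ?W) * E i / h ^ CARD('d) + 1 / ?W * ?n" .
  next
    show "0 \<le> 1 / ?W" using W by simp
    show "real CARD('d) * (1 / ?W) * smoothing_const (Suc l) ^ CARD('d) \<le> 1"
      using smoothing_const_ge[of "Suc l"] by simp
    show "(\<lambda>x. poly_approx a h l g x * indicator (open_cell a h) x) \<in> borel_measurable borel"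
      by (rule poly_approx_measurable[OF h])
  qed
  also have "\<dots> = sobolev_const TYPE('d) l * h ^ (2 * l) / h ^ CARD('d) * (\<Sum>i\<in>UNIV. E i)"
    unfolding sum_divide_distrib[symmetric] sum_distrib_left[symmetric] sobolev_const_def power_mult_distrib power_mult power_Suc
    by (simp only: times_divide_eq_left times_divide_eq_right mult_ac)
  finally show ?thesis .
qed

end

section \<open>Summation over the cells of the grid\<close>

definition grid_cell :: "nat \<Rightarrow> ('d \<Rightarrow> nat) \<Rightarrow> (real ^ 'd::finite) set" where
  "grid_cell m c = open_cell (\<lambda>i. real (c i) / real m) (1 / real m)"

lemma grid_cell_subset_cell: "0 < m \<Longrightarrow> grid_cell m c \<subseteq> cell m c"
  by (auto simp: grid_cell_def open_cell_def cell_def field_simps less_imp_le)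

lemma grid_cell_subset_interior:
  assumes "c \<in> cell_indices m" "0 < m"
  shows "grid_cell m c \<subseteq> interior cube"
proof -
  have "grid_cell m c \<subseteq> cube"
    using grid_cell_subset_cell[OF assms(2)] cell_subset_cube[OF assms] by blast
  then show ?thesis by (rule interior_maximal) (simp only: grid_cell_def open_cell_box open_box)
qed

lemma grid_cell_measurable [measurable]: "grid_cell m c \<in> sets borel"
  by (simp add: grid_cell_def)

text \<open>At most one cell contains \<open>x\<close>.\<close>

lemma sum_grid_cell_le:
  fixes t :: "('d::finite \<Rightarrow> nat) \<Rightarrow> ennreal"
  assumes "0 < m" "\<And>c. c \<in> cell_indices m \<Longrightarrow> x \<in> grid_cell m c \<Longrightarrow> t c \<le> u"
  shows "(\<Sum>c\<in>cell_indices m. indicator (grid_cell m c) x * t c) \<le> indicator (interior cube) x * u"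
proof (cases "\<exists>c\<in>cell_indices m. x \<in> grid_cell m c")
  case True
  then obtain c where c: "c \<in> cell_indices m" "x \<in> grid_cell m c" by blast
  have "x \<notin> grid_cell m c'" if "c' \<noteq> c" for c'
    using cell_unique[of x m c c'] c(2) grid_cell_subset_cell[OF assms(1)] that by blast
  then have "(\<Sum>c'\<in>cell_indices m. indicator (grid_cell m c') x * t c') = (\<Sum>c'\<in>cell_indices m. if c' = c then t c else 0)"
    using c(2) by (intro sum.cong refl) (auto simp: indicator_def)
  also have "\<dots> = t c" using c(1) by (subst sum.delta[OF finite_cell_indices]) simp
  also have "\<dots> \<le> u" by (rule assms(2)[OF c])
  finally show ?thesis using c grid_cell_subset_interior[OF c(1) assms(1)] by (auto simp: indicator_def)
next
  case False
  then have "(\<Sum>c\<in>cell_indices m. indicator (grid_cell m c) x * t c) = 0" by (intro sum.neutral) auto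
  then show ?thesis by simp
qed

text \<open>Passes from extended to real energies of the single cells; each is finite because their
  sum is.\<close>

lemma sum_le_of_ennreal:
  assumes "finite A" "(\<Sum>c\<in>A. t c) \<le> ennreal B" "0 \<le> B"
  shows "(\<Sum>c\<in>A. enn2real (t c)) \<le> B" "c \<in> A \<Longrightarrow> t c \<le> ennreal (enn2real (t c))"
proof -
  have fin: "t c < top" if "c \<in> A" for c
  proof -
    have "t c \<le> (\<Sum>c\<in>A. t c)" using assms(1) that by (intro member_le_sum) auto
    then show ?thesis using assms(2) by (auto simp: less_top[symmetric] top_unique dest: order_trans)
  qed
  then show "c \<in> A \<Longrightarrow> t c \<le> ennreal (enn2real (t c))" by simp
  have "ennreal (\<Sum>c\<in>A. enn2real (t c)) = (\<Sum>c\<in>A. ennreal (enn2real (t c)))"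
    by (subst sum_ennreal) auto
  also have "\<dots> = (\<Sum>c\<in>A. t c)" using fin by (intro sum.cong) auto
  also note assms(2)
  finally show "(\<Sum>c\<in>A. enn2real (t c)) \<le> B" unfolding ennreal_le_iff[OF assms(3)] .
qed

lemma sfloor_integer: "0 < \<alpha> \<Longrightarrow> \<alpha> \<in> \<int> \<Longrightarrow> real (Suc (sfloor \<alpha>)) = \<alpha>"
  by (elim Ints_cases) (simp add: sfloor_def)

lemma diameter_grid_cell:
  fixes x y :: "real ^ 'd::finite"
  assumes "x \<in> grid_cell m c" "y \<in> grid_cell m c"
  shows "norm (x - y) \<le> real CARD('d) * (1 / real m)"
proof -
  have "norm (x - y) \<le> (\<Sum>i\<in>UNIV. \<bar>(x - y) $ i\<bar>)" by (rule norm_le_l1_cart)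
  also have "\<dots> \<le> (\<Sum>i\<in>(UNIV :: 'd set). 1 / real m)"
  proof (rule sum_mono)
    fix i
    have "real (c i) / real m < x $ i" "x $ i < real (c i) / real m + 1 / real m"
      "real (c i) / real m < y $ i" "y $ i < real (c i) / real m + 1 / real m"
      using assms by (auto simp: grid_cell_def open_cell_def)
    then show "\<bar>(x - y) $ i\<bar> \<le> 1 / real m" by (simp add: abs_le_iff)
  qed
  finally show ?thesis by simp
qed

text \<open>The bracket adds the constant 1 of the integer case to that of the fractional case,
  which comes from the diameter of a cell.\<close>

definition sobolev_error_const :: "'d::finite itself \<Rightarrow> real \<Rightarrow> real" where
  "sobolev_error_const _ \<alpha> = sobolev_const TYPE('d) (sfloor \<alpha>) * real CARD('d) *
     (1 + real CARD('d) powr (2 * (\<alpha> - real (sfloor \<alpha>)) + real CARD('d)))"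

lemma sobolev_error_const_pos: "0 < sobolev_error_const TYPE('d::finite) \<alpha>"
  unfolding sobolev_error_const_def using sobolev_const_pos
  by (intro mult_pos_pos) (auto intro: add_pos_nonneg)

lemma sobolev_cells_sum:
  fixes g0 g :: "real ^ 'd::finite \<Rightarrow> real"
  assumes g0: "g0 \<in> sobolev_class \<alpha> L" and \<alpha>: "0 < \<alpha>" and m: "0 < m"
    and g: "g \<in> borel_measurable borel" "\<And>x. \<bar>g x\<bar> \<le> 1" "\<And>x. x \<in> cube \<Longrightarrow> g x = g0 x"
  shows "(\<Sum>c\<in>cell_indices m. LINT x|lborel. ((g x -
      poly_approx (\<lambda>i. real (c i) / real m) (1 / real m) (sfloor \<alpha>) g x) * indicator (grid_cell m c) x)\<^sup>2)
    \<le> sobolev_error_const TYPE('d) \<alpha> * real m powr (- (2 * \<alpha>)) * L\<^sup>2"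
proof -
  let ?l = "sfloor \<alpha>" and ?h = "1 / real m" and ?A = "cell_indices m :: ('d \<Rightarrow> nat) set"
  let ?err = "\<lambda>c. LINT x|lborel. ((g x -
      poly_approx (\<lambda>i. real (c i) / real m) ?h ?l g x) * indicator (grid_cell m c) x)\<^sup>2"
  let ?SC = "sobolev_const TYPE('d) ?l" and ?d = "real CARD('d)"
  have h: "0 < ?h" using m by simp
  have sub: "open_cell (\<lambda>i. real (c i) / real m) ?h \<subseteq> interior cube" if "c \<in> ?A" for c
    using grid_cell_subset_interior[OF that m] by (simp add: grid_cell_def)
  have SC: "0 < ?SC" by (rule sobolev_const_pos)
  obtain D where D: "if \<alpha> \<in> \<int> then
        (\<forall>\<kappa>. real (mi_size \<kappa>) = \<alpha> \<longrightarrow> weak_deriv g0 \<kappa> (D \<kappa>)) \<and>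
        (\<Sum>\<kappa> | real (mi_size \<kappa>) = \<alpha>. \<integral>\<^sup>+x\<in>cube. ennreal (\<bar>D \<kappa> x\<bar>\<^sup>2) \<partial>lborel) \<le> ennreal (L\<^sup>2)
      else
        (\<forall>\<kappa>. mi_size \<kappa> = ?l \<longrightarrow> weak_deriv g0 \<kappa> (D \<kappa>)) \<and>
        (\<Sum>\<kappa> | mi_size \<kappa> = ?l.
           \<integral>\<^sup>+x\<in>cube. (\<integral>\<^sup>+y\<in>cube.
             ennreal (\<bar>D \<kappa> x - D \<kappa> y\<bar>\<^sup>2 /
                      norm (x - y) powr (2 * (\<alpha> - real ?l) + ?d)) \<partial>lborel) \<partial>lborel)
          \<le> ennreal (L\<^sup>2)"
    using g0 unfolding sobolev_class_def by blast
  show ?thesis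
  proof (cases "\<alpha> \<in> \<int>")
    case True
    note \<alpha>l = sfloor_integer[OF \<alpha> True]
    let ?\<kappa> = "\<lambda>i :: 'd. pure_index i (Suc ?l)"
    let ?D = "\<lambda>i. D (?\<kappa> i)"
    \<comment> \<open>The derivative is known to be measurable only on the open cube, so it is cut
      off there.\<close>
    let ?Di = "\<lambda>i x. indicator (interior cube) x * ?D i x"
    have wd: "weak_deriv g0 (?\<kappa> i) (?D i)" for i
      using D True \<alpha>l by (simp add: mi_size_pure_index)
    have [measurable]: "?Di i \<in> borel_measurable borel" for i
      using wd[of i] locally_integrable_measurable unfolding weak_deriv_def by blast
    have fin\<kappa>: "finite {\<kappa> :: 'd multi_index. real (mi_size \<kappa>) = \<alpha>}"
    proof (rule finite_subset[OF _ finite_mi_size[of "Suc ?l"]])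
      show "{\<kappa> :: 'd multi_index. real (mi_size \<kappa>) = \<alpha>} \<subseteq> {\<kappa>. mi_size \<kappa> = Suc ?l}"
        using \<alpha>l by (metis (mono_tags, lifting) Collect_mono of_nat_eq_iff)
    qed
    have Sle: "(\<integral>\<^sup>+x\<in>cube. ennreal (\<bar>?D i x\<bar>\<^sup>2) \<partial>lborel) \<le> ennreal (L\<^sup>2)" for i
    proof -
      have "(\<integral>\<^sup>+x\<in>cube. ennreal (\<bar>?D i x\<bar>\<^sup>2) \<partial>lborel) \<le> (\<Sum>\<kappa> | real (mi_size \<kappa>) = \<alpha>. \<integral>\<^sup>+x\<in>cube. ennreal (\<bar>D \<kappa> x\<bar>\<^sup>2) \<partial>lborel)"
        using fin\<kappa> \<alpha>l by (intro member_le_sum[of "?\<kappa> i" _ "\<lambda>\<kappa>. \<integral>\<^sup>+x\<in>cube. ennreal (\<bar>D \<kappa> x\<bar>\<^sup>2) \<partial>lborel"]) (auto simp: mi_size_pure_index)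
      then show ?thesis using D True by (auto dest: order_trans)
    qed
    let ?t = "\<lambda>i c. \<integral>\<^sup>+x. indicator (grid_cell m c) x * ennreal ((?Di i x)\<^sup>2) \<partial>lborel"
    have tsum: "(\<Sum>c\<in>?A. ?t i c) \<le> ennreal (L\<^sup>2)" for i
    proof -
      have "(\<Sum>c\<in>?A. ?t i c) = (\<integral>\<^sup>+x. (\<Sum>c\<in>?A. indicator (grid_cell m c) x * ennreal ((?Di i x)\<^sup>2)) \<partial>lborel)"
        by (rule nn_integral_sum[symmetric]) measurable
      also have "\<dots> \<le> (\<integral>\<^sup>+x\<in>cube. ennreal (\<bar>?D i x\<bar>\<^sup>2) \<partial>lborel)"
      proof (rule nn_integral_mono)
        fix x
        have "(\<Sum>c\<in>?A. indicator (grid_cell m c) x * ennreal ((?Di i x)\<^sup>2)) \<le> indicator (interior cube) x * ennreal ((?Di i x)\<^sup>2)"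
          by (rule sum_grid_cell_le[OF m]) simp
        also have "\<dots> \<le> ennreal (\<bar>?D i x\<bar>\<^sup>2) * indicator cube x"
          using interior_subset[of cube] by (auto simp: indicator_def)
        finally show "(\<Sum>c\<in>?A. indicator (grid_cell m c) x * ennreal ((?Di i x)\<^sup>2)) \<le> ennreal (\<bar>?D i x\<bar>\<^sup>2) * indicator cube x" .
      qed
      finally show ?thesis using Sle[of i] by (rule order_trans)
    qed
    note tl = sum_le_of_ennreal[OF finite_cell_indices tsum zero_le_power2]
    have "(\<Sum>c\<in>?A. ?err c) \<le> (\<Sum>c\<in>?A. ?SC * ?h ^ (2 * Suc ?l) * (\<Sum>i\<in>UNIV. enn2real (?t i c)))"
    proof (rule sum_mono)
      fix c assume c: "c \<in> ?A"
      show "?err c \<le> ?SC * ?h ^ (2 * Suc ?l) * (\<Sum>i\<in>UNIV. enn2real (?t i c))"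
        unfolding grid_cell_def
        by (rule cell_error_integer[OF h sub[OF c] g _ wd])
          (use tl(2)[OF c] in \<open>auto simp: grid_cell_def\<close>)
    qed
    also have "\<dots> = ?SC * ?h ^ (2 * Suc ?l) * (\<Sum>i\<in>UNIV. \<Sum>c\<in>?A. enn2real (?t i c))"
      unfolding sum_distrib_left[symmetric] by (subst sum.swap) simp
    also have "\<dots> \<le> ?SC * ?h ^ (2 * Suc ?l) * (\<Sum>i\<in>(UNIV :: 'd set). L\<^sup>2)"
      using SC h by (intro mult_left_mono sum_mono tl(1)) auto
    also have "\<dots> = (?SC * ?d * 1) * ?h ^ (2 * Suc ?l) * L\<^sup>2" by simp
    also have "?h ^ (2 * Suc ?l) = real m powr (- (2 * \<alpha>))"
    proof -
      have "?h ^ (2 * Suc ?l) = ?h powr real (2 * Suc ?l)" using h by (simp only: powr_realpow)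
      also have "real (2 * Suc ?l) = 2 * \<alpha>" using \<alpha>l by simp
      also have "?h powr (2 * \<alpha>) = real m powr (- (2 * \<alpha>))" using m by (simp add: powr_divide powr_minus_divide)
      finally show ?thesis .
    qed
    also have "(?SC * ?d * 1) * real m powr (- (2 * \<alpha>)) * L\<^sup>2 \<le> sobolev_error_const TYPE('d) \<alpha> * real m powr (- (2 * \<alpha>)) * L\<^sup>2"
      unfolding sobolev_error_const_def using SC by (intro mult_right_mono mult_left_mono) auto
    finally show ?thesis .
  next
    case False
    let ?p = "2 * (\<alpha> - real ?l) + ?d"
    have p0: "0 < ?p" using sfloor_less[OF \<alpha>] by (simp add: add_pos_pos)
    let ?\<kappa> = "\<lambda>i :: 'd. pure_index i ?l"
    let ?D = "\<lambda>i. D (?\<kappa> i)"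
    let ?Di = "\<lambda>i x. indicator (interior cube) x * ?D i x"
    have wd: "weak_deriv g0 (?\<kappa> i) (?D i)" for i
      using D False by (simp add: mi_size_pure_index)
    have [measurable]: "?Di i \<in> borel_measurable borel" for i
      using wd[of i] locally_integrable_measurable unfolding weak_deriv_def by blast
    let ?S = "\<lambda>\<kappa>. \<integral>\<^sup>+x\<in>cube. (\<integral>\<^sup>+y\<in>cube. ennreal (\<bar>D \<kappa> x - D \<kappa> y\<bar>\<^sup>2 / norm (x - y) powr ?p) \<partial>lborel) \<partial>lborel"
    have Sle: "?S (?\<kappa> i) \<le> ennreal (L\<^sup>2)" for i
    proof -
      have "?S (?\<kappa> i) \<le> (\<Sum>\<kappa> | mi_size \<kappa> = ?l. ?S \<kappa>)"
        by (intro member_le_sum[of "?\<kappa> i" _ ?S]) (auto simp: mi_size_pure_index finite_mi_size)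
      then show ?thesis using D False by (auto dest: order_trans)
    qed
    let ?q = "\<lambda>i y x. ennreal (\<bar>?Di i y - ?Di i x\<bar>\<^sup>2 / norm (y - x) powr ?p)"
    let ?t = "\<lambda>i c. \<integral>\<^sup>+y. indicator (grid_cell m c) y * (\<integral>\<^sup>+x. indicator (grid_cell m c) x * ?q i y x \<partial>lborel) \<partial>lborel"
    have qm[measurable]: "(\<lambda>(y, x). ?q i y x) \<in> borel_measurable (borel \<Otimes>\<^sub>M borel)" for i
      unfolding case_prod_unfold by measurable
    have im[measurable]: "(\<lambda>y. \<integral>\<^sup>+x. indicator (grid_cell m c) x * ?q i y x \<partial>lborel) \<in> borel_measurable borel" for i c
      using lborel.borel_measurable_nn_integral[of "\<lambda>y x. indicator (grid_cell m c) x * ?q i y x" borel] by measurable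
    have tsum: "(\<Sum>c\<in>?A. ?t i c) \<le> ennreal (L\<^sup>2)" for i
    proof -
      have "(\<Sum>c\<in>?A. ?t i c) = (\<integral>\<^sup>+y. (\<Sum>c\<in>?A. indicator (grid_cell m c) y * (\<integral>\<^sup>+x. indicator (grid_cell m c) x * ?q i y x \<partial>lborel)) \<partial>lborel)"
        by (rule nn_integral_sum[symmetric]) measurable
      also have "\<dots> \<le> ?S (?\<kappa> i)"
      proof (rule nn_integral_mono)
        fix y
        let ?u = "\<integral>\<^sup>+x\<in>cube. ennreal (\<bar>?D i y - ?D i x\<bar>\<^sup>2 / norm (y - x) powr ?p) \<partial>lborel"
        have "(\<Sum>c\<in>?A. indicator (grid_cell m c) y * (\<integral>\<^sup>+x. indicator (grid_cell m c) x * ?q i y x \<partial>lborel)) \<le>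
          indicator (interior cube) y * ?u"
        proof (rule sum_grid_cell_le[OF m])
          fix c assume c: "c \<in> ?A" "y \<in> grid_cell m c"
          have "grid_cell m c \<subseteq> interior cube" by (rule grid_cell_subset_interior[OF c(1) m])
          then show "(\<integral>\<^sup>+x. indicator (grid_cell m c) x * ?q i y x \<partial>lborel) \<le> ?u"
            using c(2) interior_subset[of cube] by (intro nn_integral_mono) (auto simp: indicator_def)
        qed
        also have "\<dots> \<le> ?u * indicator cube y" using interior_subset[of cube] by (auto simp: indicator_def)
        finally show "(\<Sum>c\<in>?A. indicator (grid_cell m c) y * (\<integral>\<^sup>+x. indicator (grid_cell m c) x * ?q i y x \<partial>lborel)) \<le> ?u * indicator cube y" .
      qed
      finally show ?thesis using Sle[of i] by (rule order_trans)
    qed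
    note tl = sum_le_of_ennreal[OF finite_cell_indices tsum zero_le_power2]
    \<comment> \<open>Points of one cell are at distance at most \<open>?d * ?h\<close>, so removing
      the singular kernel costs this factor. Its part \<open>?h powr ?d\<close> cancels the volume
      of the cell, and the rest supplies the fractional exponent.\<close>
    let ?R = "(?d * ?h) powr ?p"
    have "(\<Sum>c\<in>?A. ?err c) \<le> (\<Sum>c\<in>?A. ?SC * ?h ^ (2 * ?l) / ?h ^ CARD('d) * (\<Sum>i\<in>UNIV. ?R * enn2real (?t i c)))"
    proof (rule sum_mono)
      fix c assume c: "c \<in> ?A"
      have E: "(\<integral>\<^sup>+y. indicator (grid_cell m c) y * (\<integral>\<^sup>+x. indicator (grid_cell m c) x *
           ennreal ((?Di i x - ?Di i y)\<^sup>2) \<partial>lborel) \<partial>lborel) \<le> ennreal (?R * enn2real (?t i c))" for i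
      proof -
        have pt: "(?Di i x - ?Di i y)\<^sup>2 \<le> ?R * (\<bar>?Di i y - ?Di i x\<bar>\<^sup>2 / norm (y - x) powr ?p)"
          if xy: "x \<in> grid_cell m c" "y \<in> grid_cell m c" for x y
        proof (cases "x = y")
          case ne: False
          have "norm (y - x) powr ?p \<le> ?R"
            using diameter_grid_cell[OF xy(2,1)] p0 by (intro powr_mono2) auto
          moreover have "0 < norm (y - x) powr ?p" using ne by simp
          ultimately have "1 \<le> ?R / norm (y - x) powr ?p" by (simp add: pos_le_divide_eq)
          from mult_right_mono[OF this zero_le_power2[of "?Di i x - ?Di i y"]]
          show ?thesis by (simp add: power2_commute)
        qed simp
        have "(\<integral>\<^sup>+y. indicator (grid_cell m c) y * (\<integral>\<^sup>+x. indicator (grid_cell m c) x * ennreal ((?Di i x - ?Di i y)\<^sup>2) \<partial>lborel) \<partial>lborel)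
          \<le> (\<integral>\<^sup>+y. ennreal ?R * (indicator (grid_cell m c) y * (\<integral>\<^sup>+x. indicator (grid_cell m c) x * ?q i y x \<partial>lborel)) \<partial>lborel)"
        proof (rule nn_integral_mono)
          fix y
          show "indicator (grid_cell m c) y * (\<integral>\<^sup>+x. indicator (grid_cell m c) x * ennreal ((?Di i x - ?Di i y)\<^sup>2) \<partial>lborel)
            \<le> ennreal ?R * (indicator (grid_cell m c) y * (\<integral>\<^sup>+x. indicator (grid_cell m c) x * ?q i y x \<partial>lborel))"
          proof (cases "y \<in> grid_cell m c")
            case y: True
            have "(\<integral>\<^sup>+x. indicator (grid_cell m c) x * ennreal ((?Di i x - ?Di i y)\<^sup>2) \<partial>lborel) \<le>
              (\<integral>\<^sup>+x. ennreal ?R * (indicator (grid_cell m c) x * ?q i y x) \<partial>lborel)"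
            proof (rule nn_integral_mono)
              fix x
              show "indicator (grid_cell m c) x * ennreal ((?Di i x - ?Di i y)\<^sup>2) \<le> ennreal ?R * (indicator (grid_cell m c) x * ?q i y x)"
              proof (cases "x \<in> grid_cell m c")
                case True
                have "ennreal ((?Di i x - ?Di i y)\<^sup>2) \<le> ennreal (?R * (\<bar>?Di i y - ?Di i x\<bar>\<^sup>2 / norm (y - x) powr ?p))"
                  by (rule ennreal_leI[OF pt[OF True y]])
                also have "\<dots> = ennreal ?R * ?q i y x" by (rule ennreal_mult') simp
                finally show ?thesis using True by simp
              qed simp
            qed
            also have "\<dots> = ennreal ?R * (\<integral>\<^sup>+x. indicator (grid_cell m c) x * ?q i y x \<partial>lborel)"
              by (rule nn_integral_cmult) measurable
            finally show ?thesis using y by simp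
          qed simp
        qed
        also have "\<dots> = ennreal ?R * ?t i c" by (rule nn_integral_cmult) measurable
        also have "\<dots> \<le> ennreal ?R * ennreal (enn2real (?t i c))" by (intro mult_left_mono tl(2)[OF c]) simp
        also have "\<dots> = ennreal (?R * enn2real (?t i c))" by (rule ennreal_mult'[symmetric]) simp
        finally show ?thesis .
      qed
      show "?err c \<le> ?SC * ?h ^ (2 * ?l) / ?h ^ CARD('d) * (\<Sum>i\<in>UNIV. ?R * enn2real (?t i c))"
        unfolding grid_cell_def
        by (rule cell_error_fractional[OF h sub[OF c] g _ wd])
          (use E in \<open>auto simp: grid_cell_def\<close>)
    qed
    also have "\<dots> = ?SC * ?h ^ (2 * ?l) / ?h ^ CARD('d) * ?R * (\<Sum>i\<in>UNIV. \<Sum>c\<in>?A. enn2real (?t i c))"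
      unfolding sum_distrib_left[symmetric] by (subst sum.swap) simp
    also have "\<dots> \<le> ?SC * ?h ^ (2 * ?l) / ?h ^ CARD('d) * ?R * (\<Sum>i\<in>(UNIV :: 'd set). L\<^sup>2)"
      using SC h by (intro mult_left_mono sum_mono tl(1)) auto
    also have "\<dots> = (?SC * ?d * (?d powr ?p)) * (?h ^ (2 * ?l) / ?h ^ CARD('d) * ?h powr ?p) * L\<^sup>2"
    proof -
      have R: "?R = ?d powr ?p * ?h powr ?p" by (rule powr_mult)
      show ?thesis unfolding R by simp
    qed
    also have "?h ^ (2 * ?l) / ?h ^ CARD('d) * ?h powr ?p = real m powr (- (2 * \<alpha>))"
    proof -
      have "?h ^ (2 * ?l) / ?h ^ CARD('d) * ?h powr ?p = ?h powr real (2 * ?l) / ?h powr ?d * ?h powr ?p"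
        using h by (simp only: powr_realpow)
      also have "\<dots> = ?h powr (real (2 * ?l) - ?d + ?p)" by (simp only: powr_diff powr_add)
      also have "real (2 * ?l) - ?d + ?p = 2 * \<alpha>" by simp
      also have "?h powr (2 * \<alpha>) = real m powr (- (2 * \<alpha>))" using m by (simp add: powr_divide powr_minus_divide)
      finally show ?thesis .
    qed
    also have "(?SC * ?d * (?d powr ?p)) * real m powr (- (2 * \<alpha>)) * L\<^sup>2 \<le> sobolev_error_const TYPE('d) \<alpha> * real m powr (- (2 * \<alpha>)) * L\<^sup>2"
      unfolding sobolev_error_const_def using SC by (intro mult_right_mono mult_left_mono) auto
    finally show ?thesis .
  qed
qed

section \<open>Low-rank approximation of the edge probabilities\<close>

text \<open>Extends a graphon to a Borel function on the whole space with values still in [0, 1], as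
  lemmas about \<open>lborel\<close> require.\<close>

definition to_cube :: "real ^ 'd::finite \<Rightarrow> real ^ 'd" where
  "to_cube x = (if x \<in> cube then x else 0)"

lemma to_cube_in: "to_cube x \<in> cube" and to_cube_id: "x \<in> cube \<Longrightarrow> to_cube x = x"
  by (auto simp: to_cube_def cube_def)

lemma cube_measurable [measurable]: "cube \<in> sets borel"
proof -
  have "{x \<in> space borel. \<forall>i\<in>UNIV. 0 \<le> x $ i \<and> x $ i < 1} \<in> sets (borel :: (real ^ 'a) measure)"
    by measurable
  then show ?thesis by (simp add: cube_def)
qed

lemma to_cube_measurable [measurable]: "to_cube \<in> borel \<rightarrow>\<^sub>M restrict_space borel cube"
proof (rule measurable_restrict_space2)
  show "to_cube \<in> borel \<rightarrow>\<^sub>M borel" unfolding to_cube_def[abs_def] by measurable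
qed (auto simp: to_cube_in)

lemma graphon_extension_measurable:
  assumes "graphon f"
  shows "(\<lambda>(x, y). f (to_cube x) (to_cube y)) \<in> borel_measurable (borel \<Otimes>\<^sub>M borel)"
proof -
  have [measurable]: "case_prod f \<in> borel_measurable (restrict_space borel cube \<Otimes>\<^sub>M restrict_space borel cube)"
    using assms by (simp add: graphon_def)
  have "(\<lambda>z. case_prod f (to_cube (fst z), to_cube (snd z))) \<in> borel_measurable (borel \<Otimes>\<^sub>M borel)"
    by measurable
  then show ?thesis by (simp add: case_prod_unfold)
qed

lemma graphon_bounds: "graphon f \<Longrightarrow> x \<in> cube \<Longrightarrow> y \<in> cube \<Longrightarrow> 0 \<le> f x y \<and> f x y \<le> 1 \<and> f x y = f y x"
  by (simp add: graphon_def)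

definition feature_sum :: "nat \<Rightarrow> nat \<Rightarrow> (('d::finite \<Rightarrow> nat) \<times> ('d \<Rightarrow> nat) \<Rightarrow> real) \<Rightarrow> real ^ 'd \<Rightarrow> real" where
  "feature_sum m l a x = (\<Sum>F\<in>feature_indices m l. a F * feature m F x)"

text \<open>Test functions live on open cells and features on half-open ones; the two differ by a
  null set.\<close>

lemma nn_integral_cell:
  assumes "0 < m"
  shows "(\<integral>\<^sup>+x. indicator (cell m c) x * F x \<partial>lborel) = (\<integral>\<^sup>+x. indicator (grid_cell m c) x * F x \<partial>lborel)"
proof (rule nn_integral_cong_AE)
  let ?l = "\<chi> i. real (c i) / real m" and ?u = "\<chi> i. real (c i) / real m + 1 / real m"
  have "AE x in lborel. x \<notin> cbox ?l ?u - box ?l ?u" by (rule AE_not_in[OF null_sets_cbox_Diff_box])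
  then show "AE x in lborel. indicator (cell m c) x * F x = indicator (grid_cell m c) x * F x"
  proof eventually_elim
    case (elim x)
    have "cell m c \<subseteq> cbox ?l ?u"
      using assms by (auto simp: cell_def mem_box_cart field_simps less_imp_le)
    then have "x \<in> cell m c \<longleftrightarrow> x \<in> grid_cell m c"
      using elim grid_cell_subset_cell[OF assms, of c] unfolding grid_cell_def open_cell_box by blast
    then show ?case by (simp add: indicator_def)
  qed
qed

lemma cell_measurable [measurable]: "cell m c \<in> sets borel"
proof -
  have "{x \<in> space borel. \<forall>i\<in>UNIV. real (c i) \<le> real m * x $ i \<and> real m * x $ i < real (c i) + 1} \<in> sets (borel :: (real ^ 'a) measure)"
    by measurable
  then show ?thesis by (simp add: cell_def)
qed

lemma feature_measurable [measurable]: "feature m F \<in> borel_measurable borel"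
proof -
  show ?thesis unfolding feature_def case_prod_unfold by measurable
qed

text \<open>The common consequence of the two smoothness conditions: \<open>f\<close> is within \<open>e\<close> of functions
  \<open>p\<close> for which the matrix \<open>p (x i) (x j)\<close> has rank at most the number of features.\<close>

definition feature_approximable ::
    "(real ^ 'd::finite) measure \<Rightarrow> (real ^ 'd \<Rightarrow> real ^ 'd \<Rightarrow> real) \<Rightarrow> real \<Rightarrow> real \<Rightarrow> bool" where
  "feature_approximable \<mu> f \<alpha> K \<longleftrightarrow> (\<forall>m\<ge>1. \<exists>a e.
     (\<forall>x\<in>cube. \<forall>y\<in>cube. (f x y - feature_sum m (sfloor \<alpha>) (a y) x)\<^sup>2 \<le> e x y) \<and>
     (\<forall>x\<in>cube. (feature_sum m (sfloor \<alpha>) (a x) x)\<^sup>2 \<le> K) \<and>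
     case_prod e \<in> borel_measurable (\<mu> \<Otimes>\<^sub>M \<mu>) \<and> (\<forall>x y. 0 \<le> e x y) \<and>
     (\<integral>\<^sup>+y. (\<integral>\<^sup>+x. ennreal (e x y) \<partial>\<mu>) \<partial>\<mu>) \<le> ennreal (K * real m powr (- (2 * \<alpha>))))"

text \<open>The coefficients are chosen separately for each \<open>y\<close> and may fail to be
  measurable in \<open>y\<close>, so the majorant \<open>e\<close> is a constant.\<close>

lemma hoelder_feature_approximable:
  fixes f :: "real ^ 'd::finite \<Rightarrow> real ^ 'd \<Rightarrow> real"
  assumes \<alpha>: "0 < \<alpha>" and \<mu>: "prob_space \<mu>" and f: "graphon f" and hc: "hoelder_condition \<alpha> L f"
  shows "\<exists>K. feature_approximable \<mu> f \<alpha> K"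
proof -
  interpret prob_space \<mu> by (rule \<mu>)
  define K1 where "K1 = real CARD('d) ^ sfloor \<alpha> * (\<Sum>k | mi_size (k :: 'd multi_index) = sfloor \<alpha>. mi_fact k) * L"
  show ?thesis
  proof (intro exI[of _ "(1 + \<bar>K1\<bar>)\<^sup>2"], unfold feature_approximable_def, intro allI impI)
    fix m :: nat assume m: "1 \<le> m"
    let ?e = "(\<bar>K1\<bar> * real m powr (- \<alpha>))\<^sup>2"
    have "\<forall>y\<in>cube. \<exists>a. \<forall>x\<in>cube. \<bar>f x y - feature_sum m (sfloor \<alpha>) a x\<bar> \<le> K1 * real m powr (- \<alpha>)"
      using hoelder_approximation[OF _ \<alpha>, of _ L m] hc m unfolding hoelder_condition_def feature_sum_def K1_def by auto
    then obtain a where a: "\<And>x y. x \<in> cube \<Longrightarrow> y \<in> cube \<Longrightarrow>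
      \<bar>f x y - feature_sum m (sfloor \<alpha>) (a y) x\<bar> \<le> K1 * real m powr (- \<alpha>)" by metis
    have a': "\<bar>f x y - feature_sum m (sfloor \<alpha>) (a y) x\<bar> \<le> \<bar>K1\<bar> * real m powr (- \<alpha>)" if "x \<in> cube" "y \<in> cube" for x y
      using a[OF that] by (rule order_trans) (intro mult_right_mono, auto)
    have m1: "real m powr (- \<alpha>) \<le> 1"
    proof -
      have "1 \<le> real m powr \<alpha>" using m \<alpha> by (intro ge_one_powr_ge_zero) auto
      then show ?thesis using m by (simp add: powr_minus inverse_le_1_iff)
    qed
    show "\<exists>a e. (\<forall>x\<in>cube. \<forall>y\<in>cube. (f x y - feature_sum m (sfloor \<alpha>) (a y) x)\<^sup>2 \<le> e x y) \<and>
     (\<forall>x\<in>cube. (feature_sum m (sfloor \<alpha>) (a x) x)\<^sup>2 \<le> (1 + \<bar>K1\<bar>)\<^sup>2) \<and>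
     case_prod e \<in> borel_measurable (\<mu> \<Otimes>\<^sub>M \<mu>) \<and> (\<forall>x y. 0 \<le> e x y) \<and>
     (\<integral>\<^sup>+y. (\<integral>\<^sup>+x. ennreal (e x y) \<partial>\<mu>) \<partial>\<mu>) \<le> ennreal ((1 + \<bar>K1\<bar>)\<^sup>2 * real m powr (- (2 * \<alpha>)))"
    proof (intro exI[of _ a] exI[of _ "\<lambda>_ _. ?e"] conjI ballI allI)
      fix x y :: "real ^ 'd" assume "x \<in> cube" "y \<in> cube"
      then show "(f x y - feature_sum m (sfloor \<alpha>) (a y) x)\<^sup>2 \<le> ?e"
        using a' by (intro abs_le_square_iff[THEN iffD1]) (auto intro: order_trans[OF _ abs_ge_self])
    next
      fix x :: "real ^ 'd" assume x: "x \<in> cube"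
      have "\<bar>K1\<bar> * real m powr (- \<alpha>) \<le> \<bar>K1\<bar> * 1" using m1 by (intro mult_left_mono) auto
      then have "\<bar>feature_sum m (sfloor \<alpha>) (a x) x\<bar> \<le> 1 + \<bar>K1\<bar>"
        using a'[OF x x] graphon_bounds[OF f x x] by linarith
      then have "\<bar>feature_sum m (sfloor \<alpha>) (a x) x\<bar> \<le> \<bar>1 + \<bar>K1\<bar>\<bar>" by simp
      then show "(feature_sum m (sfloor \<alpha>) (a x) x)\<^sup>2 \<le> (1 + \<bar>K1\<bar>)\<^sup>2" by (simp only: abs_le_square_iff)
    next
      have "?e \<le> (1 + \<bar>K1\<bar>)\<^sup>2 * real m powr (- (2 * \<alpha>))"
      proof -
        have "?e = \<bar>K1\<bar>\<^sup>2 * real m powr (- (2 * \<alpha>))"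
        proof -
          have "(real m powr (- \<alpha>))\<^sup>2 = real m powr (- \<alpha> + - \<alpha>)" unfolding power2_eq_square by (rule powr_add[symmetric])
          then show ?thesis unfolding power_mult_distrib by simp
        qed
        also have "\<dots> \<le> (1 + \<bar>K1\<bar>)\<^sup>2 * real m powr (- (2 * \<alpha>))" by (intro mult_right_mono power_mono) auto
        finally show ?thesis .
      qed
      then show "(\<integral>\<^sup>+y. (\<integral>\<^sup>+x. ennreal ?e \<partial>\<mu>) \<partial>\<mu>) \<le> ennreal ((1 + \<bar>K1\<bar>)\<^sup>2 * real m powr (- (2 * \<alpha>)))"
        by (simp add: emeasure_space_1 ennreal_leI)
    qed auto
  qed
qed

text \<open>Only an integrated bound is available here, so \<open>e\<close> is the squared error
  itself. It is measurable because the coefficients are built from parameter integrals of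
  \<open>f\<close>.\<close>

lemma sobolev_feature_approximable:
  fixes f :: "real ^ 'd::finite \<Rightarrow> real ^ 'd \<Rightarrow> real"
  assumes \<alpha>: "0 < \<alpha>" and f: "graphon f" and sc: "sobolev_condition \<mu> \<alpha> L f"
  shows "\<exists>K. feature_approximable \<mu> f \<alpha> K"
proof -
  let ?l = "sfloor \<alpha>"
  obtain w where \<mu>: "\<mu> = restrict_space lborel cube" and w: "w \<in> borel_measurable (restrict_space borel cube)"
    and wL: "(\<integral>\<^sup>+y\<in>cube. ennreal ((w y)\<^sup>2) \<partial>lborel) \<le> ennreal (L\<^sup>2)"
    and fs: "\<And>y. y \<in> cube \<Longrightarrow> (\<lambda>x. f x y) \<in> sobolev_class \<alpha> (w y)"
    using sc unfolding sobolev_condition_def by blast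
  have sets_\<mu>: "sets \<mu> = sets (restrict_space borel cube)" unfolding \<mu> by (intro sets_restrict_space_cong) simp
  have space_\<mu>: "space \<mu> = cube" by (simp add: \<mu> space_restrict_space)
  define g where "g y x = f (to_cube x) (to_cube y)" for y x
  have gm2: "(\<lambda>(x, y). g y x) \<in> borel_measurable (borel \<Otimes>\<^sub>M borel)"
    unfolding g_def by (rule graphon_extension_measurable[OF f])
  have gm: "g y \<in> borel_measurable borel" for y
    using measurable_compose[OF measurable_Pair[OF measurable_ident measurable_const[of y]] gm2] by simp
  have gm2'[measurable]: "(\<lambda>z. g (fst z) (snd z)) \<in> borel_measurable (borel \<Otimes>\<^sub>M borel)"
    using measurable_compose[OF measurable_Pair[OF measurable_snd measurable_fst] gm2] by simp
  have g1: "\<bar>g y x\<bar> \<le> 1" for x y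
    using graphon_bounds[OF f to_cube_in to_cube_in, of x y] by (simp add: g_def)
  have gf: "g y x = f x y" if "x \<in> cube" "y \<in> cube" for x y using that by (simp add: g_def to_cube_id)
  define KP where "KP = (\<Sum>j\<in>(degrees ?l :: ('d \<Rightarrow> nat) set). \<Prod>i\<in>UNIV. bump_const (j i))"
  \<comment> \<open>The first summand serves the diagonal, the second the integrated error.\<close>
  let ?K = "KP\<^sup>2 + sobolev_error_const TYPE('d) \<alpha> * L\<^sup>2"
  have SE: "0 < sobolev_error_const TYPE('d) \<alpha>" by (rule sobolev_error_const_pos)
  show ?thesis
  proof (intro exI[of _ ?K], unfold feature_approximable_def, intro allI impI)
    fix m :: nat assume "1 \<le> m"
    then have m: "0 < m" by simp
    let ?h = "1 / real m" and ?a = "\<lambda>(c :: 'd \<Rightarrow> nat) i. real (c i) / real m"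
    have h: "0 < ?h" using m by simp
    have "\<forall>c. \<exists>P. \<forall>g x. (\<forall>i. x $ i \<in> {?a c i..?a c i + ?h}) \<longrightarrow> poly_approx (?a c) ?h ?l g x =
      (\<Sum>k\<in>degrees ?l. (\<Sum>j\<in>degrees ?l. P j k * poly_coeff (?a c) ?h g j) * (\<Prod>i\<in>UNIV. ((x $ i - ?a c i) / ?h) ^ k i))"
      by (rule allI, rule poly_approx_features[OF h])
    then obtain P where P0: "\<forall>c g x. (\<forall>i. x $ i \<in> {?a c i..?a c i + ?h}) \<longrightarrow> poly_approx (?a c) ?h ?l g x =
      (\<Sum>k\<in>degrees ?l. (\<Sum>j\<in>degrees ?l. P c j k * poly_coeff (?a c) ?h g j) * (\<Prod>i\<in>UNIV. ((x $ i - ?a c i) / ?h) ^ k i))"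
      by (rule choice[THEN exE])
    note P = P0[rule_format]
    define a where "a y = (\<lambda>(c, k). \<Sum>j\<in>degrees ?l. P c j k * poly_coeff (?a c) ?h (g y) j)" for y
    have cell_Icc: "x $ i \<in> {?a c i..?a c i + ?h}" if "x \<in> cell m c" for x c i
      using that m by (auto simp: cell_def field_simps less_imp_le)
    have p: "feature_sum m ?l (a y) x = poly_approx (?a c) ?h ?l (g y) x" if c: "c \<in> cell_indices m" "x \<in> cell m c" for x y c
    proof -
      have "(x $ i - ?a c i) / ?h = real m * x $ i - real (c i)" for i using m by (simp add: field_simps)
      then have "poly_approx (?a c) ?h ?l (g y) x = (\<Sum>k\<in>degrees ?l. a y (c, k) * (\<Prod>i\<in>UNIV. (real m * x $ i - real (c i)) ^ k i))"
        unfolding P[OF cell_Icc[OF c(2)]] by (simp add: a_def)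
      then show ?thesis unfolding feature_sum_def feature_sum_on_cell[OF c(2,1)] by simp
    qed
    define e where "e x y = (g y x - feature_sum m ?l (a y) x)\<^sup>2" for x y
    have coeff_m: "(\<lambda>y. poly_coeff (?a c) ?h (g y) j) \<in> borel_measurable borel" for c j
    proof -
      have [measurable]: "(deriv ^^ j i) (bump (?a c i) ?h) \<in> borel_measurable borel" for i
        by (intro borel_measurable_continuous_onI smooth_continuous smooth_derivs smooth_bump)
      have "(\<lambda>(y, z). g y z * (\<Prod>i\<in>UNIV. (deriv ^^ j i) (bump (?a c i) ?h) (z $ i))) \<in> borel_measurable (borel \<Otimes>\<^sub>M lborel)"
        unfolding case_prod_unfold by measurable
      then show ?thesis unfolding poly_coeff_def by (rule lborel.borel_measurable_lebesgue_integral)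
    qed
    have [measurable]: "(\<lambda>y. a y F) \<in> borel_measurable borel" for F
      unfolding a_def case_prod_unfold by (intro borel_measurable_sum borel_measurable_times borel_measurable_const coeff_m)
    have em: "(\<lambda>z. e (fst z) (snd z)) \<in> borel_measurable (borel \<Otimes>\<^sub>M borel)"
    proof -
      have [measurable]: "(\<lambda>z. g (snd z) (fst z)) \<in> borel_measurable (borel \<Otimes>\<^sub>M borel)"
        using gm2 by (simp add: case_prod_unfold)
      have "(\<lambda>z. feature_sum m ?l (a (snd z)) (fst z)) \<in> borel_measurable (borel \<Otimes>\<^sub>M borel)"
        unfolding feature_sum_def by measurable
      then show ?thesis unfolding e_def by measurable
    qed
    have id\<mu>: "(\<lambda>x. x) \<in> \<mu> \<rightarrow>\<^sub>M borel"
      unfolding \<mu> by (rule measurable_restrict_space1) simp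
    have inner: "(\<integral>\<^sup>+x. ennreal (e x y) \<partial>\<mu>) \<le> ennreal (sobolev_error_const TYPE('d) \<alpha> * real m powr (- (2 * \<alpha>))) * ennreal ((w y)\<^sup>2)"
      if y: "y \<in> cube" for y
    proof -
      let ?err = "\<lambda>c. LINT x|lborel. ((g y x - poly_approx (?a c) ?h ?l (g y) x) * indicator (grid_cell m c) x)\<^sup>2"
      have [measurable]: "(\<lambda>x. e x y) \<in> borel_measurable borel"
        using measurable_compose[OF measurable_Pair[OF measurable_ident measurable_const[of y]] em] by simp
      have "(\<integral>\<^sup>+x. ennreal (e x y) \<partial>\<mu>) = (\<integral>\<^sup>+x. ennreal (e x y) * indicator cube x \<partial>lborel)"
        unfolding \<mu> by (subst nn_integral_restrict_space) auto
      also have "\<dots> = (\<integral>\<^sup>+x. (\<Sum>c\<in>cell_indices m. indicator (cell m c) x * ennreal (e x y)) \<partial>lborel)"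
      proof (rule nn_integral_cong)
        fix x :: "real ^ 'd"
        show "ennreal (e x y) * indicator cube x = (\<Sum>c\<in>cell_indices m. indicator (cell m c) x * ennreal (e x y))"
        proof (cases "x \<in> cube")
          case True
          obtain c where c: "c \<in> cell_indices m" "x \<in> cell m c" using cell_exists[OF True m] by blast
          have "(\<Sum>c'\<in>cell_indices m. indicator (cell m c') x * ennreal (e x y)) = (\<Sum>c'\<in>cell_indices m. if c' = c then ennreal (e x y) else 0)"
          proof (rule sum.cong[OF refl])
            fix c' :: "'d \<Rightarrow> nat"
            show "indicator (cell m c') x * ennreal (e x y) = (if c' = c then ennreal (e x y) else 0)"
            proof (cases "c' = c")
              case False
              then have "x \<notin> cell m c'" using cell_unique[OF c(2)] by blast
              then show ?thesis using False by simp
            qed (simp add: c(2))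
          qed
          also have "\<dots> = ennreal (e x y)" by (subst sum.delta[OF finite_cell_indices]) (simp add: c(1))
          finally show ?thesis using True by simp
        next
          case False
          then have "x \<notin> cell m c" if "c \<in> cell_indices m" for c using cell_subset_cube[OF that m] by blast
          then show ?thesis using False by simp
        qed
      qed
      also have "\<dots> = (\<Sum>c\<in>cell_indices m. \<integral>\<^sup>+x. indicator (cell m c) x * ennreal (e x y) \<partial>lborel)"
        by (rule nn_integral_sum) measurable
      also have "\<dots> = (\<Sum>c\<in>cell_indices m. ennreal (?err c))"
      proof (rule sum.cong[OF refl])
        fix c :: "'d \<Rightarrow> nat" assume c: "c \<in> cell_indices m"
        let ?v = "\<lambda>x. ((g y x - poly_approx (?a c) ?h ?l (g y) x) * indicator (grid_cell m c) x)\<^sup>2"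
        have "(\<integral>\<^sup>+x. indicator (cell m c) x * ennreal (e x y) \<partial>lborel) = (\<integral>\<^sup>+x. indicator (grid_cell m c) x * ennreal (e x y) \<partial>lborel)"
          by (rule nn_integral_cell[OF m])
        also have "\<dots> = (\<integral>\<^sup>+x. ennreal (?v x) \<partial>lborel)"
        proof (rule nn_integral_cong)
          fix x :: "real ^ 'd"
          show "indicator (grid_cell m c) x * ennreal (e x y) = ennreal (?v x)"
            using p[OF c] grid_cell_subset_cell[OF m, of c] by (auto simp: e_def indicator_def)
        qed
        also have "\<dots> = ennreal (?err c)"
        proof (rule nn_integral_eq_integral)
          have pm: "(\<lambda>x. poly_approx (?a c) ?h ?l (g y) x * indicator (grid_cell m c) x) \<in> borel_measurable borel"
            unfolding grid_cell_def by (rule poly_approx_measurable[OF h])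
          have [measurable]: "g y \<in> borel_measurable borel" by (rule gm)
          have "(\<lambda>x. (g y x * indicator (grid_cell m c) x - poly_approx (?a c) ?h ?l (g y) x * indicator (grid_cell m c) x)\<^sup>2) \<in> borel_measurable borel"
            using pm by measurable
          then have vm: "?v \<in> borel_measurable borel" by (simp add: left_diff_distrib)
          show "integrable lborel ?v"
          proof (rule bounded_cell_integrable[OF vm, where M = "(1 + KP)\<^sup>2" and a = "?a c" and h = "?h"])
            fix x :: "real ^ 'd"
            show "\<bar>?v x\<bar> \<le> (1 + KP)\<^sup>2"
            proof (cases "x \<in> grid_cell m c")
              case True
              then have "\<bar>poly_approx (?a c) ?h ?l (g y) x\<bar> \<le> KP"
                unfolding KP_def using grid_cell_subset_cell[OF m, of c]
                by (intro abs_poly_approx_le[OF h gm g1] cell_Icc) auto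
              then have "\<bar>g y x - poly_approx (?a c) ?h ?l (g y) x\<bar> \<le> \<bar>1 + KP\<bar>" using g1[of y x] by linarith
              then have "(g y x - poly_approx (?a c) ?h ?l (g y) x)\<^sup>2 \<le> (1 + KP)\<^sup>2" by (simp only: abs_le_square_iff)
              then show ?thesis using True by simp
            qed simp
          qed (simp add: grid_cell_def)
        qed simp
        finally show "(\<integral>\<^sup>+x. indicator (cell m c) x * ennreal (e x y) \<partial>lborel) = ennreal (?err c)" .
      qed
      also have "\<dots> = ennreal (\<Sum>c\<in>cell_indices m. ?err c)" by (intro sum_ennreal) auto
      also have "\<dots> \<le> ennreal (sobolev_error_const TYPE('d) \<alpha> * real m powr (- (2 * \<alpha>)) * (w y)\<^sup>2)"
        by (intro ennreal_leI sobolev_cells_sum[OF fs[OF y] \<alpha> m gm g1]) (simp add: gf y)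
      also have "\<dots> = ennreal (sobolev_error_const TYPE('d) \<alpha> * real m powr (- (2 * \<alpha>))) * ennreal ((w y)\<^sup>2)"
        using SE by (intro ennreal_mult') simp
      finally show ?thesis .
    qed
    show "\<exists>a e. (\<forall>x\<in>cube. \<forall>y\<in>cube. (f x y - feature_sum m ?l (a y) x)\<^sup>2 \<le> e x y) \<and>
     (\<forall>x\<in>cube. (feature_sum m ?l (a x) x)\<^sup>2 \<le> ?K) \<and>
     case_prod e \<in> borel_measurable (\<mu> \<Otimes>\<^sub>M \<mu>) \<and> (\<forall>x y. 0 \<le> e x y) \<and>
     (\<integral>\<^sup>+y. (\<integral>\<^sup>+x. ennreal (e x y) \<partial>\<mu>) \<partial>\<mu>) \<le> ennreal (?K * real m powr (- (2 * \<alpha>)))"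
    proof (intro exI[of _ a] exI[of _ e] conjI ballI allI)
      fix x y :: "real ^ 'd" assume "x \<in> cube" "y \<in> cube"
      then show "(f x y - feature_sum m ?l (a y) x)\<^sup>2 \<le> e x y" by (simp add: e_def gf)
    next
      fix x :: "real ^ 'd" assume x: "x \<in> cube"
      obtain c where c: "c \<in> cell_indices m" "x \<in> cell m c" using cell_exists[OF x m] by blast
      have "\<bar>feature_sum m ?l (a x) x\<bar> \<le> KP"
        unfolding p[OF c] KP_def by (intro abs_poly_approx_le[OF h gm g1] cell_Icc c)
      then have "(feature_sum m ?l (a x) x)\<^sup>2 \<le> KP\<^sup>2" by (intro abs_le_square_iff[THEN iffD1]) simp
      also have "\<dots> \<le> ?K" using SE by simp
      finally show "(feature_sum m ?l (a x) x)\<^sup>2 \<le> ?K" .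
    next
      have "(\<lambda>z. e (fst z) (snd z)) \<in> borel_measurable (\<mu> \<Otimes>\<^sub>M \<mu>)"
        using measurable_compose[OF measurable_Pair[OF measurable_compose[OF measurable_fst id\<mu>] measurable_compose[OF measurable_snd id\<mu>]] em]
        by simp
      then show "case_prod e \<in> borel_measurable (\<mu> \<Otimes>\<^sub>M \<mu>)" by (simp add: case_prod_unfold)
    next
      let ?C = "sobolev_error_const TYPE('d) \<alpha> * real m powr (- (2 * \<alpha>))"
      have w\<mu>: "w \<in> borel_measurable \<mu>" using w by (simp add: measurable_cong_sets[OF sets_\<mu> refl])
      have "(\<integral>\<^sup>+y. (\<integral>\<^sup>+x. ennreal (e x y) \<partial>\<mu>) \<partial>\<mu>) \<le> (\<integral>\<^sup>+y. ennreal ?C * ennreal ((w y)\<^sup>2) \<partial>\<mu>)"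
        by (intro nn_integral_mono inner) (simp add: space_\<mu>)
      also have "\<dots> = ennreal ?C * (\<integral>\<^sup>+y. ennreal ((w y)\<^sup>2) \<partial>\<mu>)" using w\<mu> by (intro nn_integral_cmult) measurable
      also have "(\<integral>\<^sup>+y. ennreal ((w y)\<^sup>2) \<partial>\<mu>) = (\<integral>\<^sup>+y\<in>cube. ennreal ((w y)\<^sup>2) \<partial>lborel)"
        unfolding \<mu> by (subst nn_integral_restrict_space) auto
      also have "ennreal ?C * (\<integral>\<^sup>+y\<in>cube. ennreal ((w y)\<^sup>2) \<partial>lborel) \<le> ennreal ?C * ennreal (L\<^sup>2)"
        by (intro mult_left_mono wL) simp
      also have "\<dots> = ennreal (?C * L\<^sup>2)" using SE by (intro ennreal_mult'[symmetric]) simp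
      also have "\<dots> \<le> ennreal (?K * real m powr (- (2 * \<alpha>)))"
        by (intro ennreal_leI) (simp add: algebra_simps)
      finally show "(\<integral>\<^sup>+y. (\<integral>\<^sup>+x. ennreal (e x y) \<partial>\<mu>) \<partial>\<mu>) \<le> ennreal (?K * real m powr (- (2 * \<alpha>)))" .
    qed (simp add: e_def)
  qed
qed

section \<open>The mean squared error\<close>

text \<open>The constant of \<open>svt_frobenius\<close> with
  \<open>\<epsilon> = \<delta> / (4 * (1 + \<delta>))\<close> inserted.\<close>

definition svt_const :: "real \<Rightarrow> real" where
  "svt_const \<delta> = 2 / (\<delta> / (4 * (1 + \<delta>))) * (1 + 1 / (4 * (\<delta> / (4 * (1 + \<delta>))))) + 4"

lemma svt_const_pos: "0 < \<delta> \<Longrightarrow> 0 < svt_const \<delta>"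
  unfolding svt_const_def by (intro add_nonneg_pos mult_nonneg_nonneg divide_nonneg_nonneg add_nonneg_nonneg) auto

lemma usvt_outputE:
  assumes "usvt_output n A \<rho> \<tau> M"
  obtains s u v where "is_svd n A s u v" "\<forall>i<n. M i i = 0"
    "\<forall>i j. i < j \<and> j < n \<longrightarrow>
      M i j = min 1 (max 0 ((\<Sum>k | k < n \<and> s k \<ge> \<tau>. s k * u k i * v k j) / \<rho>)) \<and> M j i = M i j"
  using assms unfolding usvt_output_def Let_def by (elim exE conjE) (rule that)

lemma usvt_entry_bounds:
  assumes "usvt_output n A \<rho> \<tau> M" "i < n" "j < n"
  shows "0 \<le> M i j" "M i j \<le> 1"
proof -
  obtain s u v where M0: "\<forall>i<n. M i i = 0" and M: "\<forall>i j. i < j \<and> j < n \<longrightarrow>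
      M i j = min 1 (max 0 ((\<Sum>k | k < n \<and> s k \<ge> \<tau>. s k * u k i * v k j) / \<rho>)) \<and> M j i = M i j"
    using assms(1) by (rule usvt_outputE)
  define H where "H i j = (\<Sum>k | k < n \<and> s k \<ge> \<tau>. s k * u k i * v k j) / \<rho>" for i j
  have H: "M i j = min 1 (max 0 (H i j)) \<and> M j i = M i j" if "i < j" "j < n" for i j
    using M that unfolding H_def by simp
  have "0 \<le> M i j \<and> M i j \<le> 1"
    using M0 H[of i j] H[of j i] assms(2,3)
    by (cases i j rule: linorder_cases) auto
  then show "0 \<le> M i j" "M i j \<le> 1" by auto
qed

lemma clip_error:
  fixes x y :: real
  assumes "0 \<le> x" "x \<le> 1"
  shows "(x - min 1 (max 0 y))\<^sup>2 \<le> (x - y)\<^sup>2"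
  using assms by (intro abs_le_square_iff[THEN iffD1]) (auto simp: min_def max_def)

lemma usvt_error_le:
  fixes B :: rmatrix
  assumes M: "usvt_output n A \<rho> ((1 + \<delta>) * \<theta>) M" and \<rho>: "0 < \<rho>" and \<theta>: "0 < \<theta>" and \<delta>: "0 < \<delta>"
    and op: "op_le n (\<lambda>i j. A i j - \<rho> * B i j) \<theta>"
    and B: "\<And>i j. i < n \<Longrightarrow> j < n \<Longrightarrow> 0 \<le> B i j \<and> B i j \<le> 1 \<and> B i j = B j i" "\<And>i. B i i = 0"
    and F: "finite F" and P: "\<And>i j. i < n \<Longrightarrow> j < n \<Longrightarrow> P i j = (\<Sum>a\<in>F. c j a * \<phi> a i)"
  shows "(\<Sum>i<n. \<Sum>j<n. (B i j - M i j)\<^sup>2) \<le>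
    2 * svt_const \<delta> * (real (card F) * ((1 + \<delta>) * \<theta>)\<^sup>2 / \<rho>\<^sup>2 + (\<Sum>i<n. \<Sum>j<n. (B i j - P i j)\<^sup>2))"
proof -
  let ?\<tau> = "(1 + \<delta>) * \<theta>"
  obtain s u v where svd: "is_svd n A s u v" and M0: "\<forall>i<n. M i i = 0" and M': "\<forall>i j. i < j \<and> j < n \<longrightarrow>
      M i j = min 1 (max 0 ((\<Sum>k | k < n \<and> s k \<ge> ?\<tau>. s k * u k i * v k j) / \<rho>)) \<and> M j i = M i j"
    using M by (rule usvt_outputE)
  define H where "H i j = (\<Sum>k | k < n \<and> s k \<ge> ?\<tau>. s k * u k i * v k j)" for i j
  have Mij: "M i j = min 1 (max 0 (H i j / \<rho>)) \<and> M j i = M i j" if "i < j" "j < n" for i j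
    using M' that unfolding H_def by simp
  obtain R q where R: "R \<le> card F" "onf n R q" and q: "\<forall>a\<in>F. \<exists>b. \<forall>i<n. \<phi> a i = (\<Sum>r<R. b r * q r i)"
    using Gram_Schmidt[OF F, of n \<phi>] by blast
  obtain b where b: "\<And>a i. a \<in> F \<Longrightarrow> i < n \<Longrightarrow> \<phi> a i = (\<Sum>r<R. b a r * q r i)"
    using bchoice[OF q] by blast
  have Pq: "\<forall>i<n. \<rho> * P i j = (\<Sum>r<R. (\<rho> * (\<Sum>a\<in>F. c j a * b a r)) * q r i)" if j: "j < n" for j
  proof (intro allI impI)
    fix i assume i: "i < n"
    have "P i j = (\<Sum>a\<in>F. \<Sum>r<R. c j a * (b a r * q r i))"
      unfolding P[OF i j] by (intro sum.cong refl) (simp add: b[OF _ i] sum_distrib_left)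
    also have "\<dots> = (\<Sum>r<R. (\<Sum>a\<in>F. c j a * b a r) * q r i)"
      by (subst sum.swap) (simp add: sum_distrib_right mult.assoc)
    finally show "\<rho> * P i j = (\<Sum>r<R. (\<rho> * (\<Sum>a\<in>F. c j a * b a r)) * q r i)"
      by (simp only: sum_distrib_left[of _ _ "{..<R}"] mult.assoc)
  qed
  have "(\<Sum>i<n. \<Sum>j<n. (\<rho> * B i j - H i j)\<^sup>2) \<le>
    svt_const \<delta> * (real R * ?\<tau>\<^sup>2 + (\<Sum>i<n. \<Sum>j<n. (\<rho> * B i j - \<rho> * P i j)\<^sup>2))"
    unfolding svt_const_def H_def
    by (rule svt_frobenius[OF svd op \<theta> \<delta> refl R(2), where P = "\<lambda>i j. \<rho> * P i j", OF Pq])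
  also have "\<dots> \<le> svt_const \<delta> * (real (card F) * ?\<tau>\<^sup>2 + \<rho>\<^sup>2 * (\<Sum>i<n. \<Sum>j<n. (B i j - P i j)\<^sup>2))"
    using R(1) svt_const_pos[OF \<delta>]
    by (intro mult_left_mono add_mono mult_right_mono)
      (auto simp: sum_distrib_left power_mult_distrib right_diff_distrib[symmetric])
  finally have H: "(\<Sum>i<n. \<Sum>j<n. (\<rho> * B i j - H i j)\<^sup>2) \<le> \<dots>" .
  let ?d = "\<lambda>i j. (B i j - H i j / \<rho>)\<^sup>2"
  \<comment> \<open>The lower triangle of \<open>M\<close> copies the upper one, whereas
    \<open>H\<close> is not known to be symmetric here; so an entry is charged to both
    \<open>(i, j)\<close> and \<open>(j, i)\<close>.\<close>
  have entry: "(B i j - M i j)\<^sup>2 \<le> ?d i j + ?d j i" if ij: "i < n" "j < n" for i j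
  proof (cases i j rule: linorder_cases)
    case less
    have "M i j = min 1 (max 0 (H i j / \<rho>))" using Mij[OF less ij(2)] by blast
    then have "(B i j - M i j)\<^sup>2 \<le> ?d i j" using clip_error B(1)[OF ij] by metis
    then show ?thesis by (rule add_increasing2[rotated]) simp
  next
    case equal
    then show ?thesis using M0 ij(1) B(2) by simp
  next
    case greater
    have "M i j = min 1 (max 0 (H j i / \<rho>))" "B i j = B j i" using Mij[OF greater ij(1)] B(1)[OF ij] by simp_all
    then have "(B i j - M i j)\<^sup>2 \<le> ?d j i" using clip_error B(1)[OF ij] by metis
    then show ?thesis by (rule add_increasing[rotated]) simp
  qed
  have "(\<Sum>i<n. \<Sum>j<n. (B i j - M i j)\<^sup>2) \<le> (\<Sum>i<n. \<Sum>j<n. ?d i j + ?d j i)"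
    by (intro sum_mono entry) auto
  also have "\<dots> = 2 * (\<Sum>i<n. \<Sum>j<n. ?d i j)"
    using sum.swap[of ?d "{..<n}" "{..<n}"] by (simp add: sum.distrib)
  also have "(\<Sum>i<n. \<Sum>j<n. ?d i j) = (\<Sum>i<n. \<Sum>j<n. (\<rho> * B i j - H i j)\<^sup>2) / \<rho>\<^sup>2"
  proof -
    have "?d i j = (\<rho> * B i j - H i j)\<^sup>2 / \<rho>\<^sup>2" for i j
      using \<rho> by (simp add: power_divide[symmetric] diff_divide_distrib)
    then show ?thesis by (simp add: sum_divide_distrib)
  qed
  also have "2 * \<dots> \<le> 2 * (svt_const \<delta> * (real (card F) * ?\<tau>\<^sup>2 + \<rho>\<^sup>2 * (\<Sum>i<n. \<Sum>j<n. (B i j - P i j)\<^sup>2)) / \<rho>\<^sup>2)"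
    by (intro mult_left_mono divide_right_mono H) auto
  also have "\<dots> = 2 * svt_const \<delta> * (real (card F) * ?\<tau>\<^sup>2 / \<rho>\<^sup>2 + (\<Sum>i<n. \<Sum>j<n. (B i j - P i j)\<^sup>2))"
    using \<rho> by (simp add: field_simps)
  finally show ?thesis .
qed

lemma power_of_two_between:
  fixes t :: real
  assumes "1 \<le> t"
  shows "\<exists>m. t \<le> 2 ^ m \<and> 2 ^ m \<le> 2 * t"
proof (intro exI[of _ "nat \<lceil>log 2 t\<rceil>"] conjI)
  let ?m = "nat \<lceil>log 2 t\<rceil>"
  have l: "0 \<le> log 2 t" using assms by (subst zero_le_log_cancel_iff) auto
  then have m: "real ?m = of_int \<lceil>log 2 t\<rceil>" by simp
  have t: "t = 2 powr log 2 t" using assms by simp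
  have e: "(2 :: real) ^ ?m = 2 powr real ?m" by (simp add: powr_realpow)
  show "t \<le> 2 ^ ?m" unfolding e m by (subst t, rule powr_mono) auto
  have "(2 :: real) ^ ?m \<le> 2 powr (log 2 t + 1)" unfolding e m by (rule powr_mono) (linarith, simp)
  also have "\<dots> = 2 * t" using assms by (simp add: powr_add)
  finally show "2 ^ ?m \<le> 2 * t" .
qed

text \<open>With \<open>K\<close> at least \<open>power_factor C * (n * \<rho>)\<close>, the value 2
  ensures \<open>n * (2 * \<rho>) \<le> K\<close> and the value \<open>4 / C\<close> ensures
  \<open>4 * ln n \<le> K\<close>.\<close>

definition power_factor :: "real \<Rightarrow> real" where
  "power_factor C = max 2 (4 / C)"

text \<open>Makes the base of the \<open>K\<close>-th power in \<open>prob_bad_event\<close> at most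
  \<open>exp (- 1)\<close> as long as \<open>K \<le> 2 * power_factor C * (n * \<rho>)\<close>;
  hence \<open>exp 33\<close> against the \<open>exp 32\<close> there.\<close>

definition noise_const :: "real \<Rightarrow> real" where
  "noise_const C = sqrt (4 * 48 ^ 4 * exp 33 * power_factor C)"

lemma noise_const_pos: "0 < noise_const C"
  unfolding noise_const_def power_factor_def by (intro real_sqrt_gt_zero mult_pos_pos) auto

lemma noise_deviation:
  assumes C: "0 < C" and n: "1 \<le> n" and \<rho>: "0 < \<rho>" and T: "1 \<le> real n * \<rho>" and TC: "C * ln (real n) \<le> real n * \<rho>"
    and p: "\<And>e. e \<in> pairs n \<Longrightarrow> 0 \<le> p e" "\<And>e. e \<in> pairs n \<Longrightarrow> p e \<le> \<rho>" and \<rho>1: "\<rho> \<le> 1"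
  shows "measure_pmf.prob (edge_pmf n p)
     {E. \<not> op_le n (\<lambda>i j. adj_matrix E i j - mean_matrix p i j) (noise_const C * sqrt (real n * \<rho>))}
     \<le> 4 * 48 ^ 4 / (real n)\<^sup>2"
proof -
  let ?T = "real n * \<rho>" and ?A = "power_factor C"
  let ?\<theta> = "noise_const C * sqrt ?T"
  have A: "2 \<le> ?A" "4 / C \<le> ?A" by (auto simp: power_factor_def)
  have AT: "1 \<le> ?A * ?T" using mult_mono[of 1 ?A 1 ?T] A T by simp
  obtain m where m: "?A * ?T \<le> 2 ^ m" "2 ^ m \<le> 2 * (?A * ?T)" using power_of_two_between[OF AT] by blast
  define K :: nat where "K = 2 ^ m"
  have K: "?A * ?T \<le> real K" "real K \<le> 2 * (?A * ?T)" using m by (simp_all add: K_def)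
  have \<theta>: "0 < ?\<theta>" using noise_const_pos n \<rho> by (intro mult_pos_pos real_sqrt_gt_zero) auto
  have \<theta>2: "?\<theta>\<^sup>2 = 4 * 48 ^ 4 * exp 33 * ?A * ?T"
    using A T unfolding noise_const_def power_mult_distrib by (subst real_sqrt_pow2, simp)+ simp
  have lnK: "4 * ln (real n) \<le> real K"
  proof -
    have "4 * ln (real n) = 4 / C * (C * ln (real n))" using C by simp
    also have "\<dots> \<le> ?A * ?T" by (rule mult_mono[OF A(2) TC]) (use A n C in auto)
    finally show ?thesis using K(1) by linarith
  qed
  \<comment> \<open>The second moment \<open>2 * p e * (1 - p e)\<close> is below both values, and
    the minimum keeps \<open>q \<le> 1\<close> also for \<open>\<rho>\<close> above 1/2.\<close>
  let ?q = "min 1 (2 * \<rho>)"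
  have q: "2 * p e * (1 - p e) \<le> ?q" if "e \<in> pairs n" for e
  proof -
    have "0 \<le> (2 * p e - 1)\<^sup>2" by simp
    then have "2 * p e * (1 - p e) \<le> 1" by (simp add: power2_eq_square algebra_simps)
    moreover have "2 * p e * (1 - p e) \<le> 2 * \<rho> * 1" using p[OF that] \<rho> \<rho>1 by (intro mult_mono) auto
    ultimately show ?thesis by simp
  qed
  have nq: "real n * ?q \<le> real K"
  proof -
    have "real n * ?q \<le> real n * (2 * \<rho>)" by (intro mult_left_mono) auto
    also have "\<dots> = 2 * ?T" by simp
    also have "\<dots> \<le> ?A * ?T" using A T by (intro mult_right_mono) auto
    finally show ?thesis using K(1) by linarith
  qed
  have "measure_pmf.prob (edge_pmf n p) {E. \<not> op_le n (\<lambda>i j. adj_matrix E i j - mean_matrix p i j) ?\<theta>}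
     \<le> 4 * 48 ^ 4 * real n * (2 * 48 ^ 4 * exp 32 * real K / ?\<theta>\<^sup>2) ^ K"
    by (rule prob_bad_event[of n p ?q, OF p(1) _ _ _ q K_def \<theta> nq]) (use p(2) \<rho>1 \<rho> in force)+
  also have "\<dots> \<le> 4 * 48 ^ 4 * real n * (1 / real n ^ 4)"
  proof (rule mult_left_mono)
    have "2 * 48 ^ 4 * exp 32 * real K / ?\<theta>\<^sup>2 \<le> 2 * 48 ^ 4 * exp 32 * (2 * (?A * ?T)) / ?\<theta>\<^sup>2"
      using K(2) by (intro divide_right_mono mult_left_mono) auto
    also have "\<dots> = exp 32 / exp 33"
      using A n \<rho> unfolding \<theta>2 by (simp add: field_simps)
    also have "\<dots> = exp (- 1)" by (simp flip: exp_diff)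
    finally have "(2 * 48 ^ 4 * exp 32 * real K / ?\<theta>\<^sup>2) ^ K \<le> exp (- 1) ^ K"
      by (intro power_mono) auto
    also have "\<dots> = exp (- real K)" by (simp flip: exp_of_nat_mult)
    also have "\<dots> \<le> exp (- (4 * ln (real n)))" using lnK by simp
    also have "\<dots> = 1 / real n ^ 4"
    proof -
      have "exp (4 * ln (real n)) = exp (ln (real n)) ^ 4" by (simp add: exp_of_nat_mult[of 4, simplified])
      then show ?thesis using n by (simp add: exp_minus inverse_eq_divide)
    qed
    finally show "(2 * 48 ^ 4 * exp 32 * real K / ?\<theta>\<^sup>2) ^ K \<le> 1 / real n ^ 4" .
  qed auto
  also have "\<dots> \<le> 4 * 48 ^ 4 / (real n)\<^sup>2"
  proof -
    have "real n * (1 / real n ^ 4) \<le> 1 / (real n)\<^sup>2"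
      using n by (simp add: field_simps eval_nat_numeral)
    then show ?thesis by simp
  qed
  finally show ?thesis .
qed

text \<open>On the bad event the squared error is still at most \<open>n\<^sup>2\<close>, and its
  probability of order \<open>1 / n\<^sup>2\<close> reduces this to the constant
  \<open>4 * 48 ^ 4\<close>.\<close>

lemma usvt_conditional_error:
  fixes f :: "'a \<Rightarrow> 'a \<Rightarrow> real"
  assumes C: "0 < C" and n: "1 \<le> n" and \<rho>: "0 < \<rho>" "\<rho> \<le> 1" and T: "1 \<le> real n * \<rho>" and TC: "C * ln (real n) \<le> real n * \<rho>"
    and \<delta>: "0 < \<delta>" and Mhat: "\<And>A. usvt_output n A \<rho> ((1 + \<delta>) * noise_const C * sqrt (real n * \<rho>)) (Mhat A)"
    and f: "\<And>i j. i < n \<Longrightarrow> j < n \<Longrightarrow> 0 \<le> f (x i) (x j) \<and> f (x i) (x j) \<le> 1 \<and> f (x i) (x j) = f (x j) (x i)"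
    and F: "finite F" and P: "\<And>i j. i < n \<Longrightarrow> j < n \<Longrightarrow> P i j = (\<Sum>a\<in>F. c j a * \<phi> a i)"
  shows "(\<integral>\<^sup>+A. ennreal (\<Sum>i<n. \<Sum>j<n. (edge_prob f x i j - Mhat A i j)\<^sup>2) \<partial>measure_pmf (adj_pmf f \<rho> n x)) \<le>
    ennreal (2 * svt_const \<delta> * (real (card F) * ((1 + \<delta>) * noise_const C)\<^sup>2 * (real n)\<^sup>2 / (real n * \<rho>)
      + (\<Sum>i<n. \<Sum>j<n. (edge_prob f x i j - P i j)\<^sup>2)) + 4 * 48 ^ 4)"
proof -
  define p where "p = (\<lambda>(i, j). \<rho> * edge_prob f x i j)"
  let ?\<theta> = "noise_const C * sqrt (real n * \<rho>)"
  let ?S = "\<Sum>i<n. \<Sum>j<n. (edge_prob f x i j - P i j)\<^sup>2"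
  let ?G = "2 * svt_const \<delta> * (real (card F) * ((1 + \<delta>) * ?\<theta>)\<^sup>2 / \<rho>\<^sup>2 + ?S)"
  let ?Z = "\<lambda>A. \<Sum>i<n. \<Sum>j<n. (edge_prob f x i j - Mhat A i j)\<^sup>2"
  let ?bad = "{E. \<not> op_le n (\<lambda>i j. adj_matrix E i j - mean_matrix p i j) ?\<theta>}"
  have \<theta>: "0 < ?\<theta>" using noise_const_pos n \<rho> by (intro mult_pos_pos real_sqrt_gt_zero) auto
  have B: "0 \<le> edge_prob f x i j \<and> edge_prob f x i j \<le> 1 \<and> edge_prob f x i j = edge_prob f x j i" if "i < n" "j < n" for i j
    using f[OF that] by (simp add: edge_prob_def)
  have p: "0 \<le> p e" "p e \<le> \<rho>" if "e \<in> pairs n" for e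
    using that B \<rho> by (auto simp: p_def pairs_def mult_left_le)
  have S0: "0 \<le> ?S" by (intro sum_nonneg) auto
  have G0: "0 \<le> ?G" using svt_const_pos[OF \<delta>] S0 by (intro mult_nonneg_nonneg add_nonneg_nonneg) auto
  have good: "?Z (adj_matrix E) \<le> ?G" if "E \<notin> ?bad" for E
  proof (rule usvt_error_le[OF _ \<rho>(1) \<theta> \<delta> _ B _ F P])
    show "usvt_output n (adj_matrix E) \<rho> ((1 + \<delta>) * ?\<theta>) (Mhat (adj_matrix E))"
      using Mhat[of "adj_matrix E"] by (simp add: mult.assoc)
    \<comment> \<open>\<open>mean_matrix\<close> reads the upper triangle only, so its agreement
      with \<open>\<rho> * edge_prob\<close> uses the symmetry of \<open>f\<close> at the sample
      points and holds for indices below \<open>n\<close>.\<close>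
    have "(\<Sum>j<n. (adj_matrix E i j - \<rho> * edge_prob f x i j) * y j) = (\<Sum>j<n. (adj_matrix E i j - mean_matrix p i j) * y j)"
      if "i < n" for i y
    proof (rule sum.cong[OF refl])
      fix j assume "j \<in> {..<n}"
      then show "(adj_matrix E i j - \<rho> * edge_prob f x i j) * y j = (adj_matrix E i j - mean_matrix p i j) * y j"
        using B[OF that, of j] by (cases i j rule: linorder_cases) (auto simp: mean_matrix_def p_def edge_prob_def)
    qed
    then have "ip n (mv n (\<lambda>i j. adj_matrix E i j - \<rho> * edge_prob f x i j) y) (mv n (\<lambda>i j. adj_matrix E i j - \<rho> * edge_prob f x i j) y) =
      ip n (mv n (\<lambda>i j. adj_matrix E i j - mean_matrix p i j) y) (mv n (\<lambda>i j. adj_matrix E i j - mean_matrix p i j) y)" for y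
      unfolding ip_def mv_def by (intro sum.cong refl) (simp only: lessThan_iff)
    then show "op_le n (\<lambda>i j. adj_matrix E i j - \<rho> * edge_prob f x i j) ?\<theta>"
      using that unfolding op_le_def by simp
  qed (auto simp: edge_prob_def)
  have all: "?Z A \<le> (real n)\<^sup>2" for A
  proof -
    have "(edge_prob f x i j - Mhat A i j)\<^sup>2 \<le> 1" if "i < n" "j < n" for i j
      using B[OF that] usvt_entry_bounds[OF Mhat that, of A] by (intro abs_square_le_1[THEN iffD2]) (auto simp: abs_le_iff)
    then have "?Z A \<le> (\<Sum>i<n. \<Sum>j<n. 1)" by (intro sum_mono) auto
    then show ?thesis by (simp add: power2_eq_square)
  qed
  have "(\<integral>\<^sup>+A. ennreal (?Z A) \<partial>measure_pmf (adj_pmf f \<rho> n x)) = (\<integral>\<^sup>+E. ennreal (?Z (adj_matrix E)) \<partial>measure_pmf (edge_pmf n p))"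
    by (simp add: adj_pmf_def pairs_def p_def case_prod_unfold)
  also have "\<dots> \<le> (\<integral>\<^sup>+E. ennreal ?G + ennreal ((real n)\<^sup>2) * indicator ?bad E \<partial>measure_pmf (edge_pmf n p))"
  proof (rule nn_integral_mono)
    fix E
    show "ennreal (?Z (adj_matrix E)) \<le> ennreal ?G + ennreal ((real n)\<^sup>2) * indicator ?bad E"
    proof (cases "E \<in> ?bad")
      case True
      have "ennreal (?Z (adj_matrix E)) \<le> ennreal ((real n)\<^sup>2)" by (rule ennreal_leI[OF all])
      also have "\<dots> \<le> ennreal ?G + ennreal ((real n)\<^sup>2) * indicator ?bad E" using True by (simp add: add_increasing)
      finally show ?thesis .
    next
      case False
      then show ?thesis using ennreal_leI[OF good[OF False]] by simp
    qed
  qed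
  also have "\<dots> = ennreal ?G + ennreal ((real n)\<^sup>2) * emeasure (measure_pmf (edge_pmf n p)) ?bad"
    by (subst nn_integral_add) (auto simp: nn_integral_cmult measure_pmf.emeasure_space_1)
  also have "\<dots> \<le> ennreal ?G + ennreal ((real n)\<^sup>2) * ennreal (4 * 48 ^ 4 / (real n)\<^sup>2)"
    unfolding measure_pmf.emeasure_eq_measure
    by (intro add_left_mono mult_left_mono ennreal_leI noise_deviation[OF C n \<rho>(1) T TC p \<rho>(2)]) auto
  also have "\<dots> = ennreal (?G + 4 * 48 ^ 4)"
  proof -
    have "ennreal ((real n)\<^sup>2) * ennreal (4 * 48 ^ 4 / (real n)\<^sup>2) = ennreal (4 * 48 ^ 4)"
      using n by (subst ennreal_mult[symmetric]) auto
    then show ?thesis using G0 by (simp only:) (rule ennreal_plus[symmetric], auto)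
  qed
  also have "((1 + \<delta>) * ?\<theta>)\<^sup>2 / \<rho>\<^sup>2 = ((1 + \<delta>) * noise_const C)\<^sup>2 * (real n)\<^sup>2 / (real n * \<rho>)"
  proof -
    have "((1 + \<delta>) * ?\<theta>)\<^sup>2 = ((1 + \<delta>) * noise_const C)\<^sup>2 * (real n * \<rho>)" using \<rho> by (simp add: power_mult_distrib)
    then show ?thesis using n \<rho> by (simp add: field_simps power2_eq_square)
  qed
  then have "real (card F) * ((1 + \<delta>) * ?\<theta>)\<^sup>2 / \<rho>\<^sup>2 = real (card F) * ((1 + \<delta>) * noise_const C)\<^sup>2 * (real n)\<^sup>2 / (real n * \<rho>)"
    by (metis times_divide_eq_right mult.assoc)
  finally show ?thesis .
qed

section \<open>Averaging over the latent variables\<close>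

lemma nn_integral_PiM_pair:
  fixes n i j :: nat
  assumes \<mu>: "prob_space \<mu>" and e: "case_prod e \<in> borel_measurable (\<mu> \<Otimes>\<^sub>M \<mu>)" and ij: "i < n" "j < n" "i \<noteq> j"
  shows "(\<integral>\<^sup>+x. e (x i) (x j) \<partial>Pi\<^sub>M {..<n} (\<lambda>_. \<mu>)) = (\<integral>\<^sup>+y. (\<integral>\<^sup>+z. e z y \<partial>\<mu>) \<partial>\<mu>)"
proof -
  interpret prob_space \<mu> by (rule \<mu>)
  interpret product_prob_space "\<lambda>_. \<mu>" "{..<n}" by unfold_locales
  interpret P: pair_sigma_finite \<mu> \<mu> by unfold_locales
  have em: "(\<lambda>x. e (x i) (x j)) \<in> borel_measurable (Pi\<^sub>M {i, j} (\<lambda>_. \<mu>))"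
  proof -
    have "(\<lambda>x. (x i, x j)) \<in> Pi\<^sub>M {i, j} (\<lambda>_. \<mu>) \<rightarrow>\<^sub>M \<mu> \<Otimes>\<^sub>M \<mu>" by measurable
    from measurable_compose[OF this e] show ?thesis by simp
  qed
  have "(\<integral>\<^sup>+x. e (x i) (x j) \<partial>Pi\<^sub>M {..<n} (\<lambda>_. \<mu>)) =
    (\<integral>\<^sup>+x. e (restrict x {i, j} i) (restrict x {i, j} j) \<partial>Pi\<^sub>M {..<n} (\<lambda>_. \<mu>))" by simp
  also have "\<dots> = (\<integral>\<^sup>+x. e (x i) (x j) \<partial>distr (Pi\<^sub>M {..<n} (\<lambda>_. \<mu>)) (Pi\<^sub>M {i, j} (\<lambda>_. \<mu>)) (\<lambda>x. restrict x {i, j}))"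
    by (subst nn_integral_distr) (use ij em in \<open>auto intro!: measurable_restrict_subset\<close>)
  also have "\<dots> = (\<integral>\<^sup>+x. e (x i) (x j) \<partial>Pi\<^sub>M {i, j} (\<lambda>_. \<mu>))"
    using ij by (subst distr_restrict[symmetric]) auto
  also have "\<dots> = (\<integral>\<^sup>+z. e (fst z) (snd z) \<partial>(\<mu> \<Otimes>\<^sub>M \<mu>))"
    by (rule product_nn_integral_pair[OF e ij(3)])
  also have "\<dots> = (\<integral>\<^sup>+y. (\<integral>\<^sup>+z. e z y \<partial>\<mu>) \<partial>\<mu>)"
    using P.nn_integral_snd[of "\<lambda>z. e (fst z) (snd z)"] e by (simp add: case_prod_unfold)
  finally show ?thesis .
qed

lemma MSE_leI:
  fixes f :: "real ^ 'd::finite \<Rightarrow> real ^ 'd \<Rightarrow> real"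
  assumes f: "graphon f" and \<mu>: "sets \<mu> = sets (restrict_space borel cube)" "prob_space \<mu>" and \<rho>: "0 < \<rho>" "\<rho> \<le> 1"
    and n: "1 \<le> n" and b: "0 \<le> b"
    and le: "(\<integral>\<^sup>+x. (\<integral>\<^sup>+A. ennreal (\<Sum>i<n. \<Sum>j<n. (edge_prob f x i j - Mhat A i j)\<^sup>2) \<partial>measure_pmf (adj_pmf f \<rho> n x)) \<partial>Pi\<^sub>M {..<n} (\<lambda>_. \<mu>))
      \<le> ennreal (b * (real n)\<^sup>2)"
  shows "MSE \<mu> f \<rho> n Mhat \<le> b"
proof -
  let ?X = "Pi\<^sub>M {..<n} (\<lambda>_. \<mu>)"
  let ?Z = "\<lambda>z. \<Sum>i<n. \<Sum>j<n. (edge_prob f (fst z) i j - Mhat (snd z) i j)\<^sup>2"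
  have [measurable]: "(\<lambda>z. edge_prob f (fst z) i j) \<in> borel_measurable (?X \<Otimes>\<^sub>M count_space UNIV)" if "i < n" "j < n" for i j
    using measurable_compose[OF measurable_fst measurable_edge[OF f \<mu>(1) that]] .
  \<comment> \<open>Matrices carry the discrete sigma-algebra, so any selection \<open>Mhat\<close>
    of outputs is measurable.\<close>
  have [measurable]: "(\<lambda>z. Mhat (snd z) i j) \<in> borel_measurable (?X \<Otimes>\<^sub>M count_space UNIV)" for i j
    by (rule measurable_compose[OF measurable_snd, of "\<lambda>A. Mhat A i j"]) simp
  have Zm: "?Z \<in> borel_measurable (?X \<Otimes>\<^sub>M count_space UNIV)"
    by (intro borel_measurable_sum borel_measurable_power borel_measurable_diff) auto
  note facts = graphon_model_facts[where n = n, OF f \<mu>(1) less_imp_le[OF \<rho>(1)] \<rho>(2) \<mu>(2)]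
  have Zm': "?Z \<in> borel_measurable (graphon_model \<mu> f \<rho> n)" using Zm by (simp add: measurable_cong_sets[OF facts(1) refl])
  have "(LINT z|graphon_model \<mu> f \<rho> n. ?Z z) = enn2real (\<integral>\<^sup>+z. ennreal (?Z z) \<partial>graphon_model \<mu> f \<rho> n)"
    by (rule integral_eq_nn_integral[OF Zm']) (auto intro!: sum_nonneg AE_I2)
  also have "(\<integral>\<^sup>+z. ennreal (?Z z) \<partial>graphon_model \<mu> f \<rho> n) =
    (\<integral>\<^sup>+x. (\<integral>\<^sup>+A. ennreal (?Z (x, A)) \<partial>measure_pmf (adj_pmf f \<rho> n x)) \<partial>?X)"
    by (rule facts(3)) (rule measurable_compose[OF Zm measurable_ennreal])
  also have "enn2real \<dots> \<le> enn2real (ennreal (b * (real n)\<^sup>2))"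
    using le by (intro enn2real_mono) (auto simp: ennreal_less_top)
  also have "\<dots> = b * (real n)\<^sup>2" using b by simp
  finally have "(LINT z|graphon_model \<mu> f \<rho> n. ?Z z) \<le> b * (real n)\<^sup>2" .
  then have "MSE \<mu> f \<rho> n Mhat \<le> 1 / (real n)\<^sup>2 * (b * (real n)\<^sup>2)"
    unfolding MSE_def case_prod_unfold by (intro mult_left_mono) auto
  then show ?thesis using n by simp
qed

text \<open>Covers \<open>n * \<rho> < 1\<close>, where the claimed rate exceeds 1.\<close>

lemma MSE_le_1:
  fixes f :: "real ^ 'd::finite \<Rightarrow> real ^ 'd \<Rightarrow> real"
  assumes f: "graphon f" and \<mu>: "sets \<mu> = sets (restrict_space borel cube)" "prob_space \<mu>" and \<rho>: "0 < \<rho>" "\<rho> \<le> 1"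
    and n: "1 \<le> n" and Mhat: "\<And>A. usvt_output n A \<rho> \<tau> (Mhat A)"
  shows "MSE \<mu> f \<rho> n Mhat \<le> 1"
proof (rule MSE_leI[OF f \<mu> \<rho> n])
  interpret X: prob_space "Pi\<^sub>M {..<n} (\<lambda>_. \<mu>)" by (intro prob_space_PiM \<mu>)
  have Z: "(\<Sum>i<n. \<Sum>j<n. (edge_prob f x i j - Mhat A i j)\<^sup>2) \<le> 1 * (real n)\<^sup>2" if x: "x \<in> space (Pi\<^sub>M {..<n} (\<lambda>_. \<mu>))" for x A
  proof -
    have "(edge_prob f x i j - Mhat A i j)\<^sup>2 \<le> 1" if "i < n" "j < n" for i j
      using edge_bounds[OF f \<mu>(1) that x] usvt_entry_bounds[OF Mhat that, of A]
      by (intro abs_square_le_1[THEN iffD2]) (auto simp: abs_le_iff)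
    then have "(\<Sum>i<n. \<Sum>j<n. (edge_prob f x i j - Mhat A i j)\<^sup>2) \<le> (\<Sum>i<n. \<Sum>j<n. 1)" by (intro sum_mono) auto
    then show ?thesis by (simp add: power2_eq_square)
  qed
  have "(\<integral>\<^sup>+x. (\<integral>\<^sup>+A. ennreal (\<Sum>i<n. \<Sum>j<n. (edge_prob f x i j - Mhat A i j)\<^sup>2) \<partial>measure_pmf (adj_pmf f \<rho> n x)) \<partial>Pi\<^sub>M {..<n} (\<lambda>_. \<mu>))
    \<le> (\<integral>\<^sup>+x. (\<integral>\<^sup>+A. ennreal (1 * (real n)\<^sup>2) \<partial>measure_pmf (adj_pmf f \<rho> n x)) \<partial>Pi\<^sub>M {..<n} (\<lambda>_. \<mu>))"
    by (intro nn_integral_mono ennreal_leI Z)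
  also have "\<dots> = ennreal (1 * (real n)\<^sup>2)" by (simp add: measure_pmf.emeasure_space_1 X.emeasure_space_1)
  finally show "(\<integral>\<^sup>+x. (\<integral>\<^sup>+A. ennreal (\<Sum>i<n. \<Sum>j<n. (edge_prob f x i j - Mhat A i j)\<^sup>2) \<partial>measure_pmf (adj_pmf f \<rho> n x)) \<partial>Pi\<^sub>M {..<n} (\<lambda>_. \<mu>)) \<le> ennreal (1 * (real n)\<^sup>2)" .
qed simp

lemma MSE_le_tradeoff:
  fixes f :: "real ^ 'd::finite \<Rightarrow> real ^ 'd \<Rightarrow> real"
  assumes f: "graphon f" and \<mu>: "sets \<mu> = sets (restrict_space borel cube)" "prob_space \<mu>"
    and C: "0 < C" and n: "1 \<le> n" and \<rho>: "0 < \<rho>" "\<rho> \<le> 1" and T: "1 \<le> real n * \<rho>" and TC: "C * ln (real n) \<le> real n * \<rho>"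
    and \<delta>: "0 < \<delta>" and Mhat: "\<And>A. usvt_output n A \<rho> ((1 + \<delta>) * noise_const C * sqrt (real n * \<rho>)) (Mhat A)"
    and fa: "feature_approximable \<mu> f \<alpha> K" and m: "1 \<le> m" and K0: "0 \<le> K"
  shows "MSE \<mu> f \<rho> n Mhat \<le> 2 * svt_const \<delta> *
    (real ((m * Suc (sfloor \<alpha>)) ^ CARD('d)) * ((1 + \<delta>) * noise_const C)\<^sup>2 / (real n * \<rho>) + K / real n + K * real m powr (- (2 * \<alpha>)))
     + 4 * 48 ^ 4 / (real n)\<^sup>2"
proof (rule MSE_leI[OF f \<mu> \<rho> n])
  let ?l = "sfloor \<alpha>" and ?X = "Pi\<^sub>M {..<n} (\<lambda>_. \<mu>)"
  let ?R = "real ((m * Suc ?l) ^ CARD('d)) * ((1 + \<delta>) * noise_const C)\<^sup>2"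
  interpret X: prob_space ?X by (intro prob_space_PiM \<mu>)
  obtain a e where e: "\<forall>x\<in>cube. \<forall>y\<in>cube. (f x y - feature_sum m ?l (a y) x)\<^sup>2 \<le> e x y"
    and aK: "\<forall>x\<in>cube. (feature_sum m ?l (a x) x)\<^sup>2 \<le> K"
    and em: "case_prod e \<in> borel_measurable (\<mu> \<Otimes>\<^sub>M \<mu>)" and e0: "\<forall>x y. 0 \<le> e x y"
    and eI: "(\<integral>\<^sup>+y. (\<integral>\<^sup>+x. ennreal (e x y) \<partial>\<mu>) \<partial>\<mu>) \<le> ennreal (K * real m powr (- (2 * \<alpha>)))"
    using fa[unfolded feature_approximable_def, THEN spec, THEN mp, OF m] by (elim exE conjE) (rule that)
  have sp: "space \<mu> = cube" using sets_eq_imp_space_eq[OF \<mu>(1)] by (simp add: space_restrict_space)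
  have S: "0 < svt_const \<delta>" by (rule svt_const_pos[OF \<delta>])
  \<comment> \<open>On the diagonal the target is 0 while the approximation need not be; this costs
    up to \<open>K\<close> per vertex, \<open>K / n\<close> after normalisation.\<close>
  define E where "E i j x = (if i = j then K else e (x i) (x j))" for i j :: nat and x
  have E0: "0 \<le> E i j x" for i j x using K0 e0 by (simp add: E_def)
  let ?c1 = "2 * svt_const \<delta> * (?R * (real n)\<^sup>2 / (real n * \<rho>)) + 4 * 48 ^ 4"
  have c1: "0 \<le> ?c1" using S \<rho> by (intro add_nonneg_nonneg mult_nonneg_nonneg divide_nonneg_nonneg) auto
  have Em: "(\<lambda>x. ennreal (E i j x)) \<in> borel_measurable ?X" if ij: "i < n" "j < n" for i j
  proof -
    have "(\<lambda>x. (x i, x j)) \<in> ?X \<rightarrow>\<^sub>M \<mu> \<Otimes>\<^sub>M \<mu>" using ij by (intro measurable_Pair measurable_component_singleton) auto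
    from measurable_compose[OF this em] have "(\<lambda>x. e (x i) (x j)) \<in> borel_measurable ?X" by simp
    then show ?thesis by (simp add: E_def)
  qed
  have EI: "(\<integral>\<^sup>+x. ennreal (E i j x) \<partial>?X) \<le> ennreal (K * of_bool (i = j) + K * real m powr (- (2 * \<alpha>)))" if ij: "i < n" "j < n" for i j
  proof (cases "i = j")
    case True
    then show ?thesis using K0 by (auto simp: E_def X.emeasure_space_1 intro!: ennreal_leI)
  next
    case False
    have "(\<lambda>(x, y). ennreal (e x y)) \<in> borel_measurable (\<mu> \<Otimes>\<^sub>M \<mu>)"
      using measurable_compose[OF em measurable_ennreal] by (simp add: case_prod_unfold)
    from nn_integral_PiM_pair[OF \<mu>(2) this ij False] show ?thesis using eI False by (simp add: E_def)
  qed
  have cond: "(\<integral>\<^sup>+A. ennreal (\<Sum>i<n. \<Sum>j<n. (edge_prob f x i j - Mhat A i j)\<^sup>2) \<partial>measure_pmf (adj_pmf f \<rho> n x))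
     \<le> ennreal ?c1 + ennreal (2 * svt_const \<delta>) * (\<Sum>i<n. \<Sum>j<n. ennreal (E i j x))" if x: "x \<in> space ?X" for x
  proof -
    have xc: "x i \<in> cube" if "i < n" for i using x that by (auto simp: space_PiM sp)
    let ?P = "\<lambda>i j. feature_sum m ?l (a (x j)) (x i)"
    have "(\<integral>\<^sup>+A. ennreal (\<Sum>i<n. \<Sum>j<n. (edge_prob f x i j - Mhat A i j)\<^sup>2) \<partial>measure_pmf (adj_pmf f \<rho> n x)) \<le>
      ennreal (2 * svt_const \<delta> * (real (card (feature_indices m ?l :: (('d \<Rightarrow> nat) \<times> ('d \<Rightarrow> nat)) set)) * ((1 + \<delta>) * noise_const C)\<^sup>2 * (real n)\<^sup>2 / (real n * \<rho>)
      + (\<Sum>i<n. \<Sum>j<n. (edge_prob f x i j - ?P i j)\<^sup>2)) + 4 * 48 ^ 4)"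
      by (rule usvt_conditional_error[OF C n \<rho> T TC \<delta> Mhat _ finite_feature_indices, where c = "\<lambda>j. a (x j)" and \<phi> = "\<lambda>F i. feature m F (x i)"])
        (use graphon_bounds[OF f xc xc] in \<open>auto simp: feature_sum_def\<close>)
    also have "\<dots> \<le> ennreal (2 * svt_const \<delta> * (?R * (real n)\<^sup>2 / (real n * \<rho>) + (\<Sum>i<n. \<Sum>j<n. E i j x)) + 4 * 48 ^ 4)"
    proof (intro ennreal_leI add_right_mono mult_left_mono)
      have "(\<Sum>i<n. \<Sum>j<n. (edge_prob f x i j - ?P i j)\<^sup>2) \<le> (\<Sum>i<n. \<Sum>j<n. E i j x)"
        using xc e aK by (intro sum_mono) (auto simp: E_def edge_prob_def)
      then show "real (card (feature_indices m ?l :: (('d \<Rightarrow> nat) \<times> ('d \<Rightarrow> nat)) set)) * ((1 + \<delta>) * noise_const C)\<^sup>2 * (real n)\<^sup>2 / (real n * \<rho>)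
        + (\<Sum>i<n. \<Sum>j<n. (edge_prob f x i j - ?P i j)\<^sup>2) \<le> ?R * (real n)\<^sup>2 / (real n * \<rho>) + (\<Sum>i<n. \<Sum>j<n. E i j x)"
        by (simp only: card_feature_indices add_le_cancel_left)
    qed (use S in simp)
    also have "2 * svt_const \<delta> * (?R * (real n)\<^sup>2 / (real n * \<rho>) + (\<Sum>i<n. \<Sum>j<n. E i j x)) + 4 * 48 ^ 4 =
      ?c1 + 2 * svt_const \<delta> * (\<Sum>i<n. \<Sum>j<n. E i j x)" by (simp only: distrib_left add_ac)
    also have "ennreal \<dots> = ennreal ?c1 + ennreal (2 * svt_const \<delta> * (\<Sum>i<n. \<Sum>j<n. E i j x))"
      using S by (intro ennreal_plus[OF c1] mult_nonneg_nonneg sum_nonneg E0) auto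
    also have "ennreal (2 * svt_const \<delta> * (\<Sum>i<n. \<Sum>j<n. E i j x)) = ennreal (2 * svt_const \<delta>) * (\<Sum>i<n. \<Sum>j<n. ennreal (E i j x))"
      using S by (subst ennreal_mult) (auto simp: sum_nonneg E0)
    finally show ?thesis .
  qed
  have sumK: "(\<Sum>i<n. \<Sum>j<n. K * of_bool (i = j) + K * real m powr (- (2 * \<alpha>))) = real n * K + (real n)\<^sup>2 * (K * real m powr (- (2 * \<alpha>)))"
  proof -
    have "(\<Sum>i<n. \<Sum>j<n. K * of_bool (i = j)) = real n * K"
      by (simp add: of_bool_def if_distrib sum.delta cong: if_cong)
    then show ?thesis by (simp add: sum.distrib power2_eq_square algebra_simps)
  qed
  have "(\<integral>\<^sup>+x. (\<integral>\<^sup>+A. ennreal (\<Sum>i<n. \<Sum>j<n. (edge_prob f x i j - Mhat A i j)\<^sup>2) \<partial>measure_pmf (adj_pmf f \<rho> n x)) \<partial>?X)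
    \<le> (\<integral>\<^sup>+x. ennreal ?c1 + ennreal (2 * svt_const \<delta>) * (\<Sum>i<n. \<Sum>j<n. ennreal (E i j x)) \<partial>?X)"
    by (rule nn_integral_mono[OF cond])
  also have "\<dots> = ennreal ?c1 + ennreal (2 * svt_const \<delta>) * (\<Sum>i<n. \<Sum>j<n. (\<integral>\<^sup>+x. ennreal (E i j x) \<partial>?X))"
  proof -
    have m1: "(\<lambda>x. \<Sum>i<n. \<Sum>j<n. ennreal (E i j x)) \<in> borel_measurable ?X" by (intro borel_measurable_sum Em) auto
    have "(\<integral>\<^sup>+x. (\<Sum>i<n. \<Sum>j<n. ennreal (E i j x)) \<partial>?X) = (\<Sum>i<n. \<integral>\<^sup>+x. (\<Sum>j<n. ennreal (E i j x)) \<partial>?X)"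
      by (intro nn_integral_sum borel_measurable_sum Em) auto
    also have "\<dots> = (\<Sum>i<n. \<Sum>j<n. (\<integral>\<^sup>+x. ennreal (E i j x) \<partial>?X))"
      by (intro sum.cong refl nn_integral_sum Em) auto
    finally show ?thesis using m1
      by (subst nn_integral_add) (auto simp: nn_integral_cmult X.emeasure_space_1)
  qed
  also have "\<dots> \<le> ennreal ?c1 + ennreal (2 * svt_const \<delta>) * (\<Sum>i<n. \<Sum>j<n. ennreal (K * of_bool (i = j) + K * real m powr (- (2 * \<alpha>))))"
    by (intro add_left_mono mult_left_mono sum_mono EI) auto
  also have "(\<Sum>i<n. \<Sum>j<n. ennreal (K * of_bool (i = j) + K * real m powr (- (2 * \<alpha>)))) = ennreal (real n * K + (real n)\<^sup>2 * (K * real m powr (- (2 * \<alpha>))))"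
    using K0 unfolding sumK[symmetric] by (simp add: sum_nonneg del: ennreal_plus)
  also have "ennreal ?c1 + ennreal (2 * svt_const \<delta>) * \<dots> = ennreal (?c1 + 2 * svt_const \<delta> * (real n * K + (real n)\<^sup>2 * (K * real m powr (- (2 * \<alpha>)))))"
  proof -
    have W: "0 \<le> real n * K + (real n)\<^sup>2 * (K * real m powr (- (2 * \<alpha>)))" using K0 by simp
    have S2: "0 \<le> 2 * svt_const \<delta>" using S by simp
    show ?thesis unfolding ennreal_mult[OF S2 W, symmetric] by (rule ennreal_plus[OF c1 mult_nonneg_nonneg[OF S2 W], symmetric])
  qed
  also have "?c1 + 2 * svt_const \<delta> * (real n * K + (real n)\<^sup>2 * (K * real m powr (- (2 * \<alpha>)))) =
    (2 * svt_const \<delta> * (?R / (real n * \<rho>) + K / real n + K * real m powr (- (2 * \<alpha>))) + 4 * 48 ^ 4 / (real n)\<^sup>2) * (real n)\<^sup>2"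
    using n by (simp add: distrib_left distrib_right power2_eq_square)
  finally show "(\<integral>\<^sup>+x. (\<integral>\<^sup>+A. ennreal (\<Sum>i<n. \<Sum>j<n. (edge_prob f x i j - Mhat A i j)\<^sup>2) \<partial>measure_pmf (adj_pmf f \<rho> n x)) \<partial>?X)
    \<le> ennreal ((2 * svt_const \<delta> * (?R / (real n * \<rho>) + K / real n + K * real m powr (- (2 * \<alpha>))) + 4 * 48 ^ 4 / (real n)\<^sup>2) * (real n)\<^sup>2)" .
  show "0 \<le> 2 * svt_const \<delta> * (?R / (real n * \<rho>) + K / real n + K * real m powr (- (2 * \<alpha>))) + 4 * 48 ^ 4 / (real n)\<^sup>2"
    using S K0 \<rho> by (intro add_nonneg_nonneg mult_nonneg_nonneg divide_nonneg_nonneg) auto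
qed

text \<open>\<open>m\<close> is the balancing value \<open>T powr (1 / (2 * \<alpha> + d))\<close>
  rounded up. That value is at least 1, so rounding at most doubles it, whence the factor
  \<open>2 ^ d\<close>.\<close>

lemma resolution_exists:
  fixes T \<alpha> :: real and d :: nat
  assumes T: "1 \<le> T" and \<alpha>: "0 < \<alpha>"
  defines "\<beta> \<equiv> 2 * \<alpha> / (2 * \<alpha> + real d)"
  shows "\<exists>m\<ge>1. real m powr (- (2 * \<alpha>)) \<le> T powr (- \<beta>) \<and> real m ^ d / T \<le> 2 ^ d * T powr (- \<beta>)"
proof -
  define t where "t = T powr (1 / (2 * \<alpha> + real d))"
  define m where "m = nat \<lceil>t\<rceil>"
  have D: "0 < 2 * \<alpha> + real d" using \<alpha> by simp
  have t: "1 \<le> t" unfolding t_def using T D by (intro ge_one_powr_ge_zero) auto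
  have "1 \<le> \<lceil>t\<rceil>" using t by linarith
  then have "real m = of_int \<lceil>t\<rceil>" and m1: "1 \<le> m" unfolding m_def by linarith+
  then have m: "t \<le> real m" "real m \<le> 2 * t" using t by linarith+
  have "real m powr (- (2 * \<alpha>)) \<le> t powr (- (2 * \<alpha>))" using m t \<alpha> by (intro powr_mono2') auto
  also have "\<dots> = T powr (- \<beta>)" by (simp add: t_def powr_powr \<beta>_def)
  finally have 1: "real m powr (- (2 * \<alpha>)) \<le> T powr (- \<beta>)" .
  have "real m ^ d \<le> (2 * t) ^ d" using m by (intro power_mono) auto
  also have "\<dots> = 2 ^ d * T powr (real d / (2 * \<alpha> + real d))"
    using T by (simp add: t_def power_mult_distrib powr_powr flip: powr_realpow)
  finally have "real m ^ d / T \<le> 2 ^ d * T powr (real d / (2 * \<alpha> + real d)) / T" using T by (intro divide_right_mono) auto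
  also have "\<dots> = 2 ^ d * T powr (real d / (2 * \<alpha> + real d) - 1)" using T by (simp add: powr_diff)
  also have "real d / (2 * \<alpha> + real d) - 1 = - \<beta>" using D by (simp add: \<beta>_def field_simps)
  finally have "real m ^ d / T \<le> 2 ^ d * T powr (- \<beta>)" .
  then show ?thesis using 1 m1 by blast
qed

theorem theorem3:
  fixes C \<alpha> L :: real
    and f :: "real ^ 'd::finite \<Rightarrow> real ^ 'd \<Rightarrow> real"
    and \<mu> :: "(real ^ 'd) measure"
  assumes "C > 0" and "\<alpha> > 0" and "L > 0"
    and "prob_space \<mu>" and "sets \<mu> = sets (restrict_space borel cube)"
    and "graphon f"
    and "hoelder_condition \<alpha> L f \<or> sobolev_condition \<mu> \<alpha> L f"
  shows "\<exists>\<kappa>>0. \<forall>\<delta>>0. \<exists>c>0. \<forall>n\<ge>1. \<forall>\<rho> Mhat.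
           0 < \<rho> \<and> \<rho> \<le> 1 \<and> real n * \<rho> \<ge> C * ln (real n) \<and>
           (\<forall>A. usvt_output n A \<rho> ((1 + \<delta>) * \<kappa> * sqrt (real n * \<rho>)) (Mhat A)) \<longrightarrow>
           MSE \<mu> f \<rho> n Mhat \<le> c * (real n * \<rho>) powr (- (2 * \<alpha> / (2 * \<alpha> + real CARD('d))))"
proof -
  let ?d = "CARD('d)"
  let ?\<beta> = "2 * \<alpha> / (2 * \<alpha> + real ?d)"
  obtain K where fa: "feature_approximable \<mu> f \<alpha> K"
    using assms(7) hoelder_feature_approximable[OF assms(2,4,6)] sobolev_feature_approximable[OF assms(2,6)] by blast
  have K0: "0 \<le> K"
  proof -
    have z: "(0 :: real ^ 'd) \<in> cube" by (simp add: cube_def)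
    obtain a where "\<forall>x\<in>cube. (feature_sum 1 (sfloor \<alpha>) (a x) (x :: real ^ 'd))\<^sup>2 \<le> K"
      using fa[unfolded feature_approximable_def, THEN spec, THEN mp, OF order_refl[of "1 :: nat"]] by (elim exE conjE) (rule that)
    then show ?thesis using z order_trans[OF zero_le_power2] by blast
  qed
  have \<beta>: "?\<beta> < 1" "0 \<le> ?\<beta>" using assms(2) by (auto simp: field_simps)
  \<comment> \<open>The witness for \<open>\<kappa>\<close> depends on \<open>C\<close> alone, not
    on \<open>f\<close>, \<open>\<mu>\<close> or \<open>\<delta>\<close>.\<close>
  show ?thesis
  proof (rule exI[of _ "noise_const C"], intro conjI allI impI noise_const_pos)
    fix \<delta> :: real assume \<delta>: "0 < \<delta>"
    let ?r = "real (Suc (sfloor \<alpha>)) ^ ?d * ((1 + \<delta>) * noise_const C)\<^sup>2"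
    \<comment> \<open>The last summand makes \<open>?c \<ge> 1\<close>, so that the trivial bound
      suffices when \<open>n * \<rho> < 1\<close>.\<close>
    let ?c = "2 * svt_const \<delta> * (?r * 2 ^ ?d + K + K) + 4 * 48 ^ 4 + 1"
    have S: "0 < svt_const \<delta>" by (rule svt_const_pos[OF \<delta>])
    have c1: "1 \<le> ?c" using S K0 by (intro add_increasing mult_nonneg_nonneg add_nonneg_nonneg) auto
    show "\<exists>c>0. \<forall>n\<ge>1. \<forall>\<rho> Mhat.
           0 < \<rho> \<and> \<rho> \<le> 1 \<and> real n * \<rho> \<ge> C * ln (real n) \<and>
           (\<forall>A. usvt_output n A \<rho> ((1 + \<delta>) * noise_const C * sqrt (real n * \<rho>)) (Mhat A)) \<longrightarrow>
           MSE \<mu> f \<rho> n Mhat \<le> c * (real n * \<rho>) powr (- ?\<beta>)"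
    proof (intro exI[of _ ?c] conjI allI impI)
      show "0 < ?c" using c1 by linarith
      fix n :: nat and \<rho> :: real and Mhat
      assume n: "1 \<le> n" and "0 < \<rho> \<and> \<rho> \<le> 1 \<and> real n * \<rho> \<ge> C * ln (real n) \<and>
           (\<forall>A. usvt_output n A \<rho> ((1 + \<delta>) * noise_const C * sqrt (real n * \<rho>)) (Mhat A))"
      then have \<rho>: "0 < \<rho>" "\<rho> \<le> 1" and TC: "C * ln (real n) \<le> real n * \<rho>"
        and Mhat: "\<And>A. usvt_output n A \<rho> ((1 + \<delta>) * noise_const C * sqrt (real n * \<rho>)) (Mhat A)" by auto
      let ?T = "real n * \<rho>"
      have T0: "0 < ?T" using n \<rho> by simp
      show "MSE \<mu> f \<rho> n Mhat \<le> ?c * ?T powr (- ?\<beta>)"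
      proof (cases "1 \<le> ?T")
        case False
        have "MSE \<mu> f \<rho> n Mhat \<le> 1 * 1" using MSE_le_1[OF assms(6,5,4) \<rho> n Mhat] by simp
        also have "1 \<le> ?T powr (- ?\<beta>)"
        proof -
          have "?T powr ?\<beta> \<le> 1" using False T0 \<beta> by (intro powr_le1) auto
          then show ?thesis using n \<rho> by (simp add: powr_minus one_le_inverse_iff)
        qed
        then have "1 * 1 \<le> ?c * ?T powr (- ?\<beta>)" using c1 by (intro mult_mono) auto
        finally show ?thesis .
      next
        case True
        obtain m where m: "1 \<le> m" "real m powr (- (2 * \<alpha>)) \<le> ?T powr (- ?\<beta>)" "real m ^ ?d / ?T \<le> 2 ^ ?d * ?T powr (- ?\<beta>)"
          using resolution_exists[OF True assms(2), of ?d] by blast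
        \<comment> \<open>The diagonal and the bad event contribute orders \<open>1 / n\<close> and
          \<open>1 / n\<^sup>2\<close>. Since \<open>?\<beta> < 1\<close>, both are dominated by the
          rate.\<close>
        have T1: "1 / ?T \<le> ?T powr (- ?\<beta>)"
        proof -
          have "?T powr (- 1) \<le> ?T powr (- ?\<beta>)" using \<beta> True by (intro powr_mono) auto
          then show ?thesis using T0 by (simp add: powr_minus_divide)
        qed
        have nT: "1 / real n \<le> 1 / ?T" using n \<rho> by (intro divide_left_mono) (auto simp: mult_left_le)
        have nT1: "1 / real n \<le> ?T powr (- ?\<beta>)" using nT T1 by linarith
        have n2: "1 / (real n)\<^sup>2 \<le> ?T powr (- ?\<beta>)"
        proof -
          have "1 / (real n)\<^sup>2 \<le> 1 / real n" using n by (simp add: field_simps power2_eq_square)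
          then show ?thesis using nT1 by linarith
        qed
        have "MSE \<mu> f \<rho> n Mhat \<le> 2 * svt_const \<delta> *
          (real ((m * Suc (sfloor \<alpha>)) ^ ?d) * ((1 + \<delta>) * noise_const C)\<^sup>2 / ?T + K / real n + K * real m powr (- (2 * \<alpha>)))
           + 4 * 48 ^ 4 / (real n)\<^sup>2"
          by (rule MSE_le_tradeoff[OF assms(6,5,4,1) n \<rho> True TC \<delta> Mhat fa m(1) K0])
        also have "\<dots> = 2 * svt_const \<delta> * (?r * (real m ^ ?d / ?T) + K * (1 / real n) + K * real m powr (- (2 * \<alpha>)))
           + 4 * 48 ^ 4 * (1 / (real n)\<^sup>2)"
          by (simp only: of_nat_power of_nat_mult power_mult_distrib) (simp add: mult_ac)
        also have "\<dots> \<le> 2 * svt_const \<delta> * (?r * (2 ^ ?d * ?T powr (- ?\<beta>)) + K * ?T powr (- ?\<beta>) + K * ?T powr (- ?\<beta>))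
           + 4 * 48 ^ 4 * ?T powr (- ?\<beta>)"
          using S K0 by (intro add_mono mult_left_mono m n2 nT1) auto
        also have "\<dots> = (?c - 1) * ?T powr (- ?\<beta>)" by (simp only: add_diff_cancel_right' distrib_left distrib_right mult.assoc)
        also have "\<dots> \<le> ?c * ?T powr (- ?\<beta>)" by (intro mult_right_mono) auto
        finally show ?thesis .
      qed
    qed
  qed
qed

end
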